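(* Let $S=\{x_1,x_2,y_1,y_2\}$ and let $r:S\times S\to[0,\infty)$ be the transition rates of an irreducible continuous-time random walk on $S$ with $r(x,x)=0$, reversible with respect to a probability measure $m$ on $S$ (i.e. $m(x)r(x,y)=m(y)r(y,x)$ for all $x,y$). Assume $r(y_p,x_i)>r(x_i,y_p)>0$ for all $1\le i,p\le 2$, $r(x_1,x_2)=r(x_2,x_1)=0$, and $m(x_1)=m(x_2)$ (so that $S_\star=\{x_1,x_2\}$). Let $(d_N)_{N\ge1}$ be positive reals with $d_N\to0$, $\lim_{N\to\infty}d_N\log N=0$, which decay subexponentially (i.e. $\lim_{N\to\infty}d_Ne^{\epsilon N}=\infty$ for every $\epsilon>0$), and such that $\lim_{N\to\infty}d_NN^2(\log N)^2=0$. Set $\theta_{N,2}=N/d_N^2$ and $$\mathfrak{R}=\int_0^1\frac{dt}{\sum_{p=1}^{2}\frac{1}{(1-m_\star(y_p))\left(\frac{1-t}{r(x_1,y_p)}+\frac{t}{r(x_2,y_p)}\right)}}.$$ Fix $i_0\in\{1,2\}$. Then the law of the rescaled process $\{Y_N^{\mathrm{spl}}(\theta_{N,2}t)\}_{t\ge0}$ started at $i_0$ (i.e. with the inclusion process started at $\xi_N^{x_{i_0}}$) converges, with respect to the Skorokhod topology on $D([0,\infty);\{1,2\})$, to the law of the Markov process on $\{1,2\}$ started at $i_0$ that jumps back and forth between $1$ and $2$ at rate $1/\mathfrak{R}$.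
   Context: $M_\star=\max_{x\in S}m(x)$, $S_\star=\{x:m(x)=M_\star\}$, $m_\star(x)=m(x)/M_\star$. $\mathcal{H}_N=\{\eta\in\mathbb{N}^S:\sum_x\eta_x=N\}$. The inclusion process $\{\eta_N(t)\}_{t\ge0}$ is the continuous-time Markov chain on $\mathcal{H}_N$ with generator $(\mathcal{L}_Nf)(\eta)=\sum_{x,y\in S}\eta_x(d_N+\eta_y)r(x,y)\{f(\sigma^{x,y}\eta)-f(\eta)\}$, where $\sigma^{x,y}\eta$ is obtained from $\eta$ by moving one particle from $x$ to $y$ if $\eta_x\ge1$ (and $\sigma^{x,y}\eta=\eta$ if $\eta_x=0$). $\xi_N^x$ denotes the configuration with all $N$ particles at $x$. For a nonempty $\mathcal{G}\subseteq\mathcal{H}_N$, the trace process on $\mathcal{G}$ is $\eta_N^{\mathcal{G}}(t)=\eta_N(S^{\mathcal{G}}(t))$, where $T^{\mathcal{G}}(t)=\int_0^t\mathbf{1}\{\eta_N(s)\in\mathcal{G}\}ds$ and $S^{\mathcal{G}}(t)=\sup\{s\ge0:T^{\mathcal{G}}(s)\le t\}$. Let $\eta_N^\star$ be the trace process on $\{\xi_N^{x_1},\xi_N^{x_2}\}$, and $Y_N^{\mathrm{spl}}(t)=i$ if $\eta_N^\star(t)=\xi_N^{x_i}$. *)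

theory Defs
  imports "HOL-Probability.Probability"
begin

datatype site = X1 | X2 | Y1 | Y2

lemma UNIV_site: "(UNIV :: site set) = {X1, X2, Y1, Y2}"
  using site.exhaust by auto

instance site :: finite
  by standard (simp add: UNIV_site)

definition xpt :: "nat \<Rightarrow> site" where
  "xpt i = (if i = 1 then X1 else X2)"

definition Mstar :: "(site \<Rightarrow> real) \<Rightarrow> real" where
  "Mstar m = Max (range m)"

definition mstar :: "(site \<Rightarrow> real) \<Rightarrow> site \<Rightarrow> real" where
  "mstar m x = m x / Mstar m"

definition Rfrak :: "(site \<Rightarrow> site \<Rightarrow> real) \<Rightarrow> (site \<Rightarrow> real) \<Rightarrow> real" where
  "Rfrak r m = integral {0..1::real}
     (\<lambda>t. 1 / (\<Sum>p\<in>{Y1, Y2}. 1 / ((1 - mstar m p) * ((1 - t) / r X1 p + t / r X2 p))))"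

definition config_space :: "nat \<Rightarrow> (site \<Rightarrow> nat) set" where
  "config_space N = {\<eta>. (\<Sum>x\<in>UNIV. \<eta> x) = N}"

definition sigma_move :: "site \<Rightarrow> site \<Rightarrow> (site \<Rightarrow> nat) \<Rightarrow> (site \<Rightarrow> nat)" where
  "sigma_move x y \<eta> = (if 1 \<le> \<eta> x \<and> x \<noteq> y then \<eta>(x := \<eta> x - 1, y := \<eta> y + 1) else \<eta>)"

text \<open>Jump rate from configuration eta to configuration zeta (eta different from zeta)
  of the inclusion process with generator
  L f(eta) = sum_{x,y} eta_x (d_N + eta_y) r(x,y) (f(sigma^{x,y} eta) - f(eta)).\<close>
definition incl_rate :: "(site \<Rightarrow> site \<Rightarrow> real) \<Rightarrow> real \<Rightarrow> (site \<Rightarrow> nat) \<Rightarrow> (site \<Rightarrow> nat) \<Rightarrow> real" where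
  "incl_rate r dN \<eta> \<zeta> =
     (\<Sum>x\<in>UNIV. \<Sum>y\<in>UNIV. if sigma_move x y \<eta> = \<zeta> then real (\<eta> x) * (dN + real (\<eta> y)) * r x y else 0)"

definition xi :: "nat \<Rightarrow> site \<Rightarrow> (site \<Rightarrow> nat)" where
  "xi N x = (\<lambda>z. if z = x then N else 0)"

definition gen_matrix :: "'b set \<Rightarrow> ('b \<Rightarrow> 'b \<Rightarrow> real) \<Rightarrow> 'b \<Rightarrow> 'b \<Rightarrow> real" where
  "gen_matrix E q a b = (if a = b then - (\<Sum>c\<in>E - {a}. q a c) else q a b)"

fun gen_pow :: "'b set \<Rightarrow> ('b \<Rightarrow> 'b \<Rightarrow> real) \<Rightarrow> nat \<Rightarrow> 'b \<Rightarrow> 'b \<Rightarrow> real" where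
  "gen_pow E q 0 a b = (if a = b then 1 else 0)"
| "gen_pow E q (Suc n) a b = (\<Sum>c\<in>E. gen_matrix E q a c * gen_pow E q n c b)"

definition trans_prob :: "'b set \<Rightarrow> ('b \<Rightarrow> 'b \<Rightarrow> real) \<Rightarrow> real \<Rightarrow> 'b \<Rightarrow> 'b \<Rightarrow> real" where
  "trans_prob E q t a b = (\<Sum>n. t ^ n / fact n * gen_pow E q n a b)"

fun fdd :: "'b set \<Rightarrow> ('b \<Rightarrow> 'b \<Rightarrow> real) \<Rightarrow> real \<Rightarrow> 'b \<Rightarrow> (real \<times> 'b) list \<Rightarrow> real" where
  "fdd E q t a [] = 1"
| "fdd E q t a ((s, b) # rest) = trans_prob E q (s - t) a b * fdd E q s b rest"

text \<open>Cadlag paths [0,\<infinity>) \<rightarrow> E (E carries the discrete topology); paths are extended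
  to negative times by their value at 0.\<close>
definition cadlag_paths :: "'b set \<Rightarrow> (real \<Rightarrow> 'b) set" where
  "cadlag_paths E = {\<omega>. (\<forall>t. \<omega> t \<in> E) \<and> (\<forall>t<0. \<omega> t = \<omega> 0)
      \<and> (\<forall>t\<ge>0. \<exists>\<delta>>0. \<forall>s\<in>{t..<t+\<delta>}. \<omega> s = \<omega> t)
      \<and> (\<forall>t>0. \<exists>\<delta>>0. \<exists>l. \<forall>s\<in>{t-\<delta><..<t}. \<omega> s = l)}"

text \<open>Path space D([0,\<infinity>);E) with the sigma-algebra generated by the coordinate maps
  (which is the Borel sigma-algebra of the Skorokhod topology).\<close>
definition path_space :: "'b set \<Rightarrow> (real \<Rightarrow> 'b) measure" where
  "path_space E = sigma (cadlag_paths E)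
     {{\<omega>\<in>cadlag_paths E. \<omega> t = a} | t a. 0 \<le> t \<and> a \<in> E}"

definition is_ctmc_law :: "'b set \<Rightarrow> ('b \<Rightarrow> 'b \<Rightarrow> real) \<Rightarrow> 'b \<Rightarrow> (real \<Rightarrow> 'b) measure \<Rightarrow> bool" where
  "is_ctmc_law E q a0 P \<longleftrightarrow> prob_space P \<and> sets P = sets (path_space E) \<and>
     (\<forall>pts. sorted_wrt (<) (map fst pts) \<and> (\<forall>p\<in>set pts. 0 \<le> fst p \<and> snd p \<in> E) \<longrightarrow>
        measure P {\<omega>\<in>cadlag_paths E. \<forall>p\<in>set pts. \<omega> (fst p) = snd p} = fdd E q 0 a0 pts)"

definition occ_time :: "'b set \<Rightarrow> (real \<Rightarrow> 'b) \<Rightarrow> real \<Rightarrow> real" where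
  "occ_time G \<omega> t = measure lborel {s\<in>{0..t}. \<omega> s \<in> G}"

definition inv_time :: "'b set \<Rightarrow> (real \<Rightarrow> 'b) \<Rightarrow> real \<Rightarrow> real" where
  "inv_time G \<omega> t = Sup {s. 0 \<le> s \<and> occ_time G \<omega> s \<le> t}"

definition trace_path :: "'b set \<Rightarrow> (real \<Rightarrow> 'b) \<Rightarrow> real \<Rightarrow> 'b" where
  "trace_path G \<omega> t = \<omega> (inv_time G \<omega> (max t 0))"

definition spl_index :: "nat \<Rightarrow> (site \<Rightarrow> nat) \<Rightarrow> nat" where
  "spl_index N \<eta> = (if \<eta> = xi N X1 then 1 else if \<eta> = xi N X2 then 2 else 0)"

definition spl_rescaled :: "nat \<Rightarrow> real \<Rightarrow> (real \<Rightarrow> site \<Rightarrow> nat) \<Rightarrow> real \<Rightarrow> nat" where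
  "spl_rescaled N \<theta> \<omega> = (\<lambda>t. spl_index N (trace_path {xi N X1, xi N X2} \<omega> (\<theta> * t)))"

text \<open>Same map, sent to a fixed path on the (null) set where it is not a cadlag
  {1,2}-valued path.\<close>
definition spl_map :: "nat \<Rightarrow> real \<Rightarrow> (real \<Rightarrow> site \<Rightarrow> nat) \<Rightarrow> real \<Rightarrow> nat" where
  "spl_map N \<theta> \<omega> = (if spl_rescaled N \<theta> \<omega> \<in> cadlag_paths {1, 2} then spl_rescaled N \<theta> \<omega> else (\<lambda>_. 1))"

section \<open>Skorokhod J1 metric on D([0,\<infinity>);E), E with the discrete metric (Ethier--Kurtz 3.5)\<close>

definition sk_time_changes :: "(real \<Rightarrow> real) set" where
  "sk_time_changes = {l. strict_mono_on {0..} l \<and> l ` {0..} = {0..} \<and>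
     bdd_above {\<bar>ln ((l s - l t) / (s - t))\<bar> | s t. 0 \<le> t \<and> t < s}}"

definition sk_gamma :: "(real \<Rightarrow> real) \<Rightarrow> real" where
  "sk_gamma l = Sup {\<bar>ln ((l s - l t) / (s - t))\<bar> | s t. 0 \<le> t \<and> t < s}"

definition sk_local :: "(real \<Rightarrow> 'b) \<Rightarrow> (real \<Rightarrow> 'b) \<Rightarrow> (real \<Rightarrow> real) \<Rightarrow> real \<Rightarrow> real" where
  "sk_local x y l u = (if \<exists>t\<ge>0. x (min t u) \<noteq> y (min (l t) u) then 1 else 0)"

definition sk_dist :: "(real \<Rightarrow> 'b) \<Rightarrow> (real \<Rightarrow> 'b) \<Rightarrow> real" where
  "sk_dist x y = Inf {max (sk_gamma l) (LBINT u:{0..}. exp (- u) * sk_local x y l u) | l. l \<in> sk_time_changes}"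

definition sk_continuous :: "'b set \<Rightarrow> ((real \<Rightarrow> 'b) \<Rightarrow> real) \<Rightarrow> bool" where
  "sk_continuous E f \<longleftrightarrow> (\<forall>x\<in>cadlag_paths E. \<forall>\<epsilon>>0. \<exists>\<delta>>0. \<forall>y\<in>cadlag_paths E.
      sk_dist x y < \<delta> \<longrightarrow> \<bar>f y - f x\<bar> < \<epsilon>)"

definition weak_conv_paths :: "'b set \<Rightarrow> (nat \<Rightarrow> (real \<Rightarrow> 'b) measure) \<Rightarrow> (real \<Rightarrow> 'b) measure \<Rightarrow> bool" where
  "weak_conv_paths E Pn P \<longleftrightarrow> (\<forall>f. sk_continuous E f \<and> (\<exists>B. \<forall>x\<in>cadlag_paths E. \<bar>f x\<bar> \<le> B) \<longrightarrow>
      (\<lambda>n. \<integral>x. f x \<partial>(Pn n)) \<longlonglongrightarrow> (\<integral>x. f x \<partial>P))"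

end

theory Submission
  imports Defs "HOL-Real_Asymp.Real_Asymp"
begin

text \<open>
  Let \<open>h\<close> be the equilibrium potential between the two full configurations and \<open>\<alpha>\<close> the effective jump rate.
  Then \<open>F = 2 h - 1\<close> satisfies \<open>L F + 2 \<alpha> 1\<^sub>G F = 0\<close>, where \<open>G\<close> consists of the two full configurations, so
  \<open>exp (2 \<alpha> T\<^sup>G(t)) F(\<eta>(t))\<close> is a martingale. Stopping it at the inverse occupation time shows that the trace process
  is exactly the symmetric two-state chain with rate \<open>\<alpha>\<close>. Consequently the rescaled process is the limit process run at
  a deterministic speed, and only the convergence of this speed to 1 is needed.

  By the Dirichlet principle the speed is a minimal energy. The upper bound uses the test function \<open>\<phi>(u)\<close>, where
  \<open>u\<close> is the expected final fraction of particles at \<open>X1\<close> and \<open>\<phi>'\<close> is proportional to the local resistance. The lower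
  bound keeps only the edges on configurations with few particles at a single site \<open>Y1\<close> or \<open>Y2\<close> and tests the
  potential against the corresponding explicit flow, with geometric weights in the number of these particles.
\<close>

section \<open>Path space and finite-dimensional laws\<close>

text \<open>A direct study of the trace would need the strong Markov property and the excursions
  away from the two full configurations. The martingale avoids both: \<open>F\<close> is 1 and -1
  there, so the law of the trace at one further time is read off from a single expectation. What
  must be built instead is a Feynman-Kac martingale from bare finite-dimensional laws, and its
  stopping at the inverse clock, through a grid. The scale: each relevant conductance carries three
  factors \<open>d N\<close>, two from the ends of the jump and one from a further occupied site.
  The minimal energy is of order \<open>d N ^ 3 / N ^ 2\<close>, the weight of a full configuration
  is about \<open>d N / N\<close>, hence the rate is of order \<open>d N ^ 2 / N\<close>. Both
  energy bounds evaluate one resistor network: for a fraction t of particles at \<open>X1\<close>,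
  two edges in series through each \<open>Y\<close> site, summed geometrically over the number of
  particles there; the two \<open>Y\<close> sites in parallel; all fractions t in series. This is
  the formula for \<open>Rfrak\<close>.\<close>

lemma space_path_space [simp]: "space (path_space E) = cadlag_paths E"
  by (simp add: path_space_def space_measure_of_conv)

lemma sets_path_space:
  "sets (path_space E) = sigma_sets (cadlag_paths E)
     {{\<omega>\<in>cadlag_paths E. \<omega> t = a} | t a. 0 \<le> t \<and> a \<in> E}"
  unfolding path_space_def by (rule sets_measure_of) auto

lemma cadlag_neg: "\<omega> \<in> cadlag_paths E \<Longrightarrow> t \<le> 0 \<Longrightarrow> \<omega> t = \<omega> 0"
  by (cases "t = 0") (auto simp: cadlag_paths_def)

lemma cadlag_in: "\<omega> \<in> cadlag_paths E \<Longrightarrow> \<omega> t \<in> E"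
  by (auto simp: cadlag_paths_def)

text \<open>Since paths are constant on negative times, one-sided limits are available at every real
  time, and later arguments need no case distinction on the sign.\<close>

lemma cadlag_right:
  assumes "\<omega> \<in> cadlag_paths E"
  obtains \<delta> where "\<delta> > 0" "\<And>s. t \<le> s \<Longrightarrow> s < t + \<delta> \<Longrightarrow> \<omega> s = \<omega> t"
proof (cases "t \<ge> 0")
  case True
  have "\<forall>t\<ge>0. \<exists>\<delta>>0. \<forall>s\<in>{t..<t+\<delta>}. \<omega> s = \<omega> t" using assms unfolding cadlag_paths_def mem_Collect_eq by (elim conjE)
  from this[rule_format, OF True] obtain \<delta> where d: "\<delta> > 0" "\<forall>s\<in>{t..<t + \<delta>}. \<omega> s = \<omega> t" by blast
  show ?thesis by (rule that[of \<delta>, OF d(1)], rule d(2)[rule_format]) simp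
next
  case False
  show ?thesis
  proof (rule that[of "-t"])
    fix s assume "t \<le> s" "s < t + - t"
    then show "\<omega> s = \<omega> t" using cadlag_neg[OF assms, of s] cadlag_neg[OF assms, of t] False by simp
  qed (use False in simp)
qed

lemma cadlag_left:
  assumes "\<omega> \<in> cadlag_paths E"
  obtains \<delta> l where "\<delta> > 0" "\<And>s. t - \<delta> < s \<Longrightarrow> s < t \<Longrightarrow> \<omega> s = l"
proof (cases "t > 0")
  case True
  have "\<forall>t>0. \<exists>\<delta>>0. \<exists>l. \<forall>s\<in>{t-\<delta><..<t}. \<omega> s = l" using assms unfolding cadlag_paths_def mem_Collect_eq by (elim conjE)
  from this[rule_format, OF True] obtain \<delta> l where d: "\<delta> > 0" "\<forall>s\<in>{t - \<delta><..<t}. \<omega> s = l" by blast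
  show ?thesis by (rule that[of \<delta> l, OF d(1)], rule d(2)[rule_format]) simp
next
  case False
  show ?thesis
  proof (rule that[of 1 "\<omega> 0"])
    fix s assume "t - 1 < s" "s < t"
    then show "\<omega> s = \<omega> 0" using cadlag_neg[OF assms, of s] False by simp
  qed simp
qed

lemma coord_set: "{\<omega>\<in>cadlag_paths E. \<omega> t = a} \<in> sets (path_space E)"
proof (cases "a \<in> E")
  case True
  have *: "{\<omega>\<in>cadlag_paths E. \<omega> s = a} \<in> sets (path_space E)" if "s \<ge> 0" for s
    unfolding sets_path_space using True that by (auto intro!: sigma_sets.Basic)
  show ?thesis
  proof (cases "t \<ge> 0")
    case False
    then have "{\<omega>\<in>cadlag_paths E. \<omega> t = a} = {\<omega>\<in>cadlag_paths E. \<omega> 0 = a}"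
      using cadlag_neg[of _ E t] by (metis (no_types, lifting) not_le less_imp_le)
    then show ?thesis using *[of 0] by simp
  qed (use * in auto)
next
  case False
  then have "{\<omega>\<in>cadlag_paths E. \<omega> t = a} = {}" by (auto dest: cadlag_in)
  then show ?thesis by (metis sets.empty_sets)
qed

lemma measurable_coord:
  assumes "finite E" shows "(\<lambda>\<omega>. \<omega> t) \<in> measurable (path_space E) (count_space E)"
proof (subst measurable_count_space_eq2[OF assms], safe)
  fix \<omega> show "\<omega> \<in> space (path_space E) \<Longrightarrow> \<omega> t \<in> E" by (auto dest: cadlag_in)
next
  fix a show "(\<lambda>\<omega>. \<omega> t) -` {a} \<inter> space (path_space E) \<in> sets (path_space E)"
    using coord_set[of E t a] by (simp add: vimage_def Int_def conj_commute)
qed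

lemma measurable_coord_fun:
  assumes "finite E" shows "(\<lambda>\<omega>. g (\<omega> t)) \<in> measurable (path_space E) (count_space UNIV)"
  by (rule measurable_compose[OF measurable_coord[OF assms]]) simp

lemma borel_measurable_coord_fun:
  assumes "finite E" shows "(\<lambda>\<omega>. g (\<omega> t)) \<in> measurable (path_space E) borel"
  by (rule measurable_compose[OF measurable_coord[OF assms]]) simp

lemma measurable_into_path_space:
  assumes "\<And>w. w \<in> space M \<Longrightarrow> f w \<in> cadlag_paths E"
    and "\<And>t a. 0 \<le> t \<Longrightarrow> a \<in> E \<Longrightarrow> {w\<in>space M. f w t = a} \<in> sets M"
  shows "f \<in> measurable M (path_space E)"
  unfolding path_space_def
proof (rule measurable_measure_of)
  fix A assume "A \<in> {{\<omega> \<in> cadlag_paths E. \<omega> t = a} |t a. 0 \<le> t \<and> a \<in> E}"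
  then obtain t a where A: "A = {\<omega> \<in> cadlag_paths E. \<omega> t = a}" "0 \<le> t" "a \<in> E" by auto
  have "f -` A \<inter> space M = {w\<in>space M. f w t = a}" using A assms(1) by auto
  then show "f -` A \<inter> space M \<in> sets M" using assms(2) A by simp
qed (use assms(1) in auto)

text \<open>The past up to time u is encoded by the stopped path: a functional of the past is one of
  the form \<open>H (stop u \<omega>)\<close>. This takes the place of a filtration and of
  conditional expectations.\<close>

definition stop :: "real \<Rightarrow> (real \<Rightarrow> 'b) \<Rightarrow> real \<Rightarrow> 'b" where
  "stop u \<omega> = (\<lambda>t. \<omega> (min t u))"

lemma stop_cadlag:
  assumes w: "\<omega> \<in> cadlag_paths E" and u: "0 \<le> u"
  shows "stop u \<omega> \<in> cadlag_paths E"
  unfolding cadlag_paths_def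
proof (intro CollectI conjI allI impI)
  fix t show "stop u \<omega> t \<in> E" using w by (auto simp: stop_def cadlag_in)
next
  fix t :: real assume "t < 0" then show "stop u \<omega> t = stop u \<omega> 0"
    using cadlag_neg[OF w, of t] u by (simp add: stop_def)
next
  fix t :: real assume "0 \<le> t"
  show "\<exists>\<delta>>0. \<forall>s\<in>{t..<t + \<delta>}. stop u \<omega> s = stop u \<omega> t"
  proof (cases "t < u")
    case True
    obtain \<delta> where d: "\<delta> > 0" "\<And>s. t \<le> s \<Longrightarrow> s < t + \<delta> \<Longrightarrow> \<omega> s = \<omega> t"
      by (rule cadlag_right[OF w, of t]) (rule that)
    show ?thesis
    proof (intro exI[of _ "min \<delta> (u - t)"] conjI ballI)
      fix s assume "s \<in> {t..<t + min \<delta> (u - t)}"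
      then have "t \<le> s" "s < t + \<delta>" "s < u" using True by auto
      then show "stop u \<omega> s = stop u \<omega> t"
        using d(2)[of s] True by (simp add: stop_def)
    qed (use True d(1) in simp)
  qed (auto simp: stop_def intro!: exI[of _ 1])
next
  fix t :: real assume "0 < t"
  show "\<exists>\<delta>>0. \<exists>l. \<forall>s\<in>{t - \<delta><..<t}. stop u \<omega> s = l"
  proof (cases "t \<le> u")
    case True
    obtain \<delta> l where "\<delta> > 0" "\<And>s. t - \<delta> < s \<Longrightarrow> s < t \<Longrightarrow> \<omega> s = l"
      by (rule cadlag_left[OF w, of t]) (rule that)
    then show ?thesis using True by (intro exI[of _ \<delta>] conjI exI[of _ l]) (auto simp: stop_def)
  next
    case False
    then show ?thesis by (intro exI[of _ "t - u"] conjI exI[of _ "\<omega> u"]) (auto simp: stop_def)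
  qed
qed

lemma measurable_stop:
  assumes "0 \<le> u" shows "stop u \<in> measurable (path_space E) (path_space E)"
proof (rule measurable_into_path_space)
  fix t a show "{w \<in> space (path_space E). stop u w t = a} \<in> sets (path_space E)"
    using coord_set[of E "min t u" a] by (simp add: stop_def)
qed (use assms in \<open>auto intro: stop_cadlag\<close>)

section \<open>Cylinder sets and measures on path space\<close>

definition cyl :: "'b set \<Rightarrow> real set \<Rightarrow> (real \<Rightarrow> 'b) \<Rightarrow> (real \<Rightarrow> 'b) set" where
  "cyl E F f = {\<omega>\<in>cadlag_paths E. \<forall>s\<in>F. \<omega> s = f s}"

text \<open>The empty set is inserted to make the family stable under intersection: two cylinders
  that prescribe different values at a common time are disjoint.\<close>

definition cyls :: "'b set \<Rightarrow> (real \<Rightarrow> 'b) set set" where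
  "cyls E = insert {} {cyl E F f | F f. finite F \<and> F \<subseteq> {0..} \<and> f ` F \<subseteq> E}"

lemma cyl_sets: "finite F \<Longrightarrow> cyl E F f \<in> sets (path_space E)"
proof -
  assume "finite F"
  then have "{\<omega>\<in>space (path_space E). \<forall>s\<in>F. \<omega> s = f s} \<in> sets (path_space E)"
    by (intro sets.sets_Collect_finite_All) (auto simp: coord_set)
  then show ?thesis by (simp add: cyl_def)
qed

lemma Int_stable_cyls: "Int_stable (cyls E)"
proof (rule Int_stableI)
  fix A B assume A: "A \<in> cyls E" and B: "B \<in> cyls E"
  show "A \<inter> B \<in> cyls E"
  proof (cases "A \<inter> B = {}")
    case True then show ?thesis by (simp add: cyls_def)
  next
    case False
    then obtain F f G g where FG: "A = cyl E F f" "B = cyl E G g" "finite F" "finite G"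
      "F \<subseteq> {0..}" "G \<subseteq> {0..}" "f ` F \<subseteq> E" "g ` G \<subseteq> E"
      using A B unfolding cyls_def by blast
    \<comment> \<open>A path in the intersection prescribes compatible values on both time sets at
      once.\<close>
    from False obtain w where w: "w \<in> A" "w \<in> B" by auto
    have "A \<inter> B = cyl E (F \<union> G) w" using w unfolding FG(1,2) cyl_def by auto
    moreover have "w ` (F \<union> G) \<subseteq> E" using w unfolding FG(1,2) cyl_def by (auto dest: cadlag_in)
    ultimately show ?thesis unfolding cyls_def using FG by blast
  qed
qed

lemma sets_path_space_cyls: "sets (path_space E) = sigma_sets (cadlag_paths E) (cyls E)"
proof
  show "sets (path_space E) \<subseteq> sigma_sets (cadlag_paths E) (cyls E)"
    unfolding sets_path_space
  proof (rule sigma_sets_mono, safe)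
    fix t :: real and a assume "0 \<le> t" "a \<in> E"
    then have "{\<omega> \<in> cadlag_paths E. \<omega> t = a} \<in> cyls E"
      unfolding cyls_def by (intro insertI2 CollectI exI[of _ "{t}"] exI[of _ "\<lambda>_. a"]) (auto simp: cyl_def)
    then show "{\<omega> \<in> cadlag_paths E. \<omega> t = a} \<in> sigma_sets (cadlag_paths E) (cyls E)" by (rule sigma_sets.Basic)
  qed
  have "cyls E \<subseteq> sets (path_space E)"
    unfolding cyls_def using cyl_sets by fastforce
  then show "sigma_sets (cadlag_paths E) (cyls E) \<subseteq> sets (path_space E)"
    using sets.sigma_sets_subset[of "cyls E" "path_space E"] by simp
qed

lemma path_measure_eqI:
  assumes "prob_space M" "prob_space N"
    and sM: "sets M = sets (path_space E)" and sN: "sets N = sets (path_space E)"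
    and eq: "\<And>F f. finite F \<Longrightarrow> F \<subseteq> {0..} \<Longrightarrow> f ` F \<subseteq> E \<Longrightarrow> measure M (cyl E F f) = measure N (cyl E F f)"
  shows "M = N"
proof (rule measure_eqI_generator_eq[where E="cyls E" and \<Omega>="cadlag_paths E" and A="\<lambda>_. cadlag_paths E"])
  interpret M: prob_space M by fact
  interpret N: prob_space N by fact
  show "Int_stable (cyls E)" by (rule Int_stable_cyls)
  show "cyls E \<subseteq> Pow (cadlag_paths E)" by (auto simp: cyls_def cyl_def)
  show "emeasure M X = emeasure N X" if "X \<in> cyls E" for X
    using that unfolding cyls_def by (auto simp: M.emeasure_eq_measure N.emeasure_eq_measure eq)
  show "sets M = sigma_sets (cadlag_paths E) (cyls E)" "sets N = sigma_sets (cadlag_paths E) (cyls E)"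
    using sM sN sets_path_space_cyls by auto
  have "cadlag_paths E = cyl E {} (\<lambda>_. undefined)" by (auto simp: cyl_def)
  then show "range (\<lambda>_. cadlag_paths E) \<subseteq> cyls E" by (auto simp: cyls_def)
  show "emeasure M (cadlag_paths E) \<noteq> \<infinity>" by simp
qed auto

lemma sorted_list_of_set_snoc:
  fixes F :: "'a::linorder set"
  assumes "finite F" "\<And>s. s \<in> F \<Longrightarrow> s < t"
  shows "sorted_list_of_set (insert t F) = sorted_list_of_set F @ [t]"
proof (rule sorted_distinct_set_unique)
  show "sorted (sorted_list_of_set F @ [t])" using assms by (auto simp: sorted_append intro: less_imp_le)
qed (use assms in \<open>auto simp del: sorted_list_of_set_insert_remove\<close>)

text \<open>The recursion for \<open>fdd\<close> peels off the first time point, whereas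
  conditioning on the past needs the last one.\<close>

lemma fdd_append:
  "fdd E q t a (xs @ [(s, b)]) = fdd E q t a xs *
     trans_prob E q (s - (if xs = [] then t else fst (last xs))) (if xs = [] then a else snd (last xs)) b"
  by (induction E q t a xs rule: fdd.induct) auto

section \<open>The Markov property, derived from the finite-dimensional laws\<close>

locale ctmc =
  fixes E :: "'b set" and q :: "'b \<Rightarrow> 'b \<Rightarrow> real" and a0 :: 'b and P :: "(real \<Rightarrow> 'b) measure"
  assumes fin: "finite E" and a0: "a0 \<in> E" and law: "is_ctmc_law E q a0 P"
begin

sublocale prob_space P using law by (simp add: is_ctmc_law_def)

lemma sets_P: "sets P = sets (path_space E)" using law by (simp add: is_ctmc_law_def)

lemma space_P: "space P = cadlag_paths E"
  using sets_eq_imp_space_eq[OF sets_P] by simp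

lemma measurable_P: "measurable P N = measurable (path_space E) N"
  by (rule measurable_cong_sets) (simp_all add: sets_P)

lemma prob_cyl:
  assumes "finite F" "F \<subseteq> {0..}" "f ` F \<subseteq> E"
  shows "prob (cyl E F f) = fdd E q 0 a0 (map (\<lambda>s. (s, f s)) (sorted_list_of_set F))"
proof -
  have "sorted_wrt (<) (map fst (map (\<lambda>s. (s, f s)) (sorted_list_of_set F)))"
    by (simp add: comp_def)
  moreover have "\<forall>p\<in>set (map (\<lambda>s. (s, f s)) (sorted_list_of_set F)). 0 \<le> fst p \<and> snd p \<in> E"
    using assms by auto
  ultimately have "prob {\<omega>\<in>cadlag_paths E. \<forall>p\<in>set (map (\<lambda>s. (s, f s)) (sorted_list_of_set F)). \<omega> (fst p) = snd p}
     = fdd E q 0 a0 (map (\<lambda>s. (s, f s)) (sorted_list_of_set F))"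
    using law unfolding is_ctmc_law_def by blast
  also have "{\<omega>\<in>cadlag_paths E. \<forall>p\<in>set (map (\<lambda>s. (s, f s)) (sorted_list_of_set F)). \<omega> (fst p) = snd p} = cyl E F f"
    using assms by (auto simp: cyl_def)
  finally show ?thesis .
qed

lemma prob_cyl_extend:
  assumes F: "finite F" "F \<subseteq> {0..<u}" and u: "0 \<le> u" "u < t" and f: "f ` F \<subseteq> E" "f u \<in> E" "f t \<in> E"
  shows "prob (cyl E (insert t (insert u F)) f) = prob (cyl E (insert u F) f) * trans_prob E q (t - u) (f u) (f t)"
proof -
  have 1: "sorted_list_of_set (insert u F) = sorted_list_of_set F @ [u]"
    using F by (intro sorted_list_of_set_snoc) auto
  have 2: "sorted_list_of_set (insert t (insert u F)) = (sorted_list_of_set F @ [u]) @ [t]"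
    unfolding 1[symmetric] using F u by (intro sorted_list_of_set_snoc) force+
  have "prob (cyl E (insert t (insert u F)) f) = fdd E q 0 a0 (map (\<lambda>s. (s, f s)) (sorted_list_of_set (insert t (insert u F))))"
    using assms by (intro prob_cyl) auto
  also have "\<dots> = fdd E q 0 a0 (map (\<lambda>s. (s, f s)) (sorted_list_of_set F @ [u])) * trans_prob E q (t - u) (f u) (f t)"
    unfolding 2 map_append[of _ "_ @ [u]"] list.map fdd_append by simp
  also have "fdd E q 0 a0 (map (\<lambda>s. (s, f s)) (sorted_list_of_set F @ [u])) = prob (cyl E (insert u F) f)"
    unfolding 1[symmetric] using assms by (intro prob_cyl[symmetric]) auto
  finally show ?thesis .
qed

lemma coord_set_P: "{\<omega>\<in>cadlag_paths E. \<omega> t = a} \<in> events"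
  by (simp add: sets_P coord_set)

lemma stop_events: "0 \<le> u \<Longrightarrow> A \<in> sets (path_space E) \<Longrightarrow> {\<omega>\<in>cadlag_paths E. stop u \<omega> \<in> A} \<in> events"
  using measurable_sets[OF measurable_stop, of u A E] by (simp add: sets_P vimage_def Int_def conj_commute)

text \<open>For cylinders this is the product form of \<open>fdd\<close>. With a and b fixed, both
  sides are countably additive in \<open>A\<close>, so the identity extends to all events of the
  past by Dynkin's argument.\<close>

lemma markov_set:
  assumes u: "0 \<le> u" "u < t" and ab: "a \<in> E" "b \<in> E" and A: "A \<in> sets (path_space E)"
  shows "prob ({\<omega>\<in>cadlag_paths E. stop u \<omega> \<in> A} \<inter> {\<omega>\<in>cadlag_paths E. \<omega> u = a \<and> \<omega> t = b})
    = trans_prob E q (t - u) a b * prob ({\<omega>\<in>cadlag_paths E. stop u \<omega> \<in> A} \<inter> {\<omega>\<in>cadlag_paths E. \<omega> u = a})"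
proof -
  let ?S = "\<lambda>A. {\<omega>\<in>cadlag_paths E. stop u \<omega> \<in> A}"
  let ?B = "{\<omega>\<in>cadlag_paths E. \<omega> u = a \<and> \<omega> t = b}" and ?C = "{\<omega>\<in>cadlag_paths E. \<omega> u = a}"
  have B[measurable]: "?B \<in> events"
    using sets.Int[OF coord_set_P[of u a] coord_set_P[of t b]] by (rule back_subst[of "\<lambda>x. x \<in> events"]) auto
  have C[measurable]: "?C \<in> events" by (rule coord_set_P)
  have cylcase: "prob (?S A \<inter> ?B) = trans_prob E q (t - u) a b * prob (?S A \<inter> ?C)" if Ac: "A \<in> cyls E" for A
  proof (cases "A = {}")
    case False
    then obtain F f where A: "A = cyl E F f" "finite F" "F \<subseteq> {0..}" "f ` F \<subseteq> E"
      using Ac unfolding cyls_def by blast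
    show ?thesis
    \<comment> \<open>A stopped path keeps its value at u forever, so a cylinder either prescribes a
      at all its times from u on, and these conditions are then automatic, or it misses both
      events.\<close>
    proof (cases "\<forall>s\<in>F. u \<le> s \<longrightarrow> f s = a")
      case True
      define F' where "F' = F \<inter> {..<u}"
      define f' where "f' = f(u := a, t := b)"
      have mem: "stop u \<omega> \<in> A \<longleftrightarrow> (\<forall>s\<in>F'. \<omega> s = f s)" if "\<omega> u = a" "\<omega> \<in> cadlag_paths E" for \<omega>
      proof -
        have "stop u \<omega> \<in> A \<longleftrightarrow> (\<forall>s\<in>F. \<omega> (min s u) = f s)"
          using stop_cadlag[OF that(2) u(1)] by (auto simp: A cyl_def stop_def)
        also have "\<dots> \<longleftrightarrow> (\<forall>s\<in>F'. \<omega> s = f s)"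
        proof (intro iffI ballI)
          fix s assume *: "\<forall>s\<in>F'. \<omega> s = f s" "s \<in> F"
          show "\<omega> (min s u) = f s"
            using * True that(1) by (cases "s < u") (auto simp: F'_def)
        next
          fix s assume "\<forall>s\<in>F. \<omega> (min s u) = f s" "s \<in> F'"
          then show "\<omega> s = f s" by (auto simp: F'_def dest!: bspec)
        qed
        finally show ?thesis .
      qed
      have e1: "?S A \<inter> ?C = cyl E (insert u F') f'"
        using mem u by (auto simp: cyl_def f'_def F'_def)
      have e2: "?S A \<inter> ?B = cyl E (insert t (insert u F')) f'"
        using mem u by (auto simp: cyl_def f'_def F'_def)
      have "prob (cyl E (insert t (insert u F')) f') = prob (cyl E (insert u F') f') * trans_prob E q (t - u) (f' u) (f' t)"
        using A u ab by (intro prob_cyl_extend) (auto simp: F'_def f'_def)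
      then show ?thesis unfolding e1 e2 using u by (simp add: f'_def)
    next
      case False
      then have "?S A \<inter> ?C = {}" "?S A \<inter> ?B = {}"
        unfolding A cyl_def stop_def using u by (auto simp: min_def split: if_splits)
      then show ?thesis by simp
    qed
  qed simp
  \<comment> \<open>The instance for the whole space, which the passage to complements subtracts
    from.\<close>
  have top: "prob ?B = trans_prob E q (t - u) a b * prob ?C"
  proof -
    have "cyl E {} (\<lambda>_. a) \<in> cyls E" by (auto simp: cyls_def)
    moreover have "?S (cyl E {} (\<lambda>_. a)) = cadlag_paths E" using u by (auto simp: cyl_def stop_cadlag)
    ultimately show ?thesis using cylcase[of "cyl E {} (\<lambda>_. a)"]
      by (simp add: Int_absorb1 subset_iff)
  qed
  have "A \<in> sigma_sets (cadlag_paths E) (cyls E)" using A sets_path_space_cyls by auto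
  moreover have "cyls E \<subseteq> Pow (cadlag_paths E)" by (auto simp: cyls_def cyl_def)
  moreover note Int_stable_cyls[of E]
  ultimately show ?thesis
  proof -
    assume *: "A \<in> sigma_sets (cadlag_paths E) (cyls E)" "cyls E \<subseteq> Pow (cadlag_paths E)" "Int_stable (cyls E)"
    from *(3,2,1) show ?thesis
  proof (induction rule: sigma_sets_induct_disjoint)
    case (basic A) then show ?case by (rule cylcase)
  next
    case empty then show ?case by simp
  next
    case (compl A)
    then have A: "A \<in> sets (path_space E)" by (simp add: sets_path_space_cyls)
    note [measurable] = stop_events[OF u(1) A]
    have *: "prob (?S (cadlag_paths E - A) \<inter> X) = prob X - prob (?S A \<inter> X)" if "X \<in> events" "X \<subseteq> cadlag_paths E" for X
    proof -
      have "?S (cadlag_paths E - A) \<inter> X = X - (?S A \<inter> X)" using that u by (auto intro: stop_cadlag)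
      then show ?thesis using that stop_events[OF u(1) A] by (simp add: finite_measure_Diff)
    qed
    have "prob (?S (cadlag_paths E - A) \<inter> ?B) = prob ?B - prob (?S A \<inter> ?B)" by (rule *[OF B]) auto
    moreover have "prob (?S (cadlag_paths E - A) \<inter> ?C) = prob ?C - prob (?S A \<inter> ?C)" by (rule *[OF C]) auto
    ultimately show ?case unfolding top compl(2) by (simp only: right_diff_distrib)
  next
    case (union A)
    then have A: "A i \<in> sets (path_space E)" for i by (simp add: sets_path_space_cyls image_subset_iff)
    have *: "(\<lambda>i. prob (?S (A i) \<inter> X)) sums prob (?S (\<Union>i. A i) \<inter> X)" if "X \<in> events" for X
    proof -
      have "(\<lambda>i. prob (?S (A i) \<inter> X)) sums prob (\<Union>i. ?S (A i) \<inter> X)"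
        using union(1) that stop_events[OF u(1) A]
        by (intro finite_measure_UNION) (auto simp: disjoint_family_on_def)
      also have "(\<Union>i. ?S (A i) \<inter> X) = ?S (\<Union>i. A i) \<inter> X" by auto
      finally show ?thesis .
    qed
    have "(\<lambda>i. prob (?S (A i) \<inter> ?B)) sums (trans_prob E q (t - u) a b * prob (?S (\<Union>i. A i) \<inter> ?C))"
      unfolding union(3) by (intro sums_mult *[OF C])
    then show ?case using *[OF B] sums_unique2 by blast
  qed
  qed
qed

end

section \<open>Feynman--Kac martingales\<close>

text \<open>Passes from events to integrands. The hypothesis says that the images under
  \<open>X\<close> of \<open>M\<close> restricted to \<open>C\<close> and of \<kappa> times
  \<open>M\<close> restricted to \<open>D\<close> are the same measure; both sides are then
  integrals of \<open>H\<close> against it.\<close>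

lemma integral_indicator_transfer:
  fixes H :: "'c \<Rightarrow> real"
  assumes "finite_measure M" and X[measurable]: "X \<in> measurable M N" and C[measurable]: "C \<in> sets M" and D[measurable]: "D \<in> sets M"
    and eq: "\<And>A. A \<in> sets N \<Longrightarrow> measure M (X -` A \<inter> space M \<inter> C) = \<kappa> * measure M (X -` A \<inter> space M \<inter> D)"
    and H[measurable]: "H \<in> borel_measurable N"
  shows "(\<integral>\<omega>. H (X \<omega>) * indicator C \<omega> \<partial>M) = \<kappa> * (\<integral>\<omega>. H (X \<omega>) * indicator D \<omega> \<partial>M)"
proof -
  interpret finite_measure M by fact
  have sub: "X -` space N \<inter> space M \<inter> C = C" "X -` space N \<inter> space M \<inter> D = D"
    using measurable_space[OF X] sets.sets_into_space[OF C] sets.sets_into_space[OF D] by auto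
  have tot: "measure M C = \<kappa> * measure M D" using eq[of "space N"] sub by simp
  show ?thesis
  \<comment> \<open>If \<open>D\<close> is a null set, nothing forces \<kappa> to be nonnegative,
    and it cannot serve as a density; but then \<open>C\<close> is null as well.\<close>
  proof (cases "measure M D = 0")
    case True
    have z: "(\<integral>\<omega>. H (X \<omega>) * indicator A \<omega> \<partial>M) = 0" if A: "measure M A = 0" "A \<in> sets M" for A
    proof (rule integral_eq_zero_AE)
      have "A \<in> null_sets M" using A by (auto simp: null_sets_def emeasure_eq_measure)
      then have "AE \<omega> in M. \<omega> \<notin> A" by (rule AE_not_in)
      then show "AE \<omega> in M. H (X \<omega>) * indicator A \<omega> = 0" by eventually_elim simp
    qed
    show ?thesis using z[OF True D] z[of C] tot True C by simp
  next
    case False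
    then have "measure M D > 0" by (simp add: zero_less_measure_iff)
    then have k: "\<kappa> \<ge> 0" using tot by (metis measure_nonneg mult_less_0_iff not_less)
    have "distr (density M (\<lambda>x. ennreal (indicator C x))) N X = distr (density M (\<lambda>x. ennreal (\<kappa> * indicator D x))) N X"
    proof (rule measure_eqI)
      fix A assume "A \<in> sets (distr (density M (\<lambda>x. ennreal (indicator C x))) N X)"
      then have A[measurable]: "A \<in> sets N" by simp
      let ?S = "X -` A \<inter> space M"
      have S[measurable]: "?S \<in> sets M" by simp
      have "emeasure (density M (\<lambda>x. ennreal (indicator C x))) ?S = emeasure M (?S \<inter> C)"
        by (subst emeasure_density) (auto simp: ennreal_indicator indicator_inter_arith[symmetric] Int_commute)
      moreover have "emeasure (density M (\<lambda>x. ennreal (\<kappa> * indicator D x))) ?S = ennreal \<kappa> * emeasure M (?S \<inter> D)"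
      proof -
        have "emeasure (density M (\<lambda>x. ennreal (\<kappa> * indicator D x))) ?S
          = (\<integral>\<^sup>+x. ennreal (\<kappa> * indicator D x) * indicator ?S x \<partial>M)" by (rule emeasure_density) auto
        also have "\<dots> = (\<integral>\<^sup>+x. ennreal \<kappa> * indicator (?S \<inter> D) x \<partial>M)"
          using k by (intro nn_integral_cong) (auto simp: indicator_def)
        also have "\<dots> = ennreal \<kappa> * emeasure M (?S \<inter> D)" by (rule nn_integral_cmult_indicator) simp
        finally show ?thesis .
      qed
      moreover have "emeasure M (?S \<inter> C) = ennreal \<kappa> * emeasure M (?S \<inter> D)"
        using eq[OF A] k by (simp add: emeasure_eq_measure ennreal_mult)
      ultimately show "emeasure (distr (density M (\<lambda>x. ennreal (indicator C x))) N X) A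
         = emeasure (distr (density M (\<lambda>x. ennreal (\<kappa> * indicator D x))) N X) A"
        by (simp add: emeasure_distr)
    qed simp
    then have "(\<integral>x. H x \<partial>distr (density M (\<lambda>x. ennreal (indicator C x))) N X) = (\<integral>x. H x \<partial>distr (density M (\<lambda>x. ennreal (\<kappa> * indicator D x))) N X)"
      by simp
    then have "(\<integral>x. indicator C x * H (X x) \<partial>M) = (\<integral>x. \<kappa> * indicator D x * H (X x) \<partial>M)"
      using k by (simp add: integral_distr integral_density)
    then show ?thesis
      by (simp add: mult.assoc mult.commute[of "indicator _ _"])
  qed
qed

section \<open>Short-time expansion of the transition probabilities\<close>

lemma gen_pow_bound:
  assumes "finite E" "a \<in> E"
  shows "\<bar>gen_pow E q n a b\<bar> \<le> (\<Sum>a\<in>E. \<Sum>c\<in>E. \<bar>gen_matrix E q a c\<bar>) ^ n"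
  using assms(2)
proof (induction n arbitrary: a)
  case (Suc n)
  let ?M = "\<Sum>a\<in>E. \<Sum>c\<in>E. \<bar>gen_matrix E q a c\<bar>"
  have "\<bar>gen_pow E q (Suc n) a b\<bar> \<le> (\<Sum>c\<in>E. \<bar>gen_matrix E q a c\<bar> * ?M ^ n)"
    unfolding gen_pow.simps using Suc by (intro order_trans[OF sum_abs] sum_mono) (auto simp: abs_mult intro: mult_left_mono)
  also have "\<dots> = (\<Sum>c\<in>E. \<bar>gen_matrix E q a c\<bar>) * ?M ^ n" by (simp add: sum_distrib_right)
  also have "\<dots> \<le> ?M * ?M ^ n"
    by (intro mult_right_mono member_le_sum[of a E "\<lambda>a. \<Sum>c\<in>E. \<bar>gen_matrix E q a c\<bar>"] zero_le_power)
       (use assms Suc.prems in \<open>auto intro!: sum_nonneg\<close>)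
  finally show ?case by simp
qed auto

text \<open>The expansion of exp(hQ) to first order with a uniform quadratic error. Together with
  the Markov property this is all that is used about the transition probabilities of a general
  chain; no Chapman-Kolmogorov equation and no derivative in time occurs.\<close>

lemma trans_prob_expand:
  assumes "finite E"
  obtains C where "C \<ge> 0" "\<And>h a b. 0 \<le> h \<Longrightarrow> h \<le> 1 \<Longrightarrow> a \<in> E \<Longrightarrow> b \<in> E \<Longrightarrow>
      \<bar>trans_prob E q h a b - (if a = b then 1 else 0) - h * gen_matrix E q a b\<bar> \<le> C * h\<^sup>2"
proof -
  define M where "M = (\<Sum>a\<in>E. \<Sum>c\<in>E. \<bar>gen_matrix E q a c\<bar>)"
  have M: "M \<ge> 0" unfolding M_def by (auto intro!: sum_nonneg)
  have *: "\<bar>trans_prob E q h a b - (if a = b then 1 else 0) - h * gen_matrix E q a b\<bar> \<le> (M\<^sup>2 * exp M) * h\<^sup>2"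
    if h: "0 \<le> h" "h \<le> 1" "a \<in> E" "b \<in> E" for h a b
  proof -
    define f where "f n = h ^ n / fact n * gen_pow E q n a b" for n
    have gp: "\<bar>gen_pow E q n a b\<bar> \<le> M ^ n" for n unfolding M_def using assms h by (intro gen_pow_bound)
    have fb: "norm (f n) \<le> inverse (fact n) * (h * M) ^ n" for n
    proof -
      have "norm (f n) = h ^ n / fact n * \<bar>gen_pow E q n a b\<bar>" using h by (simp add: f_def abs_mult)
      also have "\<dots> \<le> h ^ n / fact n * M ^ n" using h by (intro mult_left_mono gp) auto
      also have "\<dots> = inverse (fact n) * (h * M) ^ n" by (simp add: power_mult_distrib divide_inverse)
      finally show ?thesis .
    qed
    have sf: "summable f" by (rule summable_comparison_test'[OF summable_exp fb])
    have "trans_prob E q h a b = (\<Sum>n. f (n + 2)) + (\<Sum>i<2. f i)"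
      unfolding trans_prob_def f_def[symmetric] by (rule suminf_split_initial_segment[OF sf])
    moreover have "(\<Sum>i<2. f i) = (if a = b then 1 else 0) + h * gen_matrix E q a b"
    proof -
      have "(\<Sum>c\<in>E. gen_matrix E q a c * (if c = b then 1 else 0)) = gen_matrix E q a b"
        using h assms by (simp add: if_distrib[of "\<lambda>x. _ * x"] cong: if_cong)
      then show ?thesis by (simp add: f_def numeral_2_eq_2)
    qed
    moreover have "\<bar>\<Sum>n. f (n + 2)\<bar> \<le> (M\<^sup>2 * exp M) * h\<^sup>2"
    proof -
      have b2: "norm (f (n + 2)) \<le> h\<^sup>2 * M\<^sup>2 * (inverse (fact n) * M ^ n)" for n
      proof -
        have "norm (f (n + 2)) \<le> inverse (fact (n + 2)) * (h * M) ^ (n + 2)" by (rule fb)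
        also have "\<dots> \<le> inverse (fact n) * (h * M) ^ (n + 2)"
          using h M by (intro mult_right_mono le_imp_inverse_le fact_mono zero_le_power) auto
        also have "\<dots> = h\<^sup>2 * M\<^sup>2 * (inverse (fact n) * (h * M) ^ n)" by (simp add: power_add power_mult_distrib power2_eq_square)
        also have "\<dots> \<le> h\<^sup>2 * M\<^sup>2 * (inverse (fact n) * M ^ n)"
          using h M by (intro mult_left_mono power_mono) (auto intro: mult_left_le_one_le)
        finally show ?thesis .
      qed
      have "norm (\<Sum>n. f (n + 2)) \<le> (\<Sum>n. h\<^sup>2 * M\<^sup>2 * (inverse (fact n) * M ^ n))"
        by (rule norm_suminf_le[OF b2]) (intro summable_mult summable_exp)
      also have "\<dots> = h\<^sup>2 * M\<^sup>2 * exp M"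
        using exp_converges[of M] by (subst suminf_mult) (auto simp: summable_exp sums_iff divide_inverse mult.commute)
      finally show ?thesis by (simp add: mult_ac)
    qed
    ultimately show ?thesis by simp
  qed
  show ?thesis by (rule that[of "M\<^sup>2 * exp M"]) (use M * in auto)
qed

section \<open>Measurability and additive functionals along a path\<close>

lemma floor_grid:
  fixes s :: real
  shows "s < (of_int \<lfloor>real (Suc n) * s\<rfloor> + 1) / real (Suc n)"
    and "(of_int \<lfloor>real (Suc n) * s\<rfloor> + 1) / real (Suc n) \<le> s + 1 / real (Suc n)"
proof -
  have "real (Suc n) * s < of_int \<lfloor>real (Suc n) * s\<rfloor> + 1" by linarith
  then show "s < (of_int \<lfloor>real (Suc n) * s\<rfloor> + 1) / real (Suc n)"
    by (simp add: pos_less_divide_eq mult.commute)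
  have "of_int \<lfloor>real (Suc n) * s\<rfloor> + 1 \<le> real (Suc n) * (s + 1 / real (Suc n))"
    by (simp add: distrib_left)
  then show "(of_int \<lfloor>real (Suc n) * s\<rfloor> + 1) / real (Suc n) \<le> s + 1 / real (Suc n)"
    by (simp add: pos_divide_le_eq mult.commute)
qed

text \<open>The state space is discrete, so convergence from the right means eventual equality. The
  error 1/(n+1) is that of the grids used to approximate times from the right.\<close>

lemma cadlag_right_eventually:
  assumes w: "\<omega> \<in> cadlag_paths E" and "\<And>n. s \<le> \<tau> n" and "\<And>n. \<tau> n \<le> s + 1 / real (Suc n)"
  shows "eventually (\<lambda>n. \<omega> (\<tau> n) = \<omega> s) sequentially"
proof -
  obtain \<delta> where d: "\<delta> > 0" "\<And>v. s \<le> v \<Longrightarrow> v < s + \<delta> \<Longrightarrow> \<omega> v = \<omega> s" by (rule cadlag_right[OF w, of s]) (rule that)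
  have "eventually (\<lambda>n. 1 / real (Suc n) < \<delta>) sequentially"
    using order_tendstoD(2)[OF LIMSEQ_inverse_real_of_nat d(1)] by (simp add: inverse_eq_divide)
  then show ?thesis
  proof eventually_elim
    case (elim n)
    show ?case by (rule d(2)) (use assms(2,3)[of n] elim in linarith)+
  qed
qed

lemma integrable_lborel_indicator_bounded:
  "A \<in> sets borel \<Longrightarrow> bounded A \<Longrightarrow> integrable lborel (indicator A :: real \<Rightarrow> real)"
  using emeasure_bounded_finite[of A] by (auto intro!: integrable_real_indicator)

text \<open>Joint measurability in path and time is what Fubini needs. Replacing the time by the
  next grid point to its right leaves countably many coordinates for each mesh, and right continuity
  recovers the limit.\<close>

lemma measurable_path_joint:
  fixes c :: "'b \<Rightarrow> real"
  assumes E: "finite E"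
  shows "(\<lambda>x::(real \<Rightarrow> 'b) \<times> real. c (fst x (snd x))) \<in> borel_measurable (path_space E \<Otimes>\<^sub>M (borel :: real measure))"
proof (rule borel_measurable_LIMSEQ_real)
  fix n :: nat
  show "(\<lambda>x::(real \<Rightarrow> 'b) \<times> real. c (fst x ((of_int \<lfloor>real (Suc n) * snd x\<rfloor> + 1) / real (Suc n)))) \<in> borel_measurable (path_space E \<Otimes>\<^sub>M (borel :: real measure))"
  proof (rule measurable_compose_countable[where g="\<lambda>x::(real \<Rightarrow> 'b) \<times> real. \<lfloor>real (Suc n) * snd x\<rfloor>" and f="\<lambda>i (x::(real \<Rightarrow> 'b) \<times> real). c (fst x ((of_int i + 1) / real (Suc n)))"])
    fix i :: int
    show "(\<lambda>x::(real \<Rightarrow> 'b) \<times> real. c (fst x ((of_int i + 1) / real (Suc n)))) \<in> borel_measurable (path_space E \<Otimes>\<^sub>M (borel :: real measure))"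
      by (rule measurable_compose[OF measurable_fst]) (rule borel_measurable_coord_fun[OF E])
  qed measurable
next
  fix x :: "(real \<Rightarrow> 'b) \<times> real" assume "x \<in> space (path_space E \<Otimes>\<^sub>M (borel :: real measure))"
  then have w: "fst x \<in> cadlag_paths E" by (auto simp: space_pair_measure)
  have "eventually (\<lambda>n. fst x ((of_int \<lfloor>real (Suc n) * snd x\<rfloor> + 1) / real (Suc n)) = fst x (snd x)) sequentially"
    by (rule cadlag_right_eventually[OF w]) (use floor_grid[where s="snd x"] in \<open>auto intro: less_imp_le\<close>)
  then have "eventually (\<lambda>n. c (fst x ((of_int \<lfloor>real (Suc n) * snd x\<rfloor> + 1) / real (Suc n))) = c (fst x (snd x))) sequentially"
    by eventually_elim simp
  then show "(\<lambda>n. c (fst x ((of_int \<lfloor>real (Suc n) * snd x\<rfloor> + 1) / real (Suc n)))) \<longlonglongrightarrow> c (fst x (snd x))"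
    by (rule tendsto_eventually)
qed

lemma measurable_path:
  fixes c :: "'b \<Rightarrow> real"
  assumes "finite E" and w: "\<omega> \<in> cadlag_paths E" shows "(\<lambda>s. c (\<omega> s)) \<in> borel_measurable borel"
  using measurable_compose[OF measurable_Pair1'[of \<omega> "path_space E" borel] measurable_path_joint[OF assms(1), of c]] w
  by simp

text \<open>For an indicator this is the occupation time, for a general \<open>c\<close> the
  exponent of a Feynman-Kac weight; both uses share the estimates below.\<close>

definition addf :: "('b \<Rightarrow> real) \<Rightarrow> real \<Rightarrow> (real \<Rightarrow> 'b) \<Rightarrow> real" where
  "addf c t \<omega> = (\<integral>s. indicator {0..t} s * c (\<omega> s) \<partial>lborel)"

lemma measurable_addf:
  assumes "finite E" shows "addf c t \<in> borel_measurable (path_space E)"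
proof -
  have [measurable]: "(\<lambda>x. c (fst x (snd x))) \<in> borel_measurable (path_space E \<Otimes>\<^sub>M (borel :: real measure))"
    by (rule measurable_path_joint[OF assms])
  have "(\<lambda>x. indicator {0..t} (snd x) * c (fst x (snd x))) \<in> borel_measurable (path_space E \<Otimes>\<^sub>M lborel)"
    by measurable
  then show ?thesis unfolding addf_def
    by (intro lborel.borel_measurable_lebesgue_integral) (simp add: case_prod_beta')
qed

lemma path_integrable:
  fixes c :: "'b \<Rightarrow> real"
  assumes "finite E" and w: "\<omega> \<in> cadlag_paths E" and B: "\<And>a. a \<in> E \<Longrightarrow> \<bar>c a\<bar> \<le> B"
    and A: "A \<in> sets borel" "A \<subseteq> {a..b::real}"
  shows "integrable lborel (\<lambda>s. indicator A s * c (\<omega> s))"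
proof (rule Bochner_Integration.integrable_bound)
  show "integrable lborel (\<lambda>s. B * indicator {a..b} s)"
    by (intro integrable_mult_right integrable_lborel_indicator_bounded) auto
  show "(\<lambda>s. indicator A s * c (\<omega> s)) \<in> borel_measurable lborel"
    using measurable_path[OF assms(1) w, of c] A by simp
  have "0 \<le> B" using B[OF cadlag_in[OF w, of 0]] by linarith
  then show "AE s in lborel. norm (indicator A s * c (\<omega> s)) \<le> norm (B * indicator {a..b} s)"
    using A B[OF cadlag_in[OF w]] by (intro AE_I2) (auto simp: indicator_def abs_mult)
qed

lemma addf_diff:
  assumes "finite E" and w: "\<omega> \<in> cadlag_paths E" and B: "\<And>a. a \<in> E \<Longrightarrow> \<bar>c a\<bar> \<le> B" and t: "0 \<le> t" "t \<le> t'"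
  shows "addf c t' \<omega> - addf c t \<omega> = (\<integral>s. indicator {t<..t'} s * c (\<omega> s) \<partial>lborel)"
proof -
  have "addf c t' \<omega> = (\<integral>s. indicator {0..t} s * c (\<omega> s) + indicator {t<..t'} s * c (\<omega> s) \<partial>lborel)"
    unfolding addf_def using t by (intro Bochner_Integration.integral_cong) (auto simp: indicator_def)
  also have "\<dots> = addf c t \<omega> + (\<integral>s. indicator {t<..t'} s * c (\<omega> s) \<partial>lborel)"
    unfolding addf_def
    by (intro Bochner_Integration.integral_add path_integrable[OF assms(1) w B, where a=0 and b=t'])
       (use t in auto)
  finally show ?thesis by simp
qed

lemma addf_diff_bound:
  assumes "finite E" and w: "\<omega> \<in> cadlag_paths E" and B: "\<And>a. a \<in> E \<Longrightarrow> \<bar>c a\<bar> \<le> B" and t: "0 \<le> t" "t \<le> t'"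
  shows "\<bar>addf c t' \<omega> - addf c t \<omega>\<bar> \<le> B * (t' - t)"
proof -
  have "\<bar>\<integral>s. indicator {t<..t'} s * c (\<omega> s) \<partial>lborel\<bar> \<le> (\<integral>s. B * indicator {t<..t'} s \<partial>lborel)"
  proof (rule order_trans[OF integral_abs_bound], rule integral_mono)
    show "integrable lborel (\<lambda>s. \<bar>indicator {t<..t'} s * c (\<omega> s)\<bar>)"
      by (intro integrable_abs path_integrable[OF assms(1) w B, where a=t and b=t']) auto
    show "integrable lborel (\<lambda>s. B * indicator {t<..t'} s)"
      by (intro integrable_mult_right integrable_lborel_indicator_bounded) auto
  qed (use B[OF cadlag_in[OF w]] in \<open>auto simp: indicator_def\<close>)
  then show ?thesis using addf_diff[OF assms] t by simp
qed

lemma addf_0 [simp]: "addf c 0 \<omega> = 0"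
proof -
  have "addf c 0 \<omega> = (\<integral>s. c (\<omega> 0) * indicator {0::real} s \<partial>lborel)" unfolding addf_def
    by (rule Bochner_Integration.integral_cong) (auto simp: indicator_def)
  then show ?thesis by simp
qed

lemma addf_bound:
  assumes "finite E" and w: "\<omega> \<in> cadlag_paths E" and B: "\<And>a. a \<in> E \<Longrightarrow> \<bar>c a\<bar> \<le> B" and t: "0 \<le> t"
  shows "\<bar>addf c t \<omega>\<bar> \<le> B * t"
  using addf_diff_bound[OF assms(1-3) order_refl t] by simp

lemma addf_stop: "t \<le> u \<Longrightarrow> addf c t (stop u \<omega>) = addf c t \<omega>"
  unfolding addf_def stop_def by (intro Bochner_Integration.integral_cong) (auto simp: indicator_def)

text \<open>Freezing the integrand at its initial value is wrong only while the path is away from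
  its initial state. The expected length of that time is quadratic in the length of the interval,
  which is why the error is stated in this form.\<close>

lemma addf_deviation:
  assumes "finite E" and w: "\<omega> \<in> cadlag_paths E" and B: "\<And>a. a \<in> E \<Longrightarrow> \<bar>c a\<bar> \<le> B" and t: "0 \<le> t" "t \<le> t'"
  shows "\<bar>addf c t' \<omega> - addf c t \<omega> - (t' - t) * c (\<omega> t)\<bar>
    \<le> 2 * B * (\<integral>s. indicator {t<..t'} s * (if \<omega> s = \<omega> t then 0 else 1) \<partial>lborel)"
proof -
  have B0: "0 \<le> B" using B[OF cadlag_in[OF w, of 0]] by linarith
  have i1: "integrable lborel (\<lambda>s. indicator {t<..t'} s * c (\<omega> s))"
    by (rule path_integrable[OF assms(1) w B, where a=t and b=t']) auto
  have i2: "integrable lborel (\<lambda>s. indicator {t<..t'} s * (\<lambda>x. if x = \<omega> t then 0 else 1::real) (\<omega> s))"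
    by (rule path_integrable[OF assms(1) w, where B=1 and a=t and b=t']) auto
  have i3: "integrable lborel (\<lambda>s. indicator {t<..t'} s * c (\<omega> t))"
    by (intro integrable_mult_left integrable_lborel_indicator_bounded) auto
  have "addf c t' \<omega> - addf c t \<omega> - (t' - t) * c (\<omega> t) = (\<integral>s. indicator {t<..t'} s * c (\<omega> s) - indicator {t<..t'} s * c (\<omega> t) \<partial>lborel)"
    using addf_diff[OF assms] Bochner_Integration.integral_diff[OF i1 i3] t by simp
  also have "\<bar>\<dots>\<bar> \<le> (\<integral>s. 2 * B * (indicator {t<..t'} s * (if \<omega> s = \<omega> t then 0 else 1)) \<partial>lborel)"
  proof (rule order_trans[OF integral_abs_bound], rule integral_mono)
    fix s show "\<bar>indicator {t<..t'} s * c (\<omega> s) - indicator {t<..t'} s * c (\<omega> t)\<bar> \<le> 2 * B * (indicator {t<..t'} s * (if \<omega> s = \<omega> t then 0 else 1))"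
      using B[OF cadlag_in[OF w, of s]] B[OF cadlag_in[OF w, of t]] by (auto simp: indicator_def)
  qed (use i1 i2 i3 in \<open>auto intro!: integrable_abs Bochner_Integration.integrable_diff\<close>)
  finally show ?thesis by simp
qed

lemma abs_exp_minus_linear_le:
  fixes x :: real shows "\<bar>exp x - 1 - x\<bar> \<le> x\<^sup>2 * exp \<bar>x\<bar>"
proof -
  have lo: "0 \<le> exp x - 1 - x" using exp_ge_add_one_self[of x] by linarith
  have "exp x * (1 - x) \<le> exp x * exp (- x)"
    using exp_ge_add_one_self[of "- x"] by (intro mult_left_mono) auto
  then have hi: "exp x - 1 - x \<le> x * (exp x - 1)" by (simp add: exp_minus algebra_simps)
  have "x * (exp x - 1) \<le> x\<^sup>2 * exp \<bar>x\<bar>"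
  proof (cases "x \<ge> 0")
    case True
    have "exp x * (1 - x) \<le> 1" using \<open>exp x * (1 - x) \<le> exp x * exp (- x)\<close> by (simp add: exp_minus)
    then have "exp x - 1 \<le> x * exp x" by (simp add: algebra_simps)
    then have "x * (exp x - 1) \<le> x * (x * exp x)" using True by (intro mult_left_mono)
    then show ?thesis using True by (simp add: power2_eq_square)
  next
    case False
    have "(- x) * (1 - exp x) \<le> (- x) * (- x)"
      using False exp_ge_add_one_self[of x] by (intro mult_left_mono) linarith+
    also have "\<dots> \<le> x\<^sup>2 * exp \<bar>x\<bar>"
      using mult_left_mono[of 1 "exp \<bar>x\<bar>" "x\<^sup>2"] by (simp add: power2_eq_square)
    finally show ?thesis by (simp add: algebra_simps)
  qed
  then show ?thesis using lo hi by linarith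
qed

text \<open>Replaces differentiation in \<open>t\<close> when martingale properties are derived from short-time expansions.\<close>

lemma constant_if_quadratic_increments:
  fixes \<phi> :: "real \<Rightarrow> real"
  assumes "u \<le> T" and C: "\<And>t h. u \<le> t \<Longrightarrow> 0 < h \<Longrightarrow> h \<le> 1 \<Longrightarrow> t + h \<le> T \<Longrightarrow> \<bar>\<phi> (t + h) - \<phi> t\<bar> \<le> C * h\<^sup>2"
  shows "\<phi> T = \<phi> u"
proof (cases "u = T")
  case False
  then have uT: "u < T" using assms by simp
  \<comment> \<open>With n steps of length h = (T - u)/n the quadratic errors add up to n times h
    squared, which is of order 1/n.\<close>
  have key: "\<bar>\<phi> T - \<phi> u\<bar> \<le> C * (T - u)\<^sup>2 / real n" if n: "n \<ge> 1" "T - u \<le> real n" for n :: nat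
  proof -
    define h where "h = (T - u) / real n"
    have h: "0 < h" "h \<le> 1" using n uT by (auto simp: h_def field_simps)
    have nh: "real n * h = T - u" using n by (simp add: h_def)
    have "k \<le> n \<Longrightarrow> \<bar>\<phi> (u + real k * h) - \<phi> u\<bar> \<le> real k * (C * h\<^sup>2)" for k
    proof (induction k)
      case (Suc k)
      have "real (Suc k) * h \<le> real n * h" using Suc.prems h by (intro mult_right_mono) auto
      then have "\<bar>\<phi> (u + real k * h + h) - \<phi> (u + real k * h)\<bar> \<le> C * h\<^sup>2"
        using h nh by (intro C) (auto simp: algebra_simps)
      then show ?case using Suc by (simp add: algebra_simps)
    qed simp
    from this[of n] have "\<bar>\<phi> T - \<phi> u\<bar> \<le> real n * (C * h\<^sup>2)" using nh by simp
    also have "\<dots> = C * (T - u)\<^sup>2 / real n" using n by (simp add: h_def power2_eq_square field_simps)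
    finally show ?thesis .
  qed
  have "(\<lambda>n. C * (T - u)\<^sup>2 / real n) \<longlonglongrightarrow> 0" by (rule lim_const_over_n)
  moreover have "eventually (\<lambda>n. \<bar>\<phi> T - \<phi> u\<bar> \<le> C * (T - u)\<^sup>2 / real n) sequentially"
    using eventually_ge_at_top[of "nat \<lceil>T - u\<rceil> + 1"] by eventually_elim (rule key, linarith+)
  ultimately have "\<bar>\<phi> T - \<phi> u\<bar> \<le> 0" by (intro tendsto_lowerbound[of _ _ sequentially]) auto
  then show ?thesis by simp
qed simp

section \<open>From one-step estimates to martingale identities\<close>

context ctmc begin

lemma integrable_bounded_path:
  fixes f :: "(real \<Rightarrow> 'b) \<Rightarrow> real"
  assumes "f \<in> borel_measurable (path_space E)" "\<And>\<omega>. \<omega> \<in> cadlag_paths E \<Longrightarrow> \<bar>f \<omega>\<bar> \<le> B"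
  shows "integrable P f"
  by (rule integrable_const_bound[of _ B]) (use assms in \<open>auto simp: measurable_P space_P\<close>)

text \<open>The integrand is split according to the finitely many values of the path at u and t; on
  each piece \<open>markov_set\<close> applies with a bounded functional of the past in place of an
  event.\<close>

lemma markov_int:
  fixes H :: "(real \<Rightarrow> 'b) \<Rightarrow> real" and g :: "'b \<Rightarrow> real"
  assumes u: "0 \<le> u" "u < t" and H[measurable]: "H \<in> borel_measurable (path_space E)"
    and HB: "\<And>\<omega>. \<omega> \<in> cadlag_paths E \<Longrightarrow> \<bar>H \<omega>\<bar> \<le> B"
  shows "expectation (\<lambda>\<omega>. H (stop u \<omega>) * g (\<omega> t)) =
     expectation (\<lambda>\<omega>. H (stop u \<omega>) * (\<Sum>b\<in>E. trans_prob E q (t - u) (\<omega> u) b * g b))"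
proof -
  define C where "C a b = {\<omega>\<in>cadlag_paths E. \<omega> u = a \<and> \<omega> t = b}" for a b
  define D where "D a = {\<omega>\<in>cadlag_paths E. \<omega> u = a}" for a
  have D[measurable]: "D a \<in> events" for a unfolding D_def by (rule coord_set_P)
  have C[measurable]: "C a b \<in> events" for a b
    using sets.Int[OF coord_set_P[of u a] coord_set_P[of t b]] unfolding C_def
    by (rule back_subst[of "\<lambda>x. x \<in> events"]) auto
  have Hs[measurable]: "(\<lambda>\<omega>. H (stop u \<omega>)) \<in> borel_measurable P"
    unfolding measurable_P using measurable_stop[OF u(1), of E] by measurable
  have B0: "0 \<le> B"
  proof -
    obtain w where "w \<in> space P" using not_empty by blast
    then show ?thesis using HB[of w] by (simp add: space_P)
  qed
  have int: "integrable P (\<lambda>\<omega>. H (stop u \<omega>) * indicator A \<omega>)" if "A \<in> events" for A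
  proof (rule integrable_const_bound[of _ B])
    show "AE \<omega> in P. norm (H (stop u \<omega>) * indicator A \<omega>) \<le> B"
      using HB[OF stop_cadlag] u B0 by (intro AE_I2) (auto simp: space_P indicator_def)
  qed (use that in measurable)
  have key: "expectation (\<lambda>\<omega>. H (stop u \<omega>) * indicator (C a b) \<omega>) = trans_prob E q (t - u) a b * expectation (\<lambda>\<omega>. H (stop u \<omega>) * indicator (D a) \<omega>)"
    if "a \<in> E" "b \<in> E" for a b
  proof (rule integral_indicator_transfer[where X="stop u" and H=H and N="path_space E"])
    show "finite_measure P" by unfold_locales
    show "stop u \<in> measurable P (path_space E)" unfolding measurable_P by (rule measurable_stop[OF u(1)])
    fix A assume "A \<in> sets (path_space E)"
    have "stop u -` A \<inter> space P = {\<omega>\<in>cadlag_paths E. stop u \<omega> \<in> A}" by (auto simp: space_P)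
    then show "prob (stop u -` A \<inter> space P \<inter> C a b) = trans_prob E q (t - u) a b * prob (stop u -` A \<inter> space P \<inter> D a)"
      unfolding C_def D_def using markov_set[OF u that \<open>A \<in> sets (path_space E)\<close>] by simp
  qed measurable
  have "expectation (\<lambda>\<omega>. H (stop u \<omega>) * g (\<omega> t)) = expectation (\<lambda>\<omega>. \<Sum>a\<in>E. \<Sum>b\<in>E. g b * (H (stop u \<omega>) * indicator (C a b) \<omega>))"
  proof (rule Bochner_Integration.integral_cong[OF refl])
    fix \<omega> assume "\<omega> \<in> space P"
    then have w: "\<omega> \<in> cadlag_paths E" by (simp add: space_P)
    have "(\<Sum>a\<in>E. \<Sum>b\<in>E. g b * (H (stop u \<omega>) * indicator (C a b) \<omega>)) = (\<Sum>a\<in>E. \<Sum>b\<in>E. if b = \<omega> t then (if a = \<omega> u then g b * H (stop u \<omega>) else 0) else 0)"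
      using w by (intro sum.cong refl) (auto simp: C_def indicator_def)
    also have "\<dots> = g (\<omega> t) * H (stop u \<omega>)"
      using cadlag_in[OF w] fin by (simp add: sum.delta')
    finally show "H (stop u \<omega>) * g (\<omega> t) = (\<Sum>a\<in>E. \<Sum>b\<in>E. g b * (H (stop u \<omega>) * indicator (C a b) \<omega>))" by simp
  qed
  also have "\<dots> = (\<Sum>a\<in>E. \<Sum>b\<in>E. g b * expectation (\<lambda>\<omega>. H (stop u \<omega>) * indicator (C a b) \<omega>))"
    using int[OF C] by simp
  also have "\<dots> = (\<Sum>a\<in>E. \<Sum>b\<in>E. g b * (trans_prob E q (t - u) a b * expectation (\<lambda>\<omega>. H (stop u \<omega>) * indicator (D a) \<omega>)))"
    by (intro sum.cong refl) (simp add: key)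
  also have "\<dots> = expectation (\<lambda>\<omega>. \<Sum>a\<in>E. \<Sum>b\<in>E. g b * (trans_prob E q (t - u) a b * (H (stop u \<omega>) * indicator (D a) \<omega>)))"
    using int[OF D] by simp
  also have "\<dots> = expectation (\<lambda>\<omega>. H (stop u \<omega>) * (\<Sum>b\<in>E. trans_prob E q (t - u) (\<omega> u) b * g b))"
  proof (rule Bochner_Integration.integral_cong[OF refl])
    fix \<omega> assume "\<omega> \<in> space P"
    then have w: "\<omega> \<in> cadlag_paths E" by (simp add: space_P)
    have "(\<Sum>a\<in>E. \<Sum>b\<in>E. g b * (trans_prob E q (t - u) a b * (H (stop u \<omega>) * indicator (D a) \<omega>)))
      = (\<Sum>a\<in>E. if a = \<omega> u then \<Sum>b\<in>E. g b * (trans_prob E q (t - u) a b * H (stop u \<omega>)) else 0)"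
      using w by (intro sum.cong refl) (auto simp: D_def indicator_def)
    also have "\<dots> = (\<Sum>b\<in>E. g b * (trans_prob E q (t - u) (\<omega> u) b * H (stop u \<omega>)))"
      using cadlag_in[OF w] fin by (simp add: sum.delta')
    finally show "(\<Sum>a\<in>E. \<Sum>b\<in>E. g b * (trans_prob E q (t - u) a b * (H (stop u \<omega>) * indicator (D a) \<omega>)))
      = H (stop u \<omega>) * (\<Sum>b\<in>E. trans_prob E q (t - u) (\<omega> u) b * g b)"
      by (simp add: sum_distrib_left mult_ac)
  qed
  finally show ?thesis .
qed

text \<open>The probability of having left a state after time h is linear in h by the expansion of
  the semigroup; the bound is averaged over the law at time u, whose masses add up to 1.\<close>

lemma jump_prob:
  obtains C where "C \<ge> 0" "\<And>u h. 0 \<le> u \<Longrightarrow> 0 \<le> h \<Longrightarrow> h \<le> 1 \<Longrightarrow>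
     expectation (\<lambda>\<omega>. if \<omega> (u + h) = \<omega> u then 0 else 1 :: real) \<le> C * h"
proof -
  obtain C0 where C0: "C0 \<ge> 0" "\<And>h a b. 0 \<le> h \<Longrightarrow> h \<le> 1 \<Longrightarrow> a \<in> E \<Longrightarrow> b \<in> E \<Longrightarrow>
      \<bar>trans_prob E q h a b - (if a = b then 1 else 0) - h * gen_matrix E q a b\<bar> \<le> C0 * h\<^sup>2"
    by (rule trans_prob_expand[OF fin, of q]) (rule that)
  define M where "M = (\<Sum>a\<in>E. \<bar>gen_matrix E q a a\<bar>)"
  have M: "M \<ge> 0" by (simp add: M_def sum_nonneg)
  have *: "expectation (\<lambda>\<omega>. if \<omega> (u + h) = \<omega> u then 0 else 1 :: real) \<le> (C0 + M) * h" if h: "0 \<le> u" "0 \<le> h" "h \<le> 1" for u h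
  proof (cases "h = 0")
    case False
    have meas: "(\<lambda>\<omega>. indicator {a} (\<omega> s) :: real) \<in> borel_measurable (path_space E)" for a s
      by (rule borel_measurable_coord_fun[OF fin, where g="indicator {a}"])
    have int: "integrable P (\<lambda>\<omega>. indicator {a} (\<omega> s) * (1 - indicator {a} (\<omega> s')) :: real)" for a s s'
      by (rule integrable_bounded_path[of _ 1]) (use meas in \<open>auto simp: indicator_def\<close>)
    have int1: "integrable P (\<lambda>\<omega>. indicator {a} (\<omega> s) :: real)" for a s
      by (rule integrable_bounded_path[of _ 1]) (use meas in \<open>auto simp: indicator_def\<close>)
    have eq: "expectation (\<lambda>\<omega>. indicator {a} (\<omega> u) * (1 - indicator {a} (\<omega> (u + h)))) = (1 - trans_prob E q h a a) * expectation (\<lambda>\<omega>. indicator {a} (\<omega> u))"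
      if a: "a \<in> E" for a
    proof -
      have "expectation (\<lambda>\<omega>. indicator {a} (stop u \<omega> u) * indicator {a} (\<omega> (u + h)) :: real) =
        expectation (\<lambda>\<omega>. indicator {a} (stop u \<omega> u) * (\<Sum>b\<in>E. trans_prob E q (u + h - u) (\<omega> u) b * indicator {a} b))"
        by (rule markov_int[where B=1]) (use h False meas in \<open>auto simp: indicator_def\<close>)
      also have "\<dots> = expectation (\<lambda>\<omega>. trans_prob E q h a a * indicator {a} (\<omega> u))"
        using a fin by (intro Bochner_Integration.integral_cong)
          (auto simp: stop_def indicator_def if_distrib[of "\<lambda>x. _ * x"] cong: if_cong)
      finally have e: "expectation (\<lambda>\<omega>. indicator {a} (\<omega> u) * indicator {a} (\<omega> (u + h)) :: real) = trans_prob E q h a a * expectation (\<lambda>\<omega>. indicator {a} (\<omega> u))"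
        by (simp add: stop_def)
      have int2: "integrable P (\<lambda>\<omega>. indicator {a} (\<omega> u) * indicator {a} (\<omega> (u + h)) :: real)"
        by (rule integrable_bounded_path[of _ 1]) (use meas in \<open>auto simp: indicator_def\<close>)
      have "expectation (\<lambda>\<omega>. indicator {a} (\<omega> u) * (1 - indicator {a} (\<omega> (u + h)))) = expectation (\<lambda>\<omega>. indicator {a} (\<omega> u) - indicator {a} (\<omega> u) * indicator {a} (\<omega> (u + h)) :: real)"
        by (simp add: algebra_simps)
      then show ?thesis using e int1[of a u] int2 by (simp add: algebra_simps)
    qed
    have "expectation (\<lambda>\<omega>. if \<omega> (u + h) = \<omega> u then 0 else 1 :: real) = expectation (\<lambda>\<omega>. \<Sum>a\<in>E. indicator {a} (\<omega> u) * (1 - indicator {a} (\<omega> (u + h))))"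
    proof (rule Bochner_Integration.integral_cong[OF refl])
      fix \<omega> assume "\<omega> \<in> space P"
      then have "\<omega> u \<in> E" by (simp add: space_P cadlag_in)
      have "(\<Sum>a\<in>E. indicator {a} (\<omega> u) * (1 - indicator {a} (\<omega> (u + h))) :: real) = (\<Sum>a\<in>E. if a = \<omega> u then (if \<omega> (u + h) = a then 0 else 1) else 0)"
        by (intro sum.cong) (auto simp: indicator_def)
      also have "\<dots> = (if \<omega> (u + h) = \<omega> u then 0 else 1)" using \<open>\<omega> u \<in> E\<close> fin by (simp add: sum.delta')
      finally show "(if \<omega> (u + h) = \<omega> u then 0 else 1) = (\<Sum>a\<in>E. indicator {a} (\<omega> u) * (1 - indicator {a} (\<omega> (u + h))) :: real)" by simp
    qed
    also have "\<dots> = (\<Sum>a\<in>E. (1 - trans_prob E q h a a) * expectation (\<lambda>\<omega>. indicator {a} (\<omega> u)))"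
      using int by (simp add: eq)
    also have "\<dots> \<le> (\<Sum>a\<in>E. ((C0 + M) * h) * expectation (\<lambda>\<omega>. indicator {a} (\<omega> u)))"
    proof (intro sum_mono mult_right_mono)
      fix a assume a: "a \<in> E"
      have "1 - trans_prob E q h a a \<le> C0 * h\<^sup>2 + h * \<bar>gen_matrix E q a a\<bar>"
        using C0(2)[OF h(2,3) a a] abs_mult[of h "gen_matrix E q a a"] h by (auto simp: abs_if split: if_splits)
      also have "\<dots> \<le> C0 * h + h * M"
        using h a fin C0 by (intro add_mono mult_left_mono) (auto simp: M_def power2_eq_square mult_left_le intro!: member_le_sum)
      finally show "1 - trans_prob E q h a a \<le> (C0 + M) * h" by (simp add: algebra_simps)
    qed (auto intro!: Bochner_Integration.integral_nonneg)
    also have "\<dots> = ((C0 + M) * h) * expectation (\<lambda>\<omega>. \<Sum>a\<in>E. indicator {a} (\<omega> u))"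
      using int1 by (simp add: sum_distrib_left)
    also have "expectation (\<lambda>\<omega>. \<Sum>a\<in>E. indicator {a} (\<omega> u)) = expectation (\<lambda>\<omega>. 1 :: real)"
    proof (rule Bochner_Integration.integral_cong[OF refl])
      fix \<omega> assume "\<omega> \<in> space P"
      then have "\<omega> u \<in> E" by (simp add: space_P cadlag_in)
      have "(\<Sum>a\<in>E. indicator {a} (\<omega> u) :: real) = (\<Sum>a\<in>E. if a = \<omega> u then 1 else 0)"
        by (intro sum.cong) (auto simp: indicator_def)
      then show "(\<Sum>a\<in>E. indicator {a} (\<omega> u) :: real) = 1" using fin \<open>\<omega> u \<in> E\<close> by simp
    qed
    finally show ?thesis by (simp add: prob_space)
  qed simp
  show ?thesis by (rule that[of "C0 + M"]) (use C0 M * in auto)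
qed


text \<open>By Fubini the expected time spent away from the initial state is the integral of a
  probability of order s - t, and hence of order h squared.\<close>

lemma expectation_sojourn_deviation:
  assumes C: "C \<ge> 0" "\<And>u h. 0 \<le> u \<Longrightarrow> 0 \<le> h \<Longrightarrow> h \<le> 1 \<Longrightarrow>
     expectation (\<lambda>\<omega>. if \<omega> (u + h) = \<omega> u then 0 else 1 :: real) \<le> C * h"
    and t: "0 \<le> t" "0 < h" "h \<le> 1"
  defines "D \<equiv> \<lambda>\<omega> :: real \<Rightarrow> 'b. \<integral>s. indicator {t<..t + h} s * (if \<omega> s = \<omega> t then 0 else 1 :: real) \<partial>lborel"
  shows "integrable P D" "expectation D \<le> C * h\<^sup>2"
proof -
  interpret PL: pair_sigma_finite P lborel ..
  define f :: "(real \<Rightarrow> 'b) \<Rightarrow> real \<Rightarrow> real" where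
    "f \<omega> s = indicator {t<..t + h} s * (if \<omega> s = \<omega> t then 0 else 1)" for \<omega> s
  have f_sum: "f \<omega> s = indicator {t<..t + h} s * (\<Sum>a\<in>E. indicator {a} (\<omega> t) * (1 - indicator {a} (\<omega> s)))" if "\<omega> \<in> cadlag_paths E" for \<omega> s
  proof -
    have "(\<Sum>a\<in>E. indicator {a} (\<omega> t) * (1 - indicator {a} (\<omega> s)) :: real) = (\<Sum>a\<in>E. if a = \<omega> t then (if \<omega> s = a then 0 else 1) else 0)"
      by (intro sum.cong) (auto simp: indicator_def)
    also have "\<dots> = (if \<omega> s = \<omega> t then 0 else 1)" using cadlag_in[OF that] fin by (simp add: sum.delta')
    finally show ?thesis by (simp add: f_def)
  qed
  have sp: "sets (P \<Otimes>\<^sub>M (lborel :: real measure)) = sets (path_space E \<Otimes>\<^sub>M (borel :: real measure))"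
    by (intro sets_pair_measure_cong sets_P) simp
  have m1: "(\<lambda>x::(real \<Rightarrow> 'b) \<times> real. indicator {a} (fst x (snd x)) :: real) \<in> borel_measurable (P \<Otimes>\<^sub>M lborel)" for a
    unfolding measurable_cong_sets[OF sp refl] by (rule measurable_path_joint[OF fin])
  have m2: "(\<lambda>x::(real \<Rightarrow> 'b) \<times> real. indicator {a} (fst x t) :: real) \<in> borel_measurable (P \<Otimes>\<^sub>M lborel)" for a
    by (rule measurable_compose[OF measurable_fst]) (simp add: measurable_P borel_measurable_coord_fun[OF fin])
  have "(\<lambda>x. indicator {t<..t + h} (snd x) * (\<Sum>a\<in>E. indicator {a} (fst x t) * (1 - indicator {a} (fst x (snd x)))) :: real) \<in> borel_measurable (P \<Otimes>\<^sub>M lborel)"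
    using m1 m2 by measurable
  then have meas: "(\<lambda>x. f (fst x) (snd x)) \<in> borel_measurable (P \<Otimes>\<^sub>M lborel)"
    by (rule measurable_cong[THEN iffD1, rotated]) (auto simp: space_pair_measure space_P f_sum)
  have int: "integrable (P \<Otimes>\<^sub>M lborel) (\<lambda>x. f (fst x) (snd x))"
  proof (rule Bochner_Integration.integrable_bound)
    show "integrable (P \<Otimes>\<^sub>M lborel) (indicator (space P \<times> {t<..t + h}) :: _ \<Rightarrow> real)"
      using t by (intro integrable_real_indicator) (auto simp: lborel.emeasure_pair_measure_Times emeasure_space_1)
    show "AE x in P \<Otimes>\<^sub>M lborel. norm (f (fst x) (snd x)) \<le> norm (indicator (space P \<times> {t<..t + h}) x :: real)"
      by (rule AE_I2) (auto simp: f_def indicator_def space_pair_measure)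
  qed (rule meas)
  then have int': "integrable (P \<Otimes>\<^sub>M lborel) (case_prod f)" by (simp add: case_prod_beta')
  have D: "D = (\<lambda>\<omega>. \<integral>s. f \<omega> s \<partial>lborel)" by (simp add: D_def f_def)
  show "integrable P D" unfolding D by (rule PL.integrable_fst'[OF int, simplified])
  have "expectation D = (\<integral>s. expectation (\<lambda>\<omega>. f \<omega> s) \<partial>lborel)"
    unfolding D by (rule PL.Fubini_integral[OF int', symmetric])
  also have "\<dots> \<le> (\<integral>s. C * h * indicator {t<..t + h} s \<partial>lborel)"
  proof (rule integral_mono)
    show "integrable lborel (\<lambda>s. expectation (\<lambda>\<omega>. f \<omega> s))"
      using PL.integrable_snd[OF int'] by simp
    show "integrable lborel (\<lambda>s. C * h * indicator {t<..t + h} s)"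
      by (intro integrable_mult_right integrable_lborel_indicator_bounded) auto
    fix s show "expectation (\<lambda>\<omega>. f \<omega> s) \<le> C * h * indicator {t<..t + h} s"
    proof (cases "s \<in> {t<..t + h}")
      case True
      have "expectation (\<lambda>\<omega>. f \<omega> s) = expectation (\<lambda>\<omega>. if \<omega> (t + (s - t)) = \<omega> t then 0 else 1 :: real)"
        using True by (simp add: f_def)
      also have "\<dots> \<le> C * (s - t)" using True t by (intro C) auto
      also have "\<dots> \<le> C * h" using True C by (intro mult_left_mono) auto
      finally show ?thesis using True by simp
    qed (simp add: f_def)
  qed
  also have "\<dots> = C * h\<^sup>2" using t by (simp add: power2_eq_square)
  finally show "expectation D \<le> C * h\<^sup>2" .
qed

text \<open>To first order in h the semigroup changes \<open>F\<close> by h times the generator of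
  \<open>F\<close>, and the exponential weight adds h times \<open>c F\<close>. The hypothesis
  \<open>harm\<close> makes these cancel, so one step changes expectations by a quadratic amount,
  even after multiplication by a bounded functional of the past.\<close>

lemma feynman_kac_step:
  fixes F c :: "'b \<Rightarrow> real"
  assumes harm: "\<And>a. a \<in> E \<Longrightarrow> (\<Sum>b\<in>E. gen_matrix E q a b * F b) + c a * F a = 0"
    and FB: "\<And>a. a \<in> E \<Longrightarrow> \<bar>F a\<bar> \<le> B" and cB: "\<And>a. a \<in> E \<Longrightarrow> \<bar>c a\<bar> \<le> B"
  obtains C where "C \<ge> 0" "\<And>t h H K. 0 \<le> t \<Longrightarrow> 0 < h \<Longrightarrow> h \<le> 1 \<Longrightarrow> H \<in> borel_measurable (path_space E) \<Longrightarrow>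
     (\<forall>\<omega>\<in>cadlag_paths E. \<bar>H \<omega>\<bar> \<le> K) \<Longrightarrow>
     \<bar>expectation (\<lambda>\<omega>. H (stop t \<omega>) * (exp (addf c (t + h) \<omega> - addf c t \<omega>) * F (\<omega> (t + h)) - F (\<omega> t)))\<bar> \<le> K * (C * h\<^sup>2)"
proof -
  obtain C0 where C0: "C0 \<ge> 0" "\<And>h a b. 0 \<le> h \<Longrightarrow> h \<le> 1 \<Longrightarrow> a \<in> E \<Longrightarrow> b \<in> E \<Longrightarrow>
      \<bar>trans_prob E q h a b - (if a = b then 1 else 0) - h * gen_matrix E q a b\<bar> \<le> C0 * h\<^sup>2"
    by (rule trans_prob_expand[OF fin, of q]) (rule that)
  obtain C1 where C1: "C1 \<ge> 0" "\<And>u h. 0 \<le> u \<Longrightarrow> 0 \<le> h \<Longrightarrow> h \<le> 1 \<Longrightarrow>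
     expectation (\<lambda>\<omega>. if \<omega> (u + h) = \<omega> u then 0 else 1 :: real) \<le> C1 * h"
    by (rule jump_prob) (rule that)
  have B0: "B \<ge> 0" using FB[OF a0] by linarith
  \<comment> \<open>The four summands bound, in this order: the error of the semigroup expansion,
    the remainder of the exponential, the error of freezing \<open>c\<close> along the step, and the
    change of \<open>F\<close> inside the first-order term.\<close>
  define C where "C = real (card E) * (C0 * B) + B ^ 3 * exp B + 2 * B\<^sup>2 * C1 + 2 * B\<^sup>2 * C1"
  have C: "C \<ge> 0" using C0 C1 B0 by (simp add: C_def)
  show ?thesis
  proof (rule that[OF C])
    fix t h :: real and H :: "(real \<Rightarrow> 'b) \<Rightarrow> real" and K
    assume t: "0 \<le> t" and h: "0 < h" "h \<le> 1" and H[measurable]: "H \<in> borel_measurable (path_space E)"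
      and "\<forall>\<omega>\<in>cadlag_paths E. \<bar>H \<omega>\<bar> \<le> K"
    then have HK: "\<And>\<omega>. \<omega> \<in> cadlag_paths E \<Longrightarrow> \<bar>H \<omega>\<bar> \<le> K" by blast
    have K0: "0 \<le> K"
    proof -
      obtain w where "w \<in> space P" using not_empty by blast
      then show ?thesis using HK[of w] by (simp add: space_P)
    qed
    define PF where "PF a = (\<Sum>b\<in>E. trans_prob E q h a b * F b)" for a
    define D where "D = (\<lambda>\<omega> :: real \<Rightarrow> 'b. \<integral>s. indicator {t<..t + h} s * (if \<omega> s = \<omega> t then 0 else 1 :: real) \<partial>lborel)"
    define I where "I = (\<lambda>\<omega>::real \<Rightarrow> 'b. if \<omega> (t + h) = \<omega> t then 0 else 1 :: real)"
    define G where "G \<omega> = exp (addf c (t + h) \<omega> - addf c t \<omega>) * F (\<omega> (t + h)) - F (\<omega> t)" for \<omega>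
    have D: "integrable P D" "expectation D \<le> C1 * h\<^sup>2"
      unfolding D_def using expectation_sojourn_deviation[OF C1 t h] by auto
    have I: "expectation I \<le> C1 * h" unfolding I_def using C1(2)[of t h] t h by simp
    have iI: "integrable P I"
    proof (cases "integrable P I")
      case False
      have "I \<in> borel_measurable (path_space E)"
      proof -
        have m: "(\<lambda>\<omega>. indicator {a} (\<omega> s) :: real) \<in> borel_measurable (path_space E)" for a s
          by (rule borel_measurable_coord_fun[OF fin, where g="indicator {a}"])
        have "(\<lambda>\<omega>. \<Sum>a\<in>E. indicator {a} (\<omega> t) * (1 - indicator {a} (\<omega> (t + h))) :: real) \<in> borel_measurable (path_space E)"
          using m by measurable
        then show ?thesis
        proof (rule measurable_cong[THEN iffD1, rotated])
          fix \<omega> assume "\<omega> \<in> space (path_space E)"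
          then have w: "\<omega> \<in> cadlag_paths E" by simp
          have "(\<Sum>a\<in>E. indicator {a} (\<omega> t) * (1 - indicator {a} (\<omega> (t + h))) :: real) = (\<Sum>a\<in>E. if a = \<omega> t then (if \<omega> (t + h) = a then 0 else 1) else 0)"
            by (intro sum.cong) (auto simp: indicator_def)
          also have "\<dots> = I \<omega>" using cadlag_in[OF w] fin by (simp add: sum.delta' I_def)
          finally show "(\<Sum>a\<in>E. indicator {a} (\<omega> t) * (1 - indicator {a} (\<omega> (t + h))) :: real) = I \<omega>" .
        qed
      qed
      then show ?thesis by (rule integrable_bounded_path[of _ 1]) (auto simp: I_def)
    qed
    have [measurable]: "addf c s \<in> borel_measurable P" for s unfolding measurable_P by (rule measurable_addf[OF fin])
    have cm[measurable]: "(\<lambda>\<omega>. f (\<omega> s)) \<in> borel_measurable P" for s and f :: "'b \<Rightarrow> real"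
      unfolding measurable_P by (rule borel_measurable_coord_fun[OF fin])
    have Hs[measurable]: "(\<lambda>\<omega>. H (stop t \<omega>)) \<in> borel_measurable P"
      unfolding measurable_P using measurable_stop[OF t, of E] by measurable
    have HsK: "\<bar>H (stop t \<omega>)\<bar> \<le> K" if "\<omega> \<in> cadlag_paths E" for \<omega> by (rule HK[OF stop_cadlag[OF that t]])
    have PFB: "\<bar>PF a - F a + h * (c a * F a)\<bar> \<le> real (card E) * (C0 * B) * h\<^sup>2" if a: "a \<in> E" for a
    proof -
      have "F a = (\<Sum>b\<in>E. (if a = b then 1 else 0) * F b)" using a fin by (simp add: if_distrib[of "\<lambda>x. x * _"] cong: if_cong)
      moreover have "h * (c a * F a) = - (\<Sum>b\<in>E. h * gen_matrix E q a b * F b)"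
        using harm[OF a] by (simp add: sum_distrib_left[symmetric] mult.assoc) (metis add.commute add_eq_0_iff mult_minus_right)
      ultimately have "PF a - F a + h * (c a * F a) = (\<Sum>b\<in>E. (trans_prob E q h a b - (if a = b then 1 else 0) - h * gen_matrix E q a b) * F b)"
        unfolding PF_def by (simp add: sum_subtractf left_diff_distrib)
      also have "\<bar>\<dots>\<bar> \<le> (\<Sum>b\<in>E. (C0 * h\<^sup>2) * B)"
      proof (intro order_trans[OF sum_abs] sum_mono)
        fix b assume b: "b \<in> E"
        show "\<bar>(trans_prob E q h a b - (if a = b then 1 else 0) - h * gen_matrix E q a b) * F b\<bar> \<le> (C0 * h\<^sup>2) * B"
          unfolding abs_mult[of _ "F b"] using C0(1) h by (intro mult_mono C0(2) a b FB) auto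
      qed
      finally show ?thesis by (simp add: mult_ac)
    qed
    have R: "\<bar>G \<omega> - (F (\<omega> (t + h)) - PF (\<omega> t))\<bar> \<le> real (card E) * (C0 * B) * h\<^sup>2 + B ^ 3 * exp B * h\<^sup>2 + 2 * B\<^sup>2 * D \<omega> + 2 * B\<^sup>2 * h * I \<omega>"
      if w: "\<omega> \<in> cadlag_paths E" for \<omega>
    proof -
      define J where "J = addf c (t + h) \<omega> - addf c t \<omega>"
      have J: "\<bar>J\<bar> \<le> B * h" unfolding J_def using addf_diff_bound[where c=c and t'="t + h", OF fin w cB t] h by simp
      have Jd: "\<bar>J - h * c (\<omega> t)\<bar> \<le> 2 * B * D \<omega>"
        unfolding J_def D_def using addf_deviation[where c=c and t'="t + h", OF fin w cB t] h by simp
      have Fb: "\<bar>F (\<omega> s)\<bar> \<le> B" "\<bar>c (\<omega> s)\<bar> \<le> B" for s using FB cB cadlag_in[OF w] by auto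
      have e1: "\<bar>(exp J - 1 - J) * F (\<omega> (t + h))\<bar> \<le> B ^ 3 * exp B * h\<^sup>2"
      proof -
        have "\<bar>exp J - 1 - J\<bar> \<le> J\<^sup>2 * exp \<bar>J\<bar>" by (rule abs_exp_minus_linear_le)
        also have "\<dots> \<le> (B * h)\<^sup>2 * exp B"
          using J B0 h by (intro mult_mono) (auto simp: abs_le_square_iff[symmetric] intro: order_trans[OF _ mult_left_le])
        finally have "\<bar>exp J - 1 - J\<bar> * \<bar>F (\<omega> (t + h))\<bar> \<le> ((B * h)\<^sup>2 * exp B) * B" using Fb(1)[of "t + h"] by (intro mult_mono) auto
        then show ?thesis by (simp add: abs_mult power2_eq_square power3_eq_cube mult_ac)
      qed
      have e2: "\<bar>(J - h * c (\<omega> t)) * F (\<omega> (t + h))\<bar> \<le> 2 * B\<^sup>2 * D \<omega>"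
      proof -
        have "\<bar>J - h * c (\<omega> t)\<bar> * \<bar>F (\<omega> (t + h))\<bar> \<le> (2 * B * D \<omega>) * B" using Jd Fb(1)[of "t + h"] by (intro mult_mono) auto
        then show ?thesis by (simp add: abs_mult power2_eq_square mult_ac)
      qed
      have e3: "\<bar>h * c (\<omega> t) * (F (\<omega> (t + h)) - F (\<omega> t))\<bar> \<le> 2 * B\<^sup>2 * h * I \<omega>"
      proof (cases "\<omega> (t + h) = \<omega> t")
        case False
        have "\<bar>F (\<omega> (t + h)) - F (\<omega> t)\<bar> \<le> 2 * B" using Fb(1)[of "t + h"] Fb(1)[of t] by linarith
        then have "\<bar>h * c (\<omega> t)\<bar> * \<bar>F (\<omega> (t + h)) - F (\<omega> t)\<bar> \<le> (h * B) * (2 * B)"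
          using h Fb(2)[of t] B0 by (intro mult_mono) (auto simp: abs_mult)
        then show ?thesis using False by (simp add: I_def abs_mult power2_eq_square mult_ac)
      qed (simp add: I_def)
      have "G \<omega> - (F (\<omega> (t + h)) - PF (\<omega> t)) = (PF (\<omega> t) - F (\<omega> t) + h * (c (\<omega> t) * F (\<omega> t)))
         + (exp J - 1 - J) * F (\<omega> (t + h)) + (J - h * c (\<omega> t)) * F (\<omega> (t + h)) + h * c (\<omega> t) * (F (\<omega> (t + h)) - F (\<omega> t))"
        unfolding G_def J_def[symmetric] by (simp add: algebra_simps)
      then show ?thesis using e1 e2 e3 PFB[OF cadlag_in[OF w, of t]] by linarith
    qed
    have GB: "\<bar>G \<omega>\<bar> \<le> exp B * B + B" if w: "\<omega> \<in> cadlag_paths E" for \<omega>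
    proof -
      have "\<bar>addf c (t + h) \<omega> - addf c t \<omega>\<bar> \<le> B * h" using addf_diff_bound[where c=c and t'="t + h", OF fin w cB t] h by simp
      also have "\<dots> \<le> B" using B0 h by (simp add: mult_left_le)
      finally have "exp (addf c (t + h) \<omega> - addf c t \<omega>) \<le> exp B" by simp
      then have "\<bar>exp (addf c (t + h) \<omega> - addf c t \<omega>) * F (\<omega> (t + h))\<bar> \<le> exp B * B"
        using FB[OF cadlag_in[OF w]] by (auto simp: abs_mult intro!: mult_mono)
      then show ?thesis unfolding G_def using FB[OF cadlag_in[OF w, of t]] by linarith
    qed
    have iHG: "integrable P (\<lambda>\<omega>. H (stop t \<omega>) * G \<omega>)"
    proof (rule integrable_bounded_path[where B="K * (exp B * B + B)"])
      show "(\<lambda>\<omega>. H (stop t \<omega>) * G \<omega>) \<in> borel_measurable (path_space E)"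
        unfolding measurable_P[symmetric] G_def by measurable
    qed (use HsK GB K0 in \<open>auto simp: abs_mult intro!: mult_mono\<close>)
    have PFB2: "\<bar>PF a\<bar> \<le> (\<Sum>a\<in>E. \<bar>PF a\<bar>)" if "a \<in> E" for a
      using that fin by (intro member_le_sum[of a E "\<lambda>a. \<bar>PF a\<bar>"]) auto
    have iH1: "integrable P (\<lambda>\<omega>. H (stop t \<omega>) * F (\<omega> (t + h)))"
      by (rule integrable_bounded_path[where B="K * B"])
         (use HsK FB[OF cadlag_in[of _ E]] K0 in \<open>auto simp: abs_mult measurable_P[symmetric] intro!: mult_mono\<close>)
    have iH2: "integrable P (\<lambda>\<omega>. H (stop t \<omega>) * PF (\<omega> t))"
      by (rule integrable_bounded_path[where B="K * (\<Sum>a\<in>E. \<bar>PF a\<bar>)"])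
         (use HsK PFB2[OF cadlag_in[of _ E]] K0 in \<open>auto simp: abs_mult measurable_P[symmetric] intro!: mult_mono\<close>)
    \<comment> \<open>By the Markov property the difference between \<open>F\<close> at time t + h
      and its conditional mean is invisible to functionals of the past. It may be subtracted for
      free, and only terms that are quadratic in expectation remain.\<close>
    have "expectation (\<lambda>\<omega>. H (stop t \<omega>) * F (\<omega> (t + h))) = expectation (\<lambda>\<omega>. H (stop t \<omega>) * PF (\<omega> t))"
      unfolding PF_def using markov_int[OF t _ H HK, of "t + h" F] h by simp
    then have zero: "expectation (\<lambda>\<omega>. H (stop t \<omega>) * F (\<omega> (t + h)) - H (stop t \<omega>) * PF (\<omega> t)) = 0"
      using iH1 iH2 by simp
    have lin: "expectation (\<lambda>\<omega>. K * (k + a * D \<omega> + b * I \<omega>)) = K * (k + a * expectation D + b * expectation I)" for k a b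
    proof -
      have "expectation (\<lambda>\<omega>. k + a * D \<omega> + b * I \<omega>) = expectation (\<lambda>\<omega>. k + a * D \<omega>) + expectation (\<lambda>\<omega>. b * I \<omega>)"
        by (intro Bochner_Integration.integral_add Bochner_Integration.integrable_add integrable_mult_right D(1) iI integrable_const)
      also have "expectation (\<lambda>\<omega>. k + a * D \<omega>) = expectation (\<lambda>\<omega>. k) + expectation (\<lambda>\<omega>. a * D \<omega>)"
        by (intro Bochner_Integration.integral_add integrable_mult_right D(1) integrable_const)
      finally show ?thesis by (simp add: prob_space)
    qed
    have eq: "expectation (\<lambda>\<omega>. H (stop t \<omega>) * G \<omega>) = expectation (\<lambda>\<omega>. H (stop t \<omega>) * G \<omega> - (H (stop t \<omega>) * F (\<omega> (t + h)) - H (stop t \<omega>) * PF (\<omega> t)))"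
      using iHG iH1 iH2 zero by simp
    have "\<bar>expectation (\<lambda>\<omega>. H (stop t \<omega>) * G \<omega>)\<bar> \<le> expectation (\<lambda>\<omega>. K * (real (card E) * (C0 * B) * h\<^sup>2 + B ^ 3 * exp B * h\<^sup>2 + 2 * B\<^sup>2 * D \<omega> + 2 * B\<^sup>2 * h * I \<omega>))"
      unfolding eq
    proof (rule order_trans[OF integral_abs_bound], rule integral_mono)
      show "integrable P (\<lambda>\<omega>. \<bar>H (stop t \<omega>) * G \<omega> - (H (stop t \<omega>) * F (\<omega> (t + h)) - H (stop t \<omega>) * PF (\<omega> t))\<bar>)"
        by (intro integrable_abs Bochner_Integration.integrable_diff iHG iH1 iH2)
      show "integrable P (\<lambda>\<omega>. K * (real (card E) * (C0 * B) * h\<^sup>2 + B ^ 3 * exp B * h\<^sup>2 + 2 * B\<^sup>2 * D \<omega> + 2 * B\<^sup>2 * h * I \<omega>))"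
        by (intro integrable_mult_right Bochner_Integration.integrable_add D(1) iI integrable_const)
      fix \<omega> assume "\<omega> \<in> space P"
      then have w: "\<omega> \<in> cadlag_paths E" by (simp add: space_P)
      have "\<bar>H (stop t \<omega>) * G \<omega> - (H (stop t \<omega>) * F (\<omega> (t + h)) - H (stop t \<omega>) * PF (\<omega> t))\<bar> = \<bar>H (stop t \<omega>)\<bar> * \<bar>G \<omega> - (F (\<omega> (t + h)) - PF (\<omega> t))\<bar>"
        by (simp add: abs_mult[symmetric] algebra_simps)
      also have "\<dots> \<le> K * (real (card E) * (C0 * B) * h\<^sup>2 + B ^ 3 * exp B * h\<^sup>2 + 2 * B\<^sup>2 * D \<omega> + 2 * B\<^sup>2 * h * I \<omega>)"
        using HsK[OF w] R[OF w] K0 by (intro mult_mono) auto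
      finally show "\<bar>H (stop t \<omega>) * G \<omega> - (H (stop t \<omega>) * F (\<omega> (t + h)) - H (stop t \<omega>) * PF (\<omega> t))\<bar> \<le> \<dots>" .
    qed
    also have "\<dots> = K * (real (card E) * (C0 * B) * h\<^sup>2 + B ^ 3 * exp B * h\<^sup>2 + 2 * B\<^sup>2 * expectation D + 2 * B\<^sup>2 * h * expectation I)"
      by (rule lin)
    also have "\<dots> \<le> K * (real (card E) * (C0 * B) * h\<^sup>2 + B ^ 3 * exp B * h\<^sup>2 + 2 * B\<^sup>2 * (C1 * h\<^sup>2) + 2 * B\<^sup>2 * h * (C1 * h))"
    proof -
      have "2 * B\<^sup>2 * expectation D \<le> 2 * B\<^sup>2 * (C1 * h\<^sup>2)" by (rule mult_left_mono[OF D(2)]) simp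
      moreover have "2 * B\<^sup>2 * h * expectation I \<le> 2 * B\<^sup>2 * h * (C1 * h)" by (rule mult_left_mono[OF I]) (use h in simp)
      ultimately show ?thesis by (intro mult_left_mono[OF _ K0] add_mono order_refl)
    qed
    also have "\<dots> = K * (C * h\<^sup>2)" unfolding C_def power2_eq_square by (simp only: algebra_simps)
    finally show "\<bar>expectation (\<lambda>\<omega>. H (stop t \<omega>) * (exp (addf c (t + h) \<omega> - addf c t \<omega>) * F (\<omega> (t + h)) - F (\<omega> t)))\<bar> \<le> K * (C * h\<^sup>2)"
      by (simp add: G_def)
  qed
qed

text \<open>The weight accumulated up to time v is itself a bounded functional of the past, so the
  one-step estimate applies from v on; a function with quadratic increments is constant.\<close>

lemma feynman_kac_martingale:
  fixes F c :: "'b \<Rightarrow> real"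
  assumes harm: "\<And>a. a \<in> E \<Longrightarrow> (\<Sum>b\<in>E. gen_matrix E q a b * F b) + c a * F a = 0"
    and u: "0 \<le> u" "u \<le> t" and H: "H \<in> borel_measurable (path_space E)"
    and HK: "\<And>\<omega>. \<omega> \<in> cadlag_paths E \<Longrightarrow> \<bar>H \<omega>\<bar> \<le> K"
  shows "expectation (\<lambda>\<omega>. H (stop u \<omega>) * (exp (addf c t \<omega>) * F (\<omega> t))) =
         expectation (\<lambda>\<omega>. H (stop u \<omega>) * (exp (addf c u \<omega>) * F (\<omega> u)))"
proof -
  define B where "B = (\<Sum>a\<in>E. \<bar>F a\<bar> + \<bar>c a\<bar>)"
  have "\<bar>F a\<bar> + \<bar>c a\<bar> \<le> B" if "a \<in> E" for a
    unfolding B_def using that fin by (intro member_le_sum[of a E "\<lambda>a. \<bar>F a\<bar> + \<bar>c a\<bar>"]) auto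
  then have FB: "\<bar>F a\<bar> \<le> B" and cB: "\<bar>c a\<bar> \<le> B" if "a \<in> E" for a using that by fastforce+
  have B0: "B \<ge> 0" using FB[OF a0] by linarith
  have K0: "0 \<le> K"
  proof -
    obtain w where "w \<in> space P" using not_empty by blast
    then show ?thesis using HK[of w] by (simp add: space_P)
  qed
  obtain C where C: "C \<ge> 0" "\<And>t h H K. 0 \<le> t \<Longrightarrow> 0 < h \<Longrightarrow> h \<le> 1 \<Longrightarrow> H \<in> borel_measurable (path_space E) \<Longrightarrow>
     (\<forall>\<omega>\<in>cadlag_paths E. \<bar>H \<omega>\<bar> \<le> K) \<Longrightarrow>
     \<bar>expectation (\<lambda>\<omega>. H (stop t \<omega>) * (exp (addf c (t + h) \<omega> - addf c t \<omega>) * F (\<omega> (t + h)) - F (\<omega> t)))\<bar> \<le> K * (C * h\<^sup>2)"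
    by (rule feynman_kac_step[OF harm FB cB], assumption, assumption, assumption, rule that)
  define Hv where "Hv v \<omega> = H (stop u \<omega>) * exp (addf c v \<omega>)" for v \<omega>
  have Hvm: "Hv v \<in> borel_measurable (path_space E)" for v
    unfolding Hv_def using measurable_stop[OF u(1), of E] measurable_addf[OF fin, of c v] H by measurable
  have addB: "exp (addf c v \<omega>) \<le> exp (B * t)" if "\<omega> \<in> cadlag_paths E" "0 \<le> v" "v \<le> t" for v \<omega>
  proof -
    have "addf c v \<omega> \<le> B * v" using addf_bound[where c=c, OF fin that(1) cB that(2)] by simp
    also have "\<dots> \<le> B * t" using that B0 by (intro mult_left_mono)
    finally show ?thesis by simp
  qed
  have HvB: "\<bar>Hv v \<omega>\<bar> \<le> K * exp (B * t)" if "\<omega> \<in> cadlag_paths E" "0 \<le> v" "v \<le> t" for v \<omega>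
    unfolding Hv_def using HK[OF stop_cadlag[OF that(1) u(1)]] addB[OF that] K0 by (auto simp: abs_mult intro!: mult_mono)
  \<comment> \<open>The exponent up to time v reads the path only before v. This is what admits the
    weight as the functional \<open>H\<close> of the one-step estimate.\<close>
  have Hvs: "Hv v (stop v \<omega>) = Hv v \<omega>" if "u \<le> v" for v \<omega>
  proof -
    have "stop u (stop v \<omega>) = stop u \<omega>" using that by (auto simp: stop_def fun_eq_iff min_def)
    then show ?thesis by (simp add: Hv_def addf_stop)
  qed
  define \<phi> where "\<phi> v = expectation (\<lambda>\<omega>. Hv v \<omega> * F (\<omega> v))" for v
  have int: "integrable P (\<lambda>\<omega>. Hv v \<omega> * F (\<omega> s))" if "0 \<le> v" "v \<le> t" for v s
  proof (rule integrable_bounded_path[where B="K * exp (B * t) * B"])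
    show "(\<lambda>\<omega>. Hv v \<omega> * F (\<omega> s)) \<in> borel_measurable (path_space E)"
      using Hvm borel_measurable_coord_fun[OF fin, of F s] by measurable
  qed (use HvB that FB[OF cadlag_in[of _ E]] K0 in \<open>auto simp: abs_mult intro!: mult_mono\<close>)
  have "\<phi> t = \<phi> u"
  proof (rule constant_if_quadratic_increments[OF u(2)])
    fix v h :: real assume v: "u \<le> v" "0 < h" "h \<le> 1" "v + h \<le> t"
    have eq1: "\<phi> (v + h) - \<phi> v = expectation (\<lambda>\<omega>. Hv (v + h) \<omega> * F (\<omega> (v + h)) - Hv v \<omega> * F (\<omega> v))"
      unfolding \<phi>_def using int[of "v + h"] int[of v] v u by simp
    have eq2: "expectation (\<lambda>\<omega>. Hv (v + h) \<omega> * F (\<omega> (v + h)) - Hv v \<omega> * F (\<omega> v)) = expectation (\<lambda>\<omega>. Hv v (stop v \<omega>) * (exp (addf c (v + h) \<omega> - addf c v \<omega>) * F (\<omega> (v + h)) - F (\<omega> v)))"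
      unfolding Hvs[OF v(1)] unfolding Hv_def
    proof (rule Bochner_Integration.integral_cong[OF refl])
      fix \<omega>
      have "exp (addf c (v + h) \<omega>) = exp (addf c v \<omega>) * exp (addf c (v + h) \<omega> - addf c v \<omega>)"
        by (simp add: exp_add[symmetric])
      then show "H (stop u \<omega>) * exp (addf c (v + h) \<omega>) * F (\<omega> (v + h)) - H (stop u \<omega>) * exp (addf c v \<omega>) * F (\<omega> v)
        = H (stop u \<omega>) * exp (addf c v \<omega>) * (exp (addf c (v + h) \<omega> - addf c v \<omega>) * F (\<omega> (v + h)) - F (\<omega> v))"
        by (simp only: right_diff_distrib mult.assoc)
    qed
    have "\<bar>\<phi> (v + h) - \<phi> v\<bar> \<le> (K * exp (B * t)) * (C * h\<^sup>2)"
      unfolding eq1 eq2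
    proof (rule C(2))
      show "\<forall>\<omega>\<in>cadlag_paths E. \<bar>Hv v \<omega>\<bar> \<le> K * exp (B * t)" using HvB[of _ v] v u by simp
    qed (use v u Hvm in \<open>simp_all\<close>)
    then show "\<bar>\<phi> (v + h) - \<phi> v\<bar> \<le> (K * exp (B * t) * C) * h\<^sup>2" by (simp add: mult_ac)
  qed
  then show ?thesis by (simp add: \<phi>_def Hv_def mult.assoc)
qed

end

section \<open>Occupation times and trace paths\<close>

lemma occ_time_addf:
  assumes "finite E" "\<omega> \<in> cadlag_paths E"
  shows "occ_time G \<omega> t = addf (indicator G) t \<omega>"
proof -
  have "(\<lambda>s. indicator G (\<omega> s) :: real) \<in> borel_measurable borel" by (rule measurable_path[OF assms])
  then have "(\<lambda>s. indicator G (\<omega> s) :: real) -` {1} \<inter> space borel \<in> sets borel" by (rule measurable_sets) simp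
  also have "(\<lambda>s. indicator G (\<omega> s) :: real) -` {1} \<inter> space borel = {s. \<omega> s \<in> G}" by (auto simp: indicator_def)
  finally have m: "{s. \<omega> s \<in> G} \<in> sets borel" .
  have "addf (indicator G) t \<omega> = (\<integral>s. indicator {s\<in>{0..t}. \<omega> s \<in> G} s \<partial>lborel)"
    unfolding addf_def by (rule Bochner_Integration.integral_cong) (auto simp: indicator_def)
  also have "\<dots> = measure lborel {s\<in>{0..t}. \<omega> s \<in> G}" by simp
  finally show ?thesis by (simp add: occ_time_def)
qed

lemma occ_time_diff:
  assumes "finite E" "\<omega> \<in> cadlag_paths E" "0 \<le> t" "t \<le> t'"
  shows "occ_time G \<omega> t' - occ_time G \<omega> t \<le> t' - t" "occ_time G \<omega> t \<le> occ_time G \<omega> t'"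
proof -
  have b: "\<bar>indicator G a :: real\<bar> \<le> 1" for a by (simp add: indicator_def)
  have "\<bar>addf (indicator G) t' \<omega> - addf (indicator G) t \<omega>\<bar> \<le> 1 * (t' - t)"
    by (rule addf_diff_bound[where c="indicator G", OF assms(1,2) b assms(3,4)])
  then show "occ_time G \<omega> t' - occ_time G \<omega> t \<le> t' - t" by (simp add: occ_time_addf[OF assms(1,2)])
  have "addf (indicator G) t' \<omega> - addf (indicator G) t \<omega> = (\<integral>s. indicator {t<..t'} s * indicator G (\<omega> s) \<partial>lborel)"
    by (rule addf_diff[where c="indicator G", OF assms(1,2) b assms(3,4)])
  also have "\<dots> \<ge> 0" by (rule Bochner_Integration.integral_nonneg) simp
  finally show "occ_time G \<omega> t \<le> occ_time G \<omega> t'" by (simp add: occ_time_addf[OF assms(1,2)])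
qed

lemma occ_time_0: "occ_time G \<omega> 0 = 0"
proof -
  have "{s\<in>{0..0}. \<omega> s \<in> G} \<subseteq> {0::real}" by auto
  then have "{s\<in>{0..0}. \<omega> s \<in> G} = {} \<or> {s\<in>{0..0}. \<omega> s \<in> G} = {0::real}" by auto
  then show ?thesis unfolding occ_time_def by (metis measure_empty measure_lborel_singleton)
qed

lemma occ_time_stop: "t \<le> u \<Longrightarrow> occ_time G (stop u \<omega>) t = occ_time G \<omega> t"
  unfolding occ_time_def stop_def by (intro arg_cong[where f="measure lborel"]) (auto simp: min_def)

lemma measurable_occ_time:
  assumes "finite E" shows "(\<lambda>\<omega>. occ_time G \<omega> t) \<in> borel_measurable (path_space E)"
  by (rule measurable_cong[THEN iffD2, OF _ measurable_addf[OF assms, of "indicator G" t]])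
     (simp add: occ_time_addf[OF assms])

text \<open>The occupation time is a nondecreasing 1-Lipschitz clock, so if it ever exceeds t it
  attains the level t, and the supremum in \<open>inv_time\<close> is the last instant at which it
  does. There the path lies in \<open>G\<close>: otherwise it would stay outside for a while and the
  clock would stand still beyond that instant.\<close>

lemma inv_time_props:
  assumes fin: "finite E" and w: "\<omega> \<in> cadlag_paths E" and t: "0 \<le> t" and v: "occ_time G \<omega> v > t" "0 \<le> v"
  defines "S \<equiv> inv_time G \<omega> t"
  shows inv_time_nonneg: "0 \<le> S"
    and inv_time_iff: "\<And>u. 0 \<le> u \<Longrightarrow> occ_time G \<omega> u \<le> t \<longleftrightarrow> u \<le> S"
    and occ_time_inv_time: "occ_time G \<omega> S = t"
    and inv_time_in: "\<omega> S \<in> G"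
proof -
  let ?T = "occ_time G \<omega>" and ?A = "{s. 0 \<le> s \<and> occ_time G \<omega> s \<le> t}"
  have mono: "0 \<le> a \<Longrightarrow> a \<le> b \<Longrightarrow> ?T a \<le> ?T b" for a b by (rule occ_time_diff(2)[OF fin w])
  have lip: "0 \<le> a \<Longrightarrow> a \<le> b \<Longrightarrow> ?T b \<le> ?T a + (b - a)" for a b using occ_time_diff(1)[OF fin w, of a b G] by simp
  have bdd: "bdd_above ?A"
  proof (rule bdd_aboveI[of _ v])
    fix x assume "x \<in> ?A" then show "x \<le> v" using mono[of v x] v by fastforce
  qed
  have z: "0 \<in> ?A" using t by (simp add: occ_time_0)
  show S0: "0 \<le> S" unfolding S_def inv_time_def by (rule cSup_upper[OF z bdd])
  have TS: "?T S \<le> t"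
  proof (rule field_le_epsilon)
    fix e :: real assume e: "0 < e"
    have "S - e < Sup ?A" using e by (simp add: S_def inv_time_def)
    then obtain x where x: "x \<in> ?A" "S - e < x" using less_cSup_iff[of ?A "S - e"] z bdd by blast
    have "x \<le> S" unfolding S_def inv_time_def by (rule cSup_upper[OF x(1) bdd])
    then show "?T S \<le> t + e" using lip[of x S] x by auto
  qed
  show iff: "occ_time G \<omega> u \<le> t \<longleftrightarrow> u \<le> S" if "0 \<le> u" for u
  proof
    assume "?T u \<le> t" then show "u \<le> S" unfolding S_def inv_time_def using that by (intro cSup_upper bdd) auto
  next
    assume "u \<le> S" then show "?T u \<le> t" using mono[OF that] TS by fastforce
  qed
  show "?T S = t"
  proof (rule ccontr)
    assume "?T S \<noteq> t"
    then have *: "?T S < t" using TS by simp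
    then have "?T (S + (t - ?T S)) \<le> t" using lip[of S "S + (t - ?T S)"] S0 by simp
    then have "S + (t - ?T S) \<le> S" using iff[of "S + (t - ?T S)"] S0 * by simp
    then show False using * by simp
  qed
  show "\<omega> S \<in> G"
  proof (rule ccontr)
    assume nG: "\<omega> S \<notin> G"
    obtain \<delta> where d: "\<delta> > 0" "\<And>s. S \<le> s \<Longrightarrow> s < S + \<delta> \<Longrightarrow> \<omega> s = \<omega> S" by (rule cadlag_right[OF w, of S]) (rule that)
    have b: "\<bar>indicator G a :: real\<bar> \<le> 1" for a by (simp add: indicator_def)
    have "?T (S + \<delta>/2) - ?T S = (\<integral>s. indicator {S<..S + \<delta>/2} s * indicator G (\<omega> s) \<partial>lborel)"
      unfolding occ_time_addf[OF fin w] by (rule addf_diff[where c="indicator G", OF fin w b S0]) (use d in simp)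
    also have "\<dots> = (\<integral>s. 0 \<partial>(lborel :: real measure))"
    proof (rule Bochner_Integration.integral_cong[OF refl])
      fix s :: real
      show "indicator {S<..S + \<delta>/2} s * indicator G (\<omega> s) = (0 :: real)"
      proof (cases "s \<in> {S<..S + \<delta>/2}")
        case True
        then have "\<omega> s = \<omega> S" using d(1) by (intro d(2)) auto
        then show ?thesis using nG by simp
      qed simp
    qed
    finally have "?T (S + \<delta>/2) \<le> t" using TS by simp
    then show False using iff[of "S + \<delta>/2"] S0 d(1) by simp
  qed
qed

lemma inv_time_less:
  assumes fin: "finite E" and w: "\<omega> \<in> cadlag_paths E" and t: "0 \<le> t" "t < t'" and v: "occ_time G \<omega> v > t'" "0 \<le> v"
  shows "inv_time G \<omega> t < inv_time G \<omega> t'"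
proof -
  have v': "occ_time G \<omega> v > t" using v t by simp
  have a: "occ_time G \<omega> (inv_time G \<omega> t) = t" "occ_time G \<omega> (inv_time G \<omega> t') = t'"
    using occ_time_inv_time[OF fin w t(1) v' v(2)] occ_time_inv_time[OF fin w _ v] t by auto
  have n: "0 \<le> inv_time G \<omega> t" "0 \<le> inv_time G \<omega> t'" using inv_time_nonneg[OF fin w t(1) v' v(2)] inv_time_nonneg[OF fin w _ v] t by auto
  show ?thesis
  proof (rule ccontr)
    assume "\<not> ?thesis"
    then have "occ_time G \<omega> (inv_time G \<omega> t') \<le> occ_time G \<omega> (inv_time G \<omega> t)" using n by (intro occ_time_diff(2)[OF fin w]) auto
    then show False using a t by simp
  qed
qed

text \<open>The inverse clock is right continuous: just after \<open>inv_time G \<omega> t\<close>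
  the clock exceeds t, so slightly higher levels are reached within any prescribed delay, and there
  the path has not yet changed.\<close>

lemma trace_path_right:
  assumes fin: "finite E" and w: "\<omega> \<in> cadlag_paths E" and t: "0 \<le> t" and v: "occ_time G \<omega> v > t" "0 \<le> v"
  obtains \<delta> where "\<delta> > 0" "\<And>s. t \<le> s \<Longrightarrow> s < t + \<delta> \<Longrightarrow> occ_time G \<omega> v > s \<and> trace_path G \<omega> s = trace_path G \<omega> t"
proof -
  let ?S = "inv_time G \<omega>"
  have S0: "0 \<le> ?S t" by (rule inv_time_nonneg[OF fin w t v])
  obtain e where e: "e > 0" "\<And>s. ?S t \<le> s \<Longrightarrow> s < ?S t + e \<Longrightarrow> \<omega> s = \<omega> (?S t)" by (rule cadlag_right[OF w, of "?S t"]) (rule that)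
  have test_fun: "occ_time G \<omega> (?S t + e/2) > t"
    using inv_time_iff[OF fin w t v, of "?S t + e/2"] S0 e(1) by (simp add: not_le[symmetric])
  define \<delta> where "\<delta> = min (occ_time G \<omega> (?S t + e/2) - t) (occ_time G \<omega> v - t)"
  show ?thesis
  proof (rule that[of \<delta>])
    show "\<delta> > 0" using test_fun v by (simp add: \<delta>_def)
    fix s assume s: "t \<le> s" "s < t + \<delta>"
    have vs: "occ_time G \<omega> v > s" using s by (simp add: \<delta>_def)
    have s0: "0 \<le> s" using s t by simp
    have "?S t \<le> ?S s" using inv_time_less[OF fin w t _ vs v(2)] s by (cases "t = s") auto
    moreover have "?S s < ?S t + e"
    proof -
      have "\<not> occ_time G \<omega> (?S t + e/2) \<le> s" using s by (simp add: \<delta>_def)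
      then have "?S s < ?S t + e/2" using inv_time_iff[OF fin w s0 vs v(2), of "?S t + e/2"] S0 e(1) by simp
      then show ?thesis using e(1) by simp
    qed
    ultimately have "\<omega> (?S s) = \<omega> (?S t)" by (rule e(2))
    then show "occ_time G \<omega> v > s \<and> trace_path G \<omega> s = trace_path G \<omega> t" using vs s0 t by (simp add: trace_path_def)
  qed
qed

text \<open>The inverse clock is strictly increasing but may jump at t, namely when the path leaves
  \<open>G\<close> at the level t. The left limit is therefore taken at the supremum
  \<open>L\<close> of its earlier values, not at \<open>inv_time G \<omega> t\<close>.\<close>

lemma trace_path_left:
  assumes fin: "finite E" and w: "\<omega> \<in> cadlag_paths E" and t: "0 < t" and v: "occ_time G \<omega> v > t" "0 \<le> v"
  obtains \<delta> l where "\<delta> > 0" "\<And>s. t - \<delta> < s \<Longrightarrow> s < t \<Longrightarrow> trace_path G \<omega> s = l"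
proof -
  let ?S = "inv_time G \<omega>"
  let ?B = "?S ` {0..<t}"
  have ls: "?S a < ?S b" if "0 \<le> a" "a < b" "b \<le> t" for a b
    using that v by (intro inv_time_less[OF fin w _ _ _ v(2)]) auto
  have bdd: "bdd_above ?B" by (rule bdd_aboveI[of _ "?S t"]) (use ls[of _ t] in \<open>auto intro: less_imp_le\<close>)
  define L where "L = Sup ?B"
  have lL: "?S a < L" if "0 \<le> a" "a < t" for a
  proof -
    have "?S a < ?S ((a + t)/2)" using that by (intro ls) auto
    also have "\<dots> \<le> L" unfolding L_def using that by (intro cSup_upper bdd) auto
    finally show ?thesis .
  qed
  obtain e l where e: "e > 0" "\<And>s. L - e < s \<Longrightarrow> s < L \<Longrightarrow> \<omega> s = l" by (rule cadlag_left[OF w, of L]) (rule that)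
  have "L - e < Sup ?B" using e by (simp add: L_def)
  then obtain x where x: "x \<in> ?B" "L - e < x" using less_cSup_iff[of ?B "L - e"] bdd t by auto
  then obtain a where a: "0 \<le> a" "a < t" "L - e < ?S a" by auto
  show ?thesis
  proof (rule that[of "t - a" l])
    fix s assume s: "t - (t - a) < s" "s < t"
    then have "L - e < ?S s" using ls[of a s] a by auto
    moreover have "?S s < L" using s a by (intro lL) auto
    ultimately have "\<omega> (?S s) = l" by (rule e(2))
    then show "trace_path G \<omega> s = l" using s a by (simp add: trace_path_def)
  qed (use a in simp)
qed

lemma trace_path_cadlag:
  assumes fin: "finite E" and w: "\<omega> \<in> cadlag_paths E" and unb: "\<And>t. \<exists>v\<ge>0. occ_time G \<omega> v > t"
  shows "trace_path G \<omega> \<in> cadlag_paths G"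
  unfolding cadlag_paths_def
proof (intro CollectI conjI allI impI)
  fix t :: real
  obtain v where v: "v \<ge> 0" "occ_time G \<omega> v > max t 0" using unb by blast
  show "trace_path G \<omega> t \<in> G"
    unfolding trace_path_def by (rule inv_time_in[OF fin w _ v(2,1)]) simp
  { assume "t < 0" then show "trace_path G \<omega> t = trace_path G \<omega> 0" by (simp add: trace_path_def) }
  { assume t: "0 \<le> t"
    then have v': "occ_time G \<omega> v > t" using v by simp
    obtain \<delta> where d: "\<delta> > 0" "\<And>s. t \<le> s \<Longrightarrow> s < t + \<delta> \<Longrightarrow> occ_time G \<omega> v > s \<and> trace_path G \<omega> s = trace_path G \<omega> t"
      by (rule trace_path_right[OF fin w t v' v(1)]) (rule that)
    show "\<exists>\<delta>>0. \<forall>s\<in>{t..<t + \<delta>}. trace_path G \<omega> s = trace_path G \<omega> t"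
    proof (intro exI[of _ \<delta>] conjI ballI)
      fix s assume "s \<in> {t..<t + \<delta>}" then show "trace_path G \<omega> s = trace_path G \<omega> t" using d(2)[of s] by simp
    qed (rule d(1)) }
  { assume t: "0 < t"
    then have v': "occ_time G \<omega> v > t" using v by simp
    obtain \<delta> l where d: "\<delta> > 0" "\<And>s. t - \<delta> < s \<Longrightarrow> s < t \<Longrightarrow> trace_path G \<omega> s = l"
      by (rule trace_path_left[OF fin w t v' v(1)]) (rule that)
    show "\<exists>\<delta>>0. \<exists>l. \<forall>s\<in>{t - \<delta><..<t}. trace_path G \<omega> s = l"
      by (intro exI[of _ \<delta>] conjI exI[of _ l] ballI d) auto }
qed

text \<open>The inverse clock rounded up to a grid. Whether the k-th grid point has been reached
  depends on the path up to that point alone, so this is a stopping time with countably many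
  values.\<close>

definition kap :: "'b set \<Rightarrow> real \<Rightarrow> nat \<Rightarrow> (real \<Rightarrow> 'b) \<Rightarrow> nat" where
  "kap G t n \<omega> = (LEAST k. occ_time G \<omega> (real k / real (Suc n)) > t)"

lemma measurable_kap:
  assumes "finite E" shows "kap G t n \<in> measurable (path_space E) (count_space UNIV)"
  unfolding kap_def using measurable_occ_time[OF assms, of G] by measurable

lemma kap_props:
  assumes fin: "finite E" and w: "\<omega> \<in> cadlag_paths E" and t: "0 \<le> t" and v: "occ_time G \<omega> v > t" "0 \<le> v"
  shows kap_le_iff: "kap G t n \<omega> \<le> k \<longleftrightarrow> occ_time G \<omega> (real k / real (Suc n)) > t"
    and "inv_time G \<omega> t < real (kap G t n \<omega>) / real (Suc n)"
    and "real (kap G t n \<omega>) / real (Suc n) \<le> inv_time G \<omega> t + 1 / real (Suc n)"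
proof -
  let ?K = "kap G t n \<omega>"
  let ?P = "\<lambda>k. occ_time G \<omega> (real k / real (Suc n)) > t"
  have mono: "0 \<le> a \<Longrightarrow> a \<le> b \<Longrightarrow> occ_time G \<omega> a \<le> occ_time G \<omega> b" for a b by (rule occ_time_diff(2)[OF fin w])
  have "v \<le> real (nat \<lceil>v * real (Suc n)\<rceil>) / real (Suc n)"
    using v(2) by (simp add: pos_le_divide_eq del: of_nat_Suc)
  then have "?P (nat \<lceil>v * real (Suc n)\<rceil>)" using mono[OF v(2)] v(1) by fastforce
  then have PK: "?P ?K" unfolding kap_def by (rule LeastI)
  show iff: "?K \<le> k \<longleftrightarrow> ?P k" for k
  proof
    assume "?K \<le> k"
    then have "real ?K / real (Suc n) \<le> real k / real (Suc n)" by (intro divide_right_mono) auto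
    then show "?P k" using mono[of "real ?K / real (Suc n)" "real k / real (Suc n)"] PK by simp
  next
    assume "?P k" then show "?K \<le> k" unfolding kap_def by (rule Least_le)
  qed
  have iff2: "occ_time G \<omega> u \<le> t \<longleftrightarrow> u \<le> inv_time G \<omega> t" if "0 \<le> u" for u by (rule inv_time_iff[OF fin w t v that])
  show "inv_time G \<omega> t < real ?K / real (Suc n)" using iff2[of "real ?K / real (Suc n)"] PK by (simp add: not_le[symmetric])
  have "?K \<noteq> 0" using PK t by (intro notI) (simp add: occ_time_0)
  then have "\<not> ?K \<le> ?K - 1" by simp
  then have "\<not> ?P (?K - 1)" using iff by blast
  then have "real (?K - 1) / real (Suc n) \<le> inv_time G \<omega> t" using iff2[of "real (?K - 1) / real (Suc n)"] by simp
  then show "real ?K / real (Suc n) \<le> inv_time G \<omega> t + 1 / real (Suc n)"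
    using \<open>?K \<noteq> 0\<close> by (simp add: of_nat_diff diff_divide_distrib del: of_nat_Suc)
qed

lemma occ_time_exceeds_iff:
  assumes fin: "finite E" and w: "\<omega> \<in> cadlag_paths E"
  shows "(\<exists>v\<ge>0. occ_time G \<omega> v > t) \<longleftrightarrow> (\<exists>k::nat. occ_time G \<omega> (real k) > t)"
proof
  assume "\<exists>v\<ge>0. occ_time G \<omega> v > t"
  then obtain v where v: "v \<ge> 0" "occ_time G \<omega> v > t" by auto
  have "occ_time G \<omega> v \<le> occ_time G \<omega> (real (nat \<lceil>v\<rceil>))" using v by (intro occ_time_diff(2)[OF fin w]) linarith+
  then show "\<exists>k::nat. occ_time G \<omega> (real k) > t" using v by (intro exI[of _ "nat \<lceil>v\<rceil>"]) simp
qed (use of_nat_0_le_iff in blast)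

text \<open>Where the clock exceeds the level, the value is the eventual value of the path at the
  grid times \<open>kap\<close>, each a countable choice of coordinates. The other paths must be
  covered too, since the trace is defined for all of them.\<close>

lemma measurable_trace_path:
  assumes fin: "finite E"
  shows "{\<omega>\<in>cadlag_paths E. trace_path G \<omega> t = b} \<in> sets (path_space E)"
proof -
  define s where "s = max t 0"
  have s0: "0 \<le> s" by (simp add: s_def)
  note [measurable] = measurable_occ_time[OF fin, of G] measurable_kap[OF fin, of G]
  \<comment> \<open>If the clock never exceeds the level, the set in \<open>inv_time\<close> is all
    of \<open>{0..}\<close>. Its supremum is an unspecified but fixed real number, so the trace then
    reads a fixed coordinate.\<close>
  define c0 :: real where "c0 = Sup {0..}"
  define L where "L \<omega> n = \<omega> (real (kap G s n \<omega>) / real (Suc n))" for \<omega> :: "real \<Rightarrow> 'a" and n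
  have Lm: "(\<lambda>\<omega>. L \<omega> n = b) \<in> measurable (path_space E) (count_space UNIV)" for n
    unfolding L_def
    by (rule measurable_compose_countable[where g="kap G s n" and f="\<lambda>i \<omega>. \<omega> (real i / real (Suc n)) = b"])
       (auto intro: measurable_coord_fun[OF fin, where g="\<lambda>x. x = b"])
  have cm: "(\<lambda>\<omega>. \<omega> c0 = b) \<in> measurable (path_space E) (count_space UNIV)"
    by (rule measurable_coord_fun[OF fin, where g="\<lambda>x. x = b"])
  have "{\<omega>\<in>space (path_space E). if \<exists>k::nat. occ_time G \<omega> (real k) > s then \<exists>n0. \<forall>n. n0 \<le> n \<longrightarrow> L \<omega> n = b else \<omega> c0 = b} \<in> sets (path_space E)"
    using Lm cm by measurable
  also have "{\<omega>\<in>space (path_space E). if \<exists>k::nat. occ_time G \<omega> (real k) > s then \<exists>n0. \<forall>n. n0 \<le> n \<longrightarrow> L \<omega> n = b else \<omega> c0 = b}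
    = {\<omega>\<in>cadlag_paths E. trace_path G \<omega> t = b}"
  proof (intro Collect_cong conj_cong)
    fix \<omega> assume "\<omega> \<in> cadlag_paths E"
    then have w: "\<omega> \<in> cadlag_paths E" .
    show "(if \<exists>k::nat. occ_time G \<omega> (real k) > s then \<exists>n0. \<forall>n. n0 \<le> n \<longrightarrow> L \<omega> n = b else \<omega> c0 = b) \<longleftrightarrow> trace_path G \<omega> t = b"
    proof (cases "\<exists>k::nat. occ_time G \<omega> (real k) > s")
      case True
      then obtain v where v: "occ_time G \<omega> v > s" "0 \<le> v" by auto
      have "eventually (\<lambda>n. L \<omega> n = \<omega> (inv_time G \<omega> s)) sequentially"
        unfolding L_def by (rule cadlag_right_eventually[OF w]) (use kap_props(2,3)[OF fin w s0 v] in \<open>auto intro: less_imp_le\<close>)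
      then obtain n1 where n1: "\<And>n. n \<ge> n1 \<Longrightarrow> L \<omega> n = \<omega> (inv_time G \<omega> s)" by (auto simp: eventually_sequentially)
      have "(\<exists>n0. \<forall>n. n0 \<le> n \<longrightarrow> L \<omega> n = b) \<longleftrightarrow> \<omega> (inv_time G \<omega> s) = b"
      proof
        assume "\<exists>n0. \<forall>n. n0 \<le> n \<longrightarrow> L \<omega> n = b"
        then obtain n0 where "\<forall>n. n0 \<le> n \<longrightarrow> L \<omega> n = b" ..
        then show "\<omega> (inv_time G \<omega> s) = b" using n1[of "max n0 n1"] by simp
      qed (use n1 in blast)
      then show ?thesis using True by (simp add: trace_path_def s_def)
    next
      case False
      then have "occ_time G \<omega> u \<le> s" if "0 \<le> u" for u
        using occ_time_exceeds_iff[OF fin w, where G=G and t=s] that by (meson not_le)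
      then have "{u. 0 \<le> u \<and> occ_time G \<omega> u \<le> s} = {0..}" by auto
      then have "inv_time G \<omega> s = c0" by (simp add: inv_time_def c0_def)
      then show ?thesis unfolding if_not_P[OF False] by (simp add: trace_path_def s_def[symmetric])
    qed
  qed simp
  finally show ?thesis .
qed

lemma cadlag_scale_map:
  assumes x: "x \<in> cadlag_paths G" and th: "\<theta> > 0" and f: "\<And>a. a \<in> G \<Longrightarrow> f a \<in> E"
  shows "(\<lambda>t. f (x (\<theta> * t))) \<in> cadlag_paths E"
  unfolding cadlag_paths_def
proof (intro CollectI conjI allI impI)
  fix t :: real
  show "f (x (\<theta> * t)) \<in> E" by (rule f[OF cadlag_in[OF x]])
  { assume "t < 0"
    then have "x (\<theta> * t) = x 0" using th by (intro cadlag_neg[OF x]) (simp add: mult_le_0_iff)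
    then show "f (x (\<theta> * t)) = f (x (\<theta> * 0))" by simp }
  { obtain \<delta> where d: "\<delta> > 0" "\<And>s. \<theta> * t \<le> s \<Longrightarrow> s < \<theta> * t + \<delta> \<Longrightarrow> x s = x (\<theta> * t)" by (rule cadlag_right[OF x, of "\<theta> * t"]) (rule that)
    show "\<exists>\<delta>>0. \<forall>s\<in>{t..<t + \<delta>}. f (x (\<theta> * s)) = f (x (\<theta> * t))"
    proof (intro exI[of _ "\<delta> / \<theta>"] conjI ballI)
      fix s assume s: "s \<in> {t..<t + \<delta> / \<theta>}"
      then have "\<theta> * s < \<theta> * (t + \<delta> / \<theta>)" using th by (intro mult_strict_left_mono) auto
      then have "x (\<theta> * s) = x (\<theta> * t)" using s th by (intro d(2)) (auto simp: distrib_left)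
      then show "f (x (\<theta> * s)) = f (x (\<theta> * t))" by simp
    qed (use d th in simp) }
  { obtain \<delta> l where d: "\<delta> > 0" "\<And>s. \<theta> * t - \<delta> < s \<Longrightarrow> s < \<theta> * t \<Longrightarrow> x s = l" by (rule cadlag_left[OF x, of "\<theta> * t"]) (rule that)
    show "\<exists>\<delta>>0. \<exists>l. \<forall>s\<in>{t - \<delta><..<t}. f (x (\<theta> * s)) = l"
    proof (intro exI[of _ "\<delta> / \<theta>"] conjI exI[of _ "f l"] ballI)
      fix s assume s: "s \<in> {t - \<delta> / \<theta><..<t}"
      then have "\<theta> * (t - \<delta> / \<theta>) < \<theta> * s" using th by (intro mult_strict_left_mono) auto
      then have "x (\<theta> * s) = l" using s th by (intro d(2)) (auto simp: right_diff_distrib)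
      then show "f (x (\<theta> * s)) = f l" by simp
    qed (use d th in simp) }
qed

text \<open>\<open>spl_map\<close> asks whether a whole path is cadlag, which refers to uncountably
  many times. If the clock is unbounded nothing can go wrong. Otherwise the trace is eventually
  frozen at one coordinate, and it can fail only by a frozen value outside \<open>G\<close> or by
  the lack of a left limit at the terminal level; rational times detect both.\<close>

lemma trace_path_cadlag_iff:
  fixes G :: "'b set"
  assumes fin: "finite E" and w: "\<omega> \<in> cadlag_paths E"
  defines "ex \<equiv> \<lambda>t. \<exists>k::nat. occ_time G \<omega> (real k) > t"
  shows "trace_path G \<omega> \<in> cadlag_paths G \<longleftrightarrow> (\<forall>n::nat. ex (real n)) \<or>
    (\<omega> (Sup {0..}) \<in> G \<and> (\<exists>l\<in>G. \<exists>q::rat. 0 \<le> q \<and> (ex (of_rat q) \<or> \<not> ex 0) \<and>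
       (\<forall>q'::rat. q < q' \<and> ex (of_rat q') \<longrightarrow> trace_path G \<omega> (of_rat q') = l)))"
    (is "?L \<longleftrightarrow> ?W \<or> (?c \<and> ?Lc)")
proof (cases ?W)
  case True
  have "trace_path G \<omega> \<in> cadlag_paths G"
  proof (rule trace_path_cadlag[OF fin w])
    fix t :: real
    have "ex (real (nat \<lceil>t\<rceil>))" using True by blast
    then obtain k :: nat where "occ_time G \<omega> (real k) > real (nat \<lceil>t\<rceil>)" unfolding ex_def by blast
    then show "\<exists>v\<ge>0. occ_time G \<omega> v > t" by (intro exI[of _ "real k"]) linarith
  qed
  then show ?thesis using True by simp
next
  case False
  let ?y = "trace_path G \<omega>"
  have exv: "\<exists>v. occ_time G \<omega> v > t \<and> 0 \<le> v" if "ex t" for t using that unfolding ex_def using of_nat_0_le_iff by blast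
  have exmono: "ex s \<Longrightarrow> t \<le> s \<Longrightarrow> ex t" for s t unfolding ex_def by (meson order_le_less_trans)
  obtain n where n: "\<not> ex (real n)" using False by blast
  \<comment> \<open>Its supremum \<tau> is the total time that the path spends in \<open>G\<close>;
    the element 0 covers paths whose clock never starts.\<close>
  define A where "A = insert 0 {t. 0 \<le> t \<and> ex t}"
  define \<tau> where "\<tau> = Sup A"
  have bdd: "bdd_above A" unfolding A_def bdd_above_insert
  proof (rule bdd_aboveI[of _ "real n"])
    fix x assume "x \<in> {t. 0 \<le> t \<and> ex t}"
    then show "x \<le> real n" using exmono[of x "real n"] n by (cases "x \<le> real n") auto
  qed
  have t0: "0 \<le> \<tau>" unfolding \<tau>_def by (rule cSup_upper[OF _ bdd]) (simp add: A_def)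
  have ext: "ex t \<longleftrightarrow> t < \<tau>" if "0 \<le> t" for t
  proof
    assume "ex t"
    then obtain k :: nat where k: "occ_time G \<omega> (real k) > t" unfolding ex_def by blast
    then obtain t' where t': "t < t'" "t' < occ_time G \<omega> (real k)" using dense by blast
    then have "t' \<in> A" using that unfolding A_def ex_def by auto
    then have "t' \<le> \<tau>" unfolding \<tau>_def by (rule cSup_upper[OF _ bdd])
    then show "t < \<tau>" using t' by simp
  next
    assume "t < \<tau>"
    then obtain s where "s \<in> A" "t < s" unfolding \<tau>_def using less_cSup_iff[of A t] bdd by (auto simp: A_def)
    then show "ex t" using that exmono[of s t] unfolding A_def by auto
  qed
  have yc: "?y t = \<omega> (Sup {0..})" if "0 \<le> t" "\<tau> \<le> t" for t
  proof -
    have "\<not> ex t" using ext that by simp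
    then have "occ_time G \<omega> u \<le> t" if "0 \<le> u" for u
      using occ_time_exceeds_iff[OF fin w, where G=G and t=t] that unfolding ex_def by (meson not_le)
    then have "{u. 0 \<le> u \<and> occ_time G \<omega> u \<le> t} = {0..}" by auto
    then show ?thesis using that by (simp add: trace_path_def inv_time_def)
  qed
  have "?L \<longleftrightarrow> ?c \<and> ?Lc"
  proof
    assume L: ?L
    have c: ?c using yc[of \<tau>] t0 cadlag_in[OF L, of \<tau>] by simp
    have ?Lc
    proof (cases "\<tau> = 0")
      case True
      show ?thesis
      proof (rule bexI[OF _ c], rule exI[of _ 0], intro conjI allI impI)
        fix q' :: rat assume q': "0 < q' \<and> ex (of_rat q')"
        then have "ex (of_rat q')" "0 \<le> (of_rat q' :: real)" "0 < (of_rat q' :: real)" by auto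
        then show "?y (of_rat q') = \<omega> (Sup {0..})" using ext[of "of_rat q'"] True by simp
      qed (use ext[of 0] True in auto)
    next
      case False
      then have tp: "0 < \<tau>" using t0 by simp
      obtain \<delta> l where d: "\<delta> > 0" "\<And>s. \<tau> - \<delta> < s \<Longrightarrow> s < \<tau> \<Longrightarrow> ?y s = l" by (rule cadlag_left[OF L, of \<tau>]) (rule that)
      obtain q where q: "max 0 (\<tau> - \<delta>) < of_rat q" "of_rat q < \<tau>" using of_rat_dense[of "max 0 (\<tau> - \<delta>)" \<tau>] tp d(1) by auto
      have yq: "?y (of_rat q) = l" using q by (intro d(2)) auto
      have lG: "l \<in> G" using cadlag_in[OF L, of "of_rat q"] yq by simp
      show ?thesis
      proof (rule bexI[OF _ lG], rule exI[of _ q], intro conjI allI impI)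
        show "0 \<le> q" using q(1) by (simp add: less_imp_le)
        show "ex (of_rat q) \<or> \<not> ex 0" using ext[of "of_rat q"] q by simp
        fix q' :: rat assume q': "q < q' \<and> ex (of_rat q')"
        then have a: "(of_rat q :: real) < of_rat q'" by (simp add: of_rat_less)
        then have "0 \<le> (of_rat q' :: real)" using q(1) by linarith
        then have "of_rat q' < \<tau>" using ext q' by blast
        then show "?y (of_rat q') = l" using a q(1) by (intro d(2)) auto
      qed
    qed
    then show "?c \<and> ?Lc" using c by simp
  next
    assume "?c \<and> ?Lc"
    then obtain l q where c: ?c and l: "l \<in> G" and q: "0 \<le> q" "ex (of_rat q) \<or> \<not> ex 0"
      and lq: "\<And>q'::rat. q < q' \<Longrightarrow> ex (of_rat q') \<Longrightarrow> ?y (of_rat q') = l" by blast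
    show ?L
      unfolding cadlag_paths_def
    proof (intro CollectI conjI allI impI)
      fix t :: real
      show "?y t \<in> G"
      proof (cases "ex (max t 0)")
        case True
        then obtain v where "occ_time G \<omega> v > max t 0" "0 \<le> v" using exv by blast
        then show ?thesis unfolding trace_path_def by (intro inv_time_in[OF fin w]) auto
      next
        case False
        then have "?y (max t 0) = \<omega> (Sup {0..})" using ext[of "max t 0"] by (intro yc) auto
        then show ?thesis using c by (simp add: trace_path_def)
      qed
      { assume "t < 0" then show "?y t = ?y 0" by (simp add: trace_path_def) }
      { assume t: "0 \<le> t"
        show "\<exists>\<delta>>0. \<forall>s\<in>{t..<t + \<delta>}. ?y s = ?y t"
        proof (cases "ex t")
          case True
          then obtain v where v: "occ_time G \<omega> v > t" "0 \<le> v" using exv by blast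
          obtain \<delta> where d: "\<delta> > 0" "\<And>s. t \<le> s \<Longrightarrow> s < t + \<delta> \<Longrightarrow> occ_time G \<omega> v > s \<and> ?y s = ?y t"
            by (rule trace_path_right[OF fin w t v]) (rule that)
          show ?thesis
          proof (intro exI[of _ \<delta>] conjI ballI)
            fix s assume "s \<in> {t..<t + \<delta>}" then show "?y s = ?y t" using d(2)[of s] by simp
          qed (rule d(1))
        next
          case False
          then have "\<tau> \<le> t" using ext[OF t] by simp
          show ?thesis
          proof (intro exI[of _ 1] conjI ballI)
            fix s assume "s \<in> {t..<t + 1}" then show "?y s = ?y t" using yc[of s] yc[of t] t \<open>\<tau> \<le> t\<close> by simp
          qed simp
        qed }
      { assume t: "0 < t"
        consider "t < \<tau>" | "t = \<tau>" | "\<tau> < t" by linarith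
        then show "\<exists>\<delta>>0. \<exists>l. \<forall>s\<in>{t - \<delta><..<t}. ?y s = l"
        proof cases
          case 1
          then obtain v where v: "occ_time G \<omega> v > t" "0 \<le> v" using exv ext[of t] t by auto
          obtain \<delta> l where d: "\<delta> > 0" "\<And>s. t - \<delta> < s \<Longrightarrow> s < t \<Longrightarrow> ?y s = l"
            by (rule trace_path_left[OF fin w t v]) (rule that)
          show ?thesis by (intro exI[of _ \<delta>] conjI exI[of _ l] ballI d) auto
        next
          case 2
          then have "ex 0" using ext[of 0] t by simp
          then have qt: "(of_rat q :: real) < \<tau>" using q ext[of "of_rat q"] by simp
          show ?thesis
          proof (intro exI[of _ "\<tau> - of_rat q"] conjI exI[of _ l] ballI)
            fix s assume "s \<in> {t - (\<tau> - of_rat q)<..<t}"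
            then have s: "of_rat q < s" "s < \<tau>" using 2 by auto
            have "(0::real) \<le> of_rat q" using q by simp
            then have s0: "0 \<le> s" using s by linarith
            then obtain v where v: "occ_time G \<omega> v > s" "0 \<le> v" using exv ext[of s] s by auto
            obtain e where e: "e > 0" "\<And>r. s \<le> r \<Longrightarrow> r < s + e \<Longrightarrow> occ_time G \<omega> v > r \<and> ?y r = ?y s"
              by (rule trace_path_right[OF fin w s0 v]) (rule that)
            obtain q' where q': "s < of_rat q'" "of_rat q' < min (s + e) \<tau>" using of_rat_dense[of s "min (s + e) \<tau>"] s e by auto
            have "?y (of_rat q') = ?y s" using e(2)[of "of_rat q'"] q' by simp
            moreover have "(of_rat q :: real) < of_rat q'" using s q' by linarith
            then have "q < q'" by (simp add: of_rat_less)
            moreover have "(0::real) \<le> of_rat q'" using q' s0 by linarith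
            then have "ex (of_rat q')" using ext q'(2) by (metis min_less_iff_conj)
            ultimately show "?y s = l" using lq[of q'] by simp
          qed (use qt in simp)
        next
          case 3
          show ?thesis
          proof (intro exI[of _ "t - \<tau>"] conjI exI[of _ "\<omega> (Sup {0..})"] ballI)
            fix s assume "s \<in> {t - (t - \<tau>)<..<t}" then show "?y s = \<omega> (Sup {0..})" using t0 by (intro yc) auto
          qed (use 3 in simp)
        qed }
    qed
  qed
  then show ?thesis using False by blast
qed

lemma borel_measurable_trace_path_fun:
  fixes g :: "'b \<Rightarrow> real"
  assumes fin: "finite E" shows "(\<lambda>\<omega>. g (trace_path G \<omega> t)) \<in> borel_measurable (path_space E)"
proof -
  have "(\<lambda>\<omega>. trace_path G \<omega> t) \<in> measurable (path_space E) (count_space E)"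
  proof (subst measurable_count_space_eq2[OF fin], safe)
    fix \<omega> show "\<omega> \<in> space (path_space E) \<Longrightarrow> trace_path G \<omega> t \<in> E" by (simp add: trace_path_def cadlag_in)
  next
    fix a show "(\<lambda>\<omega>. trace_path G \<omega> t) -` {a} \<inter> space (path_space E) \<in> sets (path_space E)"
      using measurable_trace_path[OF fin, of G t a] by (simp add: vimage_def Int_def conj_commute)
  qed
  then show ?thesis by (rule measurable_compose) simp
qed

lemma trace_path_cadlag_set:
  assumes fin: "finite E" and G: "finite G"
  shows "{\<omega>\<in>cadlag_paths E. trace_path G \<omega> \<in> cadlag_paths G} \<in> sets (path_space E)"
proof -
  note [measurable] = measurable_occ_time[OF fin, of G]
  have tm[measurable]: "(\<lambda>\<omega>. trace_path G \<omega> t = b) \<in> measurable (path_space E) (count_space UNIV)" for t b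
    using measurable_trace_path[OF fin, of G t b] by (simp add: pred_def)
  have cm[measurable]: "(\<lambda>\<omega>. \<omega> (Sup {0..}) \<in> G) \<in> measurable (path_space E) (count_space UNIV)"
    by (rule measurable_coord_fun[OF fin, where g="\<lambda>x. x \<in> G"])
  have "{\<omega>\<in>space (path_space E). (\<forall>n::nat. \<exists>k::nat. occ_time G \<omega> (real k) > real n) \<or>
    (\<omega> (Sup {0..}) \<in> G \<and> (\<exists>l\<in>G. \<exists>q::rat. 0 \<le> q \<and> ((\<exists>k::nat. occ_time G \<omega> (real k) > of_rat q) \<or> \<not> (\<exists>k::nat. occ_time G \<omega> (real k) > 0)) \<and>
       (\<forall>q'::rat. q < q' \<and> (\<exists>k::nat. occ_time G \<omega> (real k) > of_rat q') \<longrightarrow> trace_path G \<omega> (of_rat q') = l)))} \<in> sets (path_space E)"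
    using countable_finite[OF G] by measurable
  then show ?thesis
  proof (rule back_subst[of "\<lambda>x. x \<in> sets (path_space E)"], intro Collect_cong conj_cong)
    fix \<omega> assume "\<omega> \<in> cadlag_paths E"
    then show "((\<forall>n::nat. \<exists>k::nat. occ_time G \<omega> (real k) > real n) \<or>
    (\<omega> (Sup {0..}) \<in> G \<and> (\<exists>l\<in>G. \<exists>q::rat. 0 \<le> q \<and> ((\<exists>k::nat. occ_time G \<omega> (real k) > of_rat q) \<or> \<not> (\<exists>k::nat. occ_time G \<omega> (real k) > 0)) \<and>
       (\<forall>q'::rat. q < q' \<and> (\<exists>k::nat. occ_time G \<omega> (real k) > of_rat q') \<longrightarrow> trace_path G \<omega> (of_rat q') = l)))) \<longleftrightarrow> trace_path G \<omega> \<in> cadlag_paths G"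
      by (rule trace_path_cadlag_iff[OF fin, symmetric])
  qed simp
qed

section \<open>The trace process\<close>

text \<open>The generator has the eigenvalue 0 on constants and -2 \<alpha> on the alternating
  function. The extra summand at n = 0 is the projection to the constants.\<close>

lemma gen_pow_two_state:
  assumes "a \<in> {1, 2}" "b \<in> {1, 2::nat}"
  shows "gen_pow {1, 2} (\<lambda>_ _. \<alpha>) n a b = ((if n = 0 then 1 else 0) + (if a = b then 1 else -1) * (-2 * \<alpha>) ^ n) / 2"
  using assms
proof (induction n arbitrary: a)
  case (Suc n)
  have *: "{1, 2} - {1} = {2::nat}" "{1, 2} - {2} = {1::nat}" "{1, 2} - {Suc 0} = {2::nat}" by auto
  have g: "gen_matrix {1, 2} (\<lambda>_ _. \<alpha>) a c = (if a = c then - \<alpha> else \<alpha>)" if "a \<in> {1, 2}" "c \<in> {1, 2::nat}" for a c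
    using that * by (auto simp: gen_matrix_def)
  let ?p = "gen_pow {1, 2} (\<lambda>_ _. \<alpha>) n"
  have p1: "?p 1 b = ((if n = 0 then 1 else 0) + (if 1 = b then 1 else -1) * (-2 * \<alpha>) ^ n) / 2"
    by (rule Suc.IH) (use Suc.prems in auto)
  have p2: "?p 2 b = ((if n = 0 then 1 else 0) + (if 2 = b then 1 else -1) * (-2 * \<alpha>) ^ n) / 2"
    by (rule Suc.IH) (use Suc.prems in auto)
  have "gen_pow {1, 2} (\<lambda>_ _. \<alpha>) (Suc n) a b = (\<Sum>c\<in>{1,2}. (if a = c then - \<alpha> else \<alpha>) * ?p c b)"
    unfolding gen_pow.simps by (intro sum.cong refl) (simp only: g[OF Suc.prems(1)])
  then have e: "gen_pow {1, 2} (\<lambda>_ _. \<alpha>) (Suc n) a b = (if a = 1 then - \<alpha> else \<alpha>) * ?p 1 b + (if a = 2 then - \<alpha> else \<alpha>) * ?p 2 b"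
    by (simp del: gen_pow.simps)
  consider "a = 1" "b = 1" | "a = 1" "b = 2" | "a = 2" "b = 1" | "a = 2" "b = 2" using Suc.prems by blast
  then show ?case unfolding e p1 p2 by cases (simp_all add: algebra_simps)
qed auto

lemma trans_prob_two_state:
  assumes "a \<in> {1, 2}" "b \<in> {1, 2::nat}"
  shows "trans_prob {1, 2} (\<lambda>_ _. \<alpha>) t a b = (1 + (if a = b then 1 else -1) * exp (-2 * \<alpha> * t)) / 2"
proof -
  define \<sigma> :: real where "\<sigma> = (if a = b then 1 else -1)"
  have "(\<lambda>n. inverse (fact n) * (-2 * \<alpha> * t) ^ n) sums exp (-2 * \<alpha> * t)"
    using exp_converges[of "-2 * \<alpha> * t"] by simp
  then have 1: "(\<lambda>n. \<sigma> / 2 * (inverse (fact n) * (-2 * \<alpha> * t) ^ n)) sums (\<sigma> / 2 * exp (-2 * \<alpha> * t))" by (rule sums_mult)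
  have 2: "(\<lambda>n. if n = 0 then 1 / 2 else 0 :: real) sums (1 / 2)" using sums_If_finite[of "\<lambda>n. n = 0" "\<lambda>_. 1 / 2 :: real"] by simp
  have "t ^ n / fact n * gen_pow {1, 2} (\<lambda>_ _. \<alpha>) n a b = (if n = 0 then 1 / 2 else 0) + \<sigma> / 2 * (inverse (fact n) * (-2 * \<alpha> * t) ^ n)" for n
    unfolding gen_pow_two_state[OF assms] \<sigma>_def[symmetric] power_mult_distrib by (simp add: field_simps)
  then have "(\<lambda>n. t ^ n / fact n * gen_pow {1, 2} (\<lambda>_ _. \<alpha>) n a b) sums (1 / 2 + \<sigma> / 2 * exp (-2 * \<alpha> * t))"
    using sums_add[OF 2 1] by simp
  then show ?thesis unfolding trans_prob_def \<sigma>_def[symmetric] by (simp add: sums_iff add_divide_distrib)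
qed

text \<open>Once the clock exceeds s at time v, the trace up to level s is determined by the path
  before v. Events of the past of the trace thereby become admissible functionals in
  \<open>trace_martingale\<close>.\<close>

lemma trace_path_stop:
  assumes fin: "finite E" and w: "\<omega> \<in> cadlag_paths E" and v: "0 \<le> v" "occ_time G \<omega> v > s" and u: "0 \<le> u" "u \<le> s"
  shows "trace_path G (stop v \<omega>) u = trace_path G \<omega> u"
proof -
  have w': "stop v \<omega> \<in> cadlag_paths E" by (rule stop_cadlag[OF w v(1)])
  have Tv: "occ_time G (stop v \<omega>) v = occ_time G \<omega> v" by (rule occ_time_stop) simp
  have "occ_time G (stop v \<omega>) x \<le> u \<longleftrightarrow> occ_time G \<omega> x \<le> u" if "0 \<le> x" for x
  proof (cases "x \<le> v")
    case True then show ?thesis by (simp add: occ_time_stop)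
  next
    case False
    then have "occ_time G (stop v \<omega>) v \<le> occ_time G (stop v \<omega>) x" "occ_time G \<omega> v \<le> occ_time G \<omega> x"
      using v by (auto intro!: occ_time_diff(2)[OF fin w'] occ_time_diff(2)[OF fin w])
    then show ?thesis using Tv v u by linarith
  qed
  then have "{x. 0 \<le> x \<and> occ_time G (stop v \<omega>) x \<le> u} = {x. 0 \<le> x \<and> occ_time G \<omega> x \<le> u}" by auto
  then have e: "inv_time G (stop v \<omega>) u = inv_time G \<omega> u" by (simp add: inv_time_def)
  have vu: "occ_time G \<omega> v > u" using v u by simp
  have "inv_time G \<omega> u \<le> v"
    using inv_time_iff[OF fin w u(1) vu v(1) v(1)] vu by linarith
  then show ?thesis using u by (simp add: trace_path_def e) (simp add: stop_def)
qed

text \<open>Optional stopping in discrete time: adding up the increments before the step m yields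
  the value at the stopped step.\<close>

lemma telescope_until:
  fixes f :: "nat \<Rightarrow> real"
  shows "(\<Sum>k<N. if k < m then f (Suc k) - f k else 0) = f (min m N) - f 0"
proof (induction N)
  case (Suc N) then show ?case by (cases "N < m") (auto simp: min_def le_Suc_eq)
qed simp

context ctmc begin

lemma AE_start: "AE \<omega> in P. \<omega> 0 = a0"
proof -
  obtain C0 where C0: "C0 \<ge> 0" "\<And>h a b. 0 \<le> h \<Longrightarrow> h \<le> 1 \<Longrightarrow> a \<in> E \<Longrightarrow> b \<in> E \<Longrightarrow>
      \<bar>trans_prob E q h a b - (if a = b then 1 else 0) - h * gen_matrix E q a b\<bar> \<le> C0 * h\<^sup>2"
    by (rule trans_prob_expand[OF fin, of q]) (rule that)
  have "trans_prob E q 0 a0 a0 = 1" using C0(2)[of 0 a0 a0] a0 by simp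
  then have "prob (cyl E {0} (\<lambda>_. a0)) = 1" using a0 by (subst prob_cyl) auto
  then have "AE \<omega> in P. \<omega> \<in> cyl E {0} (\<lambda>_. a0)" by (rule AE_prob_1)
  then show ?thesis by eventually_elim (simp add: cyl_def)
qed

text \<open>With \<open>c\<close> equal to minus the generator of \<open>V\<close> divided by
  \<open>V\<close>, the weighted process \<open>exp (addf c t) V\<close> has constant expectation.
  On paths whose clock stays below n it is at least a constant times exp(\<delta> t), so these paths
  have probability at most a constant times exp(-\<delta> t) for all integers t.\<close>

lemma recurrent:
  fixes V :: "'b \<Rightarrow> real"
  assumes V: "\<And>a. a \<in> E \<Longrightarrow> V a > 0" and \<delta>: "\<delta> > 0"
    and LV: "\<And>a. a \<in> E \<Longrightarrow> a \<notin> G \<Longrightarrow> (\<Sum>b\<in>E. gen_matrix E q a b * V b) \<le> - \<delta> * V a"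
  shows "AE \<omega> in P. \<forall>n::nat. \<exists>k::nat. occ_time G \<omega> (real k) > real n"
proof -
  define c where "c a = - (\<Sum>b\<in>E. gen_matrix E q a b * V b) / V a" for a
  define \<mu> where "\<mu> = (\<Sum>a\<in>E. \<bar>c a\<bar>)"
  \<comment> \<open>Outside \<open>G\<close> the function \<open>c\<close> is at least \<delta>,
    inside it is only known to be at least -\<mu>. The sum \<delta> + \<mu> combines both into
    \<open>c \<ge> \<delta> - \<kappa> * indicator G\<close>.\<close>
  define \<kappa> where "\<kappa> = \<delta> + \<mu>"
  have harm: "(\<Sum>b\<in>E. gen_matrix E q a b * V b) + c a * V a = 0" if "a \<in> E" for a
    using V[OF that] by (simp add: c_def)
  have cl: "\<bar>c a\<bar> \<le> \<mu>" if "a \<in> E" for a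
    unfolding \<mu>_def using that fin by (intro member_le_sum[of a E "\<lambda>a. \<bar>c a\<bar>"]) auto
  have cg: "c a \<ge> \<delta> - \<kappa> * indicator G a" if a: "a \<in> E" for a
  proof (cases "a \<in> G")
    case True then show ?thesis using cl[OF a] by (simp add: \<kappa>_def)
  next
    case False
    have "\<delta> * V a \<le> - (\<Sum>b\<in>E. gen_matrix E q a b * V b)" using LV[OF a False] by simp
    then have "\<delta> \<le> c a" unfolding c_def by (subst pos_le_divide_eq[OF V[OF a]])
    then show ?thesis using False by simp
  qed
  have addl: "addf c t \<omega> \<ge> \<delta> * t - \<kappa> * occ_time G \<omega> t" if w: "\<omega> \<in> cadlag_paths E" and t: "0 \<le> t" for \<omega> t
  proof -
    have i1: "integrable lborel (\<lambda>s. indicator {0..t} s * c (\<omega> s))"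
      by (rule path_integrable[where c=c, OF fin w cl, where a=0 and b=t]) auto
    have i2: "integrable lborel (\<lambda>s. indicator {0..t} s * (indicator G (\<omega> s) :: real))"
      by (rule path_integrable[where c="indicator G" and B=1, OF fin w, where a=0 and b=t]) auto
    have i3: "integrable lborel (indicator {0..t} :: real \<Rightarrow> real)" by (rule integrable_lborel_indicator_bounded) auto
    have "\<delta> * t - \<kappa> * occ_time G \<omega> t = (\<integral>s. \<delta> * indicator {0..t} s - \<kappa> * (indicator {0..t} s * indicator G (\<omega> s)) \<partial>lborel)"
      using i2 i3 t by (simp add: occ_time_addf[OF fin w] addf_def)
    also have "\<dots> \<le> addf c t \<omega>" unfolding addf_def
    proof (rule integral_mono)
      fix s show "\<delta> * indicator {0..t} s - \<kappa> * (indicator {0..t} s * indicator G (\<omega> s)) \<le> indicator {0..t} s * c (\<omega> s)"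
        using cg[OF cadlag_in[OF w, of s]] by (cases "s \<in> {0..t}") auto
    qed (intro Bochner_Integration.integrable_diff integrable_mult_right i1 i2 i3)+
    finally show ?thesis .
  qed
  define vm where "vm = Min (V ` E)"
  have vm: "vm > 0" "\<And>a. a \<in> E \<Longrightarrow> vm \<le> V a"
  proof -
    have "V ` E \<noteq> {}" using a0 by auto
    then show "vm > 0" unfolding vm_def using fin V by (subst Min_gr_iff) auto
  qed (auto simp: vm_def fin)
  define vM where "vM = (\<Sum>a\<in>E. V a)"
  have vM: "V a \<le> vM" if "a \<in> E" for a unfolding vM_def using that fin V by (intro member_le_sum[of a E V]) (auto intro: less_imp_le)
  have vM0: "vM \<ge> 0" using vM[OF a0] V[OF a0] by simp
  have k0: "\<kappa> \<ge> 0" unfolding \<kappa>_def \<mu>_def using \<delta> by (simp add: sum_nonneg)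
  have bound: "prob {\<omega>\<in>space P. \<forall>k::nat. occ_time G \<omega> (real k) \<le> real n} \<le> exp (\<kappa> * real n) * vM / vm * exp (- \<delta> * real k)" for n k
  proof -
    let ?B = "{\<omega>\<in>space P. \<forall>k::nat. occ_time G \<omega> (real k) \<le> real n}"
    note [measurable] = measurable_occ_time[OF fin, of G, folded measurable_P]
    have B[measurable]: "?B \<in> events" by measurable
    have am[measurable]: "addf c t \<in> borel_measurable P" for t unfolding measurable_P by (rule measurable_addf[OF fin])
    have Vm[measurable]: "(\<lambda>\<omega>. V (\<omega> t)) \<in> borel_measurable P" for t unfolding measurable_P by (rule borel_measurable_coord_fun[OF fin])
    have eq: "expectation (\<lambda>\<omega>. 1 * (exp (addf c (real k) \<omega>) * V (\<omega> (real k)))) = expectation (\<lambda>\<omega>. 1 * (exp (addf c 0 \<omega>) * V (\<omega> 0)))"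
      by (rule feynman_kac_martingale[where H="\<lambda>_. 1" and K=1, OF harm]) auto
    have le: "expectation (\<lambda>\<omega>. V (\<omega> 0)) \<le> vM"
    proof -
      have "expectation (\<lambda>\<omega>. V (\<omega> 0)) \<le> expectation (\<lambda>\<omega>. vM)"
      proof (rule integral_mono)
        show "integrable P (\<lambda>\<omega>. V (\<omega> 0))"
          by (rule integrable_bounded_path[where B=vM]) (use Vm[unfolded measurable_P] vM[OF cadlag_in[of _ E]] V[OF cadlag_in[of _ E]] in \<open>auto simp: abs_of_pos\<close>)
      qed (auto simp: space_P intro: vM cadlag_in)
      then show ?thesis by (simp add: prob_space)
    qed
    have "vm * exp (\<delta> * real k - \<kappa> * real n) * prob ?B = expectation (\<lambda>\<omega>. vm * exp (\<delta> * real k - \<kappa> * real n) * indicator ?B \<omega>)"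
      by simp
    also have "\<dots> \<le> expectation (\<lambda>\<omega>. exp (addf c (real k) \<omega>) * V (\<omega> (real k)))"
    proof (rule integral_mono)
      show "integrable P (\<lambda>\<omega>. exp (addf c (real k) \<omega>) * V (\<omega> (real k)))"
      proof (rule integrable_bounded_path[where B="exp (\<mu> * real k) * vM"])
        fix \<omega> assume w: "\<omega> \<in> cadlag_paths E"
        have "addf c (real k) \<omega> \<le> \<mu> * real k" using addf_bound[where c=c, OF fin w cl, of "real k"] by simp
        then show "\<bar>exp (addf c (real k) \<omega>) * V (\<omega> (real k))\<bar> \<le> exp (\<mu> * real k) * vM"
          using V[OF cadlag_in[OF w]] vM[OF cadlag_in[OF w]] by (auto simp: abs_mult abs_of_pos intro!: mult_mono less_imp_le[OF V[OF cadlag_in[OF w]]])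
      qed (unfold measurable_P[symmetric], measurable)
      fix \<omega> assume "\<omega> \<in> space P"
      then have w: "\<omega> \<in> cadlag_paths E" by (simp add: space_P)
      show "vm * exp (\<delta> * real k - \<kappa> * real n) * indicator ?B \<omega> \<le> exp (addf c (real k) \<omega>) * V (\<omega> (real k))"
      proof (cases "\<omega> \<in> ?B")
        case True
        then have "occ_time G \<omega> (real k) \<le> real n" by blast
        then have "\<kappa> * occ_time G \<omega> (real k) \<le> \<kappa> * real n" using k0 by (rule mult_left_mono)
        then have "\<delta> * real k - \<kappa> * real n \<le> addf c (real k) \<omega>" using addl[OF w, of "real k"] by simp
        then have "vm * exp (\<delta> * real k - \<kappa> * real n) \<le> V (\<omega> (real k)) * exp (addf c (real k) \<omega>)"
          using vm V[OF cadlag_in[OF w]] by (intro mult_mono vm(2)[OF cadlag_in[OF w]]) (auto intro: less_imp_le)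
        then show ?thesis using True by (simp add: mult.commute)
      qed (use V[OF cadlag_in[OF w]] in \<open>auto intro: less_imp_le\<close>)
    qed (rule integrable_mult_right, rule integrable_real_indicator[OF B], simp add: emeasure_eq_measure)
    also have "\<dots> \<le> vM" using eq le by simp
    finally have "prob ?B \<le> vM / (vm * exp (\<delta> * real k - \<kappa> * real n))"
      using vm by (simp add: pos_le_divide_eq mult.commute)
    also have "\<dots> = exp (\<kappa> * real n) * vM / vm * exp (- \<delta> * real k)"
      using vm by (simp add: exp_diff exp_minus field_simps)
    finally show ?thesis .
  qed
  have null: "prob {\<omega>\<in>space P. \<forall>k::nat. occ_time G \<omega> (real k) \<le> real n} = 0" for n
  proof -
    have "(\<lambda>k. exp (- \<delta>) ^ k) \<longlonglongrightarrow> 0" using \<delta> by (intro LIMSEQ_realpow_zero) auto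
    then have "(\<lambda>k. exp (\<kappa> * real n) * vM / vm * exp (- \<delta>) ^ k) \<longlonglongrightarrow> exp (\<kappa> * real n) * vM / vm * 0" by (rule tendsto_mult_left)
    moreover have "exp (- \<delta>) ^ k = exp (- \<delta> * real k)" for k by (simp add: exp_of_nat_mult[symmetric] mult.commute)
    ultimately have "prob {\<omega>\<in>space P. \<forall>k::nat. occ_time G \<omega> (real k) \<le> real n} \<le> 0"
      using bound[of n] by (intro tendsto_lowerbound[of "\<lambda>k. exp (\<kappa> * real n) * vM / vm * exp (- \<delta> * real k)" 0 sequentially]) auto
    then show ?thesis by (simp add: measure_le_0_iff)
  qed
  show ?thesis unfolding AE_all_countable
  proof
    fix n
    note [measurable] = measurable_occ_time[OF fin, of G, folded measurable_P]
    have "AE \<omega> in P. \<omega> \<notin> {\<omega>\<in>space P. \<forall>k::nat. occ_time G \<omega> (real k) \<le> real n}"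
      by (rule AE_not_in) (auto simp: null_sets_def emeasure_eq_measure null)
    then show "AE \<omega> in P. \<exists>k::nat. occ_time G \<omega> (real k) > real n"
      using AE_space by eventually_elim (auto simp: not_le)
  qed
qed

text \<open>At the inverse clock the random weight exp(\<beta> times occupation time) becomes the
  deterministic factor exp(\<beta> t). The inverse clock is approximated by grid times: increments
  are summed as long as the clock has not exceeded the level, each has mean zero given the past, and
  the mesh then tends to 0 by dominated convergence.\<close>

lemma trace_martingale:
  fixes F :: "'b \<Rightarrow> real"
  assumes rec: "AE \<omega> in P. \<forall>n::nat. \<exists>k::nat. occ_time G \<omega> (real k) > real n"
    and harm: "\<And>a. a \<in> E \<Longrightarrow> (\<Sum>b\<in>E. gen_matrix E q a b * F b) + (\<beta> * indicator G a) * F a = 0" and b0: "\<beta> \<ge> 0"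
    and st: "0 \<le> s" "s \<le> t"
    and Hm: "H \<in> borel_measurable (path_space E)" and HK: "\<And>\<omega>. \<omega> \<in> cadlag_paths E \<Longrightarrow> \<bar>H \<omega>\<bar> \<le> K"
    and Hs: "\<And>\<omega> v. \<omega> \<in> cadlag_paths E \<Longrightarrow> 0 \<le> v \<Longrightarrow> occ_time G \<omega> v > s \<Longrightarrow> H (stop v \<omega>) = H \<omega>"
  shows "expectation (\<lambda>\<omega>. H \<omega> * (exp (\<beta> * t) * F (trace_path G \<omega> t))) = expectation (\<lambda>\<omega>. H \<omega> * (exp (\<beta> * s) * F (trace_path G \<omega> s)))"
proof -
  note Tm[measurable] = measurable_occ_time[OF fin, of G, folded measurable_P]
  have Hm'[measurable]: "H \<in> borel_measurable P" unfolding measurable_P by (rule Hm)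
  have Fm[measurable]: "(\<lambda>\<omega>. F (\<omega> t)) \<in> borel_measurable P" for t unfolding measurable_P by (rule borel_measurable_coord_fun[OF fin])
  define FB where "FB = (\<Sum>a\<in>E. \<bar>F a\<bar>)"
  have FB: "\<bar>F a\<bar> \<le> FB" if "a \<in> E" for a
    unfolding FB_def using that fin by (intro member_le_sum[of a E "\<lambda>a. \<bar>F a\<bar>"]) auto
  have K0: "0 \<le> K"
  proof -
    obtain w where "w \<in> space P" using not_empty by blast
    then show ?thesis using HK[of w] by (simp add: space_P)
  qed
  define Z where "Z v \<omega> = exp (\<beta> * occ_time G \<omega> v) * F (\<omega> v)" for v \<omega>
  have Zm[measurable]: "Z v \<in> borel_measurable P" for v unfolding Z_def by measurable
  have Tb: "occ_time G \<omega> v \<le> v" "0 \<le> occ_time G \<omega> v" if "\<omega> \<in> cadlag_paths E" "0 \<le> v" for \<omega> v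
    using occ_time_diff[OF fin that(1) order_refl that(2), of G] by (auto simp: occ_time_0)
  have ZB: "\<bar>Z v \<omega>\<bar> \<le> exp (\<beta> * x) * FB" if "\<omega> \<in> cadlag_paths E" "occ_time G \<omega> v \<le> x" for \<omega> v x
    unfolding Z_def using that b0 FB[OF cadlag_in[OF that(1)]] by (auto simp: abs_mult intro!: mult_mono mult_left_mono)
  have addfZ: "addf (\<lambda>a. \<beta> * indicator G a) v \<omega> = \<beta> * occ_time G \<omega> v" if "\<omega> \<in> cadlag_paths E" for v \<omega>
    unfolding occ_time_addf[OF fin that] addf_def by (simp add: mult.left_commute)
  define h where "h n = 1 / real (Suc n)" for n
  have h0: "h n > 0" for n by (simp add: h_def)
  have h1: "h n \<le> 1" for n by (simp add: h_def)
  \<comment> \<open>The martingale stopped at the first grid point where the clock exceeds u, or at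
    time n + 1 if that comes earlier: (n + 1) squared steps of length 1/(n + 1). The horizon keeps
    the sum finite and eventually passes the inverse clock of every recurrent path.\<close>
  define X where "X u n \<omega> = Z 0 \<omega> + (\<Sum>k<(Suc n)\<^sup>2. if occ_time G \<omega> (real k * h n) \<le> u then Z (real (Suc k) * h n) \<omega> - Z (real k * h n) \<omega> else 0)" for u n \<omega>
  have Xm[measurable]: "X u n \<in> borel_measurable P" for u n unfolding X_def by measurable
  have ZBi: "\<exists>C. \<forall>\<omega>\<in>cadlag_paths E. \<bar>Z v \<omega>\<bar> \<le> C" if "0 \<le> v" for v
    using ZB Tb(1) that by blast
  have intHZ: "integrable P (\<lambda>\<omega>. J \<omega> * Z v \<omega>)" if v0: "0 \<le> v" and [measurable]: "J \<in> borel_measurable P" and JB: "\<And>\<omega>. \<omega> \<in> cadlag_paths E \<Longrightarrow> \<bar>J \<omega>\<bar> \<le> K" for J v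
  proof -
    obtain C where C: "\<forall>\<omega>\<in>cadlag_paths E. \<bar>Z v \<omega>\<bar> \<le> C" using ZBi[OF v0] by blast
    show ?thesis
      by (rule integrable_bounded_path[where B="K * C"])
         (use C JB K0 in \<open>auto simp: abs_mult measurable_P[symmetric] intro!: mult_mono\<close>)
  qed
  have step: "expectation (\<lambda>\<omega>. H \<omega> * X t n \<omega>) = expectation (\<lambda>\<omega>. H \<omega> * X s n \<omega>)" for n
  proof -
    \<comment> \<open>The difference of the sums for t and s involves exactly the steps at which the
      clock lies in (s, t]. At these steps the clock has passed s, so \<open>H\<close> is already
      determined by the stopped path and \<open>J\<close> is a functional of the past.\<close>
    define J where "J k \<omega> = (if s < occ_time G \<omega> (real k * h n) \<and> occ_time G \<omega> (real k * h n) \<le> t then H \<omega> else 0)" for k \<omega>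
    have Jm[measurable]: "J k \<in> borel_measurable P" for k unfolding J_def by measurable
    have JB: "\<bar>J k \<omega>\<bar> \<le> K" if "\<omega> \<in> cadlag_paths E" for k \<omega> using HK[OF that] K0 by (auto simp: J_def)
    have Jst: "J k (stop (real k * h n) \<omega>) = J k \<omega>" if w: "\<omega> \<in> cadlag_paths E" for k \<omega>
      using Hs[OF w, of "real k * h n"] h0[of n] by (simp add: J_def occ_time_stop)
    have z: "expectation (\<lambda>\<omega>. J k \<omega> * Z (real (Suc k) * h n) \<omega>) = expectation (\<lambda>\<omega>. J k \<omega> * Z (real k * h n) \<omega>)" for k
    proof -
      let ?c = "\<lambda>a. \<beta> * indicator G a" and ?u = "real k * h n" and ?v = "real (Suc k) * h n"
      have "expectation (\<lambda>\<omega>. J k (stop ?u \<omega>) * (exp (addf ?c ?v \<omega>) * F (\<omega> ?v))) = expectation (\<lambda>\<omega>. J k (stop ?u \<omega>) * (exp (addf ?c ?u \<omega>) * F (\<omega> ?u)))"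
        by (rule feynman_kac_martingale[OF harm, where K=K]) (use h0[of n] Jm[unfolded measurable_P] JB in \<open>auto simp: algebra_simps\<close>)
      also have "expectation (\<lambda>\<omega>. J k (stop ?u \<omega>) * (exp (addf ?c x \<omega>) * F (\<omega> x))) = expectation (\<lambda>\<omega>. J k \<omega> * Z x \<omega>)" for x
        by (rule Bochner_Integration.integral_cong) (auto simp: space_P Jst Z_def addfZ)
      finally show ?thesis
        using \<open>\<And>x. expectation (\<lambda>\<omega>. J k (stop ?u \<omega>) * (exp (addf ?c x \<omega>) * F (\<omega> x))) = expectation (\<lambda>\<omega>. J k \<omega> * Z x \<omega>)\<close> by simp
    qed
    have "H \<omega> * X t n \<omega> - H \<omega> * X s n \<omega> = (\<Sum>k<(Suc n)\<^sup>2. J k \<omega> * Z (real (Suc k) * h n) \<omega> - J k \<omega> * Z (real k * h n) \<omega>)" for \<omega>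
    proof -
      have "X t n \<omega> - X s n \<omega> = (\<Sum>k<(Suc n)\<^sup>2. if s < occ_time G \<omega> (real k * h n) \<and> occ_time G \<omega> (real k * h n) \<le> t then Z (real (Suc k) * h n) \<omega> - Z (real k * h n) \<omega> else 0)"
        unfolding X_def using st(2) by (auto simp: sum_subtractf[symmetric] intro!: sum.cong)
      then have "H \<omega> * (X t n \<omega> - X s n \<omega>) = (\<Sum>k<(Suc n)\<^sup>2. J k \<omega> * Z (real (Suc k) * h n) \<omega> - J k \<omega> * Z (real k * h n) \<omega>)"
        by (auto simp: sum_distrib_left J_def right_diff_distrib intro!: sum.cong)
      then show ?thesis by (simp add: right_diff_distrib)
    qed
    then have "expectation (\<lambda>\<omega>. H \<omega> * X t n \<omega> - H \<omega> * X s n \<omega>) = (\<Sum>k<(Suc n)\<^sup>2. expectation (\<lambda>\<omega>. J k \<omega> * Z (real (Suc k) * h n) \<omega>) - expectation (\<lambda>\<omega>. J k \<omega> * Z (real k * h n) \<omega>))"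
      using intHZ[OF _ Jm JB] h0[of n] by (simp add: less_imp_le)
    then have "expectation (\<lambda>\<omega>. H \<omega> * X t n \<omega> - H \<omega> * X s n \<omega>) = 0" by (simp only: z) simp
    moreover have iX: "integrable P (\<lambda>\<omega>. H \<omega> * X u n \<omega>)" for u
    proof -
      have "integrable P (\<lambda>\<omega>. H \<omega> * Z 0 \<omega> + (\<Sum>k<(Suc n)\<^sup>2. (if occ_time G \<omega> (real k * h n) \<le> u then H \<omega> else 0) * Z (real (Suc k) * h n) \<omega> - (if occ_time G \<omega> (real k * h n) \<le> u then H \<omega> else 0) * Z (real k * h n) \<omega>))"
        by (intro Bochner_Integration.integrable_add Bochner_Integration.integrable_sum Bochner_Integration.integrable_diff intHZ)
           (use HK K0 h0[of n] in \<open>auto simp: less_imp_le\<close>)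
      then show ?thesis
        by (rule Bochner_Integration.integrable_cong[THEN iffD1, rotated 2])
           (auto simp: X_def distrib_left sum_distrib_left right_diff_distrib intro!: sum.cong)
    qed
    ultimately show ?thesis by (simp add: Bochner_Integration.integral_diff[OF iX iX])
  qed
  have lim: "(\<lambda>n. expectation (\<lambda>\<omega>. H \<omega> * X u n \<omega>)) \<longlonglongrightarrow> expectation (\<lambda>\<omega>. H \<omega> * (exp (\<beta> * u) * F (trace_path G \<omega> u)))" if u: "0 \<le> u" for u
  proof -
    have good: "(\<lambda>n. X u n \<omega>) \<longlonglongrightarrow> exp (\<beta> * u) * F (trace_path G \<omega> u) \<and> (\<forall>n. \<bar>X u n \<omega>\<bar> \<le> exp (\<beta> * (u + 1)) * FB)"
      if w: "\<omega> \<in> cadlag_paths E" and ex: "\<forall>n::nat. \<exists>k::nat. occ_time G \<omega> (real k) > real n" for \<omega>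
    proof -
      obtain k :: nat where "occ_time G \<omega> (real k) > real (nat \<lceil>u\<rceil>)" using ex by blast
      then have v: "occ_time G \<omega> (real k) > u" "0 \<le> real k" by linarith+
      let ?S = "inv_time G \<omega> u"
      have S0: "0 \<le> ?S" by (rule inv_time_nonneg[OF fin w u v])
      define m where "m n = kap G u n \<omega>" for n
      have mS: "?S < real (m n) * h n" "real (m n) * h n \<le> ?S + h n" for n
        using kap_props(2,3)[OF fin w u v, of n] by (auto simp: m_def h_def)
      have Xeq: "X u n \<omega> = Z (real (min (m n) ((Suc n)\<^sup>2)) * h n) \<omega>" for n
      proof -
        have "occ_time G \<omega> (real k * h n) \<le> u \<longleftrightarrow> k < m n" for k
          using kap_le_iff[OF fin w u v, of n k] by (auto simp: m_def h_def not_le[symmetric])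
        then show ?thesis unfolding X_def using telescope_until[of "m n" "\<lambda>k. Z (real k * h n) \<omega>" "(Suc n)\<^sup>2"] by simp
      qed
      have TS: "occ_time G \<omega> ?S = u" by (rule occ_time_inv_time[OF fin w u v])
      have Tm': "u \<le> occ_time G \<omega> (real (m n) * h n)" "occ_time G \<omega> (real (m n) * h n) \<le> u + h n" for n
        using occ_time_diff[OF fin w S0 less_imp_le[OF mS(1)], of G n] mS(2)[of n] TS by auto
      \<comment> \<open>The grid time overshoots the level by at most one mesh width, so the clock
        is at most u + 1 when the sum stops; this gives an integrable bound independent of
        n.\<close>
      have "\<bar>X u n \<omega>\<bar> \<le> exp (\<beta> * (u + 1)) * FB" for n
      proof -
        have "real (min (m n) ((Suc n)\<^sup>2)) * h n \<le> real (m n) * h n" using h0[of n] by (intro mult_right_mono) auto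
        then have "occ_time G \<omega> (real (min (m n) ((Suc n)\<^sup>2)) * h n) \<le> occ_time G \<omega> (real (m n) * h n)"
          using h0[of n] by (intro occ_time_diff(2)[OF fin w]) auto
        also have "\<dots> \<le> u + 1" using Tm'(2)[of n] h1[of n] by linarith
        finally show ?thesis unfolding Xeq by (rule ZB[OF w])
      qed
      moreover have "(\<lambda>n. X u n \<omega>) \<longlonglongrightarrow> exp (\<beta> * u) * F (trace_path G \<omega> u)"
      proof -
        have "eventually (\<lambda>n. n \<ge> nat \<lceil>?S\<rceil>) sequentially" by (rule eventually_ge_at_top)
        then have e1: "eventually (\<lambda>n. X u n \<omega> = Z (real (m n) * h n) \<omega>) sequentially"
        proof eventually_elim
          case (elim n)
          have "?S \<le> real n" using elim by linarith
          then have "real (m n) * h n \<le> real (Suc n)" using mS(2)[of n] h1[of n] by simp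
          then have "real (m n) \<le> real (Suc n) * real (Suc n)" by (simp add: h_def pos_divide_le_eq del: of_nat_Suc)
          then have "real (m n) \<le> real ((Suc n)\<^sup>2)" by (simp only: power2_eq_square of_nat_mult)
          then have "m n \<le> (Suc n)\<^sup>2" by (simp only: of_nat_le_iff)
          then show ?case unfolding Xeq by (simp add: min_def)
        qed
        have e2: "eventually (\<lambda>n. \<omega> (real (m n) * h n) = \<omega> ?S) sequentially"
          by (rule cadlag_right_eventually[OF w]) (use mS in \<open>auto simp: h_def intro: less_imp_le\<close>)
        have "h \<longlonglongrightarrow> 0" unfolding h_def using LIMSEQ_inverse_real_of_nat by (simp add: inverse_eq_divide)
        then have uh: "(\<lambda>n. u + h n) \<longlonglongrightarrow> u" using tendsto_add[OF tendsto_const[of u], of h 0] by simp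
        have "(\<lambda>n. occ_time G \<omega> (real (m n) * h n)) \<longlonglongrightarrow> u"
          by (rule tendsto_sandwich[OF _ _ tendsto_const[of u] uh]) (use Tm' in \<open>auto intro!: always_eventually\<close>)
        then have "(\<lambda>n. exp (\<beta> * occ_time G \<omega> (real (m n) * h n)) * F (\<omega> ?S)) \<longlonglongrightarrow> exp (\<beta> * u) * F (\<omega> ?S)"
          by (intro tendsto_intros)
        then have "(\<lambda>n. X u n \<omega>) \<longlonglongrightarrow> exp (\<beta> * u) * F (\<omega> ?S)"
          by (rule Lim_transform_eventually) (use e1 e2 in eventually_elim, simp add: Z_def)
        then show ?thesis using u by (simp add: trace_path_def)
      qed
      ultimately show ?thesis by simp
    qed
    have trm[measurable]: "(\<lambda>\<omega>. F (trace_path G \<omega> u)) \<in> borel_measurable P"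
      unfolding measurable_P by (rule borel_measurable_trace_path_fun[OF fin])
    show ?thesis
    proof (rule integral_dominated_convergence[where w="\<lambda>_. K * (exp (\<beta> * (u + 1)) * FB)"])
      show "AE \<omega> in P. (\<lambda>n. H \<omega> * X u n \<omega>) \<longlonglongrightarrow> H \<omega> * (exp (\<beta> * u) * F (trace_path G \<omega> u))"
        using rec AE_space
      proof eventually_elim
        case (elim \<omega>)
        then have "\<omega> \<in> cadlag_paths E" by (simp add: space_P)
        then show ?case using good elim(1) by (intro tendsto_mult_left) blast
      qed
      show "AE \<omega> in P. norm (H \<omega> * X u n \<omega>) \<le> K * (exp (\<beta> * (u + 1)) * FB)" for n
        using rec AE_space
      proof eventually_elim
        case (elim \<omega>)
        then have w: "\<omega> \<in> cadlag_paths E" by (simp add: space_P)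
        then have "\<bar>X u n \<omega>\<bar> \<le> exp (\<beta> * (u + 1)) * FB" using good elim(1) by blast
        then have "\<bar>H \<omega>\<bar> * \<bar>X u n \<omega>\<bar> \<le> K * (exp (\<beta> * (u + 1)) * FB)" using HK[OF w] K0 by (intro mult_mono) auto
        then show ?case by (simp add: abs_mult)
      qed
    qed auto
  qed
  have "0 \<le> t" using st by simp
  from LIMSEQ_unique[OF lim[OF this, unfolded step] lim[OF st(1)]] show ?thesis .
qed

end

section \<open>Uniqueness of the law and convergence under time scaling\<close>

lemma ctmc_law_unique:
  assumes "finite E" "a \<in> E" "is_ctmc_law E q a P" "is_ctmc_law E q a P'"
  shows "P = P'"
proof -
  interpret P: ctmc E q a P by unfold_locales (use assms in auto)
  interpret P': ctmc E q a P' by unfold_locales (use assms in auto)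
  show ?thesis
    by (rule path_measure_eqI[where E=E, OF P.prob_space_axioms P'.prob_space_axioms P.sets_P P'.sets_P])
       (simp add: P.prob_cyl P'.prob_cyl)
qed

lemma fdd_two_state_scale:
  assumes "\<And>p. p \<in> set pts \<Longrightarrow> snd p \<in> {1, 2::nat}" "a \<in> {1, 2}"
  shows "fdd {1, 2} (\<lambda>_ _. \<alpha>) (\<theta> * t) a (map (\<lambda>p. (\<theta> * fst p, snd p)) pts) = fdd {1, 2} (\<lambda>_ _. \<alpha> * \<theta>) t a pts"
  using assms
proof (induction pts arbitrary: t a)
  case (Cons p pts)
  obtain s b where p: "p = (s, b)" by (cases p)
  have b: "b \<in> {1, 2}" using Cons.prems(1)[of p] by (simp add: p)
  have IH: "fdd {1, 2} (\<lambda>_ _. \<alpha>) (\<theta> * s) b (map (\<lambda>p. (\<theta> * fst p, snd p)) pts) = fdd {1, 2} (\<lambda>_ _. \<alpha> * \<theta>) s b pts"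
    by (rule Cons.IH) (use Cons.prems(1) b in auto)
  have "\<alpha> * (\<theta> * s - \<theta> * t) = \<alpha> * \<theta> * (s - t)" by (simp add: algebra_simps)
  then show ?case unfolding p list.map fst_conv snd_conv fdd.simps IH
    trans_prob_two_state[OF Cons.prems(2) b] mult.assoc[of "-2"] by simp
qed simp

lemma map_scale_sorted:
  fixes \<theta> :: real
  assumes "\<theta> > 0" "sorted_wrt (<) (map fst pts)"
  shows "sorted_wrt (<) (map fst (map (\<lambda>p. (\<theta> * fst p, g p)) pts))"
  using assms by (simp add: sorted_wrt_map comp_def)

text \<open>Realises a chain with a different rate on the path space of \<open>Q\<close> itself. All
  prelimit laws thus become images of the single measure \<open>Q\<close>, a coupling with the
  limit.\<close>

lemma two_state_scale_law:
  assumes Q: "is_ctmc_law {1, 2} (\<lambda>_ _. c) i0 Q" and i0: "i0 \<in> {1, 2::nat}" and l: "l > 0"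
  shows "is_ctmc_law {1, 2} (\<lambda>_ _. c * l) i0 (distr Q (path_space {1, 2}) (\<lambda>\<omega> t. \<omega> (l * t)))"
proof -
  interpret Q: ctmc "{1, 2}" "\<lambda>_ _. c" i0 Q by unfold_locales (use Q i0 in auto)
  have cad: "(\<lambda>t. \<omega> (l * t)) \<in> cadlag_paths {1, 2::nat}" if "\<omega> \<in> cadlag_paths {1, 2}" for \<omega>
    using cadlag_scale_map[OF that l, of "\<lambda>x. x" "{1,2}"] by simp
  have m: "(\<lambda>\<omega> t. \<omega> (l * t)) \<in> measurable Q (path_space {1, 2})"
    unfolding Q.measurable_P by (rule measurable_into_path_space) (use cad coord_set in auto)
  show ?thesis unfolding is_ctmc_law_def
  proof (intro conjI allI impI)
    show "prob_space (distr Q (path_space {1, 2}) (\<lambda>\<omega> t. \<omega> (l * t)))" by (rule Q.prob_space_distr[OF m])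
    fix pts :: "(real \<times> nat) list"
    assume pts: "sorted_wrt (<) (map fst pts) \<and> (\<forall>p\<in>set pts. 0 \<le> fst p \<and> snd p \<in> {1, 2})"
    let ?A = "{\<omega> \<in> cadlag_paths {1, 2}. \<forall>p\<in>set pts. \<omega> (fst p) = snd p}"
    let ?pts = "map (\<lambda>p. (l * fst p, snd p)) pts"
    have "?A = {\<omega> \<in> space (path_space {1, 2}). \<forall>p\<in>set pts. \<omega> (fst p) = snd p}" by simp
    also have "\<dots> \<in> sets (path_space {1, 2})"
      by (intro sets.sets_Collect_finite_All) (auto simp: coord_set)
    finally have A: "?A \<in> sets (path_space {1, 2})" .
    have "measure (distr Q (path_space {1, 2}) (\<lambda>\<omega> t. \<omega> (l * t))) ?A = measure Q ((\<lambda>\<omega> t. \<omega> (l * t)) -` ?A \<inter> space Q)"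
      by (rule measure_distr[OF m A])
    also have "(\<lambda>\<omega> t. \<omega> (l * t)) -` ?A \<inter> space Q = {\<omega> \<in> cadlag_paths {1, 2}. \<forall>p\<in>set ?pts. \<omega> (fst p) = snd p}"
      using cad by (auto simp: Q.space_P)
    also have "measure Q \<dots> = fdd {1, 2} (\<lambda>_ _. c) 0 i0 ?pts"
    proof -
      have "sorted_wrt (<) (map fst ?pts)" using map_scale_sorted[OF l] pts by blast
      moreover have "\<forall>p\<in>set ?pts. 0 \<le> fst p \<and> snd p \<in> {1, 2}" using pts l by auto
      ultimately show ?thesis using Q unfolding is_ctmc_law_def by blast
    qed
    also have "\<dots> = fdd {1, 2} (\<lambda>_ _. c * l) 0 i0 pts"
      using fdd_two_state_scale[of pts i0 c l 0] pts i0 by simp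
    finally show "measure (distr Q (path_space {1, 2}) (\<lambda>\<omega> t. \<omega> (l * t))) ?A = fdd {1, 2} (\<lambda>_ _. c * l) 0 i0 pts" .
  qed simp
qed

section \<open>Continuity of time scaling in the Skorokhod metric\<close>

lemma integrable_exp_minus: "integrable lborel (\<lambda>u::real. indicator {0..} u * exp (- u))"
proof -
  have p: "prob_space (density lborel (exponential_density 1))" by (rule prob_space_exponential_density) simp
  have e: "indicator {0..} u * exp (- u) = exponential_density 1 u" for u :: real
    unfolding exponential_density_def by (cases "u < 0") auto
  have "emeasure (density lborel (exponential_density 1)) (space (density lborel (exponential_density 1))) = 1"
    by (rule prob_space.emeasure_space_1[OF p])
  then have "(\<integral>\<^sup>+u. ennreal (exponential_density 1 u) * indicator UNIV u \<partial>lborel) = 1"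
    by (subst (asm) emeasure_density) simp_all
  then have "(\<integral>\<^sup>+u. ennreal (exponential_density 1 u) \<partial>lborel) < \<infinity>" by simp
  then show ?thesis unfolding e by (intro integrableI_nonneg AE_I2) (auto simp: exponential_density_nonneg)
qed

text \<open>One-sided limits in a discrete space make the path constant on both sides near any
  point, so every discontinuity is isolated from the others and the set of discontinuities is
  locally negligible.\<close>

lemma cadlag_locally_constant_AE:
  assumes x: "x \<in> cadlag_paths E"
  shows "AE u in lborel. \<exists>\<delta>>0. \<forall>s. \<bar>s - u\<bar> < \<delta> \<longrightarrow> x s = x u"
proof -
  define D where "D = {u. \<not> (\<exists>\<delta>>0. \<forall>s. \<bar>s - u\<bar> < \<delta> \<longrightarrow> x s = x u)}"
  have "negligible D"
  proof (rule locally_negligible_alt[THEN iffD2], rule ballI)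
    fix u assume u: "u \<in> D"
    obtain d1 where d1: "d1 > 0" "\<And>s. u \<le> s \<Longrightarrow> s < u + d1 \<Longrightarrow> x s = x u" by (rule cadlag_right[OF x, of u]) (rule that)
    obtain d2 l where d2: "d2 > 0" "\<And>s. u - d2 < s \<Longrightarrow> s < u \<Longrightarrow> x s = l" by (rule cadlag_left[OF x, of u]) (rule that)
    define d where "d = min d1 d2"
    have d: "d > 0" "d \<le> d1" "d \<le> d2" using d1 d2 by (auto simp: d_def)
    have nD: "v \<notin> D" if v: "\<bar>v - u\<bar> < d" "v \<noteq> u" for v
    proof (cases "v > u")
      case True
      have "x s = x v" if "\<bar>s - v\<bar> < min (v - u) (u + d - v)" for s
      proof -
        have "u \<le> s" "s < u + d1" "u \<le> v" "v < u + d1" using that True v d by (auto simp: abs_less_iff min_less_iff_conj)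
        then show ?thesis using d1(2)[of s] d1(2)[of v] by simp
      qed
      moreover have "min (v - u) (u + d - v) > 0" using True v by auto
      ultimately show ?thesis unfolding D_def by blast
    next
      case False
      have "x s = x v" if "\<bar>s - v\<bar> < min (u - v) (v - (u - d))" for s
      proof -
        have "u - d2 < s" "s < u" "u - d2 < v" "v < u" using that False v d by (auto simp: abs_less_iff min_less_iff_conj)
        then show ?thesis using d2(2)[of s] d2(2)[of v] by simp
      qed
      moreover have "min (u - v) (v - (u - d)) > 0" using False v by auto
      ultimately show ?thesis unfolding D_def by blast
    qed
    have "v = u" if "v \<in> D" "v \<in> ball u d" for v
    proof (rule ccontr)
      assume "v \<noteq> u"
      moreover have "\<bar>v - u\<bar> < d" using that(2) by (simp add: dist_real_def abs_minus_commute)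
      ultimately show False using nD that(1) by blast
    qed
    then have "D \<inter> ball u d = {u}" using u d(1) by auto
    moreover have "openin (top_of_set D) (D \<inter> ball u d)" by (rule openin_open_Int) simp
    ultimately show "\<exists>U. openin (top_of_set D) U \<and> u \<in> U \<and> negligible U"
      by (intro exI[of _ "D \<inter> ball u d"]) auto
  qed
  then have "AE u in lebesgue. u \<notin> D" by (intro AE_not_in) (simp add: negligible_iff_null_sets)
  then have "AE u in lborel. u \<notin> D" by (simp add: AE_completion_iff)
  then show ?thesis by eventually_elim (simp add: D_def)
qed

lemma measurable_path_eq:
  assumes "finite E" and x: "x \<in> cadlag_paths E"
  shows "(\<lambda>s::real. x s = a) \<in> measurable borel (count_space UNIV)"
proof -
  have "(\<lambda>s. indicator {a} (x s) :: real) \<in> borel_measurable borel" by (rule measurable_path[OF assms])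
  then have "(\<lambda>s. indicator {a} (x s) = (1::real)) \<in> measurable borel (count_space UNIV)" by measurable
  then show ?thesis by (simp add: indicator_def[abs_def])
qed

text \<open>The time change t / l undoes the scaling by l, and all its logarithmic slopes equal -ln
  l. What remains is the truncation: the paths stopped at u and at l u can differ only if the path
  changes between u and l u, which for large n does not happen at a point u of local
  constancy.\<close>

lemma sk_dist_scale_tendsto:
  assumes fin: "finite E" and x: "x \<in> cadlag_paths E" and lp: "\<And>n. l n > 0" and l1: "l \<longlonglongrightarrow> 1"
  shows "\<exists>b. b \<longlonglongrightarrow> 0 \<and> (\<forall>n. sk_dist x (\<lambda>t. x (l n * t)) \<le> b n)"
proof -
  define y where "y n = (\<lambda>t. x (l n * t))" for n
  define tch where "tch n = (\<lambda>t. t / l n)" for n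
  define I where "I n = (LBINT u:{0..}. exp (- u) * sk_local x (y n) (tch n) u)" for n
  have set1: "{\<bar>ln ((tch n s - tch n t) / (s - t))\<bar> |s t. 0 \<le> t \<and> t < s} = {\<bar>ln (l n)\<bar>}" for n
  proof -
    have eq: "\<bar>ln ((tch n s - tch n t) / (s - t))\<bar> = \<bar>ln (l n)\<bar>" if "t < s" for s t
    proof -
      have "(tch n s - tch n t) / (s - t) = inverse (l n)" using that by (simp add: tch_def diff_divide_distrib[symmetric] inverse_eq_divide)
      then show ?thesis using lp[of n] by (simp add: ln_inverse)
    qed
    show ?thesis
    proof (intro equalityI subsetI)
      fix z assume "z \<in> {\<bar>ln ((tch n s - tch n t) / (s - t))\<bar> |s t. 0 \<le> t \<and> t < s}"
      then obtain s t where "z = \<bar>ln ((tch n s - tch n t) / (s - t))\<bar>" "t < s" by blast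
      then show "z \<in> {\<bar>ln (l n)\<bar>}" using eq[of t s] by simp
    next
      fix z assume "z \<in> {\<bar>ln (l n)\<bar>}"
      then have "z = \<bar>ln ((tch n 1 - tch n 0) / (1 - 0))\<bar>" using eq[of 0 1] by simp
      then show "z \<in> {\<bar>ln ((tch n s - tch n t) / (s - t))\<bar> |s t. 0 \<le> t \<and> t < s}" by (intro CollectI exI[of _ 1] exI[of _ 0]) simp
    qed
  qed
  have tc: "tch n \<in> sk_time_changes" for n
  proof -
    have "tch n ` {0..} = {0..}"
    proof (intro equalityI subsetI)
      fix z :: real assume "z \<in> {0..}" then show "z \<in> tch n ` {0..}"
        using lp[of n] by (intro image_eqI[of _ _ "z * l n"]) (auto simp: tch_def)
    qed (use lp[of n] in \<open>auto simp: tch_def\<close>)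
    moreover have "strict_mono_on {0..} (tch n)" using lp[of n] by (auto simp: strict_mono_on_def tch_def divide_strict_right_mono)
    ultimately show ?thesis unfolding sk_time_changes_def by (simp add: set1)
  qed
  have gam: "sk_gamma (tch n) = \<bar>ln (l n)\<bar>" for n unfolding sk_gamma_def set1 by simp
  have gam0: "sk_gamma m \<ge> 0" if "m \<in> sk_time_changes" for m
  proof -
    let ?S = "{\<bar>ln ((m s - m t) / (s - t))\<bar> | s t. 0 \<le> t \<and> t < s}"
    have "\<bar>ln ((m 1 - m 0) / (1 - 0))\<bar> \<in> ?S" by (intro CollectI exI[of _ 1] exI[of _ 0]) simp
    moreover have "bdd_above ?S" using that by (simp add: sk_time_changes_def)
    ultimately have "\<bar>ln ((m 1 - m 0) / (1 - 0))\<bar> \<le> Sup ?S" by (rule cSup_upper)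
    then show ?thesis unfolding sk_gamma_def by linarith
  qed
  have le: "sk_dist x (y n) \<le> max \<bar>ln (l n)\<bar> (I n)" for n
    unfolding sk_dist_def
  proof (rule cInf_lower)
    show "max \<bar>ln (l n)\<bar> (I n) \<in> {max (sk_gamma l) (LBINT u:{0..}. exp (- u) * sk_local x (y n) l u) |l. l \<in> sk_time_changes}"
      using tc[of n] by (auto simp: gam I_def intro!: exI[of _ "tch n"])
    show "bdd_below {max (sk_gamma l) (LBINT u:{0..}. exp (- u) * sk_local x (y n) l u) |l. l \<in> sk_time_changes}"
      by (rule bdd_belowI[of _ 0]) (use gam0 in \<open>auto simp: le_max_iff_disj\<close>)
  qed
  have yeq: "y n (min (tch n t) u) = x (min t (l n * u))" for n t u
  proof -
    have "l n * min (t / l n) u = min t (l n * u)" using lp[of n] by (auto simp: min_def field_simps)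
    then show ?thesis by (simp add: y_def tch_def)
  qed
  \<comment> \<open>Right continuity cuts the existential over real times down to rationals; this is
    what makes the integrand measurable in u.\<close>
  have loc: "sk_local x (y n) (tch n) u = (if \<exists>q::rat. 0 \<le> q \<and> x (min (of_rat q) u) \<noteq> x (min (of_rat q) (l n * u)) then 1 else 0)" if u: "0 \<le> u" for n u
  proof -
    have u': "0 \<le> l n * u" using lp[of n] u by simp
    have "(\<exists>t\<ge>0. x (min t u) \<noteq> x (min t (l n * u))) \<longleftrightarrow> (\<exists>q::rat. 0 \<le> q \<and> x (min (of_rat q) u) \<noteq> x (min (of_rat q) (l n * u)))"
    proof
      assume "\<exists>t\<ge>0. x (min t u) \<noteq> x (min t (l n * u))"
      then obtain t where t: "t \<ge> 0" "x (min t u) \<noteq> x (min t (l n * u))" by blast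
      obtain d1 where d1: "d1 > 0" "\<And>s. t \<le> s \<Longrightarrow> s < t + d1 \<Longrightarrow> stop u x s = stop u x t"
        by (rule cadlag_right[OF stop_cadlag[OF x u], of t]) (rule that)
      obtain d2 where d2: "d2 > 0" "\<And>s. t \<le> s \<Longrightarrow> s < t + d2 \<Longrightarrow> stop (l n * u) x s = stop (l n * u) x t"
        by (rule cadlag_right[OF stop_cadlag[OF x u'], of t]) (rule that)
      obtain q where q: "t < of_rat q" "of_rat q < t + min d1 d2" using of_rat_dense[of t "t + min d1 d2"] d1(1) d2(1) by auto
      have "(0::real) \<le> of_rat q" using t q by linarith
      then have "0 \<le> q" by simp
      moreover have "x (min (of_rat q) u) = x (min t u)" "x (min (of_rat q) (l n * u)) = x (min t (l n * u))"
        using d1(2)[of "of_rat q"] d2(2)[of "of_rat q"] q by (auto simp: stop_def)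
      ultimately show "\<exists>q::rat. 0 \<le> q \<and> x (min (of_rat q) u) \<noteq> x (min (of_rat q) (l n * u))" using t by metis
    next
      assume "\<exists>q::rat. 0 \<le> q \<and> x (min (of_rat q) u) \<noteq> x (min (of_rat q) (l n * u))"
      then show "\<exists>t\<ge>0. x (min t u) \<noteq> x (min t (l n * u))" by (metis zero_le_of_rat_iff)
    qed
    then show ?thesis unfolding sk_local_def yeq by simp
  qed
  define g where "g n u = indicator {0..} u * (exp (- u) * (if \<exists>q::rat. 0 \<le> q \<and> x (min (of_rat q) u) \<noteq> x (min (of_rat q) (l n * u)) then 1 else 0 :: real))" for n and u :: real
  have Ig: "I n = (\<integral>u. g n u \<partial>lborel)" for n
    unfolding I_def set_lebesgue_integral_def g_def
    by (intro Bochner_Integration.integral_cong) (auto simp: loc indicator_def)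
  have gm: "g n \<in> borel_measurable lborel" for n
  proof -
    have p: "(\<lambda>s. x s = a) \<in> measurable borel (count_space UNIV)" for a by (rule measurable_path_eq[OF fin x])
    have e: "x s \<noteq> x s' \<longleftrightarrow> (\<exists>a\<in>E. x s = a \<and> \<not> x s' = a)" for s s' using cadlag_in[OF x] by auto
    have p1: "(\<lambda>u. x (min (of_rat q) u) = a) \<in> measurable borel (count_space UNIV)" for q a
      by (rule measurable_compose[OF _ p]) measurable
    have p2: "(\<lambda>u. x (min (of_rat q) (l n * u)) = a) \<in> measurable borel (count_space UNIV)" for q a
      by (rule measurable_compose[OF _ p]) measurable
    show ?thesis unfolding g_def e using p1 p2 countable_finite[OF fin] by measurable
  qed
  have "I \<longlonglongrightarrow> (\<integral>u. 0 \<partial>(lborel :: real measure))" unfolding Ig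
  proof (rule integral_dominated_convergence[where w="\<lambda>u. indicator {0..} u * exp (- u)"])
    show "integrable lborel (\<lambda>u::real. indicator {0..} u * exp (- u))" by (rule integrable_exp_minus)
    show "AE u in lborel. (\<lambda>n. g n u) \<longlonglongrightarrow> 0"
      using cadlag_locally_constant_AE[OF x]
    proof eventually_elim
      case (elim u)
      then obtain \<delta> where d: "\<delta> > 0" "\<forall>s. \<bar>s - u\<bar> < \<delta> \<longrightarrow> x s = x u" by blast
      show ?case
      proof (cases "u \<ge> 0")
        case True
        have "(\<lambda>n. l n * u) \<longlonglongrightarrow> 1 * u" by (intro tendsto_intros l1)
        then have "eventually (\<lambda>n. dist (l n * u) (1 * u) < \<delta>) sequentially" using d(1) by (rule tendstoD)
        then have "eventually (\<lambda>n. g n u = 0) sequentially"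
        proof eventually_elim
          case (elim n)
          have "x (min t u) = x (min t (l n * u))" for t
          proof (cases "t \<le> u \<and> t \<le> l n * u")
            case False
            then have "\<bar>min t u - u\<bar> < \<delta>" "\<bar>min t (l n * u) - u\<bar> < \<delta>" using elim d(1) by (auto simp: dist_real_def min_def)
            then show ?thesis using d(2) by metis
          qed simp
          then show ?case by (simp add: g_def)
        qed
        then show ?thesis by (rule tendsto_eventually)
      qed (simp add: g_def)
    qed
    show "AE u in lborel. norm (g n u) \<le> indicator {0..} u * exp (- u)" for n
      by (rule AE_I2) (auto simp: g_def indicator_def)
  qed (use gm in auto)
  then have I0: "I \<longlonglongrightarrow> 0" by simp
  have "(\<lambda>n. \<bar>ln (l n)\<bar>) \<longlonglongrightarrow> \<bar>ln 1\<bar>" by (intro tendsto_intros l1) simp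
  then have "(\<lambda>n. max \<bar>ln (l n)\<bar> (I n)) \<longlonglongrightarrow> max 0 0" using I0 by (intro tendsto_max) simp_all
  then show ?thesis using le by (intro exI[of _ "\<lambda>n. max \<bar>ln (l n)\<bar> (I n)"]) (simp add: y_def)
qed

text \<open>Because the approximating laws are images of \<open>Q\<close> under scalings that tend
  to the identity, continuous functionals converge along every path and bounded convergence
  finishes. No tightness is involved.\<close>

lemma weak_conv_scale:
  assumes fin: "finite E" and Q: "prob_space Q" "sets Q = sets (path_space E)"
    and l1: "l \<longlonglongrightarrow> 1" and ev: "eventually (\<lambda>n. l n > 0 \<and> Pn n = distr Q (path_space E) (\<lambda>\<omega> t. \<omega> (l n * t))) sequentially"
  shows "weak_conv_paths E Pn Q"
  unfolding weak_conv_paths_def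
proof (intro allI impI, elim conjE exE)
  fix f B assume f: "sk_continuous E f" and B: "\<forall>x\<in>cadlag_paths E. \<bar>f x\<bar> \<le> B"
  interpret Q: prob_space Q by fact
  have spQ: "space Q = cadlag_paths E" using sets_eq_imp_space_eq[OF Q(2)] by simp
  have mQ: "measurable Q N = measurable (path_space E) N" for N by (rule measurable_cong_sets) (simp_all add: Q)
  \<comment> \<open>Positive for all n and equal to \<open>l\<close> from some point on, so that the
    scaling map acts on path space for every n.\<close>
  define l' where "l' n = (if l n > 0 then l n else 1)" for n
  have l'p: "l' n > 0" for n by (simp add: l'_def)
  have "eventually (\<lambda>n. l' n = l n) sequentially" using ev by eventually_elim (simp add: l'_def)
  then have l'1: "l' \<longlonglongrightarrow> 1" using l1 by (metis (mono_tags, lifting) tendsto_cong)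
  have ev': "eventually (\<lambda>n. Pn n = distr Q (path_space E) (\<lambda>\<omega> t. \<omega> (l' n * t))) sequentially"
    using ev by eventually_elim (simp add: l'_def)
  have cad: "(\<lambda>t. \<omega> (l' n * t)) \<in> cadlag_paths E" if "\<omega> \<in> cadlag_paths E" for \<omega> n
    using cadlag_scale_map[OF that l'p, of "\<lambda>x. x" E] by simp
  have m: "(\<lambda>\<omega> t. \<omega> (l' n * t)) \<in> measurable Q (path_space E)" for n
    unfolding mQ by (rule measurable_into_path_space) (use cad coord_set in auto)
  show "(\<lambda>n. \<integral>x. f x \<partial>Pn n) \<longlonglongrightarrow> (\<integral>x. f x \<partial>Q)"
  \<comment> \<open>Measurability of \<open>f\<close> is not derived from its continuity. If it
    fails, the integrals against \<open>Q\<close> and, for large n, against \<open>Pn n\<close> are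
    all 0 by convention.\<close>
  proof (cases "f \<in> borel_measurable (path_space E)")
    case True
    have fm: "f \<in> borel_measurable Q" unfolding mQ by (rule True)
    have "(\<lambda>n. \<integral>\<omega>. f (\<lambda>t. \<omega> (l' n * t)) \<partial>Q) \<longlonglongrightarrow> (\<integral>x. f x \<partial>Q)"
    proof (rule integral_dominated_convergence[where w="\<lambda>_. B"])
      show "(\<lambda>\<omega>. f (\<lambda>t. \<omega> (l' n * t))) \<in> borel_measurable Q" for n by (rule measurable_compose[OF m True])
      show "AE \<omega> in Q. (\<lambda>n. f (\<lambda>t. \<omega> (l' n * t))) \<longlonglongrightarrow> f \<omega>"
      proof (rule AE_I2)
        fix \<omega> assume "\<omega> \<in> space Q"
        then have w: "\<omega> \<in> cadlag_paths E" by (simp add: spQ)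
        obtain b where b: "b \<longlonglongrightarrow> 0" "\<And>n. sk_dist \<omega> (\<lambda>t. \<omega> (l' n * t)) \<le> b n"
          using sk_dist_scale_tendsto[OF fin w l'p l'1] by blast
        show "(\<lambda>n. f (\<lambda>t. \<omega> (l' n * t))) \<longlonglongrightarrow> f \<omega>"
        proof (rule tendstoI)
          fix e :: real assume "e > 0"
          then obtain \<delta> where d: "\<delta> > 0" "\<And>y. y \<in> cadlag_paths E \<Longrightarrow> sk_dist \<omega> y < \<delta> \<Longrightarrow> \<bar>f y - f \<omega>\<bar> < e"
            using f w unfolding sk_continuous_def by meson
          have "eventually (\<lambda>n. b n < \<delta>) sequentially" by (rule order_tendstoD(2)[OF b(1) d(1)])
          then show "eventually (\<lambda>n. dist (f (\<lambda>t. \<omega> (l' n * t))) (f \<omega>) < e) sequentially"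
            by eventually_elim (use d(2)[OF cad[OF w]] b(2) in \<open>auto simp: dist_real_def intro: order_le_less_trans\<close>)
        qed
      qed
      show "AE \<omega> in Q. norm (f (\<lambda>t. \<omega> (l' n * t))) \<le> B" for n
        by (rule AE_I2) (use B cad in \<open>auto simp: spQ\<close>)
    qed (use fm in auto)
    moreover have "eventually (\<lambda>n. (\<integral>\<omega>. f (\<lambda>t. \<omega> (l' n * t)) \<partial>Q) = (\<integral>x. f x \<partial>Pn n)) sequentially"
      using ev' by eventually_elim (simp add: integral_distr[OF m True])
    ultimately show ?thesis by (rule Lim_transform_eventually)
  next
    case False
    then have "\<not> integrable Q f" using mQ by (auto dest: borel_measurable_integrable)
    moreover have "eventually (\<lambda>n. (\<integral>x. f x \<partial>Pn n) = 0) sequentially"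
      using ev'
    proof eventually_elim
      case (elim n)
      have "\<not> integrable (Pn n) f"
      proof
        assume "integrable (Pn n) f"
        then have "f \<in> borel_measurable (Pn n)" by (rule borel_measurable_integrable)
        then show False using False by (simp add: elim)
      qed
      then show ?case by (rule not_integrable_integral_eq)
    qed
    ultimately show ?thesis by (simp add: not_integrable_integral_eq tendsto_eventually)
  qed
qed

section \<open>Law of the trace on two states\<close>

context ctmc begin

text \<open>On the two states the indicator of b is (1 + \<open>F b\<close> \<open>F\<close>)/2. The
  martingale therefore yields the transition probability (1 + \<open>F b\<close> \<open>F b'\<close>
  exp(-\<beta>(t - s)))/2, which is that of the two-state chain with rate \<beta>/2. The induction
  appends time points at the end, with the event of the earlier ones as the functional
  \<open>H\<close>.\<close>

lemma trace_law:
  fixes F :: "'b \<Rightarrow> real" and \<iota> :: "'b \<Rightarrow> nat"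
  assumes g: "g1 \<noteq> g2" "a0 \<in> {g1, g2}"
    and rec: "AE \<omega> in P. \<forall>n::nat. \<exists>k::nat. occ_time {g1, g2} \<omega> (real k) > real n"
    and harm: "\<And>a. a \<in> E \<Longrightarrow> (\<Sum>b\<in>E. gen_matrix E q a b * F b) + (\<beta> * indicator {g1, g2} a) * F a = 0" and b0: "\<beta> \<ge> 0"
    and F: "F g1 = 1" "F g2 = -1" and i: "\<iota> g1 = 1" "\<iota> g2 = 2"
    and pts: "sorted_wrt (<) (map fst pts)" "\<And>p. p \<in> set pts \<Longrightarrow> 0 \<le> fst p \<and> snd p \<in> {g1, g2}"
  shows "prob {\<omega>\<in>cadlag_paths E. \<forall>p\<in>set pts. trace_path {g1, g2} \<omega> (fst p) = snd p} =
     fdd {1, 2} (\<lambda>_ _. \<beta> / 2) 0 (\<iota> a0) (map (\<lambda>p. (fst p, \<iota> (snd p))) pts)"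
  using pts
proof (induction pts rule: rev_induct)
  case Nil
  then show ?case using prob_space by (simp add: space_P)
next
  case (snoc p pts)
  let ?G = "{g1, g2}"
  let ?tr = "trace_path {g1, g2}"
  obtain t b where p: "p = (t, b)" by (cases p)
  have tb: "0 \<le> t" "b \<in> ?G" using snoc.prems(2)[of p] by (auto simp: p)
  define s where "s = (if pts = [] then 0 else fst (last pts))"
  define b' where "b' = (if pts = [] then a0 else snd (last pts))"
  have last: "last pts \<in> set pts" if "pts \<noteq> []" using that by simp
  have b': "b' \<in> ?G" using g(2) last snoc.prems(2) by (auto simp: b'_def)
  have s0: "0 \<le> s" using last snoc.prems(2) by (auto simp: s_def)
  have st: "s \<le> t"
    using snoc.prems(1) last tb by (auto simp: s_def p sorted_wrt_append less_imp_le)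
  have ps: "fst x \<le> s" if x: "x \<in> set pts" for x
  proof -
    have ne: "pts \<noteq> []" using x by auto
    then have "pts = butlast pts @ [last pts]" by simp
    moreover have "sorted_wrt (<) (map fst pts)" using snoc.prems(1) by (simp add: sorted_wrt_append)
    ultimately have "sorted_wrt (<) (map fst (butlast pts) @ [fst (last pts)])" by (metis list.simps(8,9) map_append)
    moreover have "x \<in> set (butlast pts) \<or> x = last pts" using x ne by (metis append_butlast_last_id rotate1.simps(2) set_ConsD set_rotate1)
    ultimately show ?thesis using ne by (auto simp: s_def sorted_wrt_append less_imp_le)
  qed
  define A where "A = {\<omega>\<in>cadlag_paths E. \<forall>p\<in>set pts. ?tr \<omega> (fst p) = snd p}"
  define B where "B = {\<omega>\<in>cadlag_paths E. ?tr \<omega> t = b}"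
  have "{\<omega>\<in>space (path_space E). \<forall>p\<in>set pts. ?tr \<omega> (fst p) = snd p} \<in> sets (path_space E)"
    by (intro sets.sets_Collect_finite_All) (auto simp: measurable_trace_path[OF fin])
  then have A: "A \<in> sets (path_space E)" by (simp add: A_def)
  have B: "B \<in> sets (path_space E)" unfolding B_def by (rule measurable_trace_path[OF fin])
  have good: "AE \<omega> in P. (\<forall>u\<ge>0. ?tr \<omega> u \<in> ?G) \<and> ?tr \<omega> 0 = a0"
    using rec AE_start AE_space
  proof eventually_elim
    case (elim \<omega>)
    then have w: "\<omega> \<in> cadlag_paths E" by (simp add: space_P)
    have unb: "\<exists>v\<ge>0. occ_time ?G \<omega> v > u" for u
    proof -
      obtain k :: nat where "occ_time ?G \<omega> (real k) > real (nat \<lceil>u\<rceil>)" using elim(1) by blast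
      then show ?thesis by (intro exI[of _ "real k"]) linarith
    qed
    have tc: "?tr \<omega> \<in> cadlag_paths ?G" by (rule trace_path_cadlag[OF fin w unb])
    obtain v where v: "occ_time ?G \<omega> v > 0" "0 \<le> v" using unb by blast
    \<comment> \<open>The process starts in \<open>G\<close> and stays at its starting point for a
      positive time, so the clock runs from the outset and the trace has the correct initial
      state.\<close>
    have "inv_time ?G \<omega> 0 = 0"
    proof (rule ccontr)
      assume "inv_time ?G \<omega> 0 \<noteq> 0"
      then have pos: "inv_time ?G \<omega> 0 > 0" using inv_time_nonneg[OF fin w order_refl v] by simp
      obtain \<delta> where d: "\<delta> > 0" "\<And>s. 0 \<le> s \<Longrightarrow> s < 0 + \<delta> \<Longrightarrow> \<omega> s = \<omega> 0" by (rule cadlag_right[OF w, of 0]) (rule that)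
      define r where "r = min (\<delta> / 2) (inv_time ?G \<omega> 0)"
      have r: "0 < r" "r < \<delta>" "r \<le> inv_time ?G \<omega> 0" using d pos by (auto simp: r_def)
      have "{x\<in>{0..r}. \<omega> x \<in> ?G} = {0..r}"
      proof -
        have "\<omega> x \<in> ?G" if "x \<in> {0..r}" for x using d(2)[of x] that r elim(2) g(2) by simp
        then show ?thesis by blast
      qed
      then have "occ_time ?G \<omega> r = r" using r by (simp add: occ_time_def)
      moreover have "occ_time ?G \<omega> r \<le> 0" using inv_time_iff[OF fin w order_refl v, of r] r by simp
      ultimately show False using r by simp
    qed
    then have "?tr \<omega> 0 = a0" using elim(2) by (simp add: trace_path_def)
    then show ?case using cadlag_in[OF tc] by blast
  qed
  have AEb: "AE \<omega> in P. \<omega> \<in> A \<longrightarrow> ?tr \<omega> s = b'"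
    using good by eventually_elim (use last in \<open>auto simp: A_def s_def b'_def\<close>)
  have Am: "A \<in> events" and Bm: "B \<in> events" using A B by (auto simp: sets_P)
  have trm: "(\<lambda>\<omega>. F (?tr \<omega> u)) \<in> borel_measurable P" for u
    unfolding measurable_P by (rule borel_measurable_trace_path_fun[OF fin])
  have "expectation (\<lambda>\<omega>. indicator A \<omega> * (exp (\<beta> * t) * F (?tr \<omega> t))) = expectation (\<lambda>\<omega>. indicator A \<omega> * (exp (\<beta> * s) * F (?tr \<omega> s)))"
  proof (rule trace_martingale[OF rec harm b0 s0 st, where K=1])
    show "indicator A \<in> borel_measurable (path_space E)" using A by simp
    fix \<omega> v assume w: "\<omega> \<in> cadlag_paths E" "0 \<le> v" "s < occ_time ?G \<omega> v"
    have "?tr (stop v \<omega>) (fst x) = ?tr \<omega> (fst x)" if "x \<in> set pts" for x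
      using ps[OF that] snoc.prems(2)[of x] that by (intro trace_path_stop[OF fin w]) auto
    then have "stop v \<omega> \<in> A \<longleftrightarrow> \<omega> \<in> A" unfolding A_def using w stop_cadlag[of \<omega> E v] by auto
    then show "indicator A (stop v \<omega>) = (indicator A \<omega> :: real)" by (simp add: indicator_def)
  qed (auto simp: indicator_def)
  also have "\<dots> = expectation (\<lambda>\<omega>. exp (\<beta> * s) * F b' * indicator A \<omega>)"
    by (rule integral_cong_AE) (use AEb Am trm in \<open>auto simp: indicator_def elim!: eventually_mono\<close>)
  also have "\<dots> = exp (\<beta> * s) * F b' * prob A" using Am by simp
  finally have E1: "expectation (\<lambda>\<omega>. indicator A \<omega> * (exp (\<beta> * t) * F (?tr \<omega> t))) = exp (\<beta> * s) * F b' * prob A" .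
  have "(\<lambda>\<omega>. indicator A \<omega> * (exp (\<beta> * t) * F (?tr \<omega> t))) = (\<lambda>\<omega>. exp (\<beta> * t) * (indicator A \<omega> * F (?tr \<omega> t)))"
    by (simp add: fun_eq_iff)
  then have "exp (\<beta> * t) * expectation (\<lambda>\<omega>. indicator A \<omega> * F (?tr \<omega> t)) = exp (\<beta> * s) * F b' * prob A"
    using E1 by simp
  then have "expectation (\<lambda>\<omega>. indicator A \<omega> * F (?tr \<omega> t)) = exp (\<beta> * s) / exp (\<beta> * t) * F b' * prob A"
    by (simp add: eq_divide_eq mult.commute)
  also have "exp (\<beta> * s) / exp (\<beta> * t) = exp (- \<beta> * (t - s))"
    by (simp add: exp_diff[symmetric] algebra_simps)
  finally have E2: "expectation (\<lambda>\<omega>. indicator A \<omega> * F (?tr \<omega> t)) = exp (- \<beta> * (t - s)) * F b' * prob A" .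
  have "prob (A \<inter> B) = expectation (\<lambda>\<omega>. indicator (A \<inter> B) \<omega>)" using Am Bm by simp
  also have "\<dots> = expectation (\<lambda>\<omega>. (indicator A \<omega> + F b * (indicator A \<omega> * F (?tr \<omega> t))) / 2)"
  proof (rule integral_cong_AE)
    show "AE \<omega> in P. indicator (A \<inter> B) \<omega> = (indicator A \<omega> + F b * (indicator A \<omega> * F (?tr \<omega> t))) / 2"
      using good
    proof eventually_elim
      case (elim \<omega>)
      then have "?tr \<omega> t \<in> ?G" using tb by blast
      then show ?case using F tb(2) g(1) by (auto simp: indicator_def A_def B_def)
    qed
  qed (use Am Bm trm in measurable)
  also have "\<dots> = (prob A + F b * expectation (\<lambda>\<omega>. indicator A \<omega> * F (?tr \<omega> t))) / 2"
  proof -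
    have "integrable P (\<lambda>\<omega>. indicator A \<omega> * F (?tr \<omega> t))"
    proof (rule integrable_const_bound[of _ 1])
      show "AE \<omega> in P. norm (indicator A \<omega> * F (?tr \<omega> t)) \<le> 1"
        using good
      proof eventually_elim
        case (elim \<omega>)
        then have "?tr \<omega> t \<in> ?G" using tb by blast
        then show ?case using F by (auto simp: indicator_def)
      qed
    qed (use Am trm in measurable)
    moreover have "integrable P (indicator A :: _ \<Rightarrow> real)" by (rule integrable_real_indicator[OF Am]) (simp add: emeasure_eq_measure)
    ultimately show ?thesis using Am by simp
  qed
  also have "\<dots> = prob A * ((1 + F b * F b' * exp (- \<beta> * (t - s))) / 2)" unfolding E2 by (simp add: algebra_simps)
  finally have pAB: "prob (A \<inter> B) = prob A * ((1 + F b * F b' * exp (- \<beta> * (t - s))) / 2)" .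
  have io: "\<iota> b' \<in> {1, 2}" "\<iota> b \<in> {1, 2}" using b' tb(2) i by auto
  have f1: "trans_prob {1, 2} (\<lambda>_ _. \<beta> / 2) (t - s) (\<iota> b') (\<iota> b) = (1 + F b * F b' * exp (- \<beta> * (t - s))) / 2"
    unfolding trans_prob_two_state[OF io] using b' tb(2) F i g(1) by auto
  have f2: "fdd {1, 2} (\<lambda>_ _. \<beta> / 2) 0 (\<iota> a0) (map (\<lambda>p. (fst p, \<iota> (snd p))) (pts @ [p])) =
    fdd {1, 2} (\<lambda>_ _. \<beta> / 2) 0 (\<iota> a0) (map (\<lambda>p. (fst p, \<iota> (snd p))) pts) * trans_prob {1, 2} (\<lambda>_ _. \<beta> / 2) (t - s) (\<iota> b') (\<iota> b)"
    unfolding map_append list.map p fst_conv snd_conv fdd_append by (auto simp: s_def b'_def last_map)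
  have f3: "prob A = fdd {1, 2} (\<lambda>_ _. \<beta> / 2) 0 (\<iota> a0) (map (\<lambda>p. (fst p, \<iota> (snd p))) pts)"
    unfolding A_def by (rule snoc.IH) (use snoc.prems in \<open>auto simp: sorted_wrt_append\<close>)
  have f4: "{\<omega>\<in>cadlag_paths E. \<forall>p\<in>set (pts @ [p]). ?tr \<omega> (fst p) = snd p} = A \<inter> B"
    by (auto simp: A_def B_def p)
  show ?case unfolding f4 f2 f1 f3[symmetric] by (rule pAB)
qed

end

lemma spl_index_xi: "N \<ge> 1 \<Longrightarrow> spl_index N (xi N X1) = 1" "N \<ge> 1 \<Longrightarrow> spl_index N (xi N X2) = 2"
  "N \<ge> 1 \<Longrightarrow> xi N X1 \<noteq> xi N X2"
proof -
  show ne: "xi N X1 \<noteq> xi N X2" if "N \<ge> 1"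
  proof
    assume "xi N X1 = xi N X2"
    then have "xi N X1 X1 = xi N X2 X1" by simp
    then show False using that by (simp add: xi_def)
  qed
  show "N \<ge> 1 \<Longrightarrow> spl_index N (xi N X1) = 1" "N \<ge> 1 \<Longrightarrow> spl_index N (xi N X2) = 2"
    using ne by (auto simp: spl_index_def)
qed

text \<open>The index map is injective on the two full configurations and sends every other one to
  0. An index path with values in {1, 2} can therefore be translated back.\<close>

lemma spl_rescaled_cadlag_iff:
  assumes N: "N \<ge> 1" and th: "\<theta> > 0"
  shows "spl_rescaled N \<theta> \<omega> \<in> cadlag_paths {1, 2} \<longleftrightarrow> trace_path {xi N X1, xi N X2} \<omega> \<in> cadlag_paths {xi N X1, xi N X2}"
proof
  let ?y = "trace_path {xi N X1, xi N X2} \<omega>"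
  assume L: "spl_rescaled N \<theta> \<omega> \<in> cadlag_paths {1, 2}"
  define f where "f i = (if i = (1::nat) then xi N X1 else xi N X2)" for i
  have "(\<lambda>t. f (spl_rescaled N \<theta> \<omega> (1 / \<theta> * t))) \<in> cadlag_paths {xi N X1, xi N X2}"
    by (rule cadlag_scale_map[OF L]) (use th in \<open>auto simp: f_def\<close>)
  moreover have "f (spl_rescaled N \<theta> \<omega> (1 / \<theta> * t)) = ?y t" for t
  proof -
    have "spl_rescaled N \<theta> \<omega> (1 / \<theta> * t) = spl_index N (?y t)" using th by (simp add: spl_rescaled_def)
    moreover have "spl_rescaled N \<theta> \<omega> (1 / \<theta> * t) \<in> {1, 2}" by (rule cadlag_in[OF L])
    ultimately show ?thesis by (auto simp: f_def spl_index_def split: if_splits)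
  qed
  ultimately show "?y \<in> cadlag_paths {xi N X1, xi N X2}" by simp
next
  assume "trace_path {xi N X1, xi N X2} \<omega> \<in> cadlag_paths {xi N X1, xi N X2}"
  from cadlag_scale_map[OF this th, of "spl_index N" "{1, 2}"]
  show "spl_rescaled N \<theta> \<omega> \<in> cadlag_paths {1, 2}"
    unfolding spl_rescaled_def using spl_index_xi[OF N] by auto
qed

text \<open>Recurrence makes the trace cadlag almost surely, so the default path in
  \<open>spl_map\<close> is taken on a null set only. The rate \<beta>/2 per unit of occupation time
  is multiplied by \<theta> through the rescaling.\<close>

lemma spl_map_law:
  fixes F :: "(site \<Rightarrow> nat) \<Rightarrow> real"
  assumes "ctmc E q (xi N (xpt i0)) P" and N: "N \<ge> 1" and i0: "i0 \<in> {1, 2}" and th: "\<theta> > 0"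
    and rec: "AE \<omega> in P. \<forall>n::nat. \<exists>k::nat. occ_time {xi N X1, xi N X2} \<omega> (real k) > real n"
    and harm: "\<And>a. a \<in> E \<Longrightarrow> (\<Sum>b\<in>E. gen_matrix E q a b * F b) + (\<beta> * indicator {xi N X1, xi N X2} a) * F a = 0" and b0: "\<beta> \<ge> 0"
    and F: "F (xi N X1) = 1" "F (xi N X2) = -1"
  shows "is_ctmc_law {1, 2} (\<lambda>_ _. \<beta> / 2 * \<theta>) i0 (distr P (path_space {1, 2}) (spl_map N \<theta>))"
proof -
  interpret ctmc E q "xi N (xpt i0)" P by fact
  let ?G = "{xi N X1, xi N X2}"
  let ?tr = "trace_path ?G"
  define C where "C = {\<omega>\<in>cadlag_paths E. ?tr \<omega> \<in> cadlag_paths ?G}"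
  have C: "C \<in> sets (path_space E)" unfolding C_def by (rule trace_path_cadlag_set[OF fin]) simp
  have Y: "{\<omega>\<in>cadlag_paths E. spl_index N (?tr \<omega> t) = a} \<in> sets (path_space E)" for t a
  proof -
    have "(\<lambda>\<omega>. real (spl_index N (?tr \<omega> t))) \<in> borel_measurable (path_space E)"
      by (rule borel_measurable_trace_path_fun[OF fin])
    then have "{\<omega>\<in>space (path_space E). real (spl_index N (?tr \<omega> t)) = real a} \<in> sets (path_space E)" by measurable
    then show ?thesis by simp
  qed
  have cm: "(\<lambda>_. 1) \<in> cadlag_paths {1, 2::nat}" by (auto simp: cadlag_paths_def intro!: exI[of _ 1])
  have mapC: "spl_map N \<theta> \<omega> = (if \<omega> \<in> C then (\<lambda>t. spl_index N (?tr \<omega> (\<theta> * t))) else (\<lambda>_. 1))" if "\<omega> \<in> cadlag_paths E" for \<omega>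
    unfolding spl_map_def spl_rescaled_cadlag_iff[OF N th] using that by (auto simp: C_def spl_rescaled_def)
  have m: "spl_map N \<theta> \<in> measurable P (path_space {1, 2})"
    unfolding measurable_P
  proof (rule measurable_into_path_space)
    fix \<omega> show "spl_map N \<theta> \<omega> \<in> cadlag_paths {1, 2}" using cm by (auto simp: spl_map_def)
  next
    fix t a
    have "{\<omega> \<in> space (path_space E). spl_map N \<theta> \<omega> t = a} = ({\<omega>\<in>cadlag_paths E. spl_index N (?tr \<omega> (\<theta> * t)) = a} \<inter> C) \<union> (if a = 1 then space (path_space E) - C else {})"
      by (auto simp: mapC C_def split: if_splits)
    also have "\<dots> \<in> sets (path_space E)"
      using sets.Int[OF Y C] sets.compl_sets[OF C] by (cases "a = 1") (simp_all del: space_path_space)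
    finally show "{\<omega> \<in> space (path_space E). spl_map N \<theta> \<omega> t = a} \<in> sets (path_space E)" .
  qed
  have AEC: "AE \<omega> in P. \<omega> \<in> C"
    using rec AE_space
  proof eventually_elim
    case (elim \<omega>)
    then have w: "\<omega> \<in> cadlag_paths E" by (simp add: space_P)
    have "\<exists>v\<ge>0. occ_time ?G \<omega> v > u" for u
    proof -
      obtain k :: nat where "occ_time ?G \<omega> (real k) > real (nat \<lceil>u\<rceil>)" using elim(1) by blast
      then show ?thesis by (intro exI[of _ "real k"]) linarith
    qed
    then show ?case using trace_path_cadlag[OF fin w] w by (simp add: C_def)
  qed
  note io = spl_index_xi[OF N]
  define f where "f i = (if i = (1::nat) then xi N X1 else xi N X2)" for i
  have fi: "spl_index N (f i) = i" if "i \<in> {1, 2}" for i using that io by (auto simp: f_def)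
  have fG: "f i \<in> ?G" for i by (simp add: f_def)
  have start: "xi N (xpt i0) = f i0" using i0 by (auto simp: f_def xpt_def)
  show ?thesis unfolding is_ctmc_law_def
  proof (intro conjI allI impI)
    show "prob_space (distr P (path_space {1, 2}) (spl_map N \<theta>))" by (rule prob_space_distr[OF m])
    fix pts :: "(real \<times> nat) list"
    assume pts: "sorted_wrt (<) (map fst pts) \<and> (\<forall>p\<in>set pts. 0 \<le> fst p \<and> snd p \<in> {1, 2})"
    let ?A = "{\<omega> \<in> cadlag_paths {1, 2}. \<forall>p\<in>set pts. \<omega> (fst p) = snd p}"
    let ?pts = "map (\<lambda>p. (\<theta> * fst p, f (snd p))) pts"
    let ?B = "{\<omega>\<in>cadlag_paths E. \<forall>p\<in>set ?pts. ?tr \<omega> (fst p) = snd p}"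
    have "?A = {\<omega> \<in> space (path_space {1, 2}). \<forall>p\<in>set pts. \<omega> (fst p) = snd p}" by simp
    also have "\<dots> \<in> sets (path_space {1, 2})"
      by (intro sets.sets_Collect_finite_All) (auto simp: coord_set)
    finally have A: "?A \<in> sets (path_space {1, 2})" .
    have "{\<omega>\<in>space (path_space E). \<forall>p\<in>set ?pts. ?tr \<omega> (fst p) = snd p} \<in> sets (path_space E)"
      by (intro sets.sets_Collect_finite_All) (auto simp: measurable_trace_path[OF fin])
    then have B: "?B \<in> events" by (simp add: sets_P)
    have "measure (distr P (path_space {1, 2}) (spl_map N \<theta>)) ?A = prob (spl_map N \<theta> -` ?A \<inter> space P)"
      by (rule measure_distr[OF m A])
    also have "\<dots> = prob ?B"
    proof (rule finite_measure_eq_AE)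
      show "AE \<omega> in P. \<omega> \<in> spl_map N \<theta> -` ?A \<inter> space P \<longleftrightarrow> \<omega> \<in> ?B"
        using AEC AE_space
      proof eventually_elim
        case (elim \<omega>)
        then have w: "\<omega> \<in> cadlag_paths E" by (simp add: space_P)
        have trG: "?tr \<omega> u \<in> ?G" for u using elim(1) cadlag_in unfolding C_def by blast
        have s: "spl_map N \<theta> \<omega> = (\<lambda>t. spl_index N (?tr \<omega> (\<theta> * t)))" using mapC[OF w] elim by simp
        have "spl_map N \<theta> \<omega> \<in> cadlag_paths {1, 2}" using cm by (auto simp: spl_map_def)
        then have "\<omega> \<in> spl_map N \<theta> -` ?A \<inter> space P \<longleftrightarrow> (\<forall>p\<in>set pts. spl_index N (?tr \<omega> (\<theta> * fst p)) = snd p)"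
          using elim(2) by (simp add: s)
        also have "\<dots> \<longleftrightarrow> (\<forall>p\<in>set pts. ?tr \<omega> (\<theta> * fst p) = f (snd p))"
        proof (intro ball_cong refl)
          fix p assume "p \<in> set pts"
          then have "snd p \<in> {1, 2}" using pts by blast
          then show "spl_index N (?tr \<omega> (\<theta> * fst p)) = snd p \<longleftrightarrow> ?tr \<omega> (\<theta> * fst p) = f (snd p)"
            using trG[of "\<theta> * fst p"] io by (auto simp: f_def)
        qed
        finally show ?case using w by simp
      qed
    qed (use measurable_sets[OF m A] B in auto)
    also have "\<dots> = fdd {1, 2} (\<lambda>_ _. \<beta> / 2) 0 (spl_index N (xi N (xpt i0))) (map (\<lambda>p. (fst p, spl_index N (snd p))) ?pts)"
    proof (rule trace_law[OF io(3) _ rec harm b0 F io(1,2)])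
      show "xi N (xpt i0) \<in> ?G" unfolding start by (rule fG)
      show "sorted_wrt (<) (map fst ?pts)" using map_scale_sorted[OF th, of pts "\<lambda>p. f (snd p)"] pts by blast
      fix p assume "p \<in> set ?pts"
      then obtain q where q: "q \<in> set pts" "p = (\<theta> * fst q, f (snd q))" by auto
      have "0 \<le> fst q" using pts q(1) by blast
      then have "0 \<le> \<theta> * fst q" using th by simp
      then show "0 \<le> fst p \<and> snd p \<in> ?G" unfolding q(2) using fG by simp
    qed
    also have "spl_index N (xi N (xpt i0)) = i0" using fi[OF i0] start by simp
    also have "map (\<lambda>p. (fst p, spl_index N (snd p))) ?pts = map (\<lambda>p. (\<theta> * fst p, snd p)) pts"
      using pts fi by auto
    also have "fdd {1, 2} (\<lambda>_ _. \<beta> / 2) 0 i0 (map (\<lambda>p. (\<theta> * fst p, snd p)) pts) = fdd {1, 2} (\<lambda>_ _. \<beta> / 2 * \<theta>) 0 i0 pts"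
      using fdd_two_state_scale[of pts i0 "\<beta> / 2" \<theta> 0] pts i0 by simp
    finally show "measure (distr P (path_space {1, 2}) (spl_map N \<theta>)) ?A = fdd {1, 2} (\<lambda>_ _. \<beta> / 2 * \<theta>) 0 i0 pts" .
  qed simp
qed

section \<open>Dirichlet form of the inclusion process\<close>

lemma gen_matrix_apply:
  assumes "finite E" "a \<in> E"
  shows "(\<Sum>b\<in>E. gen_matrix E q a b * h b) = (\<Sum>b\<in>E. q a b * (h b - h a))"
proof -
  have "(\<Sum>b\<in>E. gen_matrix E q a b * h b) = gen_matrix E q a a * h a + (\<Sum>b\<in>E - {a}. gen_matrix E q a b * h b)"
    using assms by (simp add: sum.remove)
  also have "(\<Sum>b\<in>E - {a}. gen_matrix E q a b * h b) = (\<Sum>b\<in>E - {a}. q a b * h b)"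
    by (intro sum.cong) (auto simp: gen_matrix_def)
  also have "gen_matrix E q a a * h a = - (\<Sum>b\<in>E - {a}. q a b * h a)"
    by (simp add: gen_matrix_def sum_distrib_right)
  finally have "(\<Sum>b\<in>E. gen_matrix E q a b * h b) = (\<Sum>b\<in>E - {a}. q a b * (h b - h a))"
    by (simp add: right_diff_distrib sum_subtractf)
  also have "\<dots> = (\<Sum>b\<in>E. q a b * (h b - h a))" using assms by (simp add: sum.remove[of E a])
  finally show ?thesis .
qed

text \<open>With \<open>V\<close> equal to 2 minus a power e to the rank, one jump that lowers the
  rank gains at least q1 times e to the power rank - 1, while all other jumps together lose at most
  Q times e to the rank. For small e the gain wins at every state outside \<open>G\<close>.\<close>

lemma lyapunov_exists:
  fixes \<rho> :: "'b \<Rightarrow> nat" and q :: "'b \<Rightarrow> 'b \<Rightarrow> real"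
  assumes fin: "finite E" and q0: "\<And>a b. a \<in> E \<Longrightarrow> b \<in> E \<Longrightarrow> 0 \<le> q a b"
    and dec: "\<And>a. a \<in> E \<Longrightarrow> a \<notin> G \<Longrightarrow> \<exists>b\<in>E. q a b > 0 \<and> \<rho> b < \<rho> a"
  obtains V \<delta> where "\<And>a. a \<in> E \<Longrightarrow> V a > (0::real)" "\<delta> > 0"
    "\<And>a. a \<in> E \<Longrightarrow> a \<notin> G \<Longrightarrow> (\<Sum>b\<in>E. gen_matrix E q a b * V b) \<le> - \<delta> * V a"
proof -
  define Q where "Q = (\<Sum>a\<in>E. \<Sum>b\<in>E. q a b) + 1"
  define S where "S = insert 1 {q a b | a b. a \<in> E \<and> b \<in> E \<and> q a b > 0}"
  have "S \<subseteq> insert 1 ((\<lambda>(a,b). q a b) ` (E \<times> E))" by (auto simp: S_def)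
  then have finS: "finite S" by (rule finite_subset) (simp add: fin)
  define q1 where "q1 = Min S"
  have q1S: "q1 \<in> S" unfolding q1_def by (rule Min_in[OF finS]) (simp add: S_def)
  then have q1: "q1 > 0" by (auto simp: S_def)
  have q1l: "q1 \<le> q a b" if "a \<in> E" "b \<in> E" "q a b > 0" for a b
    unfolding q1_def by (rule Min_le[OF finS]) (use that in \<open>auto simp: S_def\<close>)
  have Q: "Q > 0" unfolding Q_def using q0 by (simp add: add_nonneg_pos sum_nonneg)
  have QS: "(\<Sum>b\<in>E. q a b) \<le> Q" if "a \<in> E" for a
  proof -
    have "(\<Sum>b\<in>E. q a b) \<le> (\<Sum>a\<in>E. \<Sum>b\<in>E. q a b)"
      using that fin q0 by (intro member_le_sum[of a E "\<lambda>a. \<Sum>b\<in>E. q a b"]) (auto intro: sum_nonneg)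
    then show ?thesis by (simp add: Q_def)
  qed
  \<comment> \<open>Here q1 bounds the positive rates from below and Q the total exit rates from
    above, so the gain is at least twice the loss; 1/2 keeps e below 1.\<close>
  define e where "e = min (1/2) (q1 / (2 * Q))"
  have e: "0 < e" "e < 1" "e \<le> q1 / (2 * Q)" using q1 Q by (auto simp: e_def)
  define V where "V a = 2 - e ^ \<rho> a" for a
  have eb: "0 < e ^ n" "e ^ n \<le> 1" for n using e by (auto simp: power_le_one)
  have V: "V a \<ge> 1" "V a \<le> 2" for a using eb[of "\<rho> a"] by (auto simp: V_def)
  define \<rho>M where "\<rho>M = Max (insert 0 (\<rho> ` E))"
  have \<rho>M: "\<rho> a \<le> \<rho>M" if "a \<in> E" for a unfolding \<rho>M_def using that fin by (intro Max_ge) auto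
  define \<delta> where "\<delta> = Q * e ^ \<rho>M / 2"
  have \<delta>: "\<delta> > 0" using Q eb by (simp add: \<delta>_def)
  have "(\<Sum>b\<in>E. gen_matrix E q a b * V b) \<le> - \<delta> * V a" if a: "a \<in> E" "a \<notin> G" for a
  proof -
    obtain b where b: "b \<in> E" "q a b > 0" "\<rho> b < \<rho> a" using dec[OF a] by blast
    have "q1 * e ^ (\<rho> a - 1) - Q * e ^ \<rho> a \<le> (\<Sum>c\<in>E. q a c * e ^ \<rho> c) - (\<Sum>c\<in>E. q a c) * e ^ \<rho> a"
    proof -
      have "q1 * e ^ (\<rho> a - 1) \<le> q a b * e ^ \<rho> b"
        using q1l[OF a(1) b(1,2)] b e by (intro mult_mono power_decreasing) auto
      also have "\<dots> \<le> (\<Sum>c\<in>E. q a c * e ^ \<rho> c)"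
        using fin b q0[OF a(1)] eb by (intro member_le_sum[of b E "\<lambda>c. q a c * e ^ \<rho> c"]) (auto intro!: mult_nonneg_nonneg simp: less_imp_le[OF eb(1)])
      finally have 1: "q1 * e ^ (\<rho> a - 1) \<le> (\<Sum>c\<in>E. q a c * e ^ \<rho> c)" .
      have 2: "(\<Sum>c\<in>E. q a c) * e ^ \<rho> a \<le> Q * e ^ \<rho> a" using QS[OF a(1)] eb[of "\<rho> a"] by (intro mult_right_mono) auto
      show ?thesis using 1 2 by linarith
    qed
    moreover have "(\<Sum>b\<in>E. gen_matrix E q a b * V b) = - ((\<Sum>c\<in>E. q a c * e ^ \<rho> c) - (\<Sum>c\<in>E. q a c) * e ^ \<rho> a)"
      unfolding gen_matrix_apply[OF fin a(1)] V_def by (simp add: right_diff_distrib sum_subtractf sum_distrib_right)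
    moreover have "2 * Q * e ^ \<rho> a \<le> q1 * e ^ (\<rho> a - 1)"
    proof -
      have "e ^ \<rho> a = e * e ^ (\<rho> a - 1)" using b(3) by (cases "\<rho> a") auto
      moreover have "2 * Q * e \<le> q1" using e(3) Q by (simp add: pos_le_divide_eq mult.commute)
      then have "2 * Q * e * e ^ (\<rho> a - 1) \<le> q1 * e ^ (\<rho> a - 1)" using eb[of "\<rho> a - 1"] by (intro mult_right_mono) auto
      ultimately show ?thesis by (simp add: mult.assoc)
    qed
    moreover have "Q * e ^ \<rho>M \<le> Q * e ^ \<rho> a" using Q e \<rho>M[OF a(1)] by (intro mult_left_mono power_decreasing) auto
    moreover have "\<delta> * V a \<le> Q * e ^ \<rho>M" using mult_left_mono[OF V(2)[of a], of \<delta>] \<delta> by (simp add: \<delta>_def)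
    ultimately show ?thesis by linarith
  qed
  moreover have "V a > 0" for a using V(1)[of a] by linarith
  ultimately show ?thesis using \<delta> that by blast
qed

text \<open>The potential is the increasing limit of averaging steps that start from the indicator
  of a; the averaging operator is monotone and continuous, so the limit is a fixed point.\<close>

lemma harmonic_exists:
  fixes q :: "'b \<Rightarrow> 'b \<Rightarrow> real"
  assumes fin: "finite E" and q0: "\<And>a b. a \<in> E \<Longrightarrow> b \<in> E \<Longrightarrow> 0 \<le> q a b" and a: "a \<in> B"
  obtains h where "h a = (1::real)" "\<And>b. b \<in> B \<Longrightarrow> b \<noteq> a \<Longrightarrow> h b = 0" "\<And>b. 0 \<le> h b" "\<And>b. h b \<le> 1"
    "\<And>b. b \<in> E \<Longrightarrow> b \<notin> B \<Longrightarrow> (\<Sum>c\<in>E. q b c * (h c - h b)) = 0"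
proof -
  define A where "A f b = (if b \<in> B then (if b = a then 1 else 0) else if b \<in> E then (\<Sum>c\<in>E. q b c * f c) / (\<Sum>c\<in>E. q b c) else (0::real))" for f b
  define f where "f n = (A ^^ n) (\<lambda>b. if b = a then 1 else 0)" for n
  have f0: "f 0 = (\<lambda>b. if b = a then 1 else 0)" by (simp add: f_def)
  have fS: "f (Suc n) = A (f n)" for n by (simp add: f_def)
  have mono: "A g b \<le> A g' b" if "\<And>c. g c \<le> g' c" for g g' b
    unfolding A_def using q0 that by (auto intro!: divide_right_mono sum_mono mult_left_mono sum_nonneg)
  have fb: "0 \<le> f n b \<and> f n b \<le> 1" for n b
  proof (induction n arbitrary: b)
    case (Suc n)
    have "0 \<le> A (f n) b" unfolding A_def using q0 Suc by (auto intro!: divide_nonneg_nonneg sum_nonneg mult_nonneg_nonneg)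
    moreover have "A (f n) b \<le> 1"
    proof (cases "b \<in> E \<and> b \<notin> B")
      case True
      have le: "(\<Sum>c\<in>E. q b c * f n c) \<le> (\<Sum>c\<in>E. q b c)"
      proof (rule sum_mono)
        fix c assume "c \<in> E"
        then show "q b c * f n c \<le> q b c" using q0[of b c] Suc[of c] True by (intro mult_left_le) auto
      qed
      have "0 \<le> (\<Sum>c\<in>E. q b c)" using q0 True by (intro sum_nonneg) auto
      moreover have "A (f n) b = (\<Sum>c\<in>E. q b c * f n c) / (\<Sum>c\<in>E. q b c)" using True by (simp add: A_def)
      ultimately show ?thesis using le by (cases "(\<Sum>c\<in>E. q b c) = 0") (auto simp: divide_le_eq_1_pos)
    qed (auto simp: A_def)
    ultimately show ?case by (simp add: fS)
  qed (simp add: f0)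
  have inc: "f n b \<le> f (Suc n) b" for n b
  proof (induction n arbitrary: b)
    case 0
    show ?case using fb[of "Suc 0" b] a by (cases "b = a") (auto simp: f0 fS A_def)
  next
    case (Suc n)
    show ?case unfolding fS[of "Suc n"] fS[of n] by (rule mono) (use Suc fS in auto)
  qed
  have "\<exists>l. (\<lambda>n. f n b) \<longlonglongrightarrow> l" for b
    using incseq_convergent[of "\<lambda>n. f n b" 1] inc fb by (metis incseq_SucI)
  then obtain h where h: "\<And>b. (\<lambda>n. f n b) \<longlonglongrightarrow> h b" by metis
  have hA: "h b = A h b" for b
  proof -
    have "(\<lambda>n. A (f n) b) \<longlonglongrightarrow> A h b"
    proof (cases "b \<in> E \<and> b \<notin> B")
      case True
      show ?thesis
      proof (cases "(\<Sum>c\<in>E. q b c) = 0")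
        case False
        then show ?thesis unfolding A_def using True by (auto intro!: tendsto_intros h)
      qed (use True in \<open>simp add: A_def\<close>)
    qed (auto simp: A_def)
    then have "(\<lambda>n. f (Suc n) b) \<longlonglongrightarrow> A h b" by (simp add: fS)
    then show ?thesis using LIMSEQ_unique LIMSEQ_Suc[OF h] by blast
  qed
  show ?thesis
  proof (rule that[of h])
    show "h a = 1" using a by (subst hA) (simp add: A_def)
    show "h b = 0" if "b \<in> B" "b \<noteq> a" for b using that by (subst hA) (simp add: A_def)
    show "0 \<le> h b" for b by (rule LIMSEQ_le_const[OF h]) (use fb in auto)
    show "h b \<le> 1" for b by (rule LIMSEQ_le_const2[OF h]) (use fb in auto)
    fix b assume b: "b \<in> E" "b \<notin> B"
    show "(\<Sum>c\<in>E. q b c * (h c - h b)) = 0"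
    \<comment> \<open>For an absorbing state the average is 0 by division by zero and carries no
      information, but the equation then holds because all rates vanish.\<close>
    proof (cases "(\<Sum>c\<in>E. q b c) = 0")
      case True
      then have "q b c = 0" if "c \<in> E" for c using sum_nonneg_eq_0_iff[of E "q b"] fin q0 b that by auto
      then show ?thesis by simp
    next
      case False
      have "h b * (\<Sum>c\<in>E. q b c) = (\<Sum>c\<in>E. q b c * h c)" using hA[of b] b False by (simp add: A_def)
      then show ?thesis by (simp add: right_diff_distrib sum_subtractf sum_distrib_left mult.commute)
    qed
  qed
qed

section \<open>Configurations in coordinates\<close>

definition cf :: "nat \<Rightarrow> nat \<Rightarrow> nat \<Rightarrow> nat \<Rightarrow> site \<Rightarrow> nat" where
  "cf i j k l = (\<lambda>x. case x of X1 \<Rightarrow> i | X2 \<Rightarrow> j | Y1 \<Rightarrow> k | Y2 \<Rightarrow> l)"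

lemma cf_simps [simp]: "cf i j k l X1 = i" "cf i j k l X2 = j" "cf i j k l Y1 = k" "cf i j k l Y2 = l"
  by (simp_all add: cf_def)

lemma cf_eta: "cf (\<eta> X1) (\<eta> X2) (\<eta> Y1) (\<eta> Y2) = \<eta>"
  by (rule ext, rename_tac x, case_tac x) simp_all

lemma sum_site: "(\<Sum>x\<in>UNIV. f x) = f X1 + f X2 + f Y1 + (f Y2 :: 'a::comm_monoid_add)"
  by (simp add: UNIV_site add.assoc)

lemma prod_site: "(\<Prod>x\<in>UNIV. f x) = f X1 * f X2 * f Y1 * (f Y2 :: 'a::comm_monoid_mult)"
  by (simp add: UNIV_site mult.assoc)

definition quad :: "nat \<Rightarrow> (nat \<times> nat \<times> nat \<times> nat) set" where
  "quad M = {(i,j,k,l). i + j + k + l = M}"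

lemma finite_quad: "finite (quad M)"
  by (rule finite_subset[of _ "{..M} \<times> {..M} \<times> {..M} \<times> {..M}"]) (auto simp: quad_def)

lemma config_space_cf: "config_space M = (\<lambda>(i,j,k,l). cf i j k l) ` quad M"
proof (intro equalityI subsetI)
  fix \<eta> assume "\<eta> \<in> config_space M"
  then have "(\<eta> X1, \<eta> X2, \<eta> Y1, \<eta> Y2) \<in> quad M" by (simp add: config_space_def quad_def sum_site)
  then show "\<eta> \<in> (\<lambda>(i,j,k,l). cf i j k l) ` quad M" by (intro image_eqI[where x="(\<eta> X1, \<eta> X2, \<eta> Y1, \<eta> Y2)"]) (auto simp: cf_eta)
qed (auto simp: config_space_def quad_def sum_site)

lemma finite_config_space: "finite (config_space M)"
  unfolding config_space_cf by (intro finite_imageI finite_quad)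

lemma sum_config_space: "(\<Sum>\<zeta>\<in>config_space M. f \<zeta>) = (\<Sum>(i,j,k,l)\<in>quad M. f (cf i j k l))"
proof -
  have "inj_on (\<lambda>(i,j,k,l). cf i j k l) (quad M)"
    by (rule inj_onI) (auto, (metis cf_simps)+)
  then show ?thesis unfolding config_space_cf by (subst sum.reindex) (auto simp: case_prod_beta' comp_def)
qed

definition up :: "site \<Rightarrow> (site \<Rightarrow> nat) \<Rightarrow> site \<Rightarrow> nat" where
  "up x \<zeta> = \<zeta>(x := Suc (\<zeta> x))"

lemma sigma_move_up: "x \<noteq> y \<Longrightarrow> sigma_move x y (up x \<zeta>) = up y \<zeta>"
  by (auto simp: sigma_move_def up_def fun_eq_iff)

lemma up_config_space: "\<zeta> \<in> config_space M \<Longrightarrow> up x \<zeta> \<in> config_space (Suc M)"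
  by (cases x) (auto simp: config_space_def up_def sum_site)

lemma sigma_move_config_space: "\<eta> \<in> config_space N \<Longrightarrow> sigma_move x y \<eta> \<in> config_space N"
  by (cases x; cases y) (auto simp: config_space_def sigma_move_def sum_site)

text \<open>The factor \<open>\<eta> x\<close> removes exactly the configurations that do not arise
  by adding a particle at x, so nothing is lost by summing over the remaining particles.\<close>

lemma sum_config_up:
  "(\<Sum>\<eta>\<in>config_space (Suc M). real (\<eta> x) * \<phi> \<eta>) = (\<Sum>\<zeta>\<in>config_space M. real (Suc (\<zeta> x)) * \<phi> (up x \<zeta>))"
proof -
  have inj: "inj_on (up x) (config_space M)"
  proof (rule inj_onI)
    fix a b assume "up x a = up x b"
    then have "a y = b y" for y unfolding up_def fun_upd_def by (metis nat.inject)
    then show "a = b" by auto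
  qed
  have img: "up x ` config_space M = {\<eta>\<in>config_space (Suc M). \<eta> x \<noteq> 0}"
  proof (intro equalityI subsetI)
    fix \<eta> assume \<eta>: "\<eta> \<in> {\<eta>\<in>config_space (Suc M). \<eta> x \<noteq> 0}"
    then have "\<eta> = up x (\<eta>(x := \<eta> x - 1))" by (auto simp: up_def fun_eq_iff)
    moreover have "\<eta>(x := \<eta> x - 1) \<in> config_space M" using \<eta> by (cases x) (auto simp: config_space_def sum_site)
    ultimately show "\<eta> \<in> up x ` config_space M" by blast
  qed (auto simp: up_config_space, auto simp: up_def)
  have "(\<Sum>\<eta>\<in>config_space (Suc M). real (\<eta> x) * \<phi> \<eta>) = (\<Sum>\<eta>\<in>up x ` config_space M. real (\<eta> x) * \<phi> \<eta>)"
    unfolding img by (rule sum.mono_neutral_right) (auto simp: finite_config_space)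
  also have "\<dots> = (\<Sum>\<zeta>\<in>config_space M. real (up x \<zeta> x) * \<phi> (up x \<zeta>))" by (subst sum.reindex[OF inj]) simp
  finally show ?thesis by (simp add: up_def)
qed

section \<open>Generator, reversible weights and conductances\<close>

definition incl_gen :: "(site \<Rightarrow> site \<Rightarrow> real) \<Rightarrow> real \<Rightarrow> ((site \<Rightarrow> nat) \<Rightarrow> real) \<Rightarrow> (site \<Rightarrow> nat) \<Rightarrow> real" where
  "incl_gen r d h \<eta> = (\<Sum>x\<in>UNIV. \<Sum>y\<in>UNIV. real (\<eta> x) * (d + real (\<eta> y)) * r x y * (h (sigma_move x y \<eta>) - h \<eta>))"

lemma incl_rate_apply:
  assumes "\<eta> \<in> config_space N"
  shows "(\<Sum>\<zeta>\<in>config_space N. incl_rate r d \<eta> \<zeta> * (h \<zeta> - h \<eta>)) = incl_gen r d h \<eta>"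
proof -
  have "(\<Sum>\<zeta>\<in>config_space N. incl_rate r d \<eta> \<zeta> * (h \<zeta> - h \<eta>)) =
    (\<Sum>\<zeta>\<in>config_space N. \<Sum>x\<in>UNIV. \<Sum>y\<in>UNIV. if sigma_move x y \<eta> = \<zeta> then real (\<eta> x) * (d + real (\<eta> y)) * r x y * (h \<zeta> - h \<eta>) else 0)"
    unfolding incl_rate_def sum_distrib_right by (intro sum.cong refl) auto
  also have "\<dots> = (\<Sum>x\<in>UNIV. \<Sum>y\<in>UNIV. \<Sum>\<zeta>\<in>config_space N. if sigma_move x y \<eta> = \<zeta> then real (\<eta> x) * (d + real (\<eta> y)) * r x y * (h \<zeta> - h \<eta>) else 0)"
    by (subst sum.swap, intro sum.cong refl, subst sum.swap) simp
  also have "\<dots> = incl_gen r d h \<eta>"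
    unfolding incl_gen_def using sigma_move_config_space[OF assms] finite_config_space by simp
  finally show ?thesis .
qed

text \<open>The reversible weight of n particles at a site, apart from the geometric factor: the
  coefficients of (1 - z) to the power -d.\<close>

definition wgt :: "real \<Rightarrow> nat \<Rightarrow> real" where "wgt d n = pochhammer d n / fact n"

text \<open>The exact correction in (d + n) times \<open>wgt d n\<close> = d times
  \<open>prd d n\<close>. It lies between 1 and exp(d N) for n up to N, so it disappears in the
  limit when d N tends to 0.\<close>

definition prd :: "real \<Rightarrow> nat \<Rightarrow> real" where "prd d n = (\<Prod>k=1..n. 1 + d / real k)"

lemma wgt_0 [simp]: "wgt d 0 = 1" by (simp add: wgt_def)

lemma wgt_pos: "d > 0 \<Longrightarrow> wgt d n > 0" by (simp add: wgt_def pochhammer_pos)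

lemma wgt_Suc: "real (Suc n) * wgt d (Suc n) = (d + real n) * wgt d n"
proof -
  have "real (Suc n) * wgt d (Suc n) = (real (Suc n) * (pochhammer d n * (d + real n))) / (real (Suc n) * fact n)"
    by (simp add: wgt_def pochhammer_Suc)
  also have "\<dots> = pochhammer d n * (d + real n) / fact n"
    by (rule mult_divide_mult_cancel_left) simp
  finally show ?thesis by (simp add: wgt_def mult.commute)
qed

lemma wgt_prd: "(d + real n) * wgt d n = d * prd d n"
proof (induction n)
  case (Suc n)
  have "(d + real (Suc n)) * wgt d (Suc n) = (1 + d / real (Suc n)) * (real (Suc n) * wgt d (Suc n))" by (simp add: field_simps)
  also have "\<dots> = (1 + d / real (Suc n)) * (d * prd d n)" using wgt_Suc Suc by simp
  finally show ?case by (simp add: prd_def mult.commute mult.left_commute)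
qed (simp add: prd_def)

lemma wgt_Suc_prd: "wgt d (Suc n) = d * prd d n / real (Suc n)"
  using wgt_Suc[of n d] wgt_prd[of d n] by (simp add: field_simps)

lemma prd_ge_1: "d \<ge> 0 \<Longrightarrow> prd d n \<ge> 1"
  unfolding prd_def by (rule prod_ge_1) simp

lemma prd_le: "d \<ge> 0 \<Longrightarrow> n \<le> N \<Longrightarrow> prd d n \<le> exp (d * real N)"
proof -
  assume d: "d \<ge> 0" "n \<le> N"
  have "prd d n \<le> (\<Prod>k=1..n. exp d)" unfolding prd_def
  proof (intro prod_mono conjI)
    fix k assume "k \<in> {1..n}"
    then have k: "1 \<le> real k" by simp
    have "d * 1 \<le> d * real k" using d k by (intro mult_left_mono) auto
    then have "d / real k \<le> d" using k by (simp add: pos_divide_le_eq)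
    then show "1 + d / real k \<le> exp d" using exp_ge_add_one_self[of d] by linarith
    show "0 \<le> 1 + d / real k" using d by simp
  qed
  also have "\<dots> = exp (d * real n)" by (simp add: exp_of_nat_mult[symmetric] mult.commute)
  also have "\<dots> \<le> exp (d * real N)" using d by (simp add: mult_left_mono)
  finally show ?thesis .
qed

definition cwgt :: "(site \<Rightarrow> real) \<Rightarrow> real \<Rightarrow> (site \<Rightarrow> nat) \<Rightarrow> real" where
  "cwgt M d \<eta> = (\<Prod>x\<in>UNIV. M x ^ \<eta> x * wgt d (\<eta> x))"

text \<open>The conductance of an edge, stationary weight times jump rate, rewritten by
  \<open>cwgt_up\<close> in terms of the particles that do not move. In this form detailed balance
  is its symmetry in x and y.\<close>

definition cnd :: "(site \<Rightarrow> site \<Rightarrow> real) \<Rightarrow> (site \<Rightarrow> real) \<Rightarrow> real \<Rightarrow> (site \<Rightarrow> nat) \<Rightarrow> site \<Rightarrow> site \<Rightarrow> real" where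
  "cnd r M d \<zeta> x y = cwgt M d \<zeta> * (d + real (\<zeta> x)) * (d + real (\<zeta> y)) * (M x * r x y)"

text \<open>The sum runs over configurations \<open>\<zeta>\<close> of the remaining \<open>K = N - 1\<close> particles; an edge joins \<open>\<zeta>\<close> with
  a particle added at \<open>x\<close> to \<open>\<zeta>\<close> with a particle added at \<open>y\<close>.\<close>

definition dform :: "(site \<Rightarrow> site \<Rightarrow> real) \<Rightarrow> (site \<Rightarrow> real) \<Rightarrow> real \<Rightarrow> nat \<Rightarrow> ((site \<Rightarrow> nat) \<Rightarrow> real) \<Rightarrow> ((site \<Rightarrow> nat) \<Rightarrow> real) \<Rightarrow> real" where
  "dform r M d K g h = (\<Sum>x\<in>UNIV. \<Sum>y\<in>UNIV. \<Sum>\<zeta>\<in>config_space K.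
      cnd r M d \<zeta> x y * ((g (up x \<zeta>) - g (up y \<zeta>)) * (h (up x \<zeta>) - h (up y \<zeta>)))) / 2"

lemma cwgt_up: "real (Suc (\<zeta> x)) * cwgt M d (up x \<zeta>) = M x * (d + real (\<zeta> x)) * cwgt M d \<zeta>"
proof -
  have "(\<Prod>z\<in>UNIV - {x}. M z ^ up x \<zeta> z * wgt d (up x \<zeta> z)) = (\<Prod>z\<in>UNIV - {x}. M z ^ \<zeta> z * wgt d (\<zeta> z))"
    by (intro prod.cong) (auto simp: up_def)
  then have "real (Suc (\<zeta> x)) * cwgt M d (up x \<zeta>) = (real (Suc (\<zeta> x)) * wgt d (Suc (\<zeta> x))) * M x * (M x ^ \<zeta> x * (\<Prod>z\<in>UNIV - {x}. M z ^ \<zeta> z * wgt d (\<zeta> z)))"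
    unfolding cwgt_def by (simp add: prod.remove[of UNIV x] up_def mult_ac)
  also have "\<dots> = M x * (d + real (\<zeta> x)) * cwgt M d \<zeta>"
    unfolding wgt_Suc cwgt_def by (simp add: prod.remove[of UNIV x] mult_ac)
  finally show ?thesis .
qed

text \<open>The Green formula for a reversible chain. After passing to the remaining particles,
  averaging each term with the one where x and y are exchanged produces the product of differences;
  this is the origin of the factor 1/2 in \<open>dform\<close>.\<close>

lemma sum_by_parts:
  assumes rev: "\<And>x y. M x * r x y = M y * r y x"
  shows "(\<Sum>\<eta>\<in>config_space (Suc K). cwgt M d \<eta> * g \<eta> * incl_gen r d h \<eta>) = - dform r M d K g h"
proof -
  have tm: "(\<Sum>\<eta>\<in>config_space (Suc K). cwgt M d \<eta> * g \<eta> * (real (\<eta> x) * (d + real (\<eta> y)) * r x y * (h (sigma_move x y \<eta>) - h \<eta>)))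
    = (\<Sum>\<zeta>\<in>config_space K. cnd r M d \<zeta> x y * (g (up x \<zeta>) * (h (up y \<zeta>) - h (up x \<zeta>))))" for x y
  proof (cases "x = y")
    case True
    then show ?thesis by (simp add: sigma_move_def)
  next
    case False
    have "(\<Sum>\<eta>\<in>config_space (Suc K). cwgt M d \<eta> * g \<eta> * (real (\<eta> x) * (d + real (\<eta> y)) * r x y * (h (sigma_move x y \<eta>) - h \<eta>)))
      = (\<Sum>\<eta>\<in>config_space (Suc K). real (\<eta> x) * (cwgt M d \<eta> * g \<eta> * ((d + real (\<eta> y)) * r x y * (h (sigma_move x y \<eta>) - h \<eta>))))"
      by (simp add: mult_ac)
    also have "\<dots> = (\<Sum>\<zeta>\<in>config_space K. real (Suc (\<zeta> x)) * (cwgt M d (up x \<zeta>) * g (up x \<zeta>) * ((d + real (up x \<zeta> y)) * r x y * (h (sigma_move x y (up x \<zeta>)) - h (up x \<zeta>)))))"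
      by (rule sum_config_up)
    also have "\<dots> = (\<Sum>\<zeta>\<in>config_space K. cnd r M d \<zeta> x y * (g (up x \<zeta>) * (h (up y \<zeta>) - h (up x \<zeta>))))"
    proof (intro sum.cong refl)
      fix \<zeta>
      have uy: "up x \<zeta> y = \<zeta> y" using False by (simp add: up_def)
      have "real (Suc (\<zeta> x)) * (cwgt M d (up x \<zeta>) * g (up x \<zeta>) * ((d + real (up x \<zeta> y)) * r x y * (h (sigma_move x y (up x \<zeta>)) - h (up x \<zeta>))))
        = (real (Suc (\<zeta> x)) * cwgt M d (up x \<zeta>)) * (g (up x \<zeta>) * ((d + real (\<zeta> y)) * r x y * (h (up y \<zeta>) - h (up x \<zeta>))))"
        unfolding uy sigma_move_up[OF False] by (simp only: mult_ac)
      then show "real (Suc (\<zeta> x)) * (cwgt M d (up x \<zeta>) * g (up x \<zeta>) * ((d + real (up x \<zeta> y)) * r x y * (h (sigma_move x y (up x \<zeta>)) - h (up x \<zeta>))))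
        = cnd r M d \<zeta> x y * (g (up x \<zeta>) * (h (up y \<zeta>) - h (up x \<zeta>)))"
        unfolding cwgt_up cnd_def by (simp only: mult_ac)
    qed
    finally show ?thesis .
  qed
  have sym: "cnd r M d \<zeta> x y = cnd r M d \<zeta> y x" for \<zeta> x y unfolding cnd_def rev[of x y] by (simp only: mult_ac)
  define T where "T x y = (\<Sum>\<zeta>\<in>config_space K. cnd r M d \<zeta> x y * (g (up x \<zeta>) * (h (up y \<zeta>) - h (up x \<zeta>))))" for x y
  have "(\<Sum>\<eta>\<in>config_space (Suc K). cwgt M d \<eta> * g \<eta> * incl_gen r d h \<eta>) = (\<Sum>x\<in>UNIV. \<Sum>y\<in>UNIV. T x y)"
    unfolding incl_gen_def T_def tm[symmetric] sum_distrib_left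
    by (subst sum.swap, intro sum.cong refl, subst sum.swap) simp
  also have "\<dots> = ((\<Sum>x\<in>UNIV. \<Sum>y\<in>UNIV. T x y) + (\<Sum>x\<in>UNIV. \<Sum>y\<in>UNIV. T y x)) / 2"
    by (subst sum.swap[of "\<lambda>x y. T y x"]) simp
  also have "\<dots> = (\<Sum>x\<in>UNIV. \<Sum>y\<in>UNIV. T x y + T y x) / 2" by (simp add: sum.distrib)
  also have "\<dots> = (\<Sum>x\<in>UNIV. \<Sum>y\<in>UNIV. - (\<Sum>\<zeta>\<in>config_space K. cnd r M d \<zeta> x y * ((g (up x \<zeta>) - g (up y \<zeta>)) * (h (up x \<zeta>) - h (up y \<zeta>))))) / 2"
  proof (intro arg_cong2[where f="(/)"] sum.cong refl)
    fix x y
    show "T x y + T y x = - (\<Sum>\<zeta>\<in>config_space K. cnd r M d \<zeta> x y * ((g (up x \<zeta>) - g (up y \<zeta>)) * (h (up x \<zeta>) - h (up y \<zeta>))))"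
      unfolding T_def sym[of _ y x] sum.distrib[symmetric] sum_negf[symmetric]
      by (intro sum.cong refl) (simp add: algebra_simps)
  qed
  also have "\<dots> = - dform r M d K g h" by (simp add: dform_def sum_negf)
  finally show ?thesis .
qed

text \<open>The energy of g - h is nonnegative, expanded edge by edge. It is the step of the
  Dirichlet principle from an identity for h to a bound for all competitors g.\<close>

lemma dform_diff_nonneg:
  assumes "\<And>\<zeta> x y. cnd r M d \<zeta> x y \<ge> 0"
  shows "2 * dform r M d K g h - dform r M d K h h \<le> dform r M d K g g"
proof -
  let ?c = "\<lambda>\<zeta> x y. cnd r M d \<zeta> x y"
  have "(\<Sum>x\<in>UNIV. \<Sum>y\<in>UNIV. \<Sum>\<zeta>\<in>config_space K. 2 * (?c \<zeta> x y * ((g (up x \<zeta>) - g (up y \<zeta>)) * (h (up x \<zeta>) - h (up y \<zeta>)))) - ?c \<zeta> x y * ((h (up x \<zeta>) - h (up y \<zeta>)) * (h (up x \<zeta>) - h (up y \<zeta>))))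
     \<le> (\<Sum>x\<in>UNIV. \<Sum>y\<in>UNIV. \<Sum>\<zeta>\<in>config_space K. ?c \<zeta> x y * ((g (up x \<zeta>) - g (up y \<zeta>)) * (g (up x \<zeta>) - g (up y \<zeta>))))"
  proof (intro sum_mono)
    fix x y \<zeta>
    define a b where "a = g (up x \<zeta>) - g (up y \<zeta>)" and "b = h (up x \<zeta>) - h (up y \<zeta>)"
    have "2 * (a * b) - b * b \<le> a * a" using zero_le_square[of "a - b"] by (simp add: algebra_simps)
    then have "?c \<zeta> x y * (2 * (a * b) - b * b) \<le> ?c \<zeta> x y * (a * a)" by (rule mult_left_mono[OF _ assms])
    then show "2 * (?c \<zeta> x y * (a * b)) - ?c \<zeta> x y * (b * b) \<le> ?c \<zeta> x y * (a * a)" by (simp add: algebra_simps)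
  qed
  then show ?thesis unfolding dform_def by (simp add: sum_subtractf sum_distrib_left[symmetric])
qed

section \<open>Reduction of the inclusion process to a capacity\<close>

locale incl =
  fixes r :: "site \<Rightarrow> site \<Rightarrow> real" and m :: "site \<Rightarrow> real"
  assumes r_nonneg: "\<forall>x y. 0 \<le> r x y"
    and m_nonneg: "\<forall>x. 0 \<le> m x"
    and m_prob: "(\<Sum>x\<in>UNIV. m x) = 1"
    and reversible: "\<forall>x y. m x * r x y = m y * r y x"
    and rates: "\<forall>i\<in>{X1, X2}. \<forall>p\<in>{Y1, Y2}. r p i > r i p \<and> r i p > 0"
    and r_x12: "r X1 X2 = 0" and r_x21: "r X2 X1 = 0"
    and m_eq: "m X1 = m X2"
begin

abbreviation "M \<equiv> mstar m"

lemma rpos: "i \<in> {X1, X2} \<Longrightarrow> p \<in> {Y1, Y2} \<Longrightarrow> r i p > 0" "i \<in> {X1, X2} \<Longrightarrow> p \<in> {Y1, Y2} \<Longrightarrow> r p i > 0"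
  using rates by force+

lemma mX_pos: "m X1 > 0"
proof (rule ccontr)
  assume "\<not> ?thesis"
  then have z: "m X1 = 0" using m_nonneg by (simp add: not_less antisym)
  have "m p = 0" if "p \<in> {Y1, Y2}" for p
  proof -
    have "m X1 * r X1 p = m p * r p X1" using reversible by blast
    then show ?thesis using z rpos(2)[of X1 p] that by simp
  qed
  then show False using m_prob z m_eq by (simp add: sum_site)
qed

lemma mY: "p \<in> {Y1, Y2} \<Longrightarrow> 0 < m p \<and> m p < m X1"
proof -
  assume p: "p \<in> {Y1, Y2}"
  have e: "m X1 * r X1 p = m p * r p X1" using reversible by blast
  have r: "r p X1 > r X1 p" "r X1 p > 0" using rates p by auto
  have pos: "m p > 0"
  proof (rule ccontr)
    assume "\<not> ?thesis"
    then have "m p = 0" using m_nonneg by (simp add: not_less antisym)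
    then show False using e r mX_pos by simp
  qed
  moreover have "m p < m X1"
  proof (rule ccontr)
    assume "\<not> ?thesis"
    then have "m X1 * r X1 p \<le> m p * r X1 p" using r by (intro mult_right_mono) auto
    also have "\<dots> < m p * r p X1" using pos r by (intro mult_strict_left_mono)
    finally show False using e by simp
  qed
  ultimately show ?thesis by simp
qed

lemma Mstar_eq: "Mstar m = m X1"
proof -
  have "range m = {m X1, m X2, m Y1, m Y2}" by (auto simp: UNIV_site)
  then show ?thesis unfolding Mstar_def using mY[of Y1] mY[of Y2] m_eq by auto
qed

lemma M_X [simp]: "M X1 = 1" "M X2 = 1"
  using mX_pos m_eq by (simp_all add: mstar_def Mstar_eq)

lemma M_Y: "0 < M Y1" "M Y1 < 1" "0 < M Y2" "M Y2 < 1"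
  using mY[of Y1] mY[of Y2] mX_pos by (simp_all add: mstar_def Mstar_eq)

lemma M_nonneg: "0 \<le> M x"
  using m_nonneg mX_pos by (simp add: mstar_def Mstar_eq)

lemma M_rev: "M x * r x y = M y * r y x"
  using reversible by (simp add: mstar_def)

lemma cnd_nonneg: "d > 0 \<Longrightarrow> cnd r M d \<zeta> x y \<ge> 0"
  unfolding cnd_def cwgt_def using r_nonneg M_nonneg wgt_pos[of d]
  by (auto intro!: mult_nonneg_nonneg prod_nonneg zero_le_power simp: less_imp_le)

lemma incl_rate_nonneg: "d > 0 \<Longrightarrow> 0 \<le> incl_rate r d \<eta> \<zeta>"
  unfolding incl_rate_def using r_nonneg by (auto intro!: sum_nonneg)

lemma xi_config: "xi N x \<in> config_space N"
  by (cases x) (auto simp: xi_def config_space_def sum_site)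

lemma xi_cf: "xi N X1 = cf N 0 0 0" "xi N X2 = cf 0 N 0 0"
  by (auto simp: xi_def cf_def fun_eq_iff split: site.splits)

lemma cwgt_xi: "cwgt M d (xi N X1) = wgt d N" "cwgt M d (xi N X2) = wgt d N"
  by (simp_all add: cwgt_def prod_site xi_def)

lemma lyapunov:
  assumes d: "d > 0"
  obtains V \<delta> where "\<And>a. a \<in> config_space N \<Longrightarrow> V a > (0::real)" "\<delta> > 0"
    "\<And>a. a \<in> config_space N \<Longrightarrow> a \<notin> {xi N X1, xi N X2} \<Longrightarrow> (\<Sum>b\<in>config_space N. gen_matrix (config_space N) (incl_rate r d) a b * V b) \<le> - \<delta> * V a"
\<comment> \<open>The rank counts particles at \<open>Y1\<close>, \<open>Y2\<close> once and those
  at \<open>X2\<close> twice. A particle at a \<open>Y\<close> site can fall to \<open>X1\<close>,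
  and one at \<open>X2\<close> can climb to \<open>Y1\<close>, even if the target is empty because d
  is positive; both moves lower the rank, and the configuration of rank 0 is
  \<open>xi N X1\<close>.\<close>
proof (rule lyapunov_exists[where E="config_space N" and q="incl_rate r d" and G="{xi N X1, xi N X2}" and \<rho>="\<lambda>\<eta>. 2 * \<eta> X2 + \<eta> Y1 + \<eta> Y2"])
  show "finite (config_space N)" by (rule finite_config_space)
  fix \<eta> assume \<eta>: "\<eta> \<in> config_space N" "\<eta> \<notin> {xi N X1, xi N X2}"
  have move: "incl_rate r d \<eta> (sigma_move x y \<eta>) > 0" if "\<eta> x > 0" "r x y > 0" for x y
  proof -
    have "0 < real (\<eta> x) * (d + real (\<eta> y)) * r x y" using that d by (simp add: add_pos_nonneg)
    also have "\<dots> \<le> (\<Sum>y'\<in>UNIV. if sigma_move x y' \<eta> = sigma_move x y \<eta> then real (\<eta> x) * (d + real (\<eta> y')) * r x y' else 0)"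
      using r_nonneg d by (intro order_trans[OF _ member_le_sum[of y UNIV]]) auto
    also have "\<dots> \<le> incl_rate r d \<eta> (sigma_move x y \<eta>)" unfolding incl_rate_def
      using r_nonneg d by (intro member_le_sum[of x UNIV "\<lambda>x'. \<Sum>y'\<in>UNIV. if sigma_move x' y' \<eta> = sigma_move x y \<eta> then real (\<eta> x') * (d + real (\<eta> y')) * r x' y' else 0"]) (auto intro!: sum_nonneg)
    finally show ?thesis .
  qed
  have "\<exists>x y. \<eta> x > 0 \<and> r x y > 0 \<and> 2 * sigma_move x y \<eta> X2 + sigma_move x y \<eta> Y1 + sigma_move x y \<eta> Y2 < 2 * \<eta> X2 + \<eta> Y1 + \<eta> Y2"
  proof -
    consider "\<eta> Y1 > 0" | "\<eta> Y2 > 0" | "\<eta> Y1 = 0" "\<eta> Y2 = 0" "\<eta> X2 > 0" | "\<eta> Y1 = 0" "\<eta> Y2 = 0" "\<eta> X2 = 0" by blast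
    then show ?thesis
    proof cases
      case 1 then show ?thesis using rpos(2)[of X1 Y1] by (intro exI[of _ Y1] exI[of _ X1]) (auto simp: sigma_move_def)
    next
      case 2 then show ?thesis using rpos(2)[of X1 Y2] by (intro exI[of _ Y2] exI[of _ X1]) (auto simp: sigma_move_def)
    next
      case 3 then show ?thesis using rpos(1)[of X2 Y1] by (intro exI[of _ X2] exI[of _ Y1]) (auto simp: sigma_move_def)
    next
      case 4
      then have "\<eta> X1 = N" using \<eta>(1) by (simp add: config_space_def sum_site)
      then have "\<eta> = xi N X1" using 4 cf_eta[of \<eta>] by (simp add: xi_cf)
      then show ?thesis using \<eta>(2) by simp
    qed
  qed
  then show "\<exists>b\<in>config_space N. incl_rate r d \<eta> b > 0 \<and> 2 * b X2 + b Y1 + b Y2 < 2 * \<eta> X2 + \<eta> Y1 + \<eta> Y2"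
    using move sigma_move_config_space[OF \<eta>(1)] by blast
qed (use incl_rate_nonneg[OF d] that in \<open>blast+\<close>)

text \<open>The generator of the potential h vanishes off the two full configurations. Its
  stationary mean is zero and both configurations have the same weight, so its values there are
  -\<alpha> and \<alpha>; in terms of 2h - 1 this is an eigenvalue relation with factor -2 \<alpha>.
  The Green formula identifies \<alpha> times the weight with the pairing of h and any g with the
  same boundary values.\<close>

lemma reduction:
  assumes d: "d > 0" and N: "N = Suc K"
  obtains h \<alpha> where "h (xi N X1) = (1::real)" "h (xi N X2) = 0" "\<alpha> \<ge> 0"
    "\<alpha> * wgt d N = dform r M d K h h"
    "\<And>g. g (xi N X1) = 1 \<Longrightarrow> g (xi N X2) = 0 \<Longrightarrow> \<alpha> * wgt d N \<le> dform r M d K g g"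
    "\<And>\<eta>. \<eta> \<in> config_space N \<Longrightarrow> (\<Sum>b\<in>config_space N. gen_matrix (config_space N) (incl_rate r d) \<eta> b * (2 * h b - 1)) + (2 * \<alpha> * indicator {xi N X1, xi N X2} \<eta>) * (2 * h \<eta> - 1) = 0"
proof -
  let ?E = "config_space N" and ?x1 = "xi N X1" and ?x2 = "xi N X2"
  have ne: "?x1 \<noteq> ?x2" using N by (auto simp: xi_cf dest: fun_cong[of _ _ X1])
  obtain h where h: "h ?x1 = (1::real)" "\<And>b. b \<in> {?x1, ?x2} \<Longrightarrow> b \<noteq> ?x1 \<Longrightarrow> h b = 0"
    "\<And>b. b \<in> ?E \<Longrightarrow> b \<notin> {?x1, ?x2} \<Longrightarrow> (\<Sum>c\<in>?E. incl_rate r d b c * (h c - h b)) = 0"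
    by (rule harmonic_exists[of ?E "incl_rate r d" ?x1 "{?x1, ?x2}"]) (use finite_config_space incl_rate_nonneg[OF d] in auto)
  have h2: "h ?x2 = 0" using h(2)[of ?x2] ne by simp
  have L0: "incl_gen r d h \<eta> = 0" if "\<eta> \<in> ?E" "\<eta> \<notin> {?x1, ?x2}" for \<eta>
    using h(3)[OF that] incl_rate_apply[OF that(1)] by simp
  have parts: "(\<Sum>\<eta>\<in>?E. cwgt M d \<eta> * g \<eta> * incl_gen r d h \<eta>) = - dform r M d K g h" for g
    unfolding N by (rule sum_by_parts[OF M_rev])
  have two: "(\<Sum>\<eta>\<in>?E. cwgt M d \<eta> * g \<eta> * incl_gen r d h \<eta>) = wgt d N * g ?x1 * incl_gen r d h ?x1 + wgt d N * g ?x2 * incl_gen r d h ?x2" for g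
  proof -
    have "(\<Sum>\<eta>\<in>?E. cwgt M d \<eta> * g \<eta> * incl_gen r d h \<eta>) = (\<Sum>\<eta>\<in>{?x1, ?x2}. cwgt M d \<eta> * g \<eta> * incl_gen r d h \<eta>)"
      by (rule sum.mono_neutral_right) (use L0 xi_config finite_config_space in auto)
    then show ?thesis using ne by (simp add: cwgt_xi)
  qed
  define \<alpha> where "\<alpha> = - incl_gen r d h ?x1"
  have w: "wgt d N > 0" by (rule wgt_pos[OF d])
  \<comment> \<open>Testing against the constant 1: the fluxes out of the two full configurations
    balance.\<close>
  have "dform r M d K (\<lambda>_. 1) h = 0" by (simp add: dform_def)
  then have "wgt d N * (incl_gen r d h ?x1 + incl_gen r d h ?x2) = 0" using two[of "\<lambda>_. 1"] parts[of "\<lambda>_. 1"] by (simp add: distrib_left)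
  then have L2: "incl_gen r d h ?x2 = \<alpha>" using w by (simp add: \<alpha>_def)
  have cap: "\<alpha> * wgt d N = dform r M d K g h" if "g ?x1 = 1" "g ?x2 = 0" for g
    using two[of g] parts[of g] that by (simp add: \<alpha>_def mult.commute)
  have caph: "\<alpha> * wgt d N = dform r M d K h h" by (rule cap[OF h(1) h2])
  have "dform r M d K h h \<ge> 0" unfolding dform_def
    by (intro divide_nonneg_nonneg sum_nonneg zero_le_square mult_nonneg_nonneg cnd_nonneg[OF d]) simp_all
  then have \<alpha>0: "\<alpha> \<ge> 0" using caph w by (metis mult_less_0_iff not_less)
  show ?thesis
  proof (rule that[of h \<alpha>, OF h(1) h2 \<alpha>0 caph])
    fix g :: "(site \<Rightarrow> nat) \<Rightarrow> real" assume "g ?x1 = 1" "g ?x2 = 0"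
    then have "\<alpha> * wgt d N = dform r M d K g h" by (rule cap)
    then show "\<alpha> * wgt d N \<le> dform r M d K g g" using dform_diff_nonneg[OF cnd_nonneg[OF d], of K g h] caph by simp
  next
    fix \<eta> assume \<eta>: "\<eta> \<in> ?E"
    have "(\<Sum>b\<in>?E. gen_matrix ?E (incl_rate r d) \<eta> b * (2 * h b - 1)) = (\<Sum>b\<in>?E. incl_rate r d \<eta> b * ((2 * h b - 1) - (2 * h \<eta> - 1)))"
      by (rule gen_matrix_apply[OF finite_config_space \<eta>])
    also have "\<dots> = 2 * (\<Sum>b\<in>?E. incl_rate r d \<eta> b * (h b - h \<eta>))" by (simp add: sum_distrib_left algebra_simps)
    also have "\<dots> = 2 * incl_gen r d h \<eta>" by (simp add: incl_rate_apply[OF \<eta>])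
    finally have e: "(\<Sum>b\<in>?E. gen_matrix ?E (incl_rate r d) \<eta> b * (2 * h b - 1)) = 2 * incl_gen r d h \<eta>" .
    show "(\<Sum>b\<in>?E. gen_matrix ?E (incl_rate r d) \<eta> b * (2 * h b - 1)) + (2 * \<alpha> * indicator {?x1, ?x2} \<eta>) * (2 * h \<eta> - 1) = 0"
      unfolding e using L0[OF \<eta>] L2 h(1) h2 ne by (cases "\<eta> = ?x1"; cases "\<eta> = ?x2") (auto simp: \<alpha>_def)
  qed
qed

lemma up_cf: "up X1 (cf i j k l) = cf (Suc i) j k l" "up X2 (cf i j k l) = cf i (Suc j) k l"
  "up Y1 (cf i j k l) = cf i j (Suc k) l" "up Y2 (cf i j k l) = cf i j k (Suc l)"
  by (auto simp: up_def cf_def fun_eq_iff split: site.splits)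

text \<open>Isolates the powers of d. Each edge has the factor d squared, and each of the two sites
  not involved in the jump contributes a further factor of order d divided by its particle number,
  or 1 if it is empty. The leading edges between an \<open>X\<close> and a \<open>Y\<close> site
  have exactly one such site occupied, the other \<open>X\<close> site.\<close>

lemma cnd_cf:
  "cnd r M d (cf i j k l) X1 Y1 = d\<^sup>2 * M Y1 ^ k * M Y2 ^ l * (r X1 Y1 * (prd d i * prd d k * wgt d j * wgt d l))"
  "cnd r M d (cf i j k l) X1 Y2 = d\<^sup>2 * M Y1 ^ k * M Y2 ^ l * (r X1 Y2 * (prd d i * prd d l * wgt d j * wgt d k))"
  "cnd r M d (cf i j k l) X2 Y1 = d\<^sup>2 * M Y1 ^ k * M Y2 ^ l * (r X2 Y1 * (prd d j * prd d k * wgt d i * wgt d l))"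
  "cnd r M d (cf i j k l) X2 Y2 = d\<^sup>2 * M Y1 ^ k * M Y2 ^ l * (r X2 Y2 * (prd d j * prd d l * wgt d i * wgt d k))"
  "cnd r M d (cf i j k l) Y1 Y2 = d\<^sup>2 * M Y1 ^ k * M Y2 ^ l * (M Y1 * r Y1 Y2 * (prd d k * prd d l * wgt d i * wgt d j))"
proof -
  have gen: "A * wgt d n * (B * wgt d n') * (d + real n) * (d + real n') * C = d\<^sup>2 * A * B * C * (prd d n * prd d n')" for A B C n n'
  proof -
    have "A * wgt d n * (B * wgt d n') * (d + real n) * (d + real n') * C = A * B * C * ((d + real n) * wgt d n) * ((d + real n') * wgt d n')" by (simp only: mult_ac)
    then show ?thesis unfolding wgt_prd by (simp add: power2_eq_square mult_ac)
  qed
  show "cnd r M d (cf i j k l) X1 Y1 = d\<^sup>2 * M Y1 ^ k * M Y2 ^ l * (r X1 Y1 * (prd d i * prd d k * wgt d j * wgt d l))"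
    using gen[of "wgt d j * (M Y2 ^ l * wgt d l)" i "M Y1 ^ k" k "r X1 Y1"] unfolding cnd_def cwgt_def prod_site by (simp add: mult_ac)
  show "cnd r M d (cf i j k l) X1 Y2 = d\<^sup>2 * M Y1 ^ k * M Y2 ^ l * (r X1 Y2 * (prd d i * prd d l * wgt d j * wgt d k))"
    using gen[of "wgt d j * (M Y1 ^ k * wgt d k)" i "M Y2 ^ l" l "r X1 Y2"] unfolding cnd_def cwgt_def prod_site by (simp add: mult_ac)
  show "cnd r M d (cf i j k l) X2 Y1 = d\<^sup>2 * M Y1 ^ k * M Y2 ^ l * (r X2 Y1 * (prd d j * prd d k * wgt d i * wgt d l))"
    using gen[of "wgt d i * (M Y2 ^ l * wgt d l)" j "M Y1 ^ k" k "r X2 Y1"] unfolding cnd_def cwgt_def prod_site by (simp add: mult_ac)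
  show "cnd r M d (cf i j k l) X2 Y2 = d\<^sup>2 * M Y1 ^ k * M Y2 ^ l * (r X2 Y2 * (prd d j * prd d l * wgt d i * wgt d k))"
    using gen[of "wgt d i * (M Y1 ^ k * wgt d k)" j "M Y2 ^ l" l "r X2 Y2"] unfolding cnd_def cwgt_def prod_site by (simp add: mult_ac)
  show "cnd r M d (cf i j k l) Y1 Y2 = d\<^sup>2 * M Y1 ^ k * M Y2 ^ l * (M Y1 * r Y1 Y2 * (prd d k * prd d l * wgt d i * wgt d j))"
    using gen[of "wgt d i * wgt d j * M Y1 ^ k" k "M Y2 ^ l" l "M Y1 * r Y1 Y2"] unfolding cnd_def cwgt_def prod_site by (simp add: mult_ac)
qed

lemma dform_coord:
  "dform r M d K g g = (\<Sum>(i,j,k,l)\<in>quad K. d\<^sup>2 * M Y1 ^ k * M Y2 ^ l * (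
     r X1 Y1 * (prd d i * prd d k * wgt d j * wgt d l) * (g (cf (Suc i) j k l) - g (cf i j (Suc k) l))\<^sup>2
   + r X1 Y2 * (prd d i * prd d l * wgt d j * wgt d k) * (g (cf (Suc i) j k l) - g (cf i j k (Suc l)))\<^sup>2
   + r X2 Y1 * (prd d j * prd d k * wgt d i * wgt d l) * (g (cf i (Suc j) k l) - g (cf i j (Suc k) l))\<^sup>2
   + r X2 Y2 * (prd d j * prd d l * wgt d i * wgt d k) * (g (cf i (Suc j) k l) - g (cf i j k (Suc l)))\<^sup>2
   + M Y1 * r Y1 Y2 * (prd d k * prd d l * wgt d i * wgt d j) * (g (cf i j (Suc k) l) - g (cf i j k (Suc l)))\<^sup>2))"
proof -
  define T where "T x y = (\<Sum>\<zeta>\<in>config_space K. cnd r M d \<zeta> x y * (g (up x \<zeta>) - g (up y \<zeta>))\<^sup>2)" for x y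
  have sym: "cnd r M d \<zeta> x y = cnd r M d \<zeta> y x" for \<zeta> x y unfolding cnd_def M_rev[of x y] by (simp only: mult_ac)
  have Tsym: "T x y = T y x" for x y unfolding T_def sym[of _ x y] by (simp add: power2_commute)
  have T0: "T x x = 0" for x by (simp add: T_def)
  have T12: "T X1 X2 = 0" by (simp add: T_def cnd_def r_x12)
  have "dform r M d K g g = (\<Sum>x\<in>UNIV. \<Sum>y\<in>UNIV. T x y) / 2" by (simp add: dform_def T_def power2_eq_square)
  also have "\<dots> = T X1 Y1 + T X1 Y2 + T X2 Y1 + T X2 Y2 + T Y1 Y2"
    unfolding sum_site T0 Tsym[of X2 X1] T12 Tsym[of Y1 X1] Tsym[of Y2 X1] Tsym[of Y1 X2] Tsym[of Y2 X2] Tsym[of Y2 Y1] by simp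
  also have "\<dots> = (\<Sum>(i,j,k,l)\<in>quad K. cnd r M d (cf i j k l) X1 Y1 * (g (cf (Suc i) j k l) - g (cf i j (Suc k) l))\<^sup>2
   + cnd r M d (cf i j k l) X1 Y2 * (g (cf (Suc i) j k l) - g (cf i j k (Suc l)))\<^sup>2
   + cnd r M d (cf i j k l) X2 Y1 * (g (cf i (Suc j) k l) - g (cf i j (Suc k) l))\<^sup>2
   + cnd r M d (cf i j k l) X2 Y2 * (g (cf i (Suc j) k l) - g (cf i j k (Suc l)))\<^sup>2
   + cnd r M d (cf i j k l) Y1 Y2 * (g (cf i j (Suc k) l) - g (cf i j k (Suc l)))\<^sup>2)"
    unfolding T_def sum_config_space up_cf by (simp add: sum.distrib case_prod_beta')
  finally show ?thesis unfolding cnd_cf by (simp add: distrib_left mult.assoc)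
qed

end

section \<open>Upper bound for the capacity\<close>

text \<open>For Riemann sums whose summands change with N. Written as integrals of step functions
  they converge by dominated convergence, so pointwise limits in the open interval and one common
  bound suffice, without uniform estimates near the endpoints.\<close>

lemma riemann_dct:
  fixes f :: "nat \<Rightarrow> nat \<Rightarrow> real" and F :: "real \<Rightarrow> real"
  assumes B: "\<And>N i. i < N \<Longrightarrow> \<bar>f N i\<bar> \<le> B"
    and lim: "\<And>t. 0 < t \<Longrightarrow> t < 1 \<Longrightarrow> (\<lambda>N. f N (nat \<lfloor>real N * t\<rfloor>)) \<longlonglongrightarrow> F t"
    and cont: "continuous_on {0..1} F"
  shows "(\<lambda>N. (\<Sum>i<N. f N i) / real N) \<longlonglongrightarrow> integral {0..1} F"
proof -
  define g where "g N t = (\<Sum>i<N. f N i * indicator {real i / real N..<real (Suc i) / real N} t)" for N and t :: real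
  have g_eq: "g N t = (if 0 \<le> t \<and> t < 1 then f N (nat \<lfloor>real N * t\<rfloor>) else 0)" if N: "N > 0" for N t
  proof (cases "0 \<le> t \<and> t < 1")
    case True
    define i0 where "i0 = nat \<lfloor>real N * t\<rfloor>"
    have "0 \<le> real N * t" using True by simp
    then have r: "real i0 \<le> real N * t" "real N * t < real i0 + 1" unfolding i0_def by linarith+
    have "real N * t < real N * 1" using True N by (intro mult_strict_left_mono) auto
    then have i0N: "i0 < N" using r by linarith
    have "f N i * indicator {real i / real N..<real (Suc i) / real N} t = (if i = i0 then f N i0 else 0)" for i
    proof -
      have "t \<in> {real i / real N..<real (Suc i) / real N} \<longleftrightarrow> real i \<le> real N * t \<and> real N * t < real (Suc i)"
        using N by (simp add: pos_divide_le_eq pos_less_divide_eq mult.commute del: of_nat_Suc)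
      also have "\<dots> \<longleftrightarrow> i = i0"
      proof
        assume "real i \<le> real N * t \<and> real N * t < real (Suc i)"
        then have "real i < real i0 + 1" "real i0 < real i + 1" using r by auto
        then show "i = i0" by linarith
      qed (use r in simp)
      finally show ?thesis by (simp add: indicator_def)
    qed
    then show ?thesis unfolding g_def i0_def[symmetric] using i0N True by simp
  next
    case False
    have "indicator {real i / real N..<real (Suc i) / real N} t = (0::real)" if "i < N" for i
    proof -
      have "t < real i / real N \<or> t \<ge> real (Suc i) / real N"
      proof (cases "t < 0")
        case True
        have "0 \<le> real i / real N" by simp
        then show ?thesis using True by linarith
      next
        case f: False
        have "real (Suc i) / real N \<le> 1" using that N by (simp add: pos_divide_le_eq del: of_nat_Suc)
        then show ?thesis using f False by auto
      qed
      then show ?thesis by (auto simp: indicator_def)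
    qed
    then show ?thesis unfolding g_def using False by (auto intro!: sum.neutral)
  qed
  have intg: "(\<integral>t. g N t \<partial>lborel) = (\<Sum>i<N. f N i) / real N" if N: "N > 0" for N
  proof -
    have le: "real i / real N \<le> real (Suc i) / real N" for i by (rule divide_right_mono) auto
    have "(\<integral>t. g N t \<partial>lborel) = (\<Sum>i<N. \<integral>t. f N i * indicator {real i / real N..<real (Suc i) / real N} t \<partial>lborel)"
      unfolding g_def using le by (intro Bochner_Integration.integral_sum integrable_mult_right integrable_real_indicator) auto
    also have "\<dots> = (\<Sum>i<N. f N i * (1 / real N))"
      using le by (intro sum.cong refl) (simp add: diff_divide_distrib[symmetric])
    finally show ?thesis by (simp add: sum_divide_distrib)
  qed
  have B0: "B \<ge> 0" using B[of 0 1] by simp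
  have "(\<lambda>N. \<integral>t. g N t \<partial>lborel) \<longlonglongrightarrow> (\<integral>t. indicator {0..1} t *\<^sub>R F t \<partial>lborel)"
  proof (rule integral_dominated_convergence[where w="\<lambda>t. B * indicator {0..1} t"])
    show "(\<lambda>t. indicator {0..1} t *\<^sub>R F t) \<in> borel_measurable lborel"
      using borel_integrable_atLeastAtMost'[OF cont] unfolding set_integrable_def by (rule borel_measurable_integrable)
    show "g N \<in> borel_measurable lborel" for N unfolding g_def by measurable
    show "integrable lborel (\<lambda>t. B * indicator {0..1::real} t)" by (intro integrable_mult_right integrable_real_indicator) auto
    have "AE t in lborel. t \<noteq> (0::real)" "AE t in lborel. t \<noteq> (1::real)" by (rule AE_lborel_singleton)+
    then show "AE t in lborel. (\<lambda>N. g N t) \<longlonglongrightarrow> indicator {0..1} t *\<^sub>R F t"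
    proof eventually_elim
      case (elim t)
      have ev: "eventually (\<lambda>N. (if 0 \<le> t \<and> t < 1 then f N (nat \<lfloor>real N * t\<rfloor>) else 0) = g N t) sequentially"
        using eventually_gt_at_top[of 0] by eventually_elim (simp add: g_eq)
      have "(\<lambda>N. if 0 \<le> t \<and> t < 1 then f N (nat \<lfloor>real N * t\<rfloor>) else 0) \<longlonglongrightarrow> indicator {0..1} t *\<^sub>R F t"
        using lim[of t] elim by (cases "0 \<le> t \<and> t < 1") (auto simp: indicator_def)
      then show ?case by (rule Lim_transform_eventually[OF _ ev])
    qed
    show "AE t in lborel. norm (g N t) \<le> B * indicator {0..1} t" for N
    proof (rule AE_I2)
      fix t :: real
      show "norm (g N t) \<le> B * indicator {0..1} t"
      proof (cases "N > 0")
        case True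
        show ?thesis
        proof (cases "0 \<le> t \<and> t < 1")
          case T: True
          have "0 \<le> real N * t" "real N * t < real N * 1" using T True by (auto intro!: mult_strict_left_mono)
          then have "nat \<lfloor>real N * t\<rfloor> < N" by linarith
          then show ?thesis using B T by (simp add: g_eq[OF True])
        qed (use B0 in \<open>auto simp: g_eq[OF True] indicator_def\<close>)
      qed (use B0 in \<open>simp add: g_def\<close>)
    qed
  qed
  also have "(\<integral>t. indicator {0..1} t *\<^sub>R F t \<partial>lborel) = integral {0..1} F"
    using set_borel_integral_eq_integral(2)[OF borel_integrable_atLeastAtMost'[OF cont]] unfolding set_lebesgue_integral_def .
  finally show ?thesis
    by (rule Lim_transform_eventually) (use eventually_gt_at_top[of 0] in eventually_elim, simp add: intg)
qed

text \<open>The argument of \<open>\<phi>\<close> is the expected fraction of particles at \<open>X1\<close> once every particle at a site \<open>Y\<close>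
  has fallen to \<open>X1\<close> or \<open>X2\<close>.\<close>

definition tst :: "(real \<Rightarrow> real) \<Rightarrow> (real \<Rightarrow> real) \<Rightarrow> (real \<Rightarrow> real) \<Rightarrow> nat \<Rightarrow> nat \<Rightarrow> nat \<Rightarrow> nat \<Rightarrow> nat \<Rightarrow> real" where
  "tst \<phi> s1 s2 N i j k l = \<phi> ((real i + s1 (real i / real (i + j)) * real k + s2 (real i / real (i + j)) * real l) / real N)"

text \<open>Energy carried by the edges between \<open>X1\<close> and \<open>Y1\<close>; the other three families of edges reduce to it by
  exchanging the roles of \<open>Y1, Y2\<close> and of \<open>X1, X2\<close>.\<close>

definition SX :: "real \<Rightarrow> real \<Rightarrow> real \<Rightarrow> real \<Rightarrow> nat \<Rightarrow> (nat \<Rightarrow> nat \<Rightarrow> nat \<Rightarrow> nat \<Rightarrow> real) \<Rightarrow> real" where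
  "SX \<rho> a b d K g = (\<Sum>(i,j,k,l)\<in>quad K. d\<^sup>2 * a ^ k * b ^ l * (\<rho> * (prd d i * prd d k * wgt d j * wgt d l) * (g (Suc i) j k l - g i j (Suc k) l)\<^sup>2))"

text \<open>One coordinate is determined by the others. Giving up the constraint is harmless for the
  error terms, where k and l enter through geometric weights and i costs a factor of order
  N.\<close>

lemma quad_sum_le:
  fixes f :: "nat \<Rightarrow> nat \<Rightarrow> nat \<Rightarrow> real"
  assumes "\<And>i k l. f i k l \<ge> 0"
  shows "(\<Sum>(i,j,k,l)\<in>quad K. f i k l) \<le> (\<Sum>i\<le>K. \<Sum>k\<le>K. \<Sum>l\<le>K. f i k l)"
proof -
  have "inj_on (\<lambda>(i,j,k,l). (i,k,l)) (quad K)" by (auto simp: inj_on_def quad_def)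
  then have "(\<Sum>(i,j,k,l)\<in>quad K. f i k l) = (\<Sum>(i,k,l)\<in>(\<lambda>(i,j,k,l). (i,k,l)) ` quad K. f i k l)"
    by (subst sum.reindex) (auto simp: case_prod_beta' comp_def)
  also have "\<dots> \<le> (\<Sum>(i,k,l)\<in>{..K} \<times> {..K} \<times> {..K}. f i k l)"
    using assms by (intro sum_mono2) (auto simp: quad_def)
  also have "\<dots> = (\<Sum>i\<le>K. \<Sum>k\<le>K. \<Sum>l\<le>K. f i k l)" by (simp add: sum.cartesian_product)
  finally show ?thesis .
qed

lemma wgt_le:
  assumes d: "0 < d" "d \<le> 1" and n: "n \<le> N"
  shows "wgt d n \<le> exp (d * real N)" "n \<ge> 1 \<Longrightarrow> wgt d n \<le> exp (d * real N) * d / real n" "wgt d n \<ge> 0"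
proof -
  show 1: "wgt d n \<le> exp (d * real N) * d / real n" if n1: "n \<ge> 1"
  proof -
    obtain n' where n': "n = Suc n'" using n1 by (cases n) auto
    have "prd d n' \<le> exp (d * real N)" using d n n' by (intro prd_le) auto
    then show ?thesis unfolding n' wgt_Suc_prd using d by (intro divide_right_mono) (auto simp: mult.commute)
  qed
  show "wgt d n \<le> exp (d * real N)"
  proof (cases n)
    case (Suc n')
    have "wgt d n \<le> exp (d * real N) * d / real n" using 1 Suc by simp
    also have "\<dots> \<le> exp (d * real N) * 1 / 1" using d Suc by (intro frac_le mult_left_mono) auto
    finally show ?thesis by simp
  qed (use d in simp)
  show "wgt d n \<ge> 0" using wgt_pos[OF d(1), of n] by simp
qed

text \<open>The fourth power is the square of the quadratic factor in
  \<open>edge_bound\<close>.\<close>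

lemma summable_poly_geo:
  fixes a :: real assumes "0 < a" "a < 1"
  shows "summable (\<lambda>k. a ^ k * (2 + real k) ^ 4)"
proof (rule summable_comparison_test_bigo)
  define b where "b = (a + 1) / 2"
  have b: "a < b" "b < 1" "0 < b" using assms by (auto simp: b_def)
  show "summable (\<lambda>k. norm (b ^ k))" using b by (simp add: summable_geometric)
  show "(\<lambda>k. a ^ k * (2 + real k) ^ 4) \<in> O(\<lambda>k. b ^ k)" using assms b by real_asymp
qed

text \<open>The function \<kappa> is the derivative of \<phi>, and s1, s2 are absorption
  probabilities, equal to 1 when all other particles sit at \<open>X1\<close>. The locale is
  abstract because it is used for four families of edges: with \<open>Y1\<close>, \<open>Y2\<close>
  exchanged, and with \<open>X1\<close>, \<open>X2\<close> exchanged by reflection.\<close>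

locale tfun =
  fixes \<phi> \<kappa> s1 s2 :: "real \<Rightarrow> real" and L C :: real
  assumes der: "\<And>u. 0 \<le> u \<Longrightarrow> u \<le> 1 \<Longrightarrow> (\<phi> has_real_derivative \<kappa> u) (at u within {0..1})"
    and cont\<kappa>: "continuous_on {0..1} \<kappa>" and L: "\<And>u. 0 \<le> u \<Longrightarrow> u \<le> 1 \<Longrightarrow> \<bar>\<kappa> u\<bar> \<le> L"
    and s1: "\<And>t. 0 \<le> t \<Longrightarrow> t \<le> 1 \<Longrightarrow> 0 \<le> s1 t \<and> s1 t \<le> 1" "s1 1 = 1"
    and s2: "\<And>t. 0 \<le> t \<Longrightarrow> t \<le> 1 \<Longrightarrow> 0 \<le> s2 t \<and> s2 t \<le> 1" "s2 1 = 1"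
    and s1l: "\<And>t t'. 0 \<le> t \<Longrightarrow> t \<le> 1 \<Longrightarrow> 0 \<le> t' \<Longrightarrow> t' \<le> 1 \<Longrightarrow> \<bar>s1 t - s1 t'\<bar> \<le> C * \<bar>t - t'\<bar>"
    and s2l: "\<And>t t'. 0 \<le> t \<Longrightarrow> t \<le> 1 \<Longrightarrow> 0 \<le> t' \<Longrightarrow> t' \<le> 1 \<Longrightarrow> \<bar>s2 t - s2 t'\<bar> \<le> C * \<bar>t - t'\<bar>"
begin

lemma L0: "L \<ge> 0" using L[of 0] by simp
lemma C0: "C \<ge> 0" using s1l[of 0 1] by simp

lemma mvt:
  assumes "0 \<le> u" "u \<le> 1" "0 \<le> v" "v \<le> 1"
  obtains z where "min u v \<le> z" "z \<le> max u v" "\<phi> u - \<phi> v = \<kappa> z * (u - v)"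
proof -
  have lt: "\<exists>z\<in>{a<..<b}. \<phi> b - \<phi> a = \<kappa> z * (b - a)" if "0 \<le> a" "a < b" "b \<le> 1" for a b
  proof -
    have "\<exists>z\<in>{a<..<b}. \<phi> b - \<phi> a = (*) (\<kappa> z) (b - a)"
    proof (rule mvt_simple[where f=\<phi> and f'="\<lambda>x. (*) (\<kappa> x)"])
    show "a < b" by (rule that(2))
    fix x assume "a \<le> x" "x \<le> b"
    then have "(\<phi> has_real_derivative \<kappa> x) (at x within {a..b})"
      using that by (intro DERIV_subset[OF der[of x]]) auto
    then show "(\<phi> has_derivative (*) (\<kappa> x)) (at x within {a..b})" by (simp only: has_field_derivative_def)
    qed
    then show ?thesis by simp
  qed
  have "\<exists>z. min u v \<le> z \<and> z \<le> max u v \<and> \<phi> u - \<phi> v = \<kappa> z * (u - v)"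
  proof -
    consider "u = v" | "u < v" | "v < u" by linarith
    then show ?thesis
    proof cases
      case 1 then show ?thesis by (intro exI[of _ u]) auto
    next
      case 2
      then obtain z where "z \<in> {u<..<v}" "\<phi> v - \<phi> u = \<kappa> z * (v - u)" using lt[of u v] assms by auto
      then show ?thesis by (intro exI[of _ z]) (auto simp: algebra_simps)
    next
      case 3
      then obtain z where "z \<in> {v<..<u}" "\<phi> u - \<phi> v = \<kappa> z * (u - v)" using lt[of v u] assms by auto
      then show ?thesis by (intro exI[of _ z]) auto
    qed
  qed
  then show ?thesis using that by blast
qed

lemma lip: "0 \<le> u \<Longrightarrow> u \<le> 1 \<Longrightarrow> 0 \<le> v \<Longrightarrow> v \<le> 1 \<Longrightarrow> \<bar>\<phi> u - \<phi> v\<bar> \<le> L * \<bar>u - v\<bar>"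
proof -
  assume uv: "0 \<le> u" "u \<le> 1" "0 \<le> v" "v \<le> 1"
  obtain z where z: "min u v \<le> z" "z \<le> max u v" "\<phi> u - \<phi> v = \<kappa> z * (u - v)" by (rule mvt[OF uv]) (rule that)
  have "\<bar>\<kappa> z\<bar> \<le> L" using z uv by (intro L) auto
  then show ?thesis unfolding z(3) abs_mult by (rule mult_right_mono) simp
qed

definition arg :: "nat \<Rightarrow> nat \<Rightarrow> nat \<Rightarrow> nat \<Rightarrow> real" where
  "arg i j k l = real i + s1 (real i / real (i + j)) * real k + s2 (real i / real (i + j)) * real l"

lemma ratio: "0 \<le> real i / real (i + j)" "real i / real (i + j) \<le> 1"
  by (auto simp: divide_le_eq_1)

lemma arg_bounds: "0 \<le> arg i j k l" "arg i j k l \<le> real (i + j + k + l)"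
proof -
  note a = s1(1)[OF ratio[of i j]] s2(1)[OF ratio[of i j]]
  show "0 \<le> arg i j k l" unfolding arg_def using a by (intro add_nonneg_nonneg mult_nonneg_nonneg) auto
  have "s1 (real i / real (i + j)) * real k \<le> 1 * real k" by (rule mult_right_mono) (use a in auto)
  moreover have "s2 (real i / real (i + j)) * real l \<le> 1 * real l" by (rule mult_right_mono) (use a in auto)
  ultimately show "arg i j k l \<le> real (i + j + k + l)" unfolding arg_def by simp
qed

lemma unit: "i + j + k + l = N \<Longrightarrow> 0 \<le> arg i j k l / real N \<and> arg i j k l / real N \<le> 1"
  using arg_bounds[of i j k l] by (auto simp: divide_le_eq_1)

lemma tst_arg: "tst \<phi> s1 s2 N i j k l = \<phi> (arg i j k l / real N)" by (simp add: tst_def arg_def)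

lemma edge_any:
  assumes "Suc (i + j + k + l) = N"
  shows "\<bar>tst \<phi> s1 s2 N (Suc i) j k l - tst \<phi> s1 s2 N i j (Suc k) l\<bar> \<le> L"
proof -
  have u: "0 \<le> arg (Suc i) j k l / real N \<and> arg (Suc i) j k l / real N \<le> 1" "0 \<le> arg i j (Suc k) l / real N \<and> arg i j (Suc k) l / real N \<le> 1"
    by (rule unit, use assms in simp)+
  have "\<bar>tst \<phi> s1 s2 N (Suc i) j k l - tst \<phi> s1 s2 N i j (Suc k) l\<bar> \<le> L * \<bar>arg (Suc i) j k l / real N - arg i j (Suc k) l / real N\<bar>"
    unfolding tst_arg using u by (intro lip) auto
  also have "\<dots> \<le> L * 1" using u L0 by (intro mult_left_mono) auto
  finally show ?thesis by simp
qed

text \<open>Without particles at \<open>X2\<close> everything will fall to \<open>X1\<close>, so the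
  argument of \<phi> is 1 at both ends. For i = 0 the ratio at the second end would be 0/0, that is
  0, and this reasoning breaks down.\<close>

lemma edge_zero:
  assumes "Suc (i + k + l) = N" "i \<ge> 1"
  shows "tst \<phi> s1 s2 N (Suc i) 0 k l = tst \<phi> s1 s2 N i 0 (Suc k) l"
  using assms s1(2) s2(2) by (auto simp: tst_def add_ac)

lemma edge_diff:
  assumes "Suc (i + j + k + l) = N" "j \<ge> 1"
  defines "t \<equiv> real (Suc i) / real (Suc i + j)" and "t' \<equiv> real i / real (i + j)"
  shows "arg (Suc i) j k l - arg i j (Suc k) l = (1 - s1 t') + (s1 t - s1 t') * real k + (s2 t - s2 t') * real l"
  by (simp add: arg_def t_def t'_def algebra_simps)

text \<open>The decisive factor is j / N: the absorption probability differs from 1 by at most a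
  multiple of j / (i + j). Squared, it outweighs the factor 1 / j in the conductance and makes the
  sum over i bounded.\<close>

lemma edge_bound:
  assumes N: "Suc (i + j + k + l) = N" and j: "j \<ge> 1"
  shows "real N * \<bar>tst \<phi> s1 s2 N (Suc i) j k l - tst \<phi> s1 s2 N i j (Suc k) l\<bar> \<le> L * C * (real j / real N) * (2 + real k + real l)\<^sup>2"
proof -
  define t t' where "t = real (Suc i) / real (Suc i + j)" and "t' = real i / real (i + j)"
  have ij: "real (i + j) \<ge> 1" using j by simp
  have t: "0 \<le> t" "t \<le> 1" "0 \<le> t'" "t' \<le> 1" unfolding t_def t'_def using ratio[of "Suc i" j] ratio[of i j] by auto
  have q: "real j / real (i + j) \<ge> 0" by simp
  have 1: "1 - t' = real j / real (i + j)" unfolding t'_def using ij by (simp add: field_simps)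
  have 2: "t - t' = real j / real (i + j) * (1 / real (Suc i + j))"
    unfolding t_def t'_def using ij by (simp add: divide_simps) (simp add: algebra_simps)
  define x where "x = 1 / real (Suc i + j)"
  have x: "0 \<le> x" "x \<le> 1" by (auto simp: x_def divide_le_eq_1)
  have 3: "\<bar>t - t'\<bar> \<le> real j / real (i + j)"
    unfolding 2 x_def[symmetric] abs_mult abs_of_nonneg[OF q] abs_of_nonneg[OF x(1)] by (rule mult_left_le[OF x(2) q])
  have a1: "\<bar>1 - s1 t'\<bar> \<le> C * (real j / real (i + j))" using s1l[of 1 t'] t s1(2) 1 q by simp
  have Cq: "C * \<bar>t - t'\<bar> \<le> C * (real j / real (i + j))" using 3 C0 by (rule mult_left_mono)
  have a2: "\<bar>(s1 t - s1 t') * real k\<bar> \<le> C * (real j / real (i + j)) * real k"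
    unfolding abs_mult abs_of_nat by (rule mult_right_mono[OF order_trans[OF s1l[of t t'] Cq]]) (use t in auto)
  have a3: "\<bar>(s2 t - s2 t') * real l\<bar> \<le> C * (real j / real (i + j)) * real l"
    unfolding abs_mult abs_of_nat by (rule mult_right_mono[OF order_trans[OF s2l[of t t'] Cq]]) (use t in auto)
  have "\<bar>arg (Suc i) j k l - arg i j (Suc k) l\<bar> \<le> C * (real j / real (i + j)) + C * (real j / real (i + j)) * real k + C * (real j / real (i + j)) * real l"
    unfolding edge_diff[OF N j] t_def[symmetric] t'_def[symmetric] using a1 a2 a3 by linarith
  also have "\<dots> = C * real j * (1 / real (i + j)) * (1 + real k + real l)" by (simp add: algebra_simps add_divide_distrib)
  also have "\<dots> \<le> C * real j * ((2 + real k + real l) / real N) * (2 + real k + real l)"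
  proof (intro mult_mono mult_left_mono)
    \<comment> \<open>Exchanges i + j for N at the price of one more factor 2 + k + l, which the
      geometric weights absorb.\<close>
    have "real N \<le> real (i + j) * (2 + real k + real l)"
    proof -
      have "1 * (1 + real k + real l) \<le> real (i + j) * (1 + real k + real l)" using ij by (intro mult_right_mono) auto
      then show ?thesis unfolding N[symmetric] by (simp add: algebra_simps)
    qed
    then show "1 / real (i + j) \<le> (2 + real k + real l) / real N" using ij N by (simp add: divide_simps mult.commute)
  qed (use C0 in auto)
  finally have *: "\<bar>arg (Suc i) j k l - arg i j (Suc k) l\<bar> \<le> C * (real j / real N) * (2 + real k + real l)\<^sup>2"
    by (simp only: power2_eq_square times_divide_eq_left times_divide_eq_right mult_ac)
  have N0: "real N > 0" using N by simp
  have "\<bar>tst \<phi> s1 s2 N (Suc i) j k l - tst \<phi> s1 s2 N i j (Suc k) l\<bar> \<le> L * \<bar>arg (Suc i) j k l / real N - arg i j (Suc k) l / real N\<bar>"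
    unfolding tst_arg using N unit[of "Suc i" j k l N] unit[of i j "Suc k" l N] by (intro lip) auto
  then have "real N * \<bar>tst \<phi> s1 s2 N (Suc i) j k l - tst \<phi> s1 s2 N i j (Suc k) l\<bar> \<le> real N * (L * \<bar>arg (Suc i) j k l / real N - arg i j (Suc k) l / real N\<bar>)"
    using N0 by (intro mult_left_mono) auto
  also have "\<dots> = L * \<bar>arg (Suc i) j k l - arg i j (Suc k) l\<bar>"
    using N0 by (simp add: diff_divide_distrib[symmetric] abs_divide)
  also have "\<dots> \<le> L * (C * (real j / real N) * (2 + real k + real l)\<^sup>2)" by (rule mult_left_mono[OF * L0])
  finally show ?thesis by (simp add: mult.assoc)
qed

text \<open>With k fixed and i close to N t, the fraction of particles at \<open>X1\<close> tends to
  t at both ends of the edge. The change of s1 along the edge tends to 0, and the particle that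
  moves changes the argument by 1 - s1(t), in units of 1/N.\<close>

lemma edge_limit:
  assumes t: "0 < t" "t < 1"
  shows "(\<lambda>N. real N * (tst \<phi> s1 s2 N (Suc (nat \<lfloor>real N * t\<rfloor>)) (N - 1 - nat \<lfloor>real N * t\<rfloor> - k) k 0
      - tst \<phi> s1 s2 N (nat \<lfloor>real N * t\<rfloor>) (N - 1 - nat \<lfloor>real N * t\<rfloor> - k) (Suc k) 0)) \<longlonglongrightarrow> \<kappa> t * (1 - s1 t)"
    and "(\<lambda>N. real (N - 1 - nat \<lfloor>real N * t\<rfloor> - k) / real N) \<longlonglongrightarrow> 1 - t"
    and "eventually (\<lambda>N. k < N - 1 - nat \<lfloor>real N * t\<rfloor>) sequentially"
proof -
  define i where "i N = nat \<lfloor>real N * t\<rfloor>" for N :: nat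
  define j where "j N = N - 1 - i N - k" for N
  have ib: "real (i N) \<le> real N * t" "real N * t < real (i N) + 1" for N
  proof -
    have "0 \<le> real N * t" using t by simp
    then show "real (i N) \<le> real N * t" "real N * t < real (i N) + 1" unfolding i_def by linarith+
  qed
  have iN: "(\<lambda>N. real (i N) / real N) \<longlonglongrightarrow> t"
  proof (rule tendsto_sandwich)
    show "eventually (\<lambda>N. t - 1 / real N \<le> real (i N) / real N) sequentially"
      using eventually_gt_at_top[of 0]
    proof eventually_elim
      case (elim N)
      have "(real N * t - 1) / real N \<le> real (i N) / real N" using ib(2)[of N] by (intro divide_right_mono) auto
      then show ?case using elim by (simp add: diff_divide_distrib)
    qed
    show "eventually (\<lambda>N. real (i N) / real N \<le> t) sequentially"
      using eventually_gt_at_top[of 0]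
    proof eventually_elim
      case (elim N) then show ?case using ib(1)[of N] by (simp add: pos_divide_le_eq mult.commute)
    qed
    show "(\<lambda>N. t - 1 / real N) \<longlonglongrightarrow> t" by real_asymp
  qed simp
  have "eventually (\<lambda>N. real (k + 2) < real N * (1 - t)) sequentially" using t by real_asymp
  then have big: "eventually (\<lambda>N. i N + k + 2 \<le> N) sequentially"
  proof eventually_elim
    case (elim N)
    then have "real (i N + k + 2) < real N" using ib(1)[of N] by (simp add: algebra_simps)
    then show ?case by linarith
  qed
  show "eventually (\<lambda>N. k < N - 1 - nat \<lfloor>real N * t\<rfloor>) sequentially"
    unfolding i_def[symmetric] using big by eventually_elim linarith
  have jr: "eventually (\<lambda>N. real (j N) = real N - 1 - real (i N) - real k \<and> Suc (i N + j N + k) = N \<and> 1 \<le> j N) sequentially"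
    using big by eventually_elim (auto simp: j_def of_nat_diff)
  have "(\<lambda>N. 1 - real (i N) / real N - (1 + real k) / real N) \<longlonglongrightarrow> 1 - t - 0"
    by (intro tendsto_diff tendsto_const iN) real_asymp
  then have "(\<lambda>N. 1 - real (i N) / real N - (1 + real k) / real N) \<longlonglongrightarrow> 1 - t" by simp
  then show "(\<lambda>N. real (N - 1 - nat \<lfloor>real N * t\<rfloor> - k) / real N) \<longlonglongrightarrow> 1 - t"
  proof (rule Lim_transform_eventually)
    show "eventually (\<lambda>N. 1 - real (i N) / real N - (1 + real k) / real N = real (N - 1 - nat \<lfloor>real N * t\<rfloor> - k) / real N) sequentially"
      unfolding i_def[symmetric] j_def[symmetric] using jr eventually_gt_at_top[of 0]
    proof eventually_elim
      case (elim N)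
      have "real (j N) = real N - real (i N) - (1 + real k)" using elim by linarith
      then show ?case using elim(2) by (simp only: diff_divide_distrib) simp
    qed
  qed
  define t1 where "t1 N = real (Suc (i N)) / real (Suc (i N) + j N)" for N
  define t2 where "t2 N = real (i N) / real (i N + j N)" for N
  have "(\<lambda>N. (real (i N) / real N + 1 / real N) * (real N / (real N - real k))) \<longlonglongrightarrow> (t + 0) * 1"
    by (intro tendsto_mult tendsto_add iN) real_asymp+
  then have "(\<lambda>N. (real (i N) / real N + 1 / real N) * (real N / (real N - real k))) \<longlonglongrightarrow> t" by simp
  then have t1: "t1 \<longlonglongrightarrow> t"
  proof (rule Lim_transform_eventually)
    show "eventually (\<lambda>N. (real (i N) / real N + 1 / real N) * (real N / (real N - real k)) = t1 N) sequentially"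
      using jr eventually_gt_at_top[of 0]
    proof eventually_elim
      case (elim N)
      then have "real (Suc (i N) + j N) = real N - real k" by simp
      then show ?case unfolding t1_def using elim by (simp add: add_divide_distrib[symmetric])
    qed
  qed
  have "(\<lambda>N. (real (i N) / real N) * (real N / (real N - real k - 1))) \<longlonglongrightarrow> t * 1"
    by (intro tendsto_mult iN) real_asymp
  then have "(\<lambda>N. (real (i N) / real N) * (real N / (real N - real k - 1))) \<longlonglongrightarrow> t" by simp
  then have t2: "t2 \<longlonglongrightarrow> t"
  proof (rule Lim_transform_eventually)
    show "eventually (\<lambda>N. (real (i N) / real N) * (real N / (real N - real k - 1)) = t2 N) sequentially"
      using jr eventually_gt_at_top[of 0]
    proof eventually_elim
      case (elim N)
      then have "real (i N + j N) = real N - real k - 1" by simp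
      then show ?case unfolding t2_def using elim by simp
    qed
  qed
  have tb: "0 \<le> t1 N" "t1 N \<le> 1" "0 \<le> t2 N" "t2 N \<le> 1" for N
    unfolding t1_def t2_def using ratio[of "Suc (i N)" "j N"] ratio[of "i N" "j N"] by auto
  have s1c: "(\<lambda>N. s1 (x N)) \<longlonglongrightarrow> s1 t" if "x \<longlonglongrightarrow> t" "\<And>N. 0 \<le> x N \<and> x N \<le> 1" for x :: "nat \<Rightarrow> real"
  proof (rule LIM_zero_cancel, rule Lim_null_comparison)
    show "eventually (\<lambda>N. norm (s1 (x N) - s1 t) \<le> C * \<bar>x N - t\<bar>) sequentially"
      using s1l[of _ t] that(2) t by (intro always_eventually) auto
    have "(\<lambda>N. C * \<bar>x N - t\<bar>) \<longlonglongrightarrow> C * \<bar>t - t\<bar>" by (intro tendsto_intros that(1))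
    then show "(\<lambda>N. C * \<bar>x N - t\<bar>) \<longlonglongrightarrow> 0" by simp
  qed
  have st1: "(\<lambda>N. s1 (t1 N)) \<longlonglongrightarrow> s1 t" by (rule s1c[OF t1]) (use tb in auto)
  have st2: "(\<lambda>N. s1 (t2 N)) \<longlonglongrightarrow> s1 t" by (rule s1c[OF t2]) (use tb in auto)
  define u where "u N = arg (Suc (i N)) (j N) k 0 / real N" for N
  define v where "v N = arg (i N) (j N) (Suc k) 0 / real N" for N
  have inv: "(\<lambda>N. 1 / real N) \<longlonglongrightarrow> 0" by real_asymp
  have "(\<lambda>N. real (i N) / real N + (1 + s1 (t1 N) * real k) * (1 / real N)) \<longlonglongrightarrow> t + (1 + s1 t * real k) * 0"
    by (intro tendsto_intros iN st1 inv)
  then have ul: "u \<longlonglongrightarrow> t" unfolding u_def arg_def t1_def by (simp add: add_divide_distrib algebra_simps)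
  have "(\<lambda>N. real (i N) / real N + (s1 (t2 N) * real (Suc k)) * (1 / real N)) \<longlonglongrightarrow> t + (s1 t * real (Suc k)) * 0"
    by (intro tendsto_intros iN st2 inv)
  then have vl: "v \<longlonglongrightarrow> t" unfolding v_def arg_def t2_def by (simp add: add_divide_distrib)
  have "(\<lambda>N. (1 - s1 (t2 N)) + (s1 (t1 N) - s1 (t2 N)) * real k) \<longlonglongrightarrow> (1 - s1 t) + (s1 t - s1 t) * real k"
    by (intro tendsto_intros st1 st2)
  then have uvl: "(\<lambda>N. (1 - s1 (t2 N)) + (s1 (t1 N) - s1 (t2 N)) * real k) \<longlonglongrightarrow> 1 - s1 t" by simp
  have "\<exists>z. eventually (\<lambda>N. min (u N) (v N) \<le> z N \<and> z N \<le> max (u N) (v N) \<and> 0 \<le> z N \<and> z N \<le> 1 \<and> \<phi> (u N) - \<phi> (v N) = \<kappa> (z N) * (u N - v N)) sequentially"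
  proof -
    have "\<exists>z. Suc (i N + j N + k) = N \<longrightarrow> (min (u N) (v N) \<le> z \<and> z \<le> max (u N) (v N) \<and> 0 \<le> z \<and> z \<le> 1 \<and> \<phi> (u N) - \<phi> (v N) = \<kappa> z * (u N - v N))" for N
    proof (cases "Suc (i N + j N + k) = N")
      case True
      have b: "0 \<le> u N" "u N \<le> 1" "0 \<le> v N" "v N \<le> 1"
        unfolding u_def v_def using unit[of "Suc (i N)" "j N" k 0 N] unit[of "i N" "j N" "Suc k" 0 N] True by auto
      obtain z where "min (u N) (v N) \<le> z" "z \<le> max (u N) (v N)" "\<phi> (u N) - \<phi> (v N) = \<kappa> z * (u N - v N)" by (rule mvt[OF b]) (rule that)
      then show ?thesis using b by (intro exI[of _ z]) auto
    qed simp
    then obtain z where z: "\<And>N. Suc (i N + j N + k) = N \<longrightarrow> (min (u N) (v N) \<le> z N \<and> z N \<le> max (u N) (v N) \<and> 0 \<le> z N \<and> z N \<le> 1 \<and> \<phi> (u N) - \<phi> (v N) = \<kappa> (z N) * (u N - v N))" by metis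
    show ?thesis by (intro exI[of _ z]) (use jr in eventually_elim, use z in blast)
  qed
  then obtain z where z: "eventually (\<lambda>N. min (u N) (v N) \<le> z N \<and> z N \<le> max (u N) (v N) \<and> 0 \<le> z N \<and> z N \<le> 1 \<and> \<phi> (u N) - \<phi> (v N) = \<kappa> (z N) * (u N - v N)) sequentially" by blast
  have zl: "z \<longlonglongrightarrow> t"
  proof (rule tendsto_sandwich)
    show "(\<lambda>N. min (u N) (v N)) \<longlonglongrightarrow> t" using tendsto_min[OF ul vl] by simp
    show "(\<lambda>N. max (u N) (v N)) \<longlonglongrightarrow> t" using tendsto_max[OF ul vl] by simp
    show "eventually (\<lambda>N. min (u N) (v N) \<le> z N) sequentially" "eventually (\<lambda>N. z N \<le> max (u N) (v N)) sequentially"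
      using z by (auto elim: eventually_mono)
  qed
  have kz: "(\<lambda>N. \<kappa> (z N)) \<longlonglongrightarrow> \<kappa> t"
  proof (rule continuous_on_tendsto_compose[OF cont\<kappa> zl])
    show "t \<in> {0..1}" using t by simp
    show "eventually (\<lambda>N. z N \<in> {0..1}) sequentially" using z by (auto elim: eventually_mono)
  qed
  have "(\<lambda>N. \<kappa> (z N) * ((1 - s1 (t2 N)) + (s1 (t1 N) - s1 (t2 N)) * real k)) \<longlonglongrightarrow> \<kappa> t * (1 - s1 t)"
    by (intro tendsto_mult kz uvl)
  then show "(\<lambda>N. real N * (tst \<phi> s1 s2 N (Suc (nat \<lfloor>real N * t\<rfloor>)) (N - 1 - nat \<lfloor>real N * t\<rfloor> - k) k 0
      - tst \<phi> s1 s2 N (nat \<lfloor>real N * t\<rfloor>) (N - 1 - nat \<lfloor>real N * t\<rfloor> - k) (Suc k) 0)) \<longlonglongrightarrow> \<kappa> t * (1 - s1 t)"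
  proof (rule Lim_transform_eventually)
    show "eventually (\<lambda>N. \<kappa> (z N) * ((1 - s1 (t2 N)) + (s1 (t1 N) - s1 (t2 N)) * real k) = real N * (tst \<phi> s1 s2 N (Suc (nat \<lfloor>real N * t\<rfloor>)) (N - 1 - nat \<lfloor>real N * t\<rfloor> - k) k 0
      - tst \<phi> s1 s2 N (nat \<lfloor>real N * t\<rfloor>) (N - 1 - nat \<lfloor>real N * t\<rfloor> - k) (Suc k) 0)) sequentially"
      unfolding i_def[symmetric] j_def[symmetric] using z jr
    proof eventually_elim
      case (elim N)
      have N0: "real N > 0" using elim by linarith
      have "real N * (tst \<phi> s1 s2 N (Suc (i N)) (j N) k 0 - tst \<phi> s1 s2 N (i N) (j N) (Suc k) 0) = \<kappa> (z N) * (real N * (u N - v N))"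
        using elim unfolding tst_arg u_def[symmetric] v_def[symmetric] by simp
      also have "real N * (u N - v N) = arg (Suc (i N)) (j N) k 0 - arg (i N) (j N) (Suc k) 0"
        using N0 by (simp add: u_def v_def diff_divide_distrib[symmetric])
      also have "\<dots> = (1 - s1 (t2 N)) + (s1 (t1 N) - s1 (t2 N)) * real k"
        using edge_diff[of "i N" "j N" k 0 N] elim unfolding t1_def t2_def by simp
      finally show ?case by simp
    qed
  qed
qed

end

section \<open>Energy of the test function, one family of edges at a time\<close>

definition SY :: "real \<Rightarrow> real \<Rightarrow> real \<Rightarrow> real \<Rightarrow> nat \<Rightarrow> (nat \<Rightarrow> nat \<Rightarrow> nat \<Rightarrow> nat \<Rightarrow> real) \<Rightarrow> real" where
  "SY \<rho> a b d K g = (\<Sum>(i,j,k,l)\<in>quad K. d\<^sup>2 * a ^ k * b ^ l * (\<rho> * (prd d k * prd d l * wgt d i * wgt d j) * (g i j (Suc k) l - g i j k (Suc l))\<^sup>2))"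

lemma sum_quad_main:
  fixes G :: "nat \<Rightarrow> nat \<Rightarrow> nat \<Rightarrow> real"
  shows "(\<Sum>(i,j,k,l)\<in>quad K. if l = 0 \<and> j \<ge> 1 then G i j k else 0) = (\<Sum>i<Suc K. \<Sum>k<K - i. G i (K - i - k) k)"
proof -
  have "(\<Sum>(i,j,k,l)\<in>quad K. if l = 0 \<and> j \<ge> 1 then G i j k else 0) = (\<Sum>(i,j,k,l)\<in>{x\<in>quad K. snd (snd (snd x)) = 0 \<and> fst (snd x) \<ge> 1}. G i j k)"
    by (rule sum.mono_neutral_cong_right) (auto simp: finite_quad split: if_splits)
  also have "\<dots> = (\<Sum>(i,k)\<in>Sigma {..<Suc K} (\<lambda>i. {..<K - i}). G i (K - i - k) k)"
    by (rule sum.reindex_bij_witness[where i="\<lambda>(i,k). (i, K - i - k, k, 0)" and j="\<lambda>(i,j,k,l). (i,k)"]) (auto simp: quad_def)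
  also have "\<dots> = (\<Sum>i<Suc K. \<Sum>k<K - i. G i (K - i - k) k)" by (rule sum.Sigma[symmetric]) auto
  finally show ?thesis .
qed

lemma sum_triple_prod:
  fixes f g :: "nat \<Rightarrow> real"
  shows "(\<Sum>i\<le>K. \<Sum>k\<le>K. \<Sum>l\<le>K. c * f k * g l) = real (Suc K) * c * ((\<Sum>k\<le>K. f k) * (\<Sum>l\<le>K. g l))"
  by (simp add: sum_distrib_left[symmetric] sum_distrib_right[symmetric] mult.assoc)

context tfun begin

text \<open>Configurations with l = 0 and j positive give the limit. If l and j are positive, one
  more site is occupied and a further factor d appears. If j = 0 and i is positive, the increment is
  zero. If i = j = 0, all remaining particles sit at \<open>Y\<close> sites, and the exponentially
  small weight is compared with the power of d by \<open>sub\<close>.\<close>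

lemma edge_upper:
  fixes d :: "nat \<Rightarrow> real"
  assumes dp: "\<And>N. N \<ge> 1 \<Longrightarrow> 0 < d N" and d0: "d \<longlonglongrightarrow> 0" and dN: "(\<lambda>N. d N * real N) \<longlonglongrightarrow> 0"
    and sub: "\<And>c. 0 < c \<Longrightarrow> c < 1 \<Longrightarrow> (\<lambda>N. real N ^ 4 * c ^ N / d N) \<longlonglongrightarrow> 0"
    and a: "0 < a" "a < 1" and b: "0 < b" "b < 1" and \<rho>: "\<rho> \<ge> 0"
    and F: "continuous_on {0..1} F" "\<And>t. 0 < t \<Longrightarrow> t < 1 \<Longrightarrow> F t = (\<kappa> t * (1 - s1 t))\<^sup>2 / (1 - t)"
  shows "\<exists>U. eventually (\<lambda>N. (real N)\<^sup>2 / (d N) ^ 3 * SX \<rho> a b (d N) (N - 1) (tst \<phi> s1 s2 N) \<le> U N) sequentially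
     \<and> U \<longlonglongrightarrow> \<rho> / (1 - a) * integral {0..1} F"
proof -
  define e where "e N = exp (d N * real N)" for N
  define \<Delta> where "\<Delta> N i j k = tst \<phi> s1 s2 N (Suc i) j k 0 - tst \<phi> s1 s2 N i j (Suc k) 0" for N i j k
  define f where "f N i = (\<Sum>k<N - 1 - i. a ^ k * (real N / real (N - 1 - i - k)) * (real N * \<Delta> N i (N - 1 - i - k) k)\<^sup>2)" for N i
  define A where "A = (\<Sum>k. a ^ k * (2 + real k) ^ 4)"
  define B where "B = (\<Sum>k. b ^ k * (2 + real k) ^ 4)"
  have sA: "summable (\<lambda>k. a ^ k * (2 + real k) ^ 4)" and sB: "summable (\<lambda>k. b ^ k * (2 + real k) ^ 4)"
    by (rule summable_poly_geo[OF a] summable_poly_geo[OF b])+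
  have Aub: "(\<Sum>k\<in>S. a ^ k * (2 + real k) ^ 4) \<le> A" if "finite S" for S
    unfolding A_def using a that by (intro sum_le_suminf[OF sA]) auto
  have Bub: "(\<Sum>k\<in>S. b ^ k * (2 + real k) ^ 4) \<le> B" if "finite S" for S
    unfolding B_def using b that by (intro sum_le_suminf[OF sB]) auto
  have A0: "A \<ge> 0" and B0: "B \<ge> 0" using Aub[of "{}"] Bub[of "{}"] by auto
  have tb: "a ^ k * (real N / real j) * (real N * \<Delta> N i j k)\<^sup>2 \<le> (L * C)\<^sup>2 * (a ^ k * (2 + real k) ^ 4)"
    if ij: "Suc (i + j + k) = N" "j \<ge> 1" for N i j k
  proof -
    have jN: "0 < real j" "real j \<le> real N" "0 < real N" using ij by auto
    have "real N * \<bar>\<Delta> N i j k\<bar> \<le> L * C * (real j / real N) * (2 + real k)\<^sup>2"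
      unfolding \<Delta>_def using edge_bound[of i j k 0 N] ij by simp
    then have "(real N * \<bar>\<Delta> N i j k\<bar>)\<^sup>2 \<le> (L * C * (real j / real N) * (2 + real k)\<^sup>2)\<^sup>2" by (rule power_mono) simp
    then have 1: "(real N * \<Delta> N i j k)\<^sup>2 \<le> (L * C * (real j / real N) * (2 + real k)\<^sup>2)\<^sup>2" by (simp add: power_mult_distrib)
    have "(real N / real j) * (real N * \<Delta> N i j k)\<^sup>2 \<le> (real N / real j) * (L * C * (real j / real N) * (2 + real k)\<^sup>2)\<^sup>2"
      by (rule mult_left_mono[OF 1]) simp
    also have "\<dots> = (real N / real j) * (real j / real N) * ((L * C)\<^sup>2 * (2 + real k) ^ 4) * (real j / real N)"
      by (simp add: power2_eq_square power4_eq_xxxx mult_ac)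
    also have "(real N / real j) * (real j / real N) = 1" using jN by simp
    also have "1 * ((L * C)\<^sup>2 * (2 + real k) ^ 4) * (real j / real N) \<le> (L * C)\<^sup>2 * (2 + real k) ^ 4"
      using jN by (simp only: mult_1) (rule mult_left_le, auto simp: divide_le_eq_1)
    finally have "(real N / real j) * (real N * \<Delta> N i j k)\<^sup>2 \<le> (L * C)\<^sup>2 * (2 + real k) ^ 4" .
    then have "a ^ k * ((real N / real j) * (real N * \<Delta> N i j k)\<^sup>2) \<le> a ^ k * ((L * C)\<^sup>2 * (2 + real k) ^ 4)"
      using a by (intro mult_left_mono) auto
    then show ?thesis by (simp only: mult_ac)
  qed
  have f0: "0 \<le> f N i" for N i unfolding f_def using a by (intro sum_nonneg mult_nonneg_nonneg) auto
  have fB: "\<bar>f N i\<bar> \<le> (L * C)\<^sup>2 * A" for N i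
  proof -
    have "f N i \<le> (\<Sum>k<N - 1 - i. (L * C)\<^sup>2 * (a ^ k * (2 + real k) ^ 4))"
      unfolding f_def by (intro sum_mono tb) auto
    also have "\<dots> \<le> (L * C)\<^sup>2 * A" unfolding sum_distrib_left[symmetric] by (intro mult_left_mono Aub) auto
    finally show ?thesis using f0[of N i] by simp
  qed
  have flim: "(\<lambda>N. f N (nat \<lfloor>real N * t\<rfloor>)) \<longlonglongrightarrow> F t / (1 - a)" if t: "0 < t" "t < 1" for t
  proof -
    define i where "i N = nat \<lfloor>real N * t\<rfloor>" for N :: nat
    define w where "w k N = (if k < N - 1 - i N then a ^ k * (real N / real (N - 1 - i N - k)) * (real N * \<Delta> N (i N) (N - 1 - i N - k) k)\<^sup>2 else 0)" for k N
    have fw: "f N (i N) = (\<Sum>k. w k N)" for N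
      unfolding f_def by (subst suminf_finite[of "{..<N - 1 - i N}"]) (auto simp: w_def intro!: sum.cong)
    have wl: "(\<lambda>N. w k N) \<longlonglongrightarrow> a ^ k * F t" for k
    proof -
      note el = edge_limit[OF t, of k, folded i_def]
      have "(\<lambda>N. a ^ k * inverse (real (N - 1 - i N - k) / real N) * (real N * \<Delta> N (i N) (N - 1 - i N - k) k)\<^sup>2) \<longlonglongrightarrow> a ^ k * inverse (1 - t) * (\<kappa> t * (1 - s1 t))\<^sup>2"
        unfolding \<Delta>_def using t by (intro tendsto_intros el(1,2)) auto
      also have "a ^ k * inverse (1 - t) * (\<kappa> t * (1 - s1 t))\<^sup>2 = a ^ k * F t" using F(2)[OF t] by (simp add: divide_inverse mult_ac)
      finally show ?thesis
        by (rule Lim_transform_eventually) (use el(3) in eventually_elim, simp add: w_def)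
    qed
    have wb: "norm (w k N) \<le> (L * C)\<^sup>2 * (a ^ k * (2 + real k) ^ 4)" for k N
    proof (cases "k < N - 1 - i N")
      case True
      have "0 \<le> a ^ k * (real N / real (N - 1 - i N - k)) * (real N * \<Delta> N (i N) (N - 1 - i N - k) k)\<^sup>2" using a by (intro mult_nonneg_nonneg) auto
      moreover have "a ^ k * (real N / real (N - 1 - i N - k)) * (real N * \<Delta> N (i N) (N - 1 - i N - k) k)\<^sup>2 \<le> (L * C)\<^sup>2 * (a ^ k * (2 + real k) ^ 4)"
        using True by (intro tb) auto
      ultimately show ?thesis using True by (simp add: w_def)
    qed (use a in \<open>simp add: w_def\<close>)
    \<comment> \<open>Tannery's theorem exchanges the limit with the sum over k; what remains is the
      geometric series, which produces 1/(1 - a).\<close>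
    have "(\<lambda>N. suminf (\<lambda>k. w k N)) \<longlonglongrightarrow> (\<Sum>k. a ^ k * F t)"
      using tannerys_theorem[of w "\<lambda>k. a ^ k * F t" sequentially "\<lambda>k. (L * C)\<^sup>2 * (a ^ k * (2 + real k) ^ 4)"] wl wb summable_mult[OF sA]
      by (simp add: always_eventually)
    also have "(\<Sum>k. a ^ k * F t) = F t / (1 - a)" using a by (subst suminf_mult2[symmetric]) (auto simp: summable_geometric suminf_geometric)
    finally show ?thesis unfolding fw[symmetric] i_def .
  qed
  have "continuous_on {0..1} (\<lambda>t. F t / (1 - a))" using a by (intro continuous_intros F(1)) auto
  from riemann_dct[OF fB flim this]
  have main_lim: "(\<lambda>N. (\<Sum>i<N. f N i) / real N) \<longlonglongrightarrow> integral {0..1} F / (1 - a)" by simp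
  define c where "c = max a b"
  have c: "0 < c" "c < 1" "a \<le> c" "b \<le> c" using a b by (auto simp: c_def)
  \<comment> \<open>Main term, configurations with both \<open>Y\<close> sites occupied, and
    configurations with both \<open>X\<close> sites empty. In the last term two powers of N come
    from the normalisation and two from a crude count of configurations.\<close>
  define U where "U N = \<rho> * e N ^ 3 * ((\<Sum>i<N. f N i) / real N) + \<rho> * e N ^ 4 * (L * C)\<^sup>2 * A * B * d N + \<rho> * e N ^ 3 * L\<^sup>2 / c * (real N ^ 4 * c ^ N / d N)" for N
  have el: "e \<longlonglongrightarrow> 1" unfolding e_def using tendsto_exp[OF dN] by simp
  have "U \<longlonglongrightarrow> \<rho> * 1 ^ 3 * (integral {0..1} F / (1 - a)) + \<rho> * 1 ^ 4 * (L * C)\<^sup>2 * A * B * 0 + \<rho> * 1 ^ 3 * L\<^sup>2 / c * 0"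
    unfolding U_def using c by (intro tendsto_intros el main_lim d0 sub) auto
  then have Ul: "U \<longlonglongrightarrow> \<rho> / (1 - a) * integral {0..1} F" by simp
  have "eventually (\<lambda>N. d N < 1) sequentially" using order_tendstoD(2)[OF d0, of 1] by simp
  then have "eventually (\<lambda>N. (real N)\<^sup>2 / (d N) ^ 3 * SX \<rho> a b (d N) (N - 1) (tst \<phi> s1 s2 N) \<le> U N) sequentially"
    using eventually_ge_at_top[of 1]
  proof eventually_elim
    case (elim N)
    define K where "K = N - 1"
    have N: "N = Suc K" using elim by (simp add: K_def)
    define D where "D = d N"
    define E where "E = e N"
    have D: "0 < D" "D \<le> 1" using dp[of N] elim by (auto simp: D_def)
    have E1: "E \<ge> 1" unfolding E_def e_def using D by (simp add: D_def)
    have Nr: "real N > 0" "real N \<ge> 1" using elim by auto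
    have prdE: "prd D n \<le> E" "0 \<le> prd D n" if "n \<le> N" for n
      unfolding E_def e_def D_def[symmetric] using prd_le[of D n N] prd_ge_1[of D n] D that by auto
    have wE: "wgt D n \<le> E" "n \<ge> 1 \<Longrightarrow> wgt D n \<le> E * D / real n" "wgt D n \<ge> 0" if "n \<le> N" for n
      unfolding E_def e_def D_def[symmetric] using wgt_le[OF D that] by auto
    define T where "T i j k l = tst \<phi> s1 s2 N (Suc i) j k l - tst \<phi> s1 s2 N i j (Suc k) l" for i j k l
    define mn where "mn i j k = \<rho> * E ^ 3 * (a ^ k * (real N / real j) * (real N * \<Delta> N i j k)\<^sup>2) / real N" for i j k
    define e1 where "e1 k l = \<rho> * E ^ 4 * (L * C)\<^sup>2 * D / real N * (a ^ k * (2 + real k) ^ 4) * (b ^ l * (2 + real l) ^ 4)" for k l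
    define e2 where "e2 i = (if i = (0::nat) then \<rho> * E ^ 3 * L\<^sup>2 * ((real N)\<^sup>2 * c ^ K / D) else 0)" for i
    have e10: "e1 k l \<ge> 0" for k l unfolding e1_def using \<rho> E1 D a b by (intro mult_nonneg_nonneg divide_nonneg_nonneg) auto
    have e20: "e2 i \<ge> 0" for i unfolding e2_def using \<rho> E1 D c by (auto intro!: mult_nonneg_nonneg divide_nonneg_nonneg)
    have mn0: "mn i j k \<ge> 0" for i j k unfolding mn_def using \<rho> E1 a by (intro mult_nonneg_nonneg divide_nonneg_nonneg) auto
    have term_le: "(real N)\<^sup>2 / D ^ 3 * (D\<^sup>2 * a ^ k * b ^ l * (\<rho> * (prd D i * prd D k * wgt D j * wgt D l) * (T i j k l)\<^sup>2))
       \<le> (if l = 0 \<and> j \<ge> 1 then mn i j k else 0) + e1 k l + e2 i" if q: "i + j + k + l = K" for i j k l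
    proof -
      have le: "i \<le> N" "j \<le> N" "k \<le> N" "l \<le> N" using q N by auto
      have q': "Suc (i + j + k + l) = N" using q N by simp
      have pp: "prd D i * prd D k \<le> E * E" using prdE le E1 by (intro mult_mono) auto
      have pp0: "0 \<le> prd D i * prd D k" using prdE le by simp
      have eq: "(real N)\<^sup>2 / D ^ 3 * (D\<^sup>2 * a ^ k * b ^ l * (\<rho> * (prd D i * prd D k * wgt D j * wgt D l) * (T i j k l)\<^sup>2))
        = (\<rho> * (a ^ k * b ^ l) * (real N * T i j k l)\<^sup>2 / D) * (prd D i * prd D k * (wgt D j * wgt D l))"
        using D by (simp add: power2_eq_square power3_eq_cube field_simps)
      have pre0: "0 \<le> \<rho> * (a ^ k * b ^ l) * (real N * T i j k l)\<^sup>2 / D" using \<rho> a b D by (intro mult_nonneg_nonneg divide_nonneg_nonneg) auto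
      consider "j \<ge> 1" "l = 0" | "j \<ge> 1" "l \<ge> 1" | "j = 0" "i \<ge> 1" | "j = 0" "i = 0" by linarith
      then show ?thesis
      proof cases
        case 1
        have "prd D i * prd D k * (wgt D j * wgt D l) \<le> E * E * (E * D / real j)"
          by (rule mult_mono[OF pp]) (use 1 wE[OF le(2)] E1 in auto)
        then have "(\<rho> * (a ^ k * b ^ l) * (real N * T i j k l)\<^sup>2 / D) * (prd D i * prd D k * (wgt D j * wgt D l))
          \<le> (\<rho> * (a ^ k * b ^ l) * (real N * T i j k l)\<^sup>2 / D) * (E * E * (E * D / real j))" by (rule mult_left_mono[OF _ pre0])
        also have "\<dots> = mn i j k" unfolding mn_def \<Delta>_def T_def using 1 D Nr by (simp add: power3_eq_cube)
        finally show ?thesis unfolding eq using 1 e10[of k l] e20[of i] by simp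
      next
        case 2
        have "prd D i * prd D k * (wgt D j * wgt D l) \<le> E * E * ((E * D / real j) * (E * D))"
        proof -
          have "wgt D l \<le> E * D / real l" using wE(2)[OF le(4)] 2 by simp
          also have "\<dots> \<le> E * D / 1" using 2 D E1 by (intro divide_left_mono) auto
          finally have "wgt D l \<le> E * D" by simp
          then have "wgt D j * wgt D l \<le> (E * D / real j) * (E * D)" using wE[OF le(2)] wE[OF le(4)] 2 E1 D by (intro mult_mono) auto
          then show ?thesis by (rule mult_mono[OF pp]) (use E1 wE(3)[OF le(2)] wE(3)[OF le(4)] in auto)
        qed
        then have "(\<rho> * (a ^ k * b ^ l) * (real N * T i j k l)\<^sup>2 / D) * (prd D i * prd D k * (wgt D j * wgt D l))
          \<le> (\<rho> * (a ^ k * b ^ l) * (real N * T i j k l)\<^sup>2 / D) * (E * E * ((E * D / real j) * (E * D)))" by (rule mult_left_mono[OF _ pre0])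
        also have "\<dots> = (\<rho> * E ^ 4 * D * (a ^ k * b ^ l)) * ((real N * T i j k l)\<^sup>2 / real j)"
          using D by (simp add: power4_eq_xxxx)
        also have "\<dots> \<le> (\<rho> * E ^ 4 * D * (a ^ k * b ^ l)) * ((L * C)\<^sup>2 * ((2 + real k) ^ 4 * (2 + real l) ^ 4) / real N)"
        proof (rule mult_left_mono)
          have jr: "real j > 0" "real j \<le> real N" using 2 le by auto
          have "real N * \<bar>T i j k l\<bar> \<le> L * C * (real j / real N) * (2 + real k + real l)\<^sup>2"
            unfolding T_def by (rule edge_bound[OF q' 2(1)])
          also have "\<dots> \<le> L * C * (real j / real N) * ((2 + real k) * (2 + real l))\<^sup>2"
            using L0 C0 by (intro mult_left_mono power_mono) (auto simp: algebra_simps)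
          finally have "(real N * \<bar>T i j k l\<bar>)\<^sup>2 \<le> (L * C * (real j / real N) * ((2 + real k) * (2 + real l))\<^sup>2)\<^sup>2" by (rule power_mono) simp
          then have "(real N * T i j k l)\<^sup>2 \<le> (L * C * (real j / real N) * ((2 + real k) * (2 + real l))\<^sup>2)\<^sup>2" by (simp add: power_mult_distrib)
          then have "(real N * T i j k l)\<^sup>2 / real j \<le> (L * C * (real j / real N) * ((2 + real k) * (2 + real l))\<^sup>2)\<^sup>2 / real j"
            by (rule divide_right_mono) simp
          also have "\<dots> = (L * C)\<^sup>2 * ((2 + real k) ^ 4 * (2 + real l) ^ 4) / real N * (real j / real N)"
            using jr by (simp add: power2_eq_square power4_eq_xxxx)
          also have "\<dots> \<le> (L * C)\<^sup>2 * ((2 + real k) ^ 4 * (2 + real l) ^ 4) / real N"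
            using jr Nr by (intro mult_left_le) (auto simp: divide_le_eq_1)
          finally show "(real N * T i j k l)\<^sup>2 / real j \<le> (L * C)\<^sup>2 * ((2 + real k) ^ 4 * (2 + real l) ^ 4) / real N" .
          show "0 \<le> \<rho> * E ^ 4 * D * (a ^ k * b ^ l)" using \<rho> E1 D a b by (intro mult_nonneg_nonneg) auto
        qed
        also have "\<dots> = e1 k l" unfolding e1_def by simp
        finally show ?thesis unfolding eq using 2 e20[of i] by simp
      next
        case 3
        have "T i j k l = 0" unfolding T_def using edge_zero[of i k l N] q' 3 by simp
        then show ?thesis using mn0[of i j k] e10[of k l] e20[of i] by simp
      next
        case 4
        have Tb: "(T i j k l)\<^sup>2 \<le> L\<^sup>2"
          using edge_any[OF q'] unfolding T_def[symmetric] by (metis L0 abs_ge_zero power2_abs power_mono)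
        have ab: "a ^ k * b ^ l \<le> c ^ K"
        proof -
          have "a ^ k * b ^ l \<le> c ^ k * c ^ l" using a b c by (intro mult_mono power_mono) auto
          also have "\<dots> = c ^ K" using q 4 by (simp add: power_add[symmetric])
          finally show ?thesis .
        qed
        have "prd D i * prd D k * (wgt D j * wgt D l) \<le> E * E * E"
          by (rule mult_mono[OF pp]) (use 4 wE[OF le(4)] E1 in auto)
        then have "(\<rho> * (a ^ k * b ^ l) * (real N * T i j k l)\<^sup>2 / D) * (prd D i * prd D k * (wgt D j * wgt D l))
          \<le> (\<rho> * (a ^ k * b ^ l) * (real N * T i j k l)\<^sup>2 / D) * (E * E * E)" by (rule mult_left_mono[OF _ pre0])
        also have "\<dots> \<le> (\<rho> * c ^ K * ((real N)\<^sup>2 * L\<^sup>2) / D) * (E * E * E)"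
          using \<rho> ab Tb D E1 a b c
          by (intro mult_right_mono divide_right_mono mult_mono mult_left_mono) (auto simp: power_mult_distrib intro!: mult_left_mono mult_nonneg_nonneg)
        also have "\<dots> = e2 i" using 4 by (simp add: e2_def power3_eq_cube)
        finally show ?thesis unfolding eq using 4 mn0[of i j k] e10[of k l] by simp
      qed
    qed
    have "(real N)\<^sup>2 / D ^ 3 * SX \<rho> a b D K (tst \<phi> s1 s2 N)
      \<le> (\<Sum>(i,j,k,l)\<in>quad K. (if l = 0 \<and> j \<ge> 1 then mn i j k else 0) + e1 k l + e2 i)"
      unfolding SX_def sum_distrib_left
    proof (rule sum_mono)
      fix x assume "x \<in> quad K"
      then obtain i j k l where x: "x = (i,j,k,l)" "i + j + k + l = K" by (cases x) (auto simp: quad_def)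
      show "(real N)\<^sup>2 / D ^ 3 * (case x of (i,j,k,l) \<Rightarrow> D\<^sup>2 * a ^ k * b ^ l * (\<rho> * (prd D i * prd D k * wgt D j * wgt D l) * (tst \<phi> s1 s2 N (Suc i) j k l - tst \<phi> s1 s2 N i j (Suc k) l)\<^sup>2))
        \<le> (case x of (i,j,k,l) \<Rightarrow> (if l = 0 \<and> j \<ge> 1 then mn i j k else 0) + e1 k l + e2 i)"
        using term_le[OF x(2)] unfolding x(1) T_def prod.case .
    qed
    also have "\<dots> = (\<Sum>(i,j,k,l)\<in>quad K. if l = 0 \<and> j \<ge> 1 then mn i j k else 0) + (\<Sum>(i,j,k,l)\<in>quad K. e1 k l) + (\<Sum>(i,j,k,l)\<in>quad K. e2 i)"
      by (simp add: sum.distrib case_prod_beta')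
    also have "(\<Sum>(i,j,k,l)\<in>quad K. if l = 0 \<and> j \<ge> 1 then mn i j k else 0) = \<rho> * E ^ 3 * ((\<Sum>i<N. f N i) / real N)"
      unfolding sum_quad_main N[symmetric] f_def K_def[symmetric] mn_def
      by (simp add: sum_distrib_left sum_divide_distrib mult.assoc)
    also have "(\<Sum>(i,j,k,l)\<in>quad K. e1 k l) \<le> \<rho> * E ^ 4 * (L * C)\<^sup>2 * A * B * D"
    proof -
      have "(\<Sum>(i,j,k,l)\<in>quad K. e1 k l) \<le> (\<Sum>i\<le>K. \<Sum>k\<le>K. \<Sum>l\<le>K. e1 k l)" by (rule quad_sum_le[of "\<lambda>i k l. e1 k l"]) (rule e10)
      also have "\<dots> = real (Suc K) * (\<rho> * E ^ 4 * (L * C)\<^sup>2 * D / real N) * ((\<Sum>k\<le>K. a ^ k * (2 + real k) ^ 4) * (\<Sum>l\<le>K. b ^ l * (2 + real l) ^ 4))"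
        unfolding e1_def by (rule sum_triple_prod)
      also have "\<dots> \<le> real (Suc K) * (\<rho> * E ^ 4 * (L * C)\<^sup>2 * D / real N) * (A * B)"
        using Aub Bub A0 \<rho> E1 D b by (intro mult_left_mono mult_mono sum_nonneg mult_nonneg_nonneg divide_nonneg_nonneg) auto
      also have "\<dots> = \<rho> * E ^ 4 * (L * C)\<^sup>2 * A * B * D" unfolding N[symmetric] using Nr by (simp add: mult_ac)
      finally show ?thesis .
    qed
    also have "(\<Sum>(i,j,k,l)\<in>quad K. e2 i) \<le> \<rho> * E ^ 3 * L\<^sup>2 / c * (real N ^ 4 * c ^ N / D)"
    proof -
      have "(\<Sum>(i,j,k,l)\<in>quad K. e2 i) \<le> (\<Sum>i\<le>K. \<Sum>k\<le>K. \<Sum>l\<le>K. e2 i)" by (rule quad_sum_le[of "\<lambda>i k l. e2 i"]) (rule e20)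
      also have "\<dots> = real N * real N * (\<Sum>i\<le>K. e2 i)" by (simp add: sum_distrib_left N mult.assoc)
      also have "(\<Sum>i\<le>K. e2 i) = \<rho> * E ^ 3 * L\<^sup>2 * ((real N)\<^sup>2 * c ^ K / D)" by (simp add: e2_def)
      also have "real N * real N * (\<rho> * E ^ 3 * L\<^sup>2 * ((real N)\<^sup>2 * c ^ K / D)) = \<rho> * E ^ 3 * L\<^sup>2 / c * (real N ^ 4 * c ^ N / D)"
        using c unfolding N by (simp add: power2_eq_square power4_eq_xxxx mult_ac)
      finally show ?thesis .
    qed
    finally show ?case unfolding U_def D_def[symmetric] E_def[symmetric] K_def[symmetric] by simp
  qed
  then show ?thesis using Ul by blast
qed

text \<open>The increment vanishes unless both \<open>X\<close> sites are occupied, and then each of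
  them contributes a factor d. Together with an increment of order 1/N and about N values of i, the
  normalised energy is of order d N.\<close>

lemma y_edge_upper:
  fixes d :: "nat \<Rightarrow> real"
  assumes dp: "\<And>N. N \<ge> 1 \<Longrightarrow> 0 < d N" and d0: "d \<longlonglongrightarrow> 0" and dN: "(\<lambda>N. d N * real N) \<longlonglongrightarrow> 0"
    and a: "0 < a" "a < 1" and b: "0 < b" "b < 1" and \<rho>: "\<rho> \<ge> 0" and s0: "s1 0 = 0" "s2 0 = 0"
  shows "\<exists>U. eventually (\<lambda>N. (real N)\<^sup>2 / (d N) ^ 3 * SY \<rho> a b (d N) (N - 1) (tst \<phi> s1 s2 N) \<le> U N) sequentially
     \<and> U \<longlonglongrightarrow> 0"
proof -
  define e where "e N = exp (d N * real N)" for N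
  have Aub: "(\<Sum>k\<in>S. a ^ k) \<le> 1 / (1 - a)" if "finite S" for S
    using sum_le_suminf[of "\<lambda>k. a ^ k" S] that a by (simp add: summable_geometric suminf_geometric)
  have Bub: "(\<Sum>k\<in>S. b ^ k) \<le> 1 / (1 - b)" if "finite S" for S
    using sum_le_suminf[of "\<lambda>k. b ^ k" S] that b by (simp add: summable_geometric suminf_geometric)
  define U where "U N = \<rho> * e N ^ 4 * L\<^sup>2 * (1 / (1 - a) * (1 / (1 - b))) * (d N * real N)" for N
  have el: "e \<longlonglongrightarrow> 1" unfolding e_def using tendsto_exp[OF dN] by simp
  have "U \<longlonglongrightarrow> \<rho> * 1 ^ 4 * L\<^sup>2 * (1 / (1 - a) * (1 / (1 - b))) * 0"
    unfolding U_def by (intro tendsto_mult tendsto_power el dN tendsto_const)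
  then have Ul: "U \<longlonglongrightarrow> 0" by simp
  have "eventually (\<lambda>N. d N < 1) sequentially" using order_tendstoD(2)[OF d0, of 1] by simp
  then have "eventually (\<lambda>N. (real N)\<^sup>2 / (d N) ^ 3 * SY \<rho> a b (d N) (N - 1) (tst \<phi> s1 s2 N) \<le> U N) sequentially"
    using eventually_ge_at_top[of 1]
  proof eventually_elim
    case (elim N)
    define K where "K = N - 1"
    have N: "N = Suc K" using elim by (simp add: K_def)
    define D where "D = d N"
    define E where "E = e N"
    have D: "0 < D" "D \<le> 1" using dp[of N] elim by (auto simp: D_def)
    have E1: "E \<ge> 1" unfolding E_def e_def using D by (simp add: D_def)
    have Nr: "real N > 0" "real N \<ge> 1" using elim by auto
    have prdE: "prd D n \<le> E" "0 \<le> prd D n" if "n \<le> N" for n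
      unfolding E_def e_def D_def[symmetric] using prd_le[of D n N] prd_ge_1[of D n] D that by auto
    have wE: "wgt D n \<le> E * D" if "n \<le> N" "n \<ge> 1" for n
    proof -
      have "wgt D n \<le> E * D / real n" unfolding E_def e_def D_def[symmetric] using wgt_le(2)[OF D that] by simp
      also have "\<dots> \<le> E * D / 1" using that D E1 by (intro divide_left_mono) auto
      finally show ?thesis by simp
    qed
    have w0: "wgt D n \<ge> 0" for n using wgt_pos[OF D(1), of n] by simp
    define T where "T i j k l = tst \<phi> s1 s2 N i j (Suc k) l - tst \<phi> s1 s2 N i j k (Suc l)" for i j k l
    define e1 where "e1 k l = \<rho> * E ^ 4 * L\<^sup>2 * D * a ^ k * b ^ l" for k l
    have e10: "e1 k l \<ge> 0" for k l unfolding e1_def using \<rho> E1 D a b by (intro mult_nonneg_nonneg) auto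
    have term_le: "(real N)\<^sup>2 / D ^ 3 * (D\<^sup>2 * a ^ k * b ^ l * (\<rho> * (prd D k * prd D l * wgt D i * wgt D j) * (T i j k l)\<^sup>2)) \<le> e1 k l"
      if q: "i + j + k + l = K" for i j k l
    proof -
      have le: "i \<le> N" "j \<le> N" "k \<le> N" "l \<le> N" using q N by auto
      have eq: "(real N)\<^sup>2 / D ^ 3 * (D\<^sup>2 * a ^ k * b ^ l * (\<rho> * (prd D k * prd D l * wgt D i * wgt D j) * (T i j k l)\<^sup>2))
        = (\<rho> * (a ^ k * b ^ l) / D) * ((real N * T i j k l)\<^sup>2 * (prd D k * prd D l * (wgt D i * wgt D j)))"
        using D by (simp add: power2_eq_square power3_eq_cube field_simps)
      consider "i = 0" | "j = 0" "i \<ge> 1" | "i \<ge> 1" "j \<ge> 1" by linarith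
      then show ?thesis
      proof cases
        case 1
        then have "T i j k l = 0" using s0 by (simp add: T_def tst_def)
        then show ?thesis using e10 by simp
      next
        case 2
        then have "T i j k l = 0" using s1(2) s2(2) by (simp add: T_def tst_def add_ac)
        then show ?thesis using e10 by simp
      next
        case 3
        define t where "t = real i / real (i + j)"
        have u: "0 \<le> arg i j (Suc k) l / real N \<and> arg i j (Suc k) l / real N \<le> 1" "0 \<le> arg i j k (Suc l) / real N \<and> arg i j k (Suc l) / real N \<le> 1"
          by (rule unit, use q N in simp)+
        have "\<bar>T i j k l\<bar> \<le> L * \<bar>arg i j (Suc k) l / real N - arg i j k (Suc l) / real N\<bar>"
          unfolding T_def tst_arg using u by (intro lip) auto
        also have "arg i j (Suc k) l / real N - arg i j k (Suc l) / real N = (s1 t - s2 t) / real N"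
          unfolding arg_def t_def by (simp add: diff_divide_distrib[symmetric] algebra_simps)
        also have "L * \<bar>(s1 t - s2 t) / real N\<bar> \<le> L * (1 / real N)"
        proof (rule mult_left_mono[OF _ L0])
          have "\<bar>s1 t - s2 t\<bar> \<le> 1" using s1(1)[OF ratio[of i j]] s2(1)[OF ratio[of i j]] unfolding t_def by linarith
          then show "\<bar>(s1 t - s2 t) / real N\<bar> \<le> 1 / real N" using Nr by (simp add: abs_divide divide_right_mono)
        qed
        finally have "real N * \<bar>T i j k l\<bar> \<le> L" using Nr by (simp add: pos_le_divide_eq mult.commute)
        then have "(real N * \<bar>T i j k l\<bar>)\<^sup>2 \<le> L\<^sup>2" by (rule power_mono) simp
        then have T2: "(real N * T i j k l)\<^sup>2 \<le> L\<^sup>2" by (simp add: power_mult_distrib)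
        have pw: "prd D k * prd D l * (wgt D i * wgt D j) \<le> E * E * ((E * D) * (E * D))"
          using prdE le wE w0 3 E1 D by (intro mult_mono) auto
        have "(\<rho> * (a ^ k * b ^ l) / D) * ((real N * T i j k l)\<^sup>2 * (prd D k * prd D l * (wgt D i * wgt D j)))
          \<le> (\<rho> * (a ^ k * b ^ l) / D) * (L\<^sup>2 * (E * E * ((E * D) * (E * D))))"
        proof (rule mult_left_mono[OF mult_mono[OF T2 pw]])
          show "0 \<le> prd D k * prd D l * (wgt D i * wgt D j)" using prdE(2) le w0 by (intro mult_nonneg_nonneg)
          show "0 \<le> \<rho> * (a ^ k * b ^ l) / D" using \<rho> a b D by (intro mult_nonneg_nonneg divide_nonneg_nonneg) auto
        qed simp
        also have "\<dots> = e1 k l" unfolding e1_def using D by (simp add: power4_eq_xxxx)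
        finally show ?thesis unfolding eq .
      qed
    qed
    have "(real N)\<^sup>2 / D ^ 3 * SY \<rho> a b D K (tst \<phi> s1 s2 N) \<le> (\<Sum>(i,j,k,l)\<in>quad K. e1 k l)"
      unfolding SY_def sum_distrib_left
    proof (rule sum_mono)
      fix x assume "x \<in> quad K"
      then obtain i j k l where x: "x = (i,j,k,l)" "i + j + k + l = K" by (cases x) (auto simp: quad_def)
      show "(real N)\<^sup>2 / D ^ 3 * (case x of (i,j,k,l) \<Rightarrow> D\<^sup>2 * a ^ k * b ^ l * (\<rho> * (prd D k * prd D l * wgt D i * wgt D j) * (tst \<phi> s1 s2 N i j (Suc k) l - tst \<phi> s1 s2 N i j k (Suc l))\<^sup>2))
        \<le> (case x of (i,j,k,l) \<Rightarrow> e1 k l)"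
        using term_le[OF x(2)] unfolding x(1) T_def prod.case .
    qed
    also have "\<dots> \<le> (\<Sum>i\<le>K. \<Sum>k\<le>K. \<Sum>l\<le>K. e1 k l)" by (rule quad_sum_le[of "\<lambda>i k l. e1 k l"]) (rule e10)
    also have "\<dots> = real (Suc K) * (\<rho> * E ^ 4 * L\<^sup>2 * D) * ((\<Sum>k\<le>K. a ^ k) * (\<Sum>l\<le>K. b ^ l))"
      unfolding e1_def by (rule sum_triple_prod)
    also have "\<dots> \<le> real (Suc K) * (\<rho> * E ^ 4 * L\<^sup>2 * D) * (1 / (1 - a) * (1 / (1 - b)))"
      using Aub Bub \<rho> E1 D a b by (intro mult_left_mono mult_mono sum_nonneg mult_nonneg_nonneg) auto
    also have "\<dots> = U N" unfolding U_def N[symmetric] D_def[symmetric] E_def[symmetric] by (simp add: mult_ac)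
    finally show ?case unfolding D_def[symmetric] K_def[symmetric] .
  qed
  then show ?thesis using Ul by blast
qed

end

lemma quad_swap_Y: "(\<Sum>(i,j,k,l)\<in>quad K. f i j k l) = (\<Sum>(i,j,k,l)\<in>quad K. f i j l k)"
  by (rule sum.reindex_bij_witness[where i="\<lambda>(i,j,k,l). (i,j,l,k)" and j="\<lambda>(i,j,k,l). (i,j,l,k)"]) (auto simp: quad_def)

lemma quad_swap_X: "(\<Sum>(i,j,k,l)\<in>quad K. f i j k l) = (\<Sum>(i,j,k,l)\<in>quad K. f j i k l)"
  by (rule sum.reindex_bij_witness[where i="\<lambda>(i,j,k,l). (j,i,k,l)" and j="\<lambda>(i,j,k,l). (j,i,k,l)"]) (auto simp: quad_def)

text \<open>An inequality rather than an equality, since the edges at \<open>X2\<close> agree with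
  the reflected edges at \<open>X1\<close> except where both \<open>X\<close> sites are
  empty.\<close>

lemma SX_mono:
  assumes "d > 0" "a \<ge> 0" "b \<ge> 0" "\<rho> \<ge> 0"
    and "\<And>i j k l. i + j + k + l = K \<Longrightarrow> \<bar>g (Suc i) j k l - g i j (Suc k) l\<bar> \<le> \<bar>g' (Suc i) j k l - g' i j (Suc k) l\<bar>"
  shows "SX \<rho> a b d K g \<le> SX \<rho> a b d K g'"
  unfolding SX_def
proof (rule sum_mono, clarify)
  fix i j k l assume "(i, j, k, l) \<in> quad K"
  then have "\<bar>g (Suc i) j k l - g i j (Suc k) l\<bar> \<le> \<bar>g' (Suc i) j k l - g' i j (Suc k) l\<bar>" using assms(5) by (simp add: quad_def)
  then have *: "(g (Suc i) j k l - g i j (Suc k) l)\<^sup>2 \<le> (g' (Suc i) j k l - g' i j (Suc k) l)\<^sup>2" by (simp add: abs_le_square_iff)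
  have "prd d i \<ge> 0" "prd d k \<ge> 0" using prd_ge_1[of d i] prd_ge_1[of d k] assms(1) by auto
  moreover have "wgt d j \<ge> 0" "wgt d l \<ge> 0" using wgt_pos[OF assms(1)] by (auto simp: less_imp_le)
  ultimately show "d\<^sup>2 * a ^ k * b ^ l * (\<rho> * (prd d i * prd d k * wgt d j * wgt d l) * (g (Suc i) j k l - g i j (Suc k) l)\<^sup>2)
    \<le> d\<^sup>2 * a ^ k * b ^ l * (\<rho> * (prd d i * prd d k * wgt d j * wgt d l) * (g' (Suc i) j k l - g' i j (Suc k) l)\<^sup>2)"
    using assms by (intro mult_left_mono[OF mult_left_mono[OF *]] mult_nonneg_nonneg) auto
qed

lemma integral_reflect_unit:
  fixes f :: "real \<Rightarrow> real"
  assumes "continuous_on {0..1} f"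
  shows "integral {0..1} (\<lambda>t. f (1 - t)) = integral {0..1} f"
proof -
  have "(f has_integral integral {0..1} f) (cbox 0 1)"
    using integrable_integral[OF integrable_continuous_real[OF assms]] by simp
  from has_integral_affinity[OF this, of "-1" 1]
  have "((\<lambda>x. f (1 - x)) has_integral integral {0..1} f) ((\<lambda>x. - x + 1) ` {0..1})" by simp
  also have "(\<lambda>x. - x + 1) ` {0..1} = {0..1::real}" by (force intro!: image_eqI[where x="1 - _"])
  finally show ?thesis by (rule integral_unique)
qed

text \<open>With one particle at \<open>Y\<close> and a fraction \<open>t\<close> of the others at \<open>X1\<close>, this is the asymptotic probability
  that it is absorbed at \<open>X1\<close>.\<close>

definition sfun :: "real \<Rightarrow> real \<Rightarrow> real \<Rightarrow> real" where
  "sfun r1 r2 t = r1 * t / (r1 * t + r2 * (1 - t))"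

lemma convex_pos:
  fixes r1 r2 t :: real
  assumes "r1 > 0" "r2 > 0" "0 \<le> t" "t \<le> 1" shows "min r1 r2 \<le> r1 * t + r2 * (1 - t)" "r1 * t + r2 * (1 - t) > 0"
proof -
  have "min r1 r2 * t + min r1 r2 * (1 - t) \<le> r1 * t + r2 * (1 - t)"
    using assms by (intro add_mono mult_right_mono) auto
  then show "min r1 r2 \<le> r1 * t + r2 * (1 - t)" by (simp add: algebra_simps)
  then show "r1 * t + r2 * (1 - t) > 0" using assms by linarith
qed

lemma sfun_props:
  assumes r: "r1 > 0" "r2 > 0"
  shows "0 \<le> t \<Longrightarrow> t \<le> 1 \<Longrightarrow> 0 \<le> sfun r1 r2 t \<and> sfun r1 r2 t \<le> 1" "sfun r1 r2 1 = 1" "sfun r1 r2 0 = 0"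
    "0 \<le> t \<Longrightarrow> t \<le> 1 \<Longrightarrow> 0 \<le> t' \<Longrightarrow> t' \<le> 1 \<Longrightarrow> \<bar>sfun r1 r2 t - sfun r1 r2 t'\<bar> \<le> (r1 * r2 / (min r1 r2)\<^sup>2) * \<bar>t - t'\<bar>"
    "0 \<le> t \<Longrightarrow> t \<le> 1 \<Longrightarrow> 1 - sfun r1 r2 t = r2 * (1 - t) / (r1 * t + r2 * (1 - t))"
proof -
  show "sfun r1 r2 1 = 1" "sfun r1 r2 0 = 0" using r by (auto simp: sfun_def)
  show e: "1 - sfun r1 r2 t = r2 * (1 - t) / (r1 * t + r2 * (1 - t))" if "0 \<le> t" "t \<le> 1" for t
    using convex_pos(2)[OF r that] by (simp add: sfun_def field_simps)
  show "0 \<le> sfun r1 r2 t \<and> sfun r1 r2 t \<le> 1" if t: "0 \<le> t" "t \<le> 1"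
  proof
    show "0 \<le> sfun r1 r2 t" unfolding sfun_def using convex_pos(2)[OF r t] r t by (intro divide_nonneg_pos) auto
    have "0 \<le> 1 - sfun r1 r2 t" unfolding e[OF t] using convex_pos(2)[OF r t] r t by (intro divide_nonneg_pos) auto
    then show "sfun r1 r2 t \<le> 1" by simp
  qed
  assume t: "0 \<le> t" "t \<le> 1" "0 \<le> t'" "t' \<le> 1"
  define D D' where "D = r1 * t + r2 * (1 - t)" and "D' = r1 * t' + r2 * (1 - t')"
  have D: "D > 0" "D' > 0" "min r1 r2 \<le> D" "min r1 r2 \<le> D'" unfolding D_def D'_def using convex_pos[OF r] t by auto
  have "sfun r1 r2 t - sfun r1 r2 t' = (r1 * t * D' - r1 * t' * D) / (D * D')"
    unfolding sfun_def D_def[symmetric] D'_def[symmetric] using D by (simp add: field_simps)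
  also have "r1 * t * D' - r1 * t' * D = r1 * r2 * (t - t')" unfolding D_def D'_def by (simp add: algebra_simps)
  finally have "\<bar>sfun r1 r2 t - sfun r1 r2 t'\<bar> = r1 * r2 * \<bar>t - t'\<bar> / (D * D')" using D r by (simp add: abs_mult)
  also have "\<dots> \<le> r1 * r2 * \<bar>t - t'\<bar> / (min r1 r2)\<^sup>2"
    using D r by (intro divide_left_mono) (auto simp: power2_eq_square intro!: mult_mono mult_pos_pos)
  finally show "\<bar>sfun r1 r2 t - sfun r1 r2 t'\<bar> \<le> (r1 * r2 / (min r1 r2)\<^sup>2) * \<bar>t - t'\<bar>" by simp
qed

section \<open>Effective resistances and the optimal profile\<close>

context incl begin

text \<open>The resistance of the passage from \<open>X1\<close> to \<open>X2\<close> through p when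
  a fraction t is at \<open>X1\<close>: the edges on the two sides of p have resistances (1 - t)/r
  and t/r in series, and 1 - M p is the inverse of the geometric sum of the conductances over the
  number of particles at p.\<close>

definition Bf :: "site \<Rightarrow> real \<Rightarrow> real" where
  "Bf p t = (1 - M p) * ((1 - t) / r X1 p + t / r X2 p)"

definition Kf :: "real \<Rightarrow> real" where "Kf t = 1 / Bf Y1 t + 1 / Bf Y2 t"

definition R :: real where "R = Rfrak r m"

lemma R_eq: "R = integral {0..1} (\<lambda>t. 1 / Kf t)"
  unfolding R_def Rfrak_def Kf_def Bf_def by simp

lemma Bf_pos: "p \<in> {Y1, Y2} \<Longrightarrow> 0 \<le> t \<Longrightarrow> t \<le> 1 \<Longrightarrow> Bf p t > 0"
proof -
  assume p: "p \<in> {Y1, Y2}" and t: "0 \<le> t" "t \<le> 1"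
  have "1 / r X2 p * t + 1 / r X1 p * (1 - t) > 0" using rpos(1)[of X1 p] rpos(1)[of X2 p] p t by (intro convex_pos(2)) auto
  moreover have "1 - M p > 0" using M_Y p by auto
  ultimately show ?thesis unfolding Bf_def by (intro mult_pos_pos) (auto simp: algebra_simps)
qed

lemma cont_Bf: "continuous_on S (Bf p)"
  unfolding Bf_def divide_inverse by (intro continuous_intros)

lemma Kf_pos: "0 \<le> t \<Longrightarrow> t \<le> 1 \<Longrightarrow> Kf t > 0"
  unfolding Kf_def using Bf_pos[of Y1 t] Bf_pos[of Y2 t] by (intro add_pos_pos) auto

lemma cont_Kf: "continuous_on {0..1} Kf"
  unfolding Kf_def using Bf_pos by (intro continuous_intros cont_Bf) (auto simp: less_imp_neq[symmetric] dest!: Bf_pos[of Y1] Bf_pos[of Y2] intro: Bf_pos)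

lemma cont_invKf: "continuous_on {0..1} (\<lambda>t. 1 / Kf t)"
  using Kf_pos by (intro continuous_intros cont_Kf) force

lemma R_pos: "R > 0"
proof -
  obtain x where x: "x \<in> {0..1}" "\<And>y. y \<in> {0..1} \<Longrightarrow> 1 / Kf x \<le> 1 / Kf y"
    using continuous_attains_inf[OF _ _ cont_invKf] by auto
  have "1 / Kf x = integral {0..1} (\<lambda>t::real. 1 / Kf x)" by simp
  also have "\<dots> \<le> R" unfolding R_eq
    by (rule integral_le) (use x(2) integrable_continuous_real[OF cont_invKf] in auto)
  finally show ?thesis using Kf_pos[of x] x by (smt (verit) atLeastAtMost_iff divide_pos_pos)
qed

definition kp :: "real \<Rightarrow> real" where "kp t = 1 / (R * Kf t)"

definition ph :: "real \<Rightarrow> real" where "ph u = integral {0..u} kp"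

lemma cont_kp: "continuous_on {0..1} kp"
proof -
  have "kp = (\<lambda>t. 1 / R * (1 / Kf t))" by (simp add: kp_def fun_eq_iff)
  then show ?thesis using continuous_on_mult_left[OF cont_invKf, of "1 / R"] by simp
qed

lemma ph_deriv: "0 \<le> u \<Longrightarrow> u \<le> 1 \<Longrightarrow> (ph has_real_derivative kp u) (at u within {0..1})"
  unfolding ph_def[abs_def] by (rule integral_has_real_derivative[OF cont_kp]) simp

lemma ph_0: "ph 0 = 0" by (simp add: ph_def)

lemma ph_1: "ph 1 = 1"
proof -
  have "kp = (\<lambda>t. 1 / R * (1 / Kf t))" by (simp add: kp_def fun_eq_iff)
  then have "ph 1 = 1 / R * R" unfolding ph_def R_eq by (simp only: integral_mult_right)
  then show ?thesis using R_pos by simp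
qed

definition sp :: "site \<Rightarrow> real \<Rightarrow> real" where "sp p = sfun (r X1 p) (r X2 p)"

definition CL :: real where
  "CL = r X1 Y1 * r X2 Y1 / (min (r X1 Y1) (r X2 Y1))\<^sup>2 + r X1 Y2 * r X2 Y2 / (min (r X1 Y2) (r X2 Y2))\<^sup>2"

lemma sp_props:
  assumes p: "p \<in> {Y1, Y2}"
  shows "0 \<le> t \<Longrightarrow> t \<le> 1 \<Longrightarrow> 0 \<le> sp p t \<and> sp p t \<le> 1" "sp p 1 = 1" "sp p 0 = 0"
    "0 \<le> t \<Longrightarrow> t \<le> 1 \<Longrightarrow> 0 \<le> t' \<Longrightarrow> t' \<le> 1 \<Longrightarrow> \<bar>sp p t - sp p t'\<bar> \<le> CL * \<bar>t - t'\<bar>"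
proof -
  have r: "r X1 p > 0" "r X2 p > 0" using rpos(1) p by auto
  show "0 \<le> t \<Longrightarrow> t \<le> 1 \<Longrightarrow> 0 \<le> sp p t \<and> sp p t \<le> 1" "sp p 1 = 1" "sp p 0 = 0"
    unfolding sp_def using sfun_props(1-3)[OF r] by auto
  assume t: "0 \<le> t" "t \<le> 1" "0 \<le> t'" "t' \<le> 1"
  have "\<bar>sp p t - sp p t'\<bar> \<le> (r X1 p * r X2 p / (min (r X1 p) (r X2 p))\<^sup>2) * \<bar>t - t'\<bar>" unfolding sp_def by (rule sfun_props(4)[OF r t])
  also have "\<dots> \<le> CL * \<bar>t - t'\<bar>"
  proof (rule mult_right_mono)
    have "0 \<le> r X1 Y1 * r X2 Y1 / (min (r X1 Y1) (r X2 Y1))\<^sup>2" "0 \<le> r X1 Y2 * r X2 Y2 / (min (r X1 Y2) (r X2 Y2))\<^sup>2"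
      using r_nonneg by (auto intro!: divide_nonneg_nonneg mult_nonneg_nonneg)
    then show "r X1 p * r X2 p / (min (r X1 p) (r X2 p))\<^sup>2 \<le> CL" using p unfolding CL_def by auto
  qed simp
  finally show "\<bar>sp p t - sp p t'\<bar> \<le> CL * \<bar>t - t'\<bar>" .
qed

lemma kp_bound: "\<exists>L. \<forall>u. 0 \<le> u \<longrightarrow> u \<le> 1 \<longrightarrow> \<bar>kp u\<bar> \<le> L"
proof -
  have "compact (kp ` {0..1})" by (rule compact_continuous_image[OF cont_kp]) simp
  then have "bounded (kp ` {0..1})" by (rule compact_imp_bounded)
  then obtain a where "\<forall>x\<in>{0..1}. \<bar>kp x\<bar> \<le> a" by (auto simp: bounded_iff)
  then show ?thesis by (intro exI[of _ a]) auto
qed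

definition kL :: real where "kL = (SOME L. \<forall>u. 0 \<le> u \<longrightarrow> u \<le> 1 \<longrightarrow> \<bar>kp u\<bar> \<le> L)"

lemma kL: "0 \<le> u \<Longrightarrow> u \<le> 1 \<Longrightarrow> \<bar>kp u\<bar> \<le> kL"
  using someI_ex[OF kp_bound] unfolding kL_def by blast

lemma tfun_std: "p \<in> {Y1, Y2} \<Longrightarrow> p' \<in> {Y1, Y2} \<Longrightarrow> tfun ph kp (sp p) (sp p') kL CL"
  by unfold_locales (use ph_deriv cont_kp kL sp_props in auto)

lemma ph_reflect_deriv:
  assumes "0 \<le> u" "u \<le> 1"
  shows "((\<lambda>u. 1 - ph (1 - u)) has_real_derivative kp (1 - u)) (at u within {0..1})"
proof -
  have "((\<lambda>u. 1 - u) has_real_derivative -1) (at u within {0..1})" by (auto intro!: derivative_eq_intros)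
  moreover have "(ph has_real_derivative kp (1 - u)) (at (1 - u) within ((\<lambda>u. 1 - u) ` {0..1}))"
    by (rule DERIV_subset[OF ph_deriv]) (use assms in auto)
  ultimately have "((\<lambda>u. ph (1 - u)) has_real_derivative kp (1 - u) * -1) (at u within {0..1})"
    using DERIV_image_chain[of ph "kp (1 - u)" "\<lambda>u. 1 - u" u "{0..1}" "-1"] by (simp add: comp_def)
  then show ?thesis by (auto intro!: derivative_eq_intros)
qed

text \<open>The substitution of 1 - t for t exchanges the roles of \<open>X1\<close> and
  \<open>X2\<close>: the edges at \<open>X2\<close> become edges at \<open>X1\<close> for the
  reflected profile and the complementary absorption probabilities.\<close>

lemma tfun_refl: "p \<in> {Y1, Y2} \<Longrightarrow> p' \<in> {Y1, Y2} \<Longrightarrow>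
  tfun (\<lambda>u. 1 - ph (1 - u)) (\<lambda>u. kp (1 - u)) (\<lambda>t. 1 - sp p (1 - t)) (\<lambda>t. 1 - sp p' (1 - t)) kL CL"
proof unfold_locales
  assume p: "p \<in> {Y1, Y2}" "p' \<in> {Y1, Y2}"
  show "continuous_on {0..1} (\<lambda>u. kp (1 - u))"
    by (rule continuous_on_compose2[OF cont_kp]) (auto intro!: continuous_intros)
  fix t t' :: real assume t: "0 \<le> t" "t \<le> 1"
  show "((\<lambda>u. 1 - ph (1 - u)) has_real_derivative kp (1 - t)) (at t within {0..1})" by (rule ph_reflect_deriv[OF t])
  show "\<bar>kp (1 - t)\<bar> \<le> kL" using t by (intro kL) auto
  show "0 \<le> 1 - sp p (1 - t) \<and> 1 - sp p (1 - t) \<le> 1" using sp_props(1)[OF p(1), of "1 - t"] t by auto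
  show "0 \<le> 1 - sp p' (1 - t) \<and> 1 - sp p' (1 - t) \<le> 1" using sp_props(1)[OF p(2), of "1 - t"] t by auto
  assume t': "0 \<le> t'" "t' \<le> 1"
  show "\<bar>1 - sp p (1 - t) - (1 - sp p (1 - t'))\<bar> \<le> CL * \<bar>t - t'\<bar>"
    using sp_props(4)[OF p(1), of "1 - t'" "1 - t"] t t' by (simp add: abs_minus_commute)
  show "\<bar>1 - sp p' (1 - t) - (1 - sp p' (1 - t'))\<bar> \<le> CL * \<bar>t - t'\<bar>"
    using sp_props(4)[OF p(2), of "1 - t'" "1 - t"] t t' by (simp add: abs_minus_commute)
next
  assume p: "p \<in> {Y1, Y2}" "p' \<in> {Y1, Y2}"
  show "1 - sp p (1 - 1) = 1" "1 - sp p' (1 - 1) = 1" using sp_props(3)[OF p(1)] sp_props(3)[OF p(2)] by auto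
qed

definition test_fun :: "nat \<Rightarrow> (site \<Rightarrow> nat) \<Rightarrow> real" where
  "test_fun N \<eta> = tst ph (sp Y1) (sp Y2) N (\<eta> X1) (\<eta> X2) (\<eta> Y1) (\<eta> Y2)"

lemma test_fun_xi: "N \<ge> 1 \<Longrightarrow> test_fun N (xi N X1) = 1" "N \<ge> 1 \<Longrightarrow> test_fun N (xi N X2) = 0"
  by (simp_all add: test_fun_def tst_def xi_def ph_0 ph_1)

text \<open>At least one particle at an \<open>X\<close> site is required because the value 0 of the
  ratio 0/0 is not mapped to itself by the reflection.\<close>

lemma tst_swap:
  assumes "i + j + k + l = N" "i + j \<ge> 1"
  shows "tst (\<lambda>u. 1 - ph (1 - u)) (\<lambda>t. 1 - sp p (1 - t)) (\<lambda>t. 1 - sp p' (1 - t)) N j i k l = 1 - tst ph (sp p) (sp p') N i j k l"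
proof -
  have ij: "real (i + j) > 0" "real N > 0" using assms by auto
  have e: "1 - real j / real (j + i) = real i / real (i + j)" using ij by (simp add: field_simps)
  have "1 - (real j + (1 - sp p (real i / real (i + j))) * real k + (1 - sp p' (real i / real (i + j))) * real l) / real N
    = (real N - (real j + (1 - sp p (real i / real (i + j))) * real k + (1 - sp p' (real i / real (i + j))) * real l)) / real N"
    using ij by (simp add: diff_divide_distrib)
  also have "real N - (real j + (1 - sp p (real i / real (i + j))) * real k + (1 - sp p' (real i / real (i + j))) * real l)
    = real i + sp p (real i / real (i + j)) * real k + sp p' (real i / real (i + j)) * real l"
    unfolding assms(1)[symmetric] by (simp add: algebra_simps)
  finally show ?thesis unfolding tst_def e by simp
qed

lemma dform_test_fun_le:
  assumes d: "d > 0" and N: "N = Suc K"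
  defines "ph' \<equiv> \<lambda>u. 1 - ph (1 - u)" and "sr \<equiv> \<lambda>p t. 1 - sp p (1 - t)"
  shows "dform r M d K (test_fun N) (test_fun N) \<le> SX (r X1 Y1) (M Y1) (M Y2) d K (tst ph (sp Y1) (sp Y2) N)
    + SX (r X1 Y2) (M Y2) (M Y1) d K (tst ph (sp Y2) (sp Y1) N)
    + SX (r X2 Y1) (M Y1) (M Y2) d K (tst ph' (sr Y1) (sr Y2) N)
    + SX (r X2 Y2) (M Y2) (M Y1) d K (tst ph' (sr Y2) (sr Y1) N)
    + SY (M Y1 * r Y1 Y2) (M Y1) (M Y2) d K (tst ph (sp Y1) (sp Y2) N)"
proof -
  let ?g = "tst ph (sp Y1) (sp Y2) N"
  have sw: "?g i j k l = tst ph (sp Y2) (sp Y1) N i j l k" for i j k l by (simp add: tst_def add_ac)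
  have gc: "test_fun N (cf i j k l) = ?g i j k l" for i j k l by (simp add: test_fun_def)
  have edge: "\<bar>tst ph (sp p) (sp p') N i (Suc j) k l - tst ph (sp p) (sp p') N i j (Suc k) l\<bar>
    \<le> \<bar>tst ph' (sr p) (sr p') N (Suc j) i k l - tst ph' (sr p) (sr p') N j i (Suc k) l\<bar>"
    if "i + j + k + l = K" "p \<in> {Y1, Y2}" "p' \<in> {Y1, Y2}" for i j k l p p'
  proof (cases "i + j \<ge> 1")
    case True
    have "tst ph' (sr p) (sr p') N (Suc j) i k l = 1 - tst ph (sp p) (sp p') N i (Suc j) k l"
      unfolding ph'_def sr_def by (rule tst_swap) (use that N in auto)
    moreover have "tst ph' (sr p) (sr p') N j i (Suc k) l = 1 - tst ph (sp p) (sp p') N i j (Suc k) l"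
      unfolding ph'_def sr_def by (rule tst_swap) (use that N True in auto)
    ultimately show ?thesis by simp
  next
    case False
    then have "i = 0" "j = 0" by auto
    then show ?thesis using sp_props(3)[OF that(2)] sp_props(3)[OF that(3)] by (simp add: tst_def)
  qed
  have X2: "SX (r X2 p) a b d K (\<lambda>i j k l. tst ph (sp p) (sp p') N j i k l) \<le> SX (r X2 p) a b d K (tst ph' (sr p) (sr p') N)"
    if "p \<in> {Y1, Y2}" "p' \<in> {Y1, Y2}" "a \<ge> 0" "b \<ge> 0" for p p' a b
    by (rule SX_mono) (use d that r_nonneg edge in \<open>auto simp: add_ac\<close>)
  have "dform r M d K (test_fun N) (test_fun N) = 
      (\<Sum>(i,j,k,l)\<in>quad K. d\<^sup>2 * M Y1 ^ k * M Y2 ^ l * (r X1 Y1 * (prd d i * prd d k * wgt d j * wgt d l) * (?g (Suc i) j k l - ?g i j (Suc k) l)\<^sup>2))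
    + (\<Sum>(i,j,k,l)\<in>quad K. d\<^sup>2 * M Y1 ^ k * M Y2 ^ l * (r X1 Y2 * (prd d i * prd d l * wgt d j * wgt d k) * (?g (Suc i) j k l - ?g i j k (Suc l))\<^sup>2))
    + (\<Sum>(i,j,k,l)\<in>quad K. d\<^sup>2 * M Y1 ^ k * M Y2 ^ l * (r X2 Y1 * (prd d j * prd d k * wgt d i * wgt d l) * (?g i (Suc j) k l - ?g i j (Suc k) l)\<^sup>2))
    + (\<Sum>(i,j,k,l)\<in>quad K. d\<^sup>2 * M Y1 ^ k * M Y2 ^ l * (r X2 Y2 * (prd d j * prd d l * wgt d i * wgt d k) * (?g i (Suc j) k l - ?g i j k (Suc l))\<^sup>2))
    + (\<Sum>(i,j,k,l)\<in>quad K. d\<^sup>2 * M Y1 ^ k * M Y2 ^ l * (M Y1 * r Y1 Y2 * (prd d k * prd d l * wgt d i * wgt d j) * (?g i j (Suc k) l - ?g i j k (Suc l))\<^sup>2))"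
    unfolding dform_coord gc by (simp only: distrib_left sum.distrib case_prod_beta')
  also have "(\<Sum>(i,j,k,l)\<in>quad K. d\<^sup>2 * M Y1 ^ k * M Y2 ^ l * (r X1 Y2 * (prd d i * prd d l * wgt d j * wgt d k) * (?g (Suc i) j k l - ?g i j k (Suc l))\<^sup>2))
    = SX (r X1 Y2) (M Y2) (M Y1) d K (tst ph (sp Y2) (sp Y1) N)"
    unfolding SX_def sw by (subst quad_swap_Y) (simp only: mult.assoc mult.left_commute[of "M Y1 ^ _"])
  also have "(\<Sum>(i,j,k,l)\<in>quad K. d\<^sup>2 * M Y1 ^ k * M Y2 ^ l * (r X2 Y1 * (prd d j * prd d k * wgt d i * wgt d l) * (?g i (Suc j) k l - ?g i j (Suc k) l)\<^sup>2))
    = SX (r X2 Y1) (M Y1) (M Y2) d K (\<lambda>i j k l. ?g j i k l)"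
    unfolding SX_def by (subst quad_swap_X) simp
  also have "(\<Sum>(i,j,k,l)\<in>quad K. d\<^sup>2 * M Y1 ^ k * M Y2 ^ l * (r X2 Y2 * (prd d j * prd d l * wgt d i * wgt d k) * (?g i (Suc j) k l - ?g i j k (Suc l))\<^sup>2))
    = SX (r X2 Y2) (M Y2) (M Y1) d K (\<lambda>i j k l. tst ph (sp Y2) (sp Y1) N j i k l)"
    unfolding SX_def sw by (subst quad_swap_X, subst quad_swap_Y) (simp only: mult.assoc mult.left_commute[of "M Y1 ^ _"])
  finally show ?thesis
    unfolding SX_def[of "r X1 Y1", symmetric] SY_def[symmetric]
    using X2[of Y1 Y2 "M Y1" "M Y2"] X2[of Y2 Y1 "M Y2" "M Y1"] M_Y by simp
qed

text \<open>The four families add up to the integral of the squared derivative \<open>kp\<close>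
  times the local conductance \<open>Kf\<close>. Since \<open>kp\<close> is 1/(R \<open>Kf\<close>),
  the integrand is \<open>kp\<close>/R and the integral is 1/R: the profile has constant
  current.\<close>

lemma test_energy_upper:
  fixes d :: "nat \<Rightarrow> real"
  assumes dp: "\<And>N. N \<ge> 1 \<Longrightarrow> 0 < d N" and d0: "d \<longlonglongrightarrow> 0" and dN: "(\<lambda>N. d N * real N) \<longlonglongrightarrow> 0"
    and sub: "\<And>c. 0 < c \<Longrightarrow> c < 1 \<Longrightarrow> (\<lambda>N. real N ^ 4 * c ^ N / d N) \<longlonglongrightarrow> 0"
  shows "\<exists>U. eventually (\<lambda>N. (real N)\<^sup>2 / (d N) ^ 3 * dform r M (d N) (N - 1) (test_fun N) (test_fun N) \<le> U N) sequentially \<and> U \<longlonglongrightarrow> 1 / R"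
proof -
  define De where "De p t = r X1 p * t + r X2 p * (1 - t)" for p t
  have De: "De p t > 0" if "p \<in> {Y1, Y2}" "0 \<le> t" "t \<le> 1" for p t
    unfolding De_def using rpos(1) that by (intro convex_pos(2)) auto
  \<comment> \<open>The factor 1 - t from the conductance is already cancelled here, which keeps the
    integrand continuous up to the endpoints; likewise t in \<open>F2\<close>.\<close>
  define F1 where "F1 p t = (kp t)\<^sup>2 * ((r X2 p)\<^sup>2 * (1 - t) / (De p t)\<^sup>2)" for p t
  define F2 where "F2 p t = (kp t)\<^sup>2 * ((r X1 p)\<^sup>2 * t / (De p t)\<^sup>2)" for p t
  have contDe: "continuous_on {0..1} (De p)" for p unfolding De_def by (intro continuous_intros)
  have c1: "continuous_on {0..1} (F1 p)" if "p \<in> {Y1, Y2}" for p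
    unfolding F1_def using De[OF that] by (intro continuous_intros cont_kp contDe) force
  have c2: "continuous_on {0..1} (F2 p)" if "p \<in> {Y1, Y2}" for p
    unfolding F2_def using De[OF that] by (intro continuous_intros cont_kp contDe) force
  have c2': "continuous_on {0..1} (\<lambda>t. F2 p (1 - t))" if "p \<in> {Y1, Y2}" for p
    by (rule continuous_on_compose2[OF c2[OF that]]) (auto intro!: continuous_intros)
  have e1: "F1 p t = (kp t * (1 - sp p t))\<^sup>2 / (1 - t)" if p: "p \<in> {Y1, Y2}" and t: "0 < t" "t < 1" for p t
  proof -
    have "1 - sp p t = r X2 p * (1 - t) / De p t"
      unfolding sp_def De_def using sfun_props(5)[of "r X1 p" "r X2 p" t] rpos(1) p t by auto
    then show ?thesis unfolding F1_def using t by (simp add: power_mult_distrib power_divide power2_eq_square)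
  qed
  have e2: "F2 p (1 - t) = (kp (1 - t) * (1 - (1 - sp p (1 - t))))\<^sup>2 / (1 - t)" if p: "p \<in> {Y1, Y2}" and t: "0 < t" "t < 1" for p t
    unfolding F2_def sp_def sfun_def De_def using t by (simp add: power_mult_distrib power_divide power2_eq_square)
  have ne: "0 \<le> r X1 p" "0 \<le> r X2 p" "0 \<le> M Y1 * r Y1 Y2" for p using r_nonneg M_nonneg by auto
  obtain U1 where U1: "eventually (\<lambda>N. (real N)\<^sup>2 / (d N) ^ 3 * SX (r X1 Y1) (M Y1) (M Y2) (d N) (N - 1) (tst ph (sp Y1) (sp Y2) N) \<le> U1 N) sequentially"
     "U1 \<longlonglongrightarrow> r X1 Y1 / (1 - M Y1) * integral {0..1} (F1 Y1)"
    using tfun.edge_upper[OF tfun_std[of Y1 Y2] dp d0 dN sub M_Y ne(1) c1[of Y1] e1[of Y1]] by auto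
  obtain U2 where U2: "eventually (\<lambda>N. (real N)\<^sup>2 / (d N) ^ 3 * SX (r X1 Y2) (M Y2) (M Y1) (d N) (N - 1) (tst ph (sp Y2) (sp Y1) N) \<le> U2 N) sequentially"
     "U2 \<longlonglongrightarrow> r X1 Y2 / (1 - M Y2) * integral {0..1} (F1 Y2)"
    using tfun.edge_upper[OF tfun_std[of Y2 Y1] dp d0 dN sub M_Y(3,4,1,2) ne(1) c1[of Y2] e1[of Y2]] by auto
  obtain U3 where U3: "eventually (\<lambda>N. (real N)\<^sup>2 / (d N) ^ 3 * SX (r X2 Y1) (M Y1) (M Y2) (d N) (N - 1) (tst (\<lambda>u. 1 - ph (1 - u)) (\<lambda>t. 1 - sp Y1 (1 - t)) (\<lambda>t. 1 - sp Y2 (1 - t)) N) \<le> U3 N) sequentially"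
     "U3 \<longlonglongrightarrow> r X2 Y1 / (1 - M Y1) * integral {0..1} (\<lambda>t. F2 Y1 (1 - t))"
    using tfun.edge_upper[OF tfun_refl[of Y1 Y2] dp d0 dN sub M_Y ne(2) c2'[of Y1] e2[of Y1]] by auto
  obtain U4 where U4: "eventually (\<lambda>N. (real N)\<^sup>2 / (d N) ^ 3 * SX (r X2 Y2) (M Y2) (M Y1) (d N) (N - 1) (tst (\<lambda>u. 1 - ph (1 - u)) (\<lambda>t. 1 - sp Y2 (1 - t)) (\<lambda>t. 1 - sp Y1 (1 - t)) N) \<le> U4 N) sequentially"
     "U4 \<longlonglongrightarrow> r X2 Y2 / (1 - M Y2) * integral {0..1} (\<lambda>t. F2 Y2 (1 - t))"
    using tfun.edge_upper[OF tfun_refl[of Y2 Y1] dp d0 dN sub M_Y(3,4,1,2) ne(2) c2'[of Y2] e2[of Y2]] by auto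
  obtain U5 where U5: "eventually (\<lambda>N. (real N)\<^sup>2 / (d N) ^ 3 * SY (M Y1 * r Y1 Y2) (M Y1) (M Y2) (d N) (N - 1) (tst ph (sp Y1) (sp Y2) N) \<le> U5 N) sequentially" "U5 \<longlonglongrightarrow> 0"
    using tfun.y_edge_upper[OF tfun_std[of Y1 Y2] dp d0 dN M_Y ne(3) sp_props(3)[of Y1] sp_props(3)[of Y2]] by auto
  define U where "U N = U1 N + U2 N + U3 N + U4 N + U5 N" for N
  have lim: "U \<longlonglongrightarrow> r X1 Y1 / (1 - M Y1) * integral {0..1} (F1 Y1) + r X1 Y2 / (1 - M Y2) * integral {0..1} (F1 Y2)
      + r X2 Y1 / (1 - M Y1) * integral {0..1} (\<lambda>t. F2 Y1 (1 - t)) + r X2 Y2 / (1 - M Y2) * integral {0..1} (\<lambda>t. F2 Y2 (1 - t)) + 0"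
    unfolding U_def by (intro tendsto_add U1 U2 U3 U4 U5)
  have int: "integral {0..1} (\<lambda>t. F2 p (1 - t)) = integral {0..1} (F2 p)" if "p \<in> {Y1, Y2}" for p
    by (rule integral_reflect_unit[OF c2[OF that]])
  \<comment> \<open>The series law: \<open>sp p\<close> divides the drop across p in proportion to
    the resistances of the two edges, so their energies add up to that of a single resistor
    \<open>Bf p t\<close>.\<close>
  have pw: "r X1 p / (1 - M p) * F1 p t + r X2 p / (1 - M p) * F2 p t = (kp t)\<^sup>2 * (1 / Bf p t)" if p: "p \<in> {Y1, Y2}" and t: "0 \<le> t" "t \<le> 1" for p t
  proof -
    have r: "r X1 p > 0" "r X2 p > 0" using rpos(1) p by auto
    have M1: "1 - M p > 0" using M_Y p by auto
    have B: "Bf p t = (1 - M p) * (De p t / (r X1 p * r X2 p))" unfolding Bf_def De_def using r by (simp add: field_simps)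
    have "r X1 p / (1 - M p) * F1 p t + r X2 p / (1 - M p) * F2 p t
      = (kp t)\<^sup>2 / (1 - M p) * ((r X1 p * (r X2 p)\<^sup>2 * (1 - t) + r X2 p * (r X1 p)\<^sup>2 * t) / (De p t)\<^sup>2)"
      unfolding F1_def F2_def by (simp add: add_divide_distrib distrib_left mult_ac)
    also have "r X1 p * (r X2 p)\<^sup>2 * (1 - t) + r X2 p * (r X1 p)\<^sup>2 * t = r X1 p * r X2 p * De p t"
      unfolding De_def by (simp add: power2_eq_square algebra_simps)
    also have "(kp t)\<^sup>2 / (1 - M p) * (r X1 p * r X2 p * De p t / (De p t)\<^sup>2) = (kp t)\<^sup>2 * (1 / Bf p t)"
      unfolding B using De[OF p t] by (simp add: power2_eq_square)
    finally show ?thesis .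
  qed
  have "r X1 Y1 / (1 - M Y1) * integral {0..1} (F1 Y1) + r X1 Y2 / (1 - M Y2) * integral {0..1} (F1 Y2)
      + r X2 Y1 / (1 - M Y1) * integral {0..1} (F2 Y1) + r X2 Y2 / (1 - M Y2) * integral {0..1} (F2 Y2)
      = integral {0..1} (\<lambda>t. (r X1 Y1 / (1 - M Y1) * F1 Y1 t + r X2 Y1 / (1 - M Y1) * F2 Y1 t) + (r X1 Y2 / (1 - M Y2) * F1 Y2 t + r X2 Y2 / (1 - M Y2) * F2 Y2 t))"
  proof -
    have hI: "(G has_integral integral {0..1} G) {0..1}" if "continuous_on {0..1} G" for G :: "real \<Rightarrow> real"
      by (rule integrable_integral[OF integrable_continuous_real[OF that]])
    have "((\<lambda>t. (r X1 Y1 / (1 - M Y1) * F1 Y1 t + r X2 Y1 / (1 - M Y1) * F2 Y1 t) + (r X1 Y2 / (1 - M Y2) * F1 Y2 t + r X2 Y2 / (1 - M Y2) * F2 Y2 t)) has_integral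
      ((r X1 Y1 / (1 - M Y1) * integral {0..1} (F1 Y1) + r X2 Y1 / (1 - M Y1) * integral {0..1} (F2 Y1)) + (r X1 Y2 / (1 - M Y2) * integral {0..1} (F1 Y2) + r X2 Y2 / (1 - M Y2) * integral {0..1} (F2 Y2)))) {0..1}"
      by (intro has_integral_add has_integral_mult_right hI c1 c2) auto
    from integral_unique[OF this] show ?thesis by simp
  qed
  also have "\<dots> = integral {0..1} (\<lambda>t. 1 / R * kp t)"
  proof (rule Henstock_Kurzweil_Integration.integral_cong)
    fix t :: real assume "t \<in> {0..1}"
    then have t: "0 \<le> t" "t \<le> 1" by auto
    have "(r X1 Y1 / (1 - M Y1) * F1 Y1 t + r X2 Y1 / (1 - M Y1) * F2 Y1 t) + (r X1 Y2 / (1 - M Y2) * F1 Y2 t + r X2 Y2 / (1 - M Y2) * F2 Y2 t) = (kp t)\<^sup>2 * Kf t"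
    proof -
      have p1: "r X1 Y1 / (1 - M Y1) * F1 Y1 t + r X2 Y1 / (1 - M Y1) * F2 Y1 t = (kp t)\<^sup>2 * (1 / Bf Y1 t)" by (rule pw) (use t in auto)
      have p2: "r X1 Y2 / (1 - M Y2) * F1 Y2 t + r X2 Y2 / (1 - M Y2) * F2 Y2 t = (kp t)\<^sup>2 * (1 / Bf Y2 t)" by (rule pw) (use t in auto)
      show ?thesis unfolding p1 p2 Kf_def by (rule distrib_left[symmetric])
    qed
    also have "\<dots> = 1 / R * kp t" unfolding kp_def using Kf_pos[OF t] by (simp add: power2_eq_square)
    finally show "(r X1 Y1 / (1 - M Y1) * F1 Y1 t + r X2 Y1 / (1 - M Y1) * F2 Y1 t) + (r X1 Y2 / (1 - M Y2) * F1 Y2 t + r X2 Y2 / (1 - M Y2) * F2 Y2 t) = 1 / R * kp t" .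
  qed
  also have "\<dots> = 1 / R" using ph_1 unfolding ph_def by simp
  finally have lim': "U \<longlonglongrightarrow> 1 / R" using lim int[of Y1] int[of Y2] by simp
  have "eventually (\<lambda>N. (real N)\<^sup>2 / (d N) ^ 3 * dform r M (d N) (N - 1) (test_fun N) (test_fun N) \<le> U N) sequentially"
    using U1(1) U2(1) U3(1) U4(1) U5(1) eventually_ge_at_top[of 1]
  proof eventually_elim
    case (elim N)
    have dn: "d N > 0" using dp elim by simp
    have "0 \<le> (real N)\<^sup>2 / (d N) ^ 3" using dn by simp
    from mult_left_mono[OF dform_test_fun_le[OF dn, of N "N - 1"] this] elim
    show ?case unfolding U_def distrib_left by simp
  qed
  then show ?thesis using lim' by blast
qed

end

section \<open>Lower bound for the capacity\<close>

lemma floor_ratio_limit: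
  fixes t :: real assumes "0 < t"
  shows "(\<lambda>N. real (nat \<lfloor>real N * t\<rfloor>) / real N) \<longlonglongrightarrow> t"
proof (rule tendsto_sandwich)
  have ib: "real (nat \<lfloor>real N * t\<rfloor>) \<le> real N * t" "real N * t < real (nat \<lfloor>real N * t\<rfloor>) + 1" for N
  proof -
    have "0 \<le> real N * t" using assms by simp
    then show "real (nat \<lfloor>real N * t\<rfloor>) \<le> real N * t" "real N * t < real (nat \<lfloor>real N * t\<rfloor>) + 1" by linarith+
  qed
  show "eventually (\<lambda>N. t - 1 / real N \<le> real (nat \<lfloor>real N * t\<rfloor>) / real N) sequentially"
    using eventually_gt_at_top[of 0]
  proof eventually_elim
    case (elim N)
    have "(real N * t - 1) / real N \<le> real (nat \<lfloor>real N * t\<rfloor>) / real N" using ib(2)[of N] by (intro divide_right_mono) auto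
    then show ?case using elim by (simp add: diff_divide_distrib)
  qed
  show "eventually (\<lambda>N. real (nat \<lfloor>real N * t\<rfloor>) / real N \<le> t) sequentially"
    using eventually_gt_at_top[of 0]
  proof eventually_elim
    case (elim N) then show ?case using ib(1)[of N] by (simp add: pos_divide_le_eq mult.commute)
  qed
  show "(\<lambda>N. t - 1 / real N) \<longlonglongrightarrow> t" by real_asymp
qed simp

text \<open>Summation by parts. \<open>W\<close> is known to be small but its increments are not
  controlled in sum; they are traded for the increments of the smooth weight \<rho>.\<close>

lemma abel_bound:
  fixes \<rho> W :: "nat \<Rightarrow> real"
  assumes W: "\<And>n. n \<le> m \<Longrightarrow> \<bar>W n\<bar> \<le> B" and \<rho>: "\<bar>\<rho> 0\<bar> \<le> 1" "\<bar>\<rho> m\<bar> \<le> 1" and V: "\<And>n. n < m \<Longrightarrow> \<bar>\<rho> (Suc n) - \<rho> n\<bar> \<le> v"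
  shows "\<bar>\<Sum>n<m. \<rho> n * (W (Suc n) - W n)\<bar> \<le> B * (2 + real m * v)"
proof -
  have B0: "0 \<le> B" using W[of 0] by simp
  have e: "(\<Sum>n<m. \<rho> n * (W (Suc n) - W n)) = \<rho> m * W m - \<rho> 0 * W 0 - (\<Sum>n<m. (\<rho> (Suc n) - \<rho> n) * W (Suc n))" for m
    by (induction m) (simp_all add: algebra_simps)
  have e1: "\<bar>\<rho> m * W m\<bar> \<le> 1 * B" unfolding abs_mult using W[of m] \<rho> B0 by (intro mult_mono) auto
  have e2: "\<bar>\<rho> 0 * W 0\<bar> \<le> 1 * B" unfolding abs_mult using W[of 0] \<rho> B0 by (intro mult_mono) auto
  have e3: "\<bar>\<Sum>n<m. (\<rho> (Suc n) - \<rho> n) * W (Suc n)\<bar> \<le> (\<Sum>n<m. v * B)"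
  proof (intro order_trans[OF sum_abs] sum_mono)
    fix n assume "n \<in> {..<m}"
    then have "\<bar>\<rho> (Suc n) - \<rho> n\<bar> \<le> v" "\<bar>W (Suc n)\<bar> \<le> B" using V[of n] W[of "Suc n"] by auto
    then show "\<bar>(\<rho> (Suc n) - \<rho> n) * W (Suc n)\<bar> \<le> v * B" unfolding abs_mult by (intro mult_mono) auto
  qed
  have "B * (2 + real m * v) = B + B + (\<Sum>n<m. v * B)" by (simp add: algebra_simps)
  then show ?thesis unfolding e using e1 e2 e3 by linarith
qed

text \<open>The bound x stands for n + 1 or similar, so that n = 0, where the weight is 1, is
  covered by the same formula.\<close>

lemma wgt_ge:
  assumes d: "0 < d" "d \<le> 1" and x: "real n \<le> x" "1 \<le> x" shows "d / x \<le> wgt d n"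
proof (cases n)
  case 0
  then show ?thesis using d x by (simp add: divide_le_eq_1)
next
  case (Suc n')
  have "d / x \<le> d / real (Suc n')" using d x Suc by (intro divide_left_mono) auto
  also have "\<dots> \<le> d * prd d n' / real (Suc n')" using prd_ge_1[of d n'] d by (intro divide_right_mono) auto
  finally show ?thesis unfolding Suc wgt_Suc_prd .
qed

text \<open>The dual form of a quadratic energy: a lower bound that is linear in the unknown
  increment y, with x as flow through the edge and \<tau> as its strength. Linearity is what permits
  telescoping.\<close>

lemma weighted_square_ge:
  fixes c x y \<tau> :: real
  assumes "c > 0" shows "2 * \<tau> * x * y - \<tau>\<^sup>2 * (x\<^sup>2 / c) \<le> c * y\<^sup>2"
proof -
  have "0 \<le> c * (y - \<tau> * x / c)\<^sup>2" using assms by simp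
  also have "\<dots> = c * y\<^sup>2 - 2 * \<tau> * x * y + \<tau>\<^sup>2 * (x\<^sup>2 / c)" using assms by (simp add: power2_eq_square field_simps)
  finally show ?thesis by simp
qed

context incl begin

text \<open>Share of the unit current from \<open>X1\<close> to \<open>X2\<close> carried through \<open>p\<close> by two parallel resistances \<open>Bf Y1 t\<close>, \<open>Bf Y2 t\<close>.\<close>

definition rh :: "site \<Rightarrow> real \<Rightarrow> real" where "rh p t = 1 / (Bf p t * Kf t)"

lemma rh_props:
  assumes t: "0 \<le> t" "t \<le> 1"
  shows "rh Y1 t + rh Y2 t = 1" "p \<in> {Y1, Y2} \<Longrightarrow> 0 \<le> rh p t" "p \<in> {Y1, Y2} \<Longrightarrow> rh p t \<le> 1"
    "(rh Y1 t)\<^sup>2 * Bf Y1 t + (rh Y2 t)\<^sup>2 * Bf Y2 t = 1 / Kf t"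
proof -
  have B: "Bf Y1 t > 0" "Bf Y2 t > 0" using Bf_pos t by auto
  have K: "Kf t > 0" by (rule Kf_pos[OF t])
  have e: "rh p t = (1 / Bf p t) / Kf t" for p by (simp add: rh_def)
  show s: "rh Y1 t + rh Y2 t = 1" unfolding e add_divide_distrib[symmetric] Kf_def[symmetric] using K by simp
  show n: "0 \<le> rh p t" if "p \<in> {Y1, Y2}" for p unfolding e using B K that by auto
  show "rh p t \<le> 1" if "p \<in> {Y1, Y2}" using n[of Y1] n[of Y2] s that by auto
  have q: "(rh p t)\<^sup>2 * Bf p t = (1 / Bf p t) / (Kf t)\<^sup>2" if "p \<in> {Y1, Y2}" for p
    unfolding e using B that by (auto simp: power2_eq_square)
  have "(rh Y1 t)\<^sup>2 * Bf Y1 t + (rh Y2 t)\<^sup>2 * Bf Y2 t = (1 / Bf Y1 t + 1 / Bf Y2 t) / (Kf t)\<^sup>2"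
    by (simp add: q add_divide_distrib)
  then show "(rh Y1 t)\<^sup>2 * Bf Y1 t + (rh Y2 t)\<^sup>2 * Bf Y2 t = 1 / Kf t" unfolding Kf_def[symmetric] using K by (simp add: power2_eq_square)
qed

lemma cont_rh: "p \<in> {Y1, Y2} \<Longrightarrow> continuous_on {0..1} (rh p)"
  unfolding rh_def using Bf_pos Kf_pos by (intro continuous_intros cont_Bf cont_Kf) force+

lemma rh_lip:
  obtains C where "C \<ge> 0" "\<And>p t t'. p \<in> {Y1, Y2} \<Longrightarrow> 0 \<le> t \<Longrightarrow> t \<le> 1 \<Longrightarrow> 0 \<le> t' \<Longrightarrow> t' \<le> 1 \<Longrightarrow> \<bar>rh p t - rh p t'\<bar> \<le> C * \<bar>t - t'\<bar>"
proof -
  define S where "S t = Bf Y1 t + Bf Y2 t" for t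
  have contS: "continuous_on {0..1} S" unfolding S_def by (intro continuous_intros cont_Bf)
  obtain x where x: "x \<in> {0..1}" "\<And>y. y \<in> {0..1} \<Longrightarrow> S x \<le> S y"
    using continuous_attains_inf[OF _ _ contS] by auto
  define \<mu> where "\<mu> = S x"
  have Sp: "S t > 0" if "t \<in> {0..1}" for t unfolding S_def using Bf_pos[of Y1 t] Bf_pos[of Y2 t] that by auto
  have \<mu>: "\<mu> > 0" unfolding \<mu>_def using Sp x by blast
  define \<alpha> where "\<alpha> p = (1 - M p) / r X1 p" for p
  define \<gamma> where "\<gamma> p = (1 - M p) * (1 / r X2 p - 1 / r X1 p)" for p
  have Baff: "Bf p t = \<alpha> p + \<gamma> p * t" for p t unfolding Bf_def \<alpha>_def \<gamma>_def by (simp add: algebra_simps diff_divide_distrib add_divide_distrib)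
  define c where "c = \<alpha> Y1 * \<gamma> Y2 - \<alpha> Y2 * \<gamma> Y1"
  \<comment> \<open>A quotient of affine functions whose denominator is bounded away from zero,
    whence the Lipschitz estimate.\<close>
  have r1: "rh Y1 t = Bf Y2 t / S t" if "0 \<le> t" "t \<le> 1" for t
  proof -
    have B: "Bf Y1 t > 0" "Bf Y2 t > 0" using Bf_pos that by auto
    have "Bf Y1 t * Kf t = S t / Bf Y2 t" unfolding Kf_def S_def using B by (simp add: field_simps)
    then show ?thesis by (simp add: rh_def)
  qed
  have L1: "\<bar>rh Y1 t - rh Y1 t'\<bar> \<le> \<bar>c\<bar> / \<mu>\<^sup>2 * \<bar>t - t'\<bar>" if t: "0 \<le> t" "t \<le> 1" "0 \<le> t'" "t' \<le> 1" for t t'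
  proof -
    have S: "S t > 0" "S t' > 0" "\<mu> \<le> S t" "\<mu> \<le> S t'" unfolding \<mu>_def using Sp x t by auto
    have "rh Y1 t - rh Y1 t' = (Bf Y2 t * S t' - Bf Y2 t' * S t) / (S t * S t')"
      unfolding r1[OF t(1,2)] r1[OF t(3,4)] using S by (simp add: field_simps)
    also have "Bf Y2 t * S t' - Bf Y2 t' * S t = c * (t - t')" unfolding S_def Baff c_def by (simp add: algebra_simps)
    finally have "\<bar>rh Y1 t - rh Y1 t'\<bar> = \<bar>c\<bar> * \<bar>t - t'\<bar> / (S t * S t')" using S by (simp add: abs_mult)
    also have "\<dots> \<le> \<bar>c\<bar> * \<bar>t - t'\<bar> / \<mu>\<^sup>2"
      using S \<mu> by (intro divide_left_mono) (auto simp: power2_eq_square intro!: mult_mono mult_pos_pos)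
    finally show ?thesis by simp
  qed
  have L2: "\<bar>rh Y2 t - rh Y2 t'\<bar> = \<bar>rh Y1 t - rh Y1 t'\<bar>" if t: "0 \<le> t" "t \<le> 1" "0 \<le> t'" "t' \<le> 1" for t t'
    using rh_props(1)[OF t(1,2)] rh_props(1)[OF t(3,4)] by linarith
  show ?thesis
  proof (rule that[of "\<bar>c\<bar> / \<mu>\<^sup>2"])
    show "0 \<le> \<bar>c\<bar> / \<mu>\<^sup>2" by simp
    fix p and t t' :: real assume "p \<in> {Y1, Y2}" "0 \<le> t" "t \<le> 1" "0 \<le> t'" "t' \<le> 1"
    then show "\<bar>rh p t - rh p t'\<bar> \<le> \<bar>c\<bar> / \<mu>\<^sup>2 * \<bar>t - t'\<bar>" using L1[of t t'] L2[of t t'] by auto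
  qed
qed

text \<open>For fixed p and n these configurations form a column of height coordinate l, with n
  particles at \<open>X1\<close>. All columns over the same n share the base l = 0, whichever p is
  chosen.\<close>

definition line_config :: "site \<Rightarrow> nat \<Rightarrow> nat \<Rightarrow> nat \<Rightarrow> site \<Rightarrow> nat" where
  "line_config p n j l = (if p = Y1 then cf n j l 0 else cf n j 0 l)"

text \<open>Increments along two kinds of edges: \<open>eu\<close> climbs within the column over n,
  by a move from \<open>X2\<close> to p, and \<open>ev\<close> joins the column over n + 1 to that
  over n, by a move from \<open>X1\<close> to p. Their difference \<open>ev\<close> -
  \<open>eu\<close> is the increment between neighbouring columns at the same height, a passage
  through p from one \<open>X\<close> site to the other.\<close>

definition eu :: "((site \<Rightarrow> nat) \<Rightarrow> real) \<Rightarrow> nat \<Rightarrow> site \<Rightarrow> nat \<Rightarrow> nat \<Rightarrow> real" where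
  "eu h K p n l = h (line_config p n (Suc K - n - l) l) - h (line_config p n (K - n - l) (Suc l))"

definition ev :: "((site \<Rightarrow> nat) \<Rightarrow> real) \<Rightarrow> nat \<Rightarrow> site \<Rightarrow> nat \<Rightarrow> nat \<Rightarrow> real" where
  "ev h K p n l = h (line_config p (Suc n) (K - n - l) l) - h (line_config p n (K - n - l) (Suc l))"

text \<open>All edge energies are nonnegative, so edges outside the columns may be dropped. The
  corrections \<open>prd\<close> are at least 1, and the remaining weight is bounded below by d
  divided by n + 1 or N - n, which no longer depends on l.\<close>

lemma energy_lower:
  assumes d: "0 < d" "d \<le> 1" and I: "finite I" "\<And>n l. (n, l) \<in> I \<Longrightarrow> n + l \<le> K"
  shows "(\<Sum>p\<in>{Y1, Y2}. \<Sum>(n,l)\<in>I. d ^ 3 * M p ^ l * (r X2 p / real (Suc n) * (eu h K p n l)\<^sup>2 + r X1 p / real (Suc K - n) * (ev h K p n l)\<^sup>2))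
     \<le> dform r M d K h h"
proof -
  define t1 where "t1 i j k l = d\<^sup>2 * M Y1 ^ k * M Y2 ^ l * (r X1 Y1 * (prd d i * prd d k * wgt d j * wgt d l) * (h (cf (Suc i) j k l) - h (cf i j (Suc k) l))\<^sup>2)" for i j k l
  define t2 where "t2 i j k l = d\<^sup>2 * M Y1 ^ k * M Y2 ^ l * (r X1 Y2 * (prd d i * prd d l * wgt d j * wgt d k) * (h (cf (Suc i) j k l) - h (cf i j k (Suc l)))\<^sup>2)" for i j k l
  define t3 where "t3 i j k l = d\<^sup>2 * M Y1 ^ k * M Y2 ^ l * (r X2 Y1 * (prd d j * prd d k * wgt d i * wgt d l) * (h (cf i (Suc j) k l) - h (cf i j (Suc k) l))\<^sup>2)" for i j k l
  define t4 where "t4 i j k l = d\<^sup>2 * M Y1 ^ k * M Y2 ^ l * (r X2 Y2 * (prd d j * prd d l * wgt d i * wgt d k) * (h (cf i (Suc j) k l) - h (cf i j k (Suc l)))\<^sup>2)" for i j k l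
  define t5 where "t5 i j k l = d\<^sup>2 * M Y1 ^ k * M Y2 ^ l * (M Y1 * r Y1 Y2 * (prd d k * prd d l * wgt d i * wgt d j) * (h (cf i j (Suc k) l) - h (cf i j k (Suc l)))\<^sup>2)" for i j k l
  have pg: "1 \<le> prd d n" for n using prd_ge_1[of d n] d by simp
  have p0: "0 \<le> prd d n" for n using pg[of n] by simp
  have w0: "0 \<le> wgt d n" for n using wgt_pos[OF d(1), of n] by simp
  have M0: "0 \<le> M p ^ n" for p n using M_nonneg by simp
  have r0: "0 \<le> r x y" for x y using r_nonneg by blast
  have nn: "0 \<le> t1 i j k l" "0 \<le> t2 i j k l" "0 \<le> t3 i j k l" "0 \<le> t4 i j k l" "0 \<le> t5 i j k l" for i j k l
    unfolding t1_def t2_def t3_def t4_def t5_def by (intro mult_nonneg_nonneg zero_le_power2 p0 w0 M0 r0 M_nonneg)+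
  have sum: "dform r M d K h h = (\<Sum>(i,j,k,l)\<in>quad K. t1 i j k l + t3 i j k l) + (\<Sum>(i,j,k,l)\<in>quad K. t2 i j k l + t4 i j k l) + (\<Sum>(i,j,k,l)\<in>quad K. t5 i j k l)"
    unfolding dform_coord t1_def t2_def t3_def t4_def t5_def by (simp only: distrib_left sum.distrib case_prod_beta')
  have key: "d ^ 3 * m' * (r' / x) * y\<^sup>2 \<le> d\<^sup>2 * m' * (r' * (q1 * q2 * w) * y\<^sup>2)"
    if "0 \<le> m'" "0 \<le> r'" "1 \<le> q1" "1 \<le> q2" "d / x \<le> w" "0 < x" for m' r' x y q1 q2 w :: real
  proof -
    have "d / x \<le> q1 * q2 * w"
    proof -
      have dx: "0 \<le> d / x" using d that by simp
      have "1 * 1 \<le> q1 * q2" using that by (intro mult_mono) auto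
      then have "1 * (d / x) \<le> (q1 * q2) * w" using that dx by (intro mult_mono) auto
      then show ?thesis by simp
    qed
    then have le: "d\<^sup>2 * m' * (r' * (d / x) * y\<^sup>2) \<le> d\<^sup>2 * m' * (r' * (q1 * q2 * w) * y\<^sup>2)"
      using that by (intro mult_left_mono mult_right_mono) auto
    have eq: "d\<^sup>2 * m' * (r' * (d / x) * y\<^sup>2) = d ^ 3 * m' * (r' / x) * y\<^sup>2" by (simp add: power2_eq_square power3_eq_cube)
    show ?thesis using le unfolding eq .
  qed
  have Y1: "(\<Sum>(n,l)\<in>I. d ^ 3 * M Y1 ^ l * (r X2 Y1 / real (Suc n) * (eu h K Y1 n l)\<^sup>2 + r X1 Y1 / real (Suc K - n) * (ev h K Y1 n l)\<^sup>2)) \<le> (\<Sum>(i,j,k,l)\<in>quad K. t1 i j k l + t3 i j k l)"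
  proof -
    have "(\<Sum>(n,l)\<in>I. d ^ 3 * M Y1 ^ l * (r X2 Y1 / real (Suc n) * (eu h K Y1 n l)\<^sup>2 + r X1 Y1 / real (Suc K - n) * (ev h K Y1 n l)\<^sup>2))
      \<le> (\<Sum>(n,l)\<in>I. t1 n (K - n - l) l 0 + t3 n (K - n - l) l 0)"
    proof (rule sum_mono, clarify)
      fix n l assume "(n, l) \<in> I"
      then have nl: "n + l \<le> K" by (rule I(2))
      have S: "Suc K - n - l = Suc (K - n - l)" using nl by simp
      have a: "d ^ 3 * M Y1 ^ l * (r X1 Y1 / real (Suc K - n)) * (ev h K Y1 n l)\<^sup>2 \<le> t1 n (K - n - l) l 0"
        unfolding t1_def ev_def line_config_def using key[of "M Y1 ^ l" "r X1 Y1" "prd d n" "prd d l" "real (Suc K - n)" "wgt d (K - n - l)"] M0 r0 pg nl wgt_ge[OF d, of "K - n - l" "real (Suc K - n)"]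
        by (simp add: of_nat_diff)
      have b: "d ^ 3 * M Y1 ^ l * (r X2 Y1 / real (Suc n)) * (eu h K Y1 n l)\<^sup>2 \<le> t3 n (K - n - l) l 0"
        unfolding t3_def eu_def line_config_def S using key[of "M Y1 ^ l" "r X2 Y1" "prd d (K - n - l)" "prd d l" "real (Suc n)" "wgt d n"] M0 r0 pg wgt_ge[OF d, of n "real (Suc n)"]
        by simp
      show "d ^ 3 * M Y1 ^ l * (r X2 Y1 / real (Suc n) * (eu h K Y1 n l)\<^sup>2 + r X1 Y1 / real (Suc K - n) * (ev h K Y1 n l)\<^sup>2) \<le> t1 n (K - n - l) l 0 + t3 n (K - n - l) l 0"
        using a b by (simp only: distrib_left mult.assoc)
    qed
    also have "\<dots> = (\<Sum>(i,j,k,l)\<in>(\<lambda>(n,l). (n, K - n - l, l, 0)) ` I. t1 i j k l + t3 i j k l)"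
      by (subst sum.reindex) (auto simp: inj_on_def case_prod_beta')
    also have "\<dots> \<le> (\<Sum>(i,j,k,l)\<in>quad K. t1 i j k l + t3 i j k l)"
      using I(1) nn by (intro sum_mono2 finite_quad) (auto simp: quad_def dest!: I(2))
    finally show ?thesis .
  qed
  have Y2: "(\<Sum>(n,l)\<in>I. d ^ 3 * M Y2 ^ l * (r X2 Y2 / real (Suc n) * (eu h K Y2 n l)\<^sup>2 + r X1 Y2 / real (Suc K - n) * (ev h K Y2 n l)\<^sup>2)) \<le> (\<Sum>(i,j,k,l)\<in>quad K. t2 i j k l + t4 i j k l)"
  proof -
    have "(\<Sum>(n,l)\<in>I. d ^ 3 * M Y2 ^ l * (r X2 Y2 / real (Suc n) * (eu h K Y2 n l)\<^sup>2 + r X1 Y2 / real (Suc K - n) * (ev h K Y2 n l)\<^sup>2))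
      \<le> (\<Sum>(n,l)\<in>I. t2 n (K - n - l) 0 l + t4 n (K - n - l) 0 l)"
    proof (rule sum_mono, clarify)
      fix n l assume "(n, l) \<in> I"
      then have nl: "n + l \<le> K" by (rule I(2))
      have S: "Suc K - n - l = Suc (K - n - l)" using nl by simp
      have a: "d ^ 3 * M Y2 ^ l * (r X1 Y2 / real (Suc K - n)) * (ev h K Y2 n l)\<^sup>2 \<le> t2 n (K - n - l) 0 l"
        unfolding t2_def ev_def line_config_def using key[of "M Y2 ^ l" "r X1 Y2" "prd d n" "prd d l" "real (Suc K - n)" "wgt d (K - n - l)"] M0 r0 pg nl wgt_ge[OF d, of "K - n - l" "real (Suc K - n)"]
        by (simp add: of_nat_diff)
      have b: "d ^ 3 * M Y2 ^ l * (r X2 Y2 / real (Suc n)) * (eu h K Y2 n l)\<^sup>2 \<le> t4 n (K - n - l) 0 l"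
        unfolding t4_def eu_def line_config_def S using key[of "M Y2 ^ l" "r X2 Y2" "prd d (K - n - l)" "prd d l" "real (Suc n)" "wgt d n"] M0 r0 pg wgt_ge[OF d, of n "real (Suc n)"]
        by simp
      show "d ^ 3 * M Y2 ^ l * (r X2 Y2 / real (Suc n) * (eu h K Y2 n l)\<^sup>2 + r X1 Y2 / real (Suc K - n) * (ev h K Y2 n l)\<^sup>2) \<le> t2 n (K - n - l) 0 l + t4 n (K - n - l) 0 l"
        using a b by (simp only: distrib_left mult.assoc)
    qed
    also have "\<dots> = (\<Sum>(i,j,k,l)\<in>(\<lambda>(n,l). (n, K - n - l, 0, l)) ` I. t2 i j k l + t4 i j k l)"
      by (subst sum.reindex) (auto simp: inj_on_def case_prod_beta')
    also have "\<dots> \<le> (\<Sum>(i,j,k,l)\<in>quad K. t2 i j k l + t4 i j k l)"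
      using I(1) nn by (intro sum_mono2 finite_quad) (auto simp: quad_def dest!: I(2))
    finally show ?thesis .
  qed
  have "0 \<le> (\<Sum>(i,j,k,l)\<in>quad K. t5 i j k l)" using nn by (intro sum_nonneg) auto
  then show ?thesis unfolding sum using Y1 Y2 by simp
qed

text \<open>One edge cannot carry more than the whole energy; N replaces the denominators n + 1 and
  N - n.\<close>

lemma edge_lower:
  assumes d: "0 < d" "d \<le> 1" and nl: "n + l \<le> K" and p: "p \<in> {Y1, Y2}"
  defines "N \<equiv> Suc K"
  shows "(eu h K p n l)\<^sup>2 \<le> (dform r M d K h h * real N / d ^ 3) / (M p ^ l * r X2 p)"
    "(ev h K p n l)\<^sup>2 \<le> (dform r M d K h h * real N / d ^ 3) / (M p ^ l * r X1 p)"
proof -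
  let ?T = "\<lambda>p. d ^ 3 * M p ^ l * (r X2 p / real (Suc n) * (eu h K p n l)\<^sup>2 + r X1 p / real (Suc K - n) * (ev h K p n l)\<^sup>2)"
  have T0: "?T p' \<ge> 0" for p' using d r_nonneg M_nonneg by (intro mult_nonneg_nonneg add_nonneg_nonneg) auto
  have "?T Y1 + ?T Y2 \<le> dform r M d K h h" using energy_lower[OF d, of "{(n,l)}" K h] nl by simp
  then have T: "?T p \<le> dform r M d K h h" using p T0[of Y1] T0[of Y2] by auto
  have pos: "M p ^ l > 0" "r X1 p > 0" "r X2 p > 0" "d ^ 3 > 0" using p M_Y rpos(1) d by auto
  have aux: "e\<^sup>2 \<le> (D * real N / d ^ 3) / (mm * rr)"
    if "d ^ 3 * mm * (rr / x * e\<^sup>2) \<le> D" "0 < x" "x \<le> real N" "mm > 0" "rr > 0" for e D mm rr x :: real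
  proof -
    have D0: "0 \<le> D" using that pos by (intro order_trans[OF _ that(1)] mult_nonneg_nonneg) auto
    have "e\<^sup>2 * (d ^ 3 * mm * rr) = d ^ 3 * mm * (rr / x * e\<^sup>2) * x" using that by simp
    also have "\<dots> \<le> D * x" using that by (intro mult_right_mono) auto
    also have "\<dots> \<le> D * real N" using that D0 by (intro mult_left_mono) auto
    finally have "e\<^sup>2 \<le> D * real N / (d ^ 3 * mm * rr)" using that pos by (simp add: pos_le_divide_eq)
    then show ?thesis by (simp add: mult.assoc)
  qed
  have a: "d ^ 3 * M p ^ l * (r X2 p / real (Suc n) * (eu h K p n l)\<^sup>2) \<le> ?T p" "d ^ 3 * M p ^ l * (r X1 p / real (Suc K - n) * (ev h K p n l)\<^sup>2) \<le> ?T p"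
    by (rule mult_left_mono, use pos in \<open>simp add: less_imp_le\<close>, use pos in simp)+
  show "(eu h K p n l)\<^sup>2 \<le> (dform r M d K h h * real N / d ^ 3) / (M p ^ l * r X2 p)"
    by (rule aux[OF order_trans[OF a(1) T]]) (use pos nl N_def in auto)
  show "(ev h K p n l)\<^sup>2 \<le> (dform r M d K h h * real N / d ^ 3) / (M p ^ l * r X1 p)"
    by (rule aux[OF order_trans[OF a(2) T]]) (use pos nl N_def in auto)
qed

text \<open>If h were constant on each column, the weights \<open>lam\<close> (total 1 in l) and
  \<open>rh\<close> (total 1 in p) would make the sum telescope along the bases. The column averages
  deviate from the base values by at most L \<eta>, and summation by parts moves this deviation onto
  \<open>rh\<close>, whose increments sum to at most C.\<close>

lemma lower_flow:
  fixes \<eta> C :: real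
  assumes L: "1 \<le> L" "L \<le> Suc K" and h1: "h (xi (Suc K) X1) = 1" and h0: "h (xi (Suc K) X2) = 0"
    and \<eta>: "\<And>p n l. p \<in> {Y1, Y2} \<Longrightarrow> n + l \<le> K \<Longrightarrow> l < L \<Longrightarrow> \<bar>eu h K p n l\<bar> \<le> \<eta> \<and> \<bar>ev h K p n l\<bar> \<le> \<eta>"
    and C: "0 \<le> C" "\<And>p t t'. p \<in> {Y1, Y2} \<Longrightarrow> 0 \<le> t \<Longrightarrow> t \<le> 1 \<Longrightarrow> 0 \<le> t' \<Longrightarrow> t' \<le> 1 \<Longrightarrow> \<bar>rh p t - rh p t'\<bar> \<le> C * \<bar>t - t'\<bar>"
    and lam: "\<And>p l. p \<in> {Y1, Y2} \<Longrightarrow> 0 \<le> lam p l" "\<And>p. p \<in> {Y1, Y2} \<Longrightarrow> (\<Sum>l<L. lam p l) = 1"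
  shows "1 - (2 * real L * \<eta> + 2 * (real L * \<eta> * (2 + C))) \<le>
    (\<Sum>p\<in>{Y1, Y2}. \<Sum>n<Suc K - L. \<Sum>l<L. lam p l * rh p (real n / real (Suc K)) * (ev h K p n l - eu h K p n l))"
proof -
  define a where "a p n l = h (line_config p n (Suc K - n - l) l)" for p n l
  define A where "A n = a Y1 n 0" for n
  define H where "H p n = (\<Sum>l<L. lam p l * a p n l)" for p n
  define W where "W p n = A n - H p n" for p n
  define \<rho> where "\<rho> p n = rh p (real n / real (Suc K))" for p n
  let ?M = "Suc K - L"
  have \<eta>0: "0 \<le> \<eta>" using \<eta>[of Y1 0 0] L by auto
  have A: "a p n 0 = A n" for p n unfolding a_def A_def line_config_def by simp
  have eu: "eu h K p n l = a p n l - a p n (Suc l)" for p n l unfolding eu_def a_def by simp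
  have ev: "ev h K p n l = a p (Suc n) l - a p n (Suc l)" for p n l unfolding ev_def a_def by simp
  have AN: "A (Suc K) = 1"
  proof -
    have "line_config Y1 (Suc K) 0 0 = xi (Suc K) X1" by (rule ext, rename_tac x, case_tac x) (auto simp: line_config_def xi_def)
    then show ?thesis using h1 by (simp add: A_def a_def)
  qed
  have A0: "A 0 = 0"
  proof -
    have "line_config Y1 0 (Suc K) 0 = xi (Suc K) X2" by (rule ext, rename_tac x, case_tac x) (auto simp: line_config_def xi_def)
    then show ?thesis using h0 by (simp add: A_def a_def)
  qed
  \<comment> \<open>Beyond \<open>?M\<close> the columns are shorter than L. The remaining L steps
    to the full configuration at \<open>X1\<close> are taken at height 0, with two edges per
    step.\<close>
  have tail: "\<bar>A (?M + k) - A ?M\<bar> \<le> 2 * real k * \<eta>" if "k \<le> L" for k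
    using that
  proof (induction k)
    case (Suc k)
    have "A (?M + Suc k) - A (?M + k) = ev h K Y1 (?M + k) 0 - eu h K Y1 (?M + k) 0" unfolding eu ev A by simp
    moreover have "\<bar>eu h K Y1 (?M + k) 0\<bar> \<le> \<eta>" "\<bar>ev h K Y1 (?M + k) 0\<bar> \<le> \<eta>" using \<eta>[of Y1 "?M + k" 0] Suc.prems L by auto
    ultimately have "\<bar>A (?M + Suc k) - A (?M + k)\<bar> \<le> 2 * \<eta>" by linarith
    then have "\<bar>A (?M + Suc k) - A ?M\<bar> \<le> 2 * real k * \<eta> + 2 * \<eta>" using Suc by linarith
    then show ?case by (simp add: algebra_simps)
  qed simp
  have column: "\<bar>A n - a p n l\<bar> \<le> real l * \<eta>" if "p \<in> {Y1, Y2}" "n \<le> ?M" "l \<le> L" for p n l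
    using that(3)
  proof (induction l)
    case (Suc l)
    have "n + l \<le> K" using that Suc.prems L by linarith
    then have "\<bar>eu h K p n l\<bar> \<le> \<eta>" using \<eta>[OF that(1), of n l] Suc.prems by simp
    then have "\<bar>A n - a p n (Suc l)\<bar> \<le> real l * \<eta> + \<eta>" using Suc unfolding eu by linarith
    then show ?case by (simp add: algebra_simps)
  qed (simp add: A)
  have W: "\<bar>W p n\<bar> \<le> real L * \<eta>" if p: "p \<in> {Y1, Y2}" and n: "n \<le> ?M" for p n
  proof -
    have "W p n = A n * (\<Sum>l<L. lam p l) - H p n" unfolding W_def lam(2)[OF p] by simp
    also have "\<dots> = (\<Sum>l<L. lam p l * (A n - a p n l))"
      unfolding H_def sum_distrib_left sum_subtractf[symmetric] by (intro sum.cong) (auto simp: algebra_simps)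
    finally have "\<bar>W p n\<bar> \<le> (\<Sum>l<L. \<bar>lam p l * (A n - a p n l)\<bar>)" by (simp only: sum_abs)
    moreover have "(\<Sum>l<L. \<bar>lam p l * (A n - a p n l)\<bar>) \<le> (\<Sum>l<L. lam p l * (real L * \<eta>))"
    proof (rule sum_mono)
      fix l assume l: "l \<in> {..<L}"
      have "real l * \<eta> \<le> real L * \<eta>" using l \<eta>0 by (intro mult_right_mono) auto
      then have "\<bar>A n - a p n l\<bar> \<le> real L * \<eta>" using column[OF p n, of l] l by auto
      then show "\<bar>lam p l * (A n - a p n l)\<bar> \<le> lam p l * (real L * \<eta>)"
        unfolding abs_mult using lam(1)[OF p, of l] by (simp add: mult_left_mono)
    qed
    moreover have "(\<Sum>l<L. lam p l * (real L * \<eta>)) = real L * \<eta>" unfolding sum_distrib_right[symmetric] lam(2)[OF p] by simp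
    ultimately show ?thesis by linarith
  qed
  have inner: "(\<Sum>l<L. lam p l * rh p (real n / real (Suc K)) * (ev h K p n l - eu h K p n l)) = \<rho> p n * (A (Suc n) - A n) - \<rho> p n * (W p (Suc n) - W p n)" for p n
  proof -
    have "(\<Sum>l<L. lam p l * rh p (real n / real (Suc K)) * (ev h K p n l - eu h K p n l)) = (\<Sum>l<L. \<rho> p n * (lam p l * a p (Suc n) l - lam p l * a p n l))"
      unfolding eu ev \<rho>_def by (intro sum.cong) (auto simp: algebra_simps)
    also have "\<dots> = \<rho> p n * (H p (Suc n) - H p n)" unfolding H_def sum_subtractf[symmetric] sum_distrib_left ..
    finally show ?thesis unfolding W_def by (simp add: algebra_simps)
  qed
  have abel: "\<bar>\<Sum>n<?M. \<rho> p n * (W p (Suc n) - W p n)\<bar> \<le> real L * \<eta> * (2 + C)" if p: "p \<in> {Y1, Y2}" for p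
  proof -
    have u: "0 \<le> real n / real (Suc K)" "real n / real (Suc K) \<le> 1" if "n \<le> Suc K" for n
      using that by (auto simp: divide_le_eq_1)
    have "\<bar>\<Sum>n<?M. \<rho> p n * (W p (Suc n) - W p n)\<bar> \<le> real L * \<eta> * (2 + real ?M * (C / real (Suc K)))"
    proof (rule abel_bound)
      show "\<bar>W p n\<bar> \<le> real L * \<eta>" if "n \<le> ?M" for n using W[OF p that] .
      have "\<bar>\<rho> p n\<bar> \<le> 1" if "n \<le> Suc K" for n unfolding \<rho>_def using rh_props(2,3)[OF u[OF that] p] by simp
      then show "\<bar>\<rho> p 0\<bar> \<le> 1" "\<bar>\<rho> p ?M\<bar> \<le> 1" by auto
      fix n assume n: "n < ?M"
      have "\<bar>rh p (real (Suc n) / real (Suc K)) - rh p (real n / real (Suc K))\<bar> \<le> C * \<bar>real (Suc n) / real (Suc K) - real n / real (Suc K)\<bar>"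
        by (rule C(2)[OF p u u]) (use n in auto)
      moreover have "real (Suc n) / real (Suc K) - real n / real (Suc K) = 1 / real (Suc K)" by (simp add: diff_divide_distrib[symmetric])
      ultimately show "\<bar>\<rho> p (Suc n) - \<rho> p n\<bar> \<le> C / real (Suc K)" unfolding \<rho>_def by simp
    qed
    also have "\<dots> \<le> real L * \<eta> * (2 + C)"
    proof (rule mult_left_mono)
      have "real ?M * C \<le> real (Suc K) * C" using C(1) by (intro mult_right_mono) auto
      then have "real ?M * C / real (Suc K) \<le> C" by (simp add: pos_divide_le_eq mult.commute)
      then show "2 + real ?M * (C / real (Suc K)) \<le> 2 + C" by simp
    qed (use \<eta>0 in simp)
    finally show ?thesis .
  qed
  have main: "(\<Sum>n<?M. \<rho> Y1 n * (A (Suc n) - A n)) + (\<Sum>n<?M. \<rho> Y2 n * (A (Suc n) - A n)) = A ?M - A 0"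
  proof -
    have "(\<Sum>n<?M. \<rho> Y1 n * (A (Suc n) - A n)) + (\<Sum>n<?M. \<rho> Y2 n * (A (Suc n) - A n)) = (\<Sum>n<?M. A (Suc n) - A n)"
      unfolding sum.distrib[symmetric]
    proof (rule sum.cong)
      fix n assume "n \<in> {..<?M}"
      then have "0 \<le> real n / real (Suc K)" "real n / real (Suc K) \<le> 1" by (auto simp: divide_le_eq_1)
      from rh_props(1)[OF this] have "\<rho> Y1 n + \<rho> Y2 n = 1" unfolding \<rho>_def .
      then show "\<rho> Y1 n * (A (Suc n) - A n) + \<rho> Y2 n * (A (Suc n) - A n) = A (Suc n) - A n"
        unfolding distrib_right[symmetric] by simp
    qed simp
    then show ?thesis by (simp add: sum_lessThan_telescope)
  qed
  have "(\<Sum>p\<in>{Y1, Y2}. \<Sum>n<?M. \<Sum>l<L. lam p l * rh p (real n / real (Suc K)) * (ev h K p n l - eu h K p n l))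
    = A ?M - A 0 - (\<Sum>n<?M. \<rho> Y1 n * (W Y1 (Suc n) - W Y1 n)) - (\<Sum>n<?M. \<rho> Y2 n * (W Y2 (Suc n) - W Y2 n))"
    unfolding inner sum_subtractf main[symmetric] by simp
  moreover have "\<bar>1 - A ?M\<bar> \<le> 2 * real L * \<eta>" using tail[of L] L AN by simp
  moreover define e where "e = real L * \<eta> * (2 + C)"
  moreover have "\<bar>\<Sum>n<?M. \<rho> Y1 n * (W Y1 (Suc n) - W Y1 n)\<bar> \<le> e" "\<bar>\<Sum>n<?M. \<rho> Y2 n * (W Y2 (Suc n) - W Y2 n)\<bar> \<le> e"
    unfolding e_def using abel by auto
  ultimately show ?thesis unfolding e_def[symmetric] using A0 by linarith
qed

text \<open>The energy is at least 2 \<tau> times the pairing of the flow with the increments of h,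
  minus \<tau> squared times the energy of the flow. The pairing is nearly 1 by
  \<open>lower_flow\<close>, and the energy of the flow is a Riemann sum of resistances.\<close>

lemma lower_det:
  fixes \<eta> C :: real
  assumes d: "0 < d" "d \<le> 1"
    and L: "1 \<le> L" "L \<le> Suc K" and h1: "h (xi (Suc K) X1) = 1" and h0: "h (xi (Suc K) X2) = 0"
    and \<eta>: "\<And>p n l. p \<in> {Y1, Y2} \<Longrightarrow> n + l \<le> K \<Longrightarrow> l < L \<Longrightarrow> \<bar>eu h K p n l\<bar> \<le> \<eta> \<and> \<bar>ev h K p n l\<bar> \<le> \<eta>"
    and C: "0 \<le> C" "\<And>p t t'. p \<in> {Y1, Y2} \<Longrightarrow> 0 \<le> t \<Longrightarrow> t \<le> 1 \<Longrightarrow> 0 \<le> t' \<Longrightarrow> t' \<le> 1 \<Longrightarrow> \<bar>rh p t - rh p t'\<bar> \<le> C * \<bar>t - t'\<bar>"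
  defines "N \<equiv> Suc K"
  shows "2 / R * (1 - (2 * real L * \<eta> + 2 * (real L * \<eta> * (2 + C))))
      - (\<Sum>n<N. \<Sum>p\<in>{Y1, Y2}. (rh p (real n / real N))\<^sup>2 * ((1 - M p) / (1 - M p ^ L)) * (real (Suc n) / real N / r X2 p + real (N - n) / real N / r X1 p)) / real N / R\<^sup>2
    \<le> (real N)\<^sup>2 / d ^ 3 * dform r M d K h h"
proof -
  \<comment> \<open>Normalises the geometric weights on a column of height L. The flow is
    distributed in proportion to the conductances, as current divides among parallel
    resistors.\<close>
  define \<sigma> where "\<sigma> p = (1 - M p) / (1 - M p ^ L)" for p
  define lam where "lam p l = M p ^ l * \<sigma> p" for p l
  define \<rho> where "\<rho> p n = rh p (real n / real N)" for p n
  \<comment> \<open>The maximiser of 2 \<tau> - \<tau> squared times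
    \<open>N ^ 2 * R / d ^ 3\<close>, the limiting value of the dual bound.\<close>
  define \<tau> where "\<tau> = d ^ 3 / ((real N)\<^sup>2 * R)"
  let ?M = "N - L"
  have NN: "real N > 0" by (simp add: N_def)
  have R: "R > 0" by (rule R_pos)
  have My: "0 < M p" "M p < 1" if "p \<in> {Y1, Y2}" for p using that M_Y by auto
  have powM: "M p ^ L < 1" if "p \<in> {Y1, Y2}" for p using My[OF that] L by (simp add: power_Suc_less_one power_less_one_iff)
  have \<sigma>: "0 < \<sigma> p" if "p \<in> {Y1, Y2}" for p unfolding \<sigma>_def using My[OF that] powM[OF that] by simp
  have lam0: "0 \<le> lam p l" if "p \<in> {Y1, Y2}" for p l unfolding lam_def using My[OF that] \<sigma>[OF that] by simp
  have geo: "(\<Sum>l<L. M p ^ l) * \<sigma> p = 1" if "p \<in> {Y1, Y2}" for p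
  proof -
    have "(\<Sum>l<L. M p ^ l) * (1 - M p) = 1 - M p ^ L" using sum_gp_strict[of "M p" L] My[OF that] by simp
    then show ?thesis unfolding \<sigma>_def using powM[OF that] by simp
  qed
  have lam1: "(\<Sum>l<L. lam p l) = 1" if "p \<in> {Y1, Y2}" for p unfolding lam_def sum_distrib_right[symmetric] by (rule geo[OF that])
  define S where "S = (\<Sum>p\<in>{Y1, Y2}. \<Sum>n<?M. \<Sum>l<L. lam p l * \<rho> p n * (ev h K p n l - eu h K p n l))"
  define Q where "Q p n = real (Suc n) / r X2 p + real (N - n) / r X1 p" for p n
  have S: "1 - (2 * real L * \<eta> + 2 * (real L * \<eta> * (2 + C))) \<le> S"
    unfolding S_def \<rho>_def N_def by (rule lower_flow[where \<eta> = \<eta> and C = C, OF L h1 h0 \<eta> C lam0 lam1])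
  have pointwise: "2 * \<tau> * (lam p l * \<rho> p n * (ev h K p n l - eu h K p n l)) - \<tau>\<^sup>2 * ((\<rho> p n)\<^sup>2 * (\<sigma> p)\<^sup>2 * Q p n / d ^ 3 * M p ^ l)
     \<le> d ^ 3 * M p ^ l * (r X2 p / real (Suc n) * (eu h K p n l)\<^sup>2 + r X1 p / real (Suc K - n) * (ev h K p n l)\<^sup>2)"
    if p: "p \<in> {Y1, Y2}" and n: "n < ?M" for p n l
  proof -
    define x where "x = lam p l * \<rho> p n"
    have pos: "0 < r X1 p" "0 < r X2 p" "0 < M p ^ l" "0 < real (N - n)" "0 < d ^ 3"
      using rpos(1)[of X1 p] rpos(1)[of X2 p] p My[OF p] n d by auto
    have e1: "2 * \<tau> * (- x) * eu h K p n l - \<tau>\<^sup>2 * ((- x)\<^sup>2 / (d ^ 3 * M p ^ l * (r X2 p / real (Suc n)))) \<le> d ^ 3 * M p ^ l * (r X2 p / real (Suc n)) * (eu h K p n l)\<^sup>2"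
      using pos by (intro weighted_square_ge) auto
    have e2: "2 * \<tau> * x * ev h K p n l - \<tau>\<^sup>2 * (x\<^sup>2 / (d ^ 3 * M p ^ l * (r X1 p / real (N - n)))) \<le> d ^ 3 * M p ^ l * (r X1 p / real (N - n)) * (ev h K p n l)\<^sup>2"
      using pos by (intro weighted_square_ge) auto
    have x2: "x\<^sup>2 = (\<rho> p n)\<^sup>2 * (\<sigma> p)\<^sup>2 * M p ^ l * M p ^ l" unfolding x_def lam_def by (simp add: power2_eq_square mult_ac)
    have qq: "g * z * z / (D * z * (s / y)) = g * (y / s) / D * z" if "0 < z" "0 < D" "0 < s" "0 < y" for g z D s y :: real
      using that by (simp add: field_simps)
    have q1: "(- x)\<^sup>2 / (d ^ 3 * M p ^ l * (r X2 p / real (Suc n))) = (\<rho> p n)\<^sup>2 * (\<sigma> p)\<^sup>2 * (real (Suc n) / r X2 p) / d ^ 3 * M p ^ l"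
      unfolding power2_minus x2 by (rule qq) (use pos in auto)
    have q2: "x\<^sup>2 / (d ^ 3 * M p ^ l * (r X1 p / real (N - n))) = (\<rho> p n)\<^sup>2 * (\<sigma> p)\<^sup>2 * (real (N - n) / r X1 p) / d ^ 3 * M p ^ l"
      unfolding x2 by (rule qq) (use pos in auto)
    have g1: "2 * \<tau> * (x * (ev h K p n l - eu h K p n l)) - \<tau>\<^sup>2 * ((\<rho> p n)\<^sup>2 * (\<sigma> p)\<^sup>2 * Q p n / d ^ 3 * M p ^ l)
      = (2 * \<tau> * (- x) * eu h K p n l - \<tau>\<^sup>2 * ((\<rho> p n)\<^sup>2 * (\<sigma> p)\<^sup>2 * (real (Suc n) / r X2 p) / d ^ 3 * M p ^ l))
      + (2 * \<tau> * x * ev h K p n l - \<tau>\<^sup>2 * ((\<rho> p n)\<^sup>2 * (\<sigma> p)\<^sup>2 * (real (N - n) / r X1 p) / d ^ 3 * M p ^ l))"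
      unfolding Q_def by (simp only: ring_distribs add_divide_distrib)
    have g2: "d ^ 3 * M p ^ l * (r X2 p / real (Suc n) * (eu h K p n l)\<^sup>2 + r X1 p / real (Suc K - n) * (ev h K p n l)\<^sup>2)
      = d ^ 3 * M p ^ l * (r X2 p / real (Suc n)) * (eu h K p n l)\<^sup>2 + d ^ 3 * M p ^ l * (r X1 p / real (N - n)) * (ev h K p n l)\<^sup>2"
      unfolding N_def distrib_left by (simp only: mult.assoc)
    show ?thesis unfolding g2 x_def[symmetric] g1 by (rule add_mono[OF e1[unfolded q1] e2[unfolded q2]])
  qed
  define Z where "Z = (\<Sum>p\<in>{Y1, Y2}. \<Sum>n<?M. (\<rho> p n)\<^sup>2 * \<sigma> p * Q p n)"
  have "2 * \<tau> * S - \<tau>\<^sup>2 * (Z / d ^ 3)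
    = (\<Sum>p\<in>{Y1, Y2}. \<Sum>n<?M. \<Sum>l<L. 2 * \<tau> * (lam p l * \<rho> p n * (ev h K p n l - eu h K p n l)) - \<tau>\<^sup>2 * ((\<rho> p n)\<^sup>2 * (\<sigma> p)\<^sup>2 * Q p n / d ^ 3 * M p ^ l))"
  proof -
    have "(\<Sum>l<L. (\<rho> p n)\<^sup>2 * (\<sigma> p)\<^sup>2 * Q p n / d ^ 3 * M p ^ l) = (\<rho> p n)\<^sup>2 * \<sigma> p * Q p n / d ^ 3" if "p \<in> {Y1, Y2}" for p n
    proof -
      have "(\<Sum>l<L. (\<rho> p n)\<^sup>2 * (\<sigma> p)\<^sup>2 * Q p n / d ^ 3 * M p ^ l) = (\<rho> p n)\<^sup>2 * \<sigma> p * Q p n / d ^ 3 * ((\<Sum>l<L. M p ^ l) * \<sigma> p)"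
        unfolding sum_distrib_left[symmetric] by (simp add: power2_eq_square)
      then show ?thesis unfolding geo[OF that] by simp
    qed
    then have "(\<Sum>p\<in>{Y1, Y2}. \<Sum>n<?M. \<Sum>l<L. (\<rho> p n)\<^sup>2 * (\<sigma> p)\<^sup>2 * Q p n / d ^ 3 * M p ^ l) = Z / d ^ 3"
      unfolding Z_def sum_divide_distrib by (intro sum.cong refl) auto
    then show ?thesis unfolding S_def sum_subtractf sum_distrib_left[symmetric] by simp
  qed
  also have "\<dots> \<le> (\<Sum>p\<in>{Y1, Y2}. \<Sum>n<?M. \<Sum>l<L. d ^ 3 * M p ^ l * (r X2 p / real (Suc n) * (eu h K p n l)\<^sup>2 + r X1 p / real (Suc K - n) * (ev h K p n l)\<^sup>2))"
    by (intro sum_mono pointwise) auto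
  also have "\<dots> = (\<Sum>p\<in>{Y1, Y2}. \<Sum>(n,l)\<in>{..<?M} \<times> {..<L}. d ^ 3 * M p ^ l * (r X2 p / real (Suc n) * (eu h K p n l)\<^sup>2 + r X1 p / real (Suc K - n) * (ev h K p n l)\<^sup>2))"
    by (simp only: sum.cartesian_product)
  also have "\<dots> \<le> dform r M d K h h"
    by (rule energy_lower[OF d]) (use L in \<open>auto simp: N_def\<close>)
  finally have main: "2 * \<tau> * S - \<tau>\<^sup>2 * (Z / d ^ 3) \<le> dform r M d K h h" .
  have d3: "0 < d ^ 3" using d by simp
  have Z: "Z \<le> real N * (\<Sum>n<N. \<Sum>p\<in>{Y1, Y2}. (rh p (real n / real N))\<^sup>2 * \<sigma> p * (real (Suc n) / real N / r X2 p + real (N - n) / real N / r X1 p))"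
  proof -
    have "Z \<le> (\<Sum>p\<in>{Y1, Y2}. \<Sum>n<N. (\<rho> p n)\<^sup>2 * \<sigma> p * Q p n)" unfolding Z_def
    proof (intro sum_mono sum_mono2)
      fix p n assume p: "p \<in> {Y1, Y2}"
      have "0 \<le> Q p n" unfolding Q_def using rpos(1)[of X1 p] rpos(1)[of X2 p] p by (intro add_nonneg_nonneg divide_nonneg_pos) auto
      then show "0 \<le> (\<rho> p n)\<^sup>2 * \<sigma> p * Q p n" using \<sigma>[OF p] by (intro mult_nonneg_nonneg) auto
    qed auto
    also have "\<dots> = (\<Sum>n<N. \<Sum>p\<in>{Y1, Y2}. (\<rho> p n)\<^sup>2 * \<sigma> p * Q p n)" by (rule sum.swap)
    also have "\<dots> = (\<Sum>n<N. \<Sum>p\<in>{Y1, Y2}. real N * ((rh p (real n / real N))\<^sup>2 * \<sigma> p * (real (Suc n) / real N / r X2 p + real (N - n) / real N / r X1 p)))"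
    proof (intro sum.cong refl)
      fix n p
      have "Q p n = real N * (real (Suc n) / real N / r X2 p + real (N - n) / real N / r X1 p)"
        unfolding Q_def distrib_left using NN by simp
      then show "(\<rho> p n)\<^sup>2 * \<sigma> p * Q p n = real N * ((rh p (real n / real N))\<^sup>2 * \<sigma> p * (real (Suc n) / real N / r X2 p + real (N - n) / real N / r X1 p))"
        unfolding \<rho>_def by (simp only: mult_ac)
    qed
    finally show ?thesis unfolding sum_distrib_left .
  qed
  define Y where "Y = (\<Sum>n<N. \<Sum>p\<in>{Y1, Y2}. (rh p (real n / real N))\<^sup>2 * \<sigma> p * (real (Suc n) / real N / r X2 p + real (N - n) / real N / r X1 p))"
  have "2 / R * (1 - (2 * real L * \<eta> + 2 * (real L * \<eta> * (2 + C)))) - Y / real N / R\<^sup>2 \<le> 2 / R * S - Z / (real N)\<^sup>2 / R\<^sup>2"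
  proof (rule diff_mono)
    show "2 / R * (1 - (2 * real L * \<eta> + 2 * (real L * \<eta> * (2 + C)))) \<le> 2 / R * S" using S R by (intro mult_left_mono) auto
    have "Z / (real N)\<^sup>2 \<le> real N * Y / (real N)\<^sup>2" using Z unfolding Y_def by (intro divide_right_mono) auto
    also have "\<dots> = Y / real N" using NN by (simp add: power2_eq_square)
    finally show "Z / (real N)\<^sup>2 / R\<^sup>2 \<le> Y / real N / R\<^sup>2" by (intro divide_right_mono) auto
  qed
  also have "\<dots> = (real N)\<^sup>2 / d ^ 3 * (2 * \<tau> * S - \<tau>\<^sup>2 * (Z / d ^ 3))"
    unfolding \<tau>_def using NN R d3 by (simp add: field_simps power2_eq_square)
  also have "\<dots> \<le> (real N)\<^sup>2 / d ^ 3 * dform r M d K h h" using main d3 by (intro mult_left_mono) auto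
  finally show ?thesis unfolding Y_def \<sigma>_def .
qed

text \<open>A priori each single edge increment is \<open>O(N\<^sup>-\<^sup>1\<^sup>/\<^sup>2)\<close> by the energy bound, so all values of \<open>h\<close> on a column of bounded
  height agree up to \<open>o(1)\<close>; testing the energy against an explicit flow on columns of height \<open>L\<close> then loses only
  a factor tending to 1 as \<open>L\<close> grows.\<close>

lemma min_energy_lower:
  fixes d :: "nat \<Rightarrow> real"
  assumes dp: "\<And>N. N \<ge> 1 \<Longrightarrow> 0 < d N" and d0: "d \<longlonglongrightarrow> 0"
    and h1: "\<And>N. N \<ge> 1 \<Longrightarrow> h N (xi N X1) = 1" and h0: "\<And>N. N \<ge> 1 \<Longrightarrow> h N (xi N X2) = 0"
    and Cb: "0 \<le> Cb" "eventually (\<lambda>N. (real N)\<^sup>2 / d N ^ 3 * dform r M (d N) (N - 1) (h N) (h N) \<le> Cb) sequentially"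
    and \<epsilon>: "\<epsilon> > 0"
  shows "eventually (\<lambda>N. 1 / R - \<epsilon> < (real N)\<^sup>2 / d N ^ 3 * dform r M (d N) (N - 1) (h N) (h N)) sequentially"
proof -
  have R: "R > 0" by (rule R_pos)
  obtain C where C: "C \<ge> 0" "\<And>p t t'. p \<in> {Y1, Y2} \<Longrightarrow> 0 \<le> t \<Longrightarrow> t \<le> 1 \<Longrightarrow> 0 \<le> t' \<Longrightarrow> t' \<le> 1 \<Longrightarrow> \<bar>rh p t - rh p t'\<bar> \<le> C * \<bar>t - t'\<bar>"
    using rh_lip by blast
  define c where "c = max (M Y1) (M Y2)"
  have c: "0 < c" "c < 1" unfolding c_def using M_Y by auto
  \<comment> \<open>The dual bound in the limit of large N, with columns of height L: truncation
    raises the resistance at most by the factor 1/(1 - c^L). The height is fixed here, before N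
    tends to infinity.\<close>
  have "(\<lambda>L. 2 / R - R / (1 - c ^ L) / R\<^sup>2) \<longlonglongrightarrow> 2 / R - R / (1 - 0) / R\<^sup>2"
    using c R by (intro tendsto_intros LIMSEQ_power_zero) auto
  also have "2 / R - R / (1 - 0) / R\<^sup>2 = 1 / R" using R by (simp add: power2_eq_square field_simps)
  finally have "eventually (\<lambda>L. 1 / R - \<epsilon> < 2 / R - R / (1 - c ^ L) / R\<^sup>2) sequentially"
    using \<epsilon> by (intro order_tendstoD(1)) auto
  then have "eventually (\<lambda>L. 1 \<le> L \<and> 1 / R - \<epsilon> < 2 / R - R / (1 - c ^ L) / R\<^sup>2) sequentially"
    using eventually_ge_at_top[of 1] by eventually_elim simp
  then obtain L where L: "1 \<le> L" "1 / R - \<epsilon> < 2 / R - R / (1 - c ^ L) / R\<^sup>2"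
    using eventually_happens'[OF sequentially_bot] by blast
  have cL: "c ^ L < 1" using c L by (simp add: power_less_one_iff)
  have My: "0 < M p" "M p < 1" "M p \<le> c" if "p \<in> {Y1, Y2}" for p using that M_Y unfolding c_def by auto
  have powM: "M p ^ L \<le> c ^ L" if "p \<in> {Y1, Y2}" for p using My[OF that] by (intro power_mono) auto
  have rp: "0 < r X1 p" "0 < r X2 p" if "p \<in> {Y1, Y2}" for p using rpos(1)[of X1 p] rpos(1)[of X2 p] that by auto
  define \<sigma> where "\<sigma> p = (1 - M p) / (1 - M p ^ L)" for p
  have \<sigma>: "0 < \<sigma> p" if "p \<in> {Y1, Y2}" for p unfolding \<sigma>_def using My[OF that] powM[OF that] cL by simp
  define f where "f N n = (\<Sum>p\<in>{Y1, Y2}. (rh p (real n / real N))\<^sup>2 * \<sigma> p * (real (Suc n) / real N / r X2 p + real (N - n) / real N / r X1 p))" for N n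
  define F where "F t = (\<Sum>p\<in>{Y1, Y2}. (rh p t)\<^sup>2 * \<sigma> p * (t / r X2 p + (1 - t) / r X1 p))" for t
  have contF: "continuous_on {0..1} F" unfolding F_def divide_inverse by (intro continuous_intros cont_rh) auto
  have lim: "(\<lambda>N. (\<Sum>n<N. f N n) / real N) \<longlonglongrightarrow> integral {0..1} F"
  proof (rule riemann_dct[OF _ _ contF])
    fix N n :: nat assume n: "n < N"
    have u: "0 \<le> real n / real N" "real n / real N \<le> 1" "real (Suc n) / real N \<le> 1" "real (N - n) / real N \<le> 1" using n by auto
    have "\<bar>f N n\<bar> \<le> (\<Sum>p\<in>{Y1, Y2}. \<bar>(rh p (real n / real N))\<^sup>2 * \<sigma> p * (real (Suc n) / real N / r X2 p + real (N - n) / real N / r X1 p)\<bar>)"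
      unfolding f_def by (rule sum_abs)
    also have "\<dots> \<le> (\<Sum>p\<in>{Y1, Y2}. 1 * \<sigma> p * (1 / r X2 p + 1 / r X1 p))"
    proof (rule sum_mono)
      fix p assume p: "p \<in> {Y1, Y2}"
      have q: "0 \<le> real (Suc n) / real N / r X2 p + real (N - n) / real N / r X1 p" using rp[OF p] by (intro add_nonneg_nonneg divide_nonneg_nonneg) auto
      have q': "real (Suc n) / real N / r X2 p + real (N - n) / real N / r X1 p \<le> 1 / r X2 p + 1 / r X1 p"
        using rp[OF p] u by (intro add_mono divide_right_mono) auto
      have s: "(rh p (real n / real N))\<^sup>2 \<le> 1" using rh_props(2,3)[OF u(1,2) p] by (simp add: power_le_one)
      have "(rh p (real n / real N))\<^sup>2 * \<sigma> p \<le> 1 * \<sigma> p" using s \<sigma>[OF p] by (intro mult_right_mono) auto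
      then have "(rh p (real n / real N))\<^sup>2 * \<sigma> p * (real (Suc n) / real N / r X2 p + real (N - n) / real N / r X1 p) \<le> 1 * \<sigma> p * (1 / r X2 p + 1 / r X1 p)"
        by (rule mult_mono[OF _ q']) (use \<sigma>[OF p] q in auto)
      moreover have "0 \<le> (rh p (real n / real N))\<^sup>2 * \<sigma> p * (real (Suc n) / real N / r X2 p + real (N - n) / real N / r X1 p)"
        using \<sigma>[OF p] q by (intro mult_nonneg_nonneg) auto
      ultimately show "\<bar>(rh p (real n / real N))\<^sup>2 * \<sigma> p * (real (Suc n) / real N / r X2 p + real (N - n) / real N / r X1 p)\<bar> \<le> 1 * \<sigma> p * (1 / r X2 p + 1 / r X1 p)" by linarith
    qed
    finally show "\<bar>f N n\<bar> \<le> (\<Sum>p\<in>{Y1, Y2}. 1 * \<sigma> p * (1 / r X2 p + 1 / r X1 p))" .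
  next
    fix t :: real assume t: "0 < t" "t < 1"
    let ?n = "\<lambda>N. nat \<lfloor>real N * t\<rfloor>"
    have l1: "(\<lambda>N. real (?n N) / real N) \<longlonglongrightarrow> t" by (rule floor_ratio_limit[OF t(1)])
    have "(\<lambda>N. real (?n N) / real N + 1 / real N) \<longlonglongrightarrow> t + 0" by (intro tendsto_add l1) real_asymp
    then have l2: "(\<lambda>N. real (Suc (?n N)) / real N) \<longlonglongrightarrow> t" by (simp add: add_divide_distrib add.commute)
    have le: "?n N \<le> N" for N
    proof -
      have "real N * t \<le> real N" using t by (simp add: mult_left_le)
      then show ?thesis by linarith
    qed
    have "(\<lambda>N. 1 - real (?n N) / real N) \<longlonglongrightarrow> 1 - t" by (intro tendsto_intros l1)
    moreover have "eventually (\<lambda>N. 1 - real (?n N) / real N = real (N - ?n N) / real N) sequentially"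
      using eventually_gt_at_top[of 0] by eventually_elim (simp add: of_nat_diff le diff_divide_distrib)
    ultimately have l3: "(\<lambda>N. real (N - ?n N) / real N) \<longlonglongrightarrow> 1 - t" by (rule Lim_transform_eventually)
    have l4: "(\<lambda>N. rh p (real (?n N) / real N)) \<longlonglongrightarrow> rh p t" if "p \<in> {Y1, Y2}" for p
    proof (rule continuous_on_tendsto_compose[OF cont_rh[OF that] l1])
      show "eventually (\<lambda>N. real (?n N) / real N \<in> {0..1}) sequentially"
        using eventually_gt_at_top[of 0] by eventually_elim (use le in auto)
    qed (use t in auto)
    show "(\<lambda>N. f N (?n N)) \<longlonglongrightarrow> F t" unfolding f_def F_def
    proof (rule tendsto_sum)
      fix p assume p: "p \<in> {Y1, Y2}"
      show "(\<lambda>N. (rh p (real (?n N) / real N))\<^sup>2 * \<sigma> p * (real (Suc (?n N)) / real N / r X2 p + real (N - ?n N) / real N / r X1 p))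
        \<longlonglongrightarrow> (rh p t)\<^sup>2 * \<sigma> p * (t / r X2 p + (1 - t) / r X1 p)"
        by (intro tendsto_mult tendsto_power l4 p tendsto_const tendsto_add tendsto_divide l2 l3) (use rp[OF p] in auto)
    qed
  qed
  \<comment> \<open>For p alone, truncation at height L multiplies the resistance by 1/(1 - M p ^
    L), which c bounds for both sites at once; the split \<open>rh\<close> then gives the parallel
    resistance 1/\<open>Kf\<close>.\<close>
  have intF: "integral {0..1} F \<le> R / (1 - c ^ L)"
  proof -
    have "integral {0..1} F \<le> integral {0..1} (\<lambda>t. 1 / (1 - c ^ L) * (1 / Kf t))"
    proof (rule integral_le)
      show "F integrable_on {0..1}" by (rule integrable_continuous_real[OF contF])
      show "(\<lambda>t. 1 / (1 - c ^ L) * (1 / Kf t)) integrable_on {0..1}"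
        by (intro integrable_continuous_real continuous_on_mult continuous_on_const cont_invKf)
      fix t :: real assume "t \<in> {0..1}"
      then have t: "0 \<le> t" "t \<le> 1" by auto
      have "(rh p t)\<^sup>2 * \<sigma> p * (t / r X2 p + (1 - t) / r X1 p) \<le> 1 / (1 - c ^ L) * ((rh p t)\<^sup>2 * Bf p t)" if p: "p \<in> {Y1, Y2}" for p
      proof -
        have "(rh p t)\<^sup>2 * \<sigma> p * (t / r X2 p + (1 - t) / r X1 p) = 1 / (1 - M p ^ L) * ((rh p t)\<^sup>2 * Bf p t)"
          unfolding \<sigma>_def Bf_def by (simp add: add.commute)
        also have "\<dots> \<le> 1 / (1 - c ^ L) * ((rh p t)\<^sup>2 * Bf p t)"
          using powM[OF p] cL Bf_pos[OF p t] by (intro mult_right_mono divide_left_mono) auto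
        finally show ?thesis .
      qed
      then have "F t \<le> (\<Sum>p\<in>{Y1, Y2}. 1 / (1 - c ^ L) * ((rh p t)\<^sup>2 * Bf p t))" unfolding F_def by (intro sum_mono)
      also have "\<dots> = 1 / (1 - c ^ L) * ((rh Y1 t)\<^sup>2 * Bf Y1 t + (rh Y2 t)\<^sup>2 * Bf Y2 t)" unfolding sum_distrib_left[symmetric] by simp
      finally show "F t \<le> 1 / (1 - c ^ L) * (1 / Kf t)" unfolding rh_props(4)[OF t] .
    qed
    also have "\<dots> = 1 / (1 - c ^ L) * R" unfolding R_eq by (rule integral_mult_right)
    finally show ?thesis by simp
  qed
  define mm where "mm = min (M Y1) (M Y2)"
  define rm where "rm = Min {r X1 Y1, r X1 Y2, r X2 Y1, r X2 Y2}"
  have mm: "0 < mm" "mm < 1" unfolding mm_def using M_Y by auto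
  have rm: "0 < rm" unfolding rm_def using rp by simp
  have rmle: "rm \<le> r X1 p" "rm \<le> r X2 p" if "p \<in> {Y1, Y2}" for p using that unfolding rm_def by auto
  define \<kappa> where "\<kappa> = mm ^ L * rm"
  have \<kappa>: "0 < \<kappa>" unfolding \<kappa>_def using mm rm by simp
  have mmle: "mm ^ L \<le> M p ^ l" if "p \<in> {Y1, Y2}" "l < L" for p l
  proof -
    have "mm ^ L \<le> M p ^ L" using that mm unfolding mm_def by (intro power_mono) auto
    also have "\<dots> \<le> M p ^ l" using that My[OF that(1)] by (intro power_decreasing) auto
    finally show ?thesis .
  qed
  have \<kappa>le: "\<kappa> \<le> M p ^ l * r X1 p" "\<kappa> \<le> M p ^ l * r X2 p" if "p \<in> {Y1, Y2}" "l < L" for p l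
    unfolding \<kappa>_def using mmle[OF that] rmle[OF that(1)] mm rm My[OF that(1)] by (auto intro!: mult_mono)
  \<comment> \<open>Every edge of height below L has conductance at least \<kappa> times
    \<open>d N ^ 3 / N\<close>, while the energy is at most \<open>Cb * d N ^ 3 / N ^ 2\<close>; the
    increments are therefore at most this root.\<close>
  define \<eta> where "\<eta> N = sqrt (Cb / real N / \<kappa>)" for N
  define e where "e N = 2 * real L * \<eta> N + 2 * (real L * \<eta> N * (2 + C))" for N
  have "(\<lambda>N. Cb / real N / \<kappa>) \<longlonglongrightarrow> 0 / \<kappa>" using \<kappa> by (intro tendsto_divide tendsto_const lim_const_over_n) auto
  then have "\<eta> \<longlonglongrightarrow> sqrt (0 / \<kappa>)" unfolding \<eta>_def by (rule tendsto_real_sqrt)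
  then have \<eta>0: "\<eta> \<longlonglongrightarrow> 0" by simp
  have "e \<longlonglongrightarrow> 2 * real L * 0 + 2 * (real L * 0 * (2 + C))" unfolding e_def by (intro tendsto_intros \<eta>0)
  then have e0: "e \<longlonglongrightarrow> 0" by simp
  have "(\<lambda>N. 2 / R * (1 - e N) - (\<Sum>n<N. f N n) / real N / R\<^sup>2) \<longlonglongrightarrow> 2 / R * (1 - 0) - integral {0..1} F / R\<^sup>2"
    using R by (intro tendsto_intros e0 lim) auto
  moreover have "1 / R - \<epsilon> < 2 / R * (1 - 0) - integral {0..1} F / R\<^sup>2"
  proof -
    have "integral {0..1} F / R\<^sup>2 \<le> R / (1 - c ^ L) / R\<^sup>2" using intF by (intro divide_right_mono) auto
    then show ?thesis using L(2) by simp
  qed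
  ultimately have ev1: "eventually (\<lambda>N. 1 / R - \<epsilon> < 2 / R * (1 - e N) - (\<Sum>n<N. f N n) / real N / R\<^sup>2) sequentially"
    by (rule order_tendstoD(1))
  have ev2: "eventually (\<lambda>N. d N < 1) sequentially" using d0 by (rule order_tendstoD(2)) simp
  show ?thesis using ev1 ev2 Cb(2) eventually_ge_at_top[of L]
  proof eventually_elim
    case (elim N)
    define K where "K = N - 1"
    have N: "N = Suc K" using elim(4) L(1) unfolding K_def by simp
    have d: "0 < d N" "d N \<le> 1" using dp[of N] elim(2) N by auto
    have D: "dform r M (d N) K (h N) (h N) * real (Suc K) / d N ^ 3 \<le> Cb / real N"
    proof -
      have "dform r M (d N) K (h N) (h N) * real (Suc K) / d N ^ 3 = ((real N)\<^sup>2 / d N ^ 3 * dform r M (d N) K (h N) (h N)) / real N"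
        unfolding N by (simp add: power2_eq_square)
      also have "\<dots> \<le> Cb / real N" using elim(3) unfolding K_def by (intro divide_right_mono) auto
      finally show ?thesis .
    qed
    have sq: "\<bar>x\<bar> \<le> \<eta> N" if "x\<^sup>2 \<le> dform r M (d N) K (h N) (h N) * real (Suc K) / d N ^ 3 / y" "\<kappa> \<le> y" for x y
    proof -
      have "dform r M (d N) K (h N) (h N) * real (Suc K) / d N ^ 3 / y \<le> Cb / real N / y" using D that(2) \<kappa> by (intro divide_right_mono) auto
      also have "\<dots> \<le> Cb / real N / \<kappa>" using Cb(1) that(2) \<kappa> by (intro divide_left_mono) auto
      finally have "x\<^sup>2 \<le> Cb / real N / \<kappa>" using that(1) by linarith
      from real_sqrt_le_mono[OF this] show ?thesis unfolding \<eta>_def by simp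
    qed
    have "2 / R * (1 - (2 * real L * \<eta> N + 2 * (real L * \<eta> N * (2 + C)))) - (\<Sum>n<Suc K. \<Sum>p\<in>{Y1, Y2}. (rh p (real n / real (Suc K)))\<^sup>2 * ((1 - M p) / (1 - M p ^ L)) * (real (Suc n) / real (Suc K) / r X2 p + real (Suc K - n) / real (Suc K) / r X1 p)) / real (Suc K) / R\<^sup>2
      \<le> (real (Suc K))\<^sup>2 / d N ^ 3 * dform r M (d N) K (h N) (h N)"
    proof (rule lower_det[OF d L(1) _ _ _ _ C])
      show "L \<le> Suc K" using elim(4) N by simp
      show "h N (xi (Suc K) X1) = 1" "h N (xi (Suc K) X2) = 0" using h1[of N] h0[of N] N by auto
      fix p n l assume p: "p \<in> {Y1, Y2}" and nl: "n + l \<le> K" and l: "l < L"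
      show "\<bar>eu (h N) K p n l\<bar> \<le> \<eta> N \<and> \<bar>ev (h N) K p n l\<bar> \<le> \<eta> N"
        using sq[OF edge_lower(1)[OF d nl p] \<kappa>le(2)[OF p l]] sq[OF edge_lower(2)[OF d nl p] \<kappa>le(1)[OF p l]] by simp
    qed
    then have "2 / R * (1 - e N) - (\<Sum>n<N. f N n) / real N / R\<^sup>2 \<le> (real N)\<^sup>2 / d N ^ 3 * dform r M (d N) K (h N) (h N)"
      unfolding e_def f_def \<sigma>_def N[symmetric] .
    then show ?case using elim(1) unfolding K_def by linarith
  qed
qed

end

theorem theorem2p8:
  fixes r :: "site \<Rightarrow> site \<Rightarrow> real" and m :: "site \<Rightarrow> real" and d :: "nat \<Rightarrow> real"
    and i0 :: nat
    and P :: "nat \<Rightarrow> (real \<Rightarrow> site \<Rightarrow> nat) measure" and Q :: "(real \<Rightarrow> nat) measure"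
  assumes r_nonneg: "\<forall>x y. 0 \<le> r x y"
    and r_diag: "\<forall>x. r x x = 0"
    and irreducible: "\<forall>x y. (x, y) \<in> {(a, b). 0 < r a b}\<^sup>*"
    and m_nonneg: "\<forall>x. 0 \<le> m x"
    and m_prob: "(\<Sum>x\<in>UNIV. m x) = 1"
    and reversible: "\<forall>x y. m x * r x y = m y * r y x"
    and rates: "\<forall>i\<in>{X1, X2}. \<forall>p\<in>{Y1, Y2}. r p i > r i p \<and> r i p > 0"
    and r_x12: "r X1 X2 = 0" and r_x21: "r X2 X1 = 0"
    and m_eq: "m X1 = m X2"
    and d_pos: "\<forall>N\<ge>1. 0 < d N"
    and d_lim: "d \<longlonglongrightarrow> 0"
    and d_log: "(\<lambda>N. d N * ln (real N)) \<longlonglongrightarrow> 0"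
    and d_subexp: "\<forall>\<epsilon>>0. filterlim (\<lambda>N. d N * exp (\<epsilon> * real N)) at_top sequentially"
    and d_N2log2: "(\<lambda>N. d N * (real N)\<^sup>2 * (ln (real N))\<^sup>2) \<longlonglongrightarrow> 0"
    and i0: "i0 \<in> {1, 2}"
    and P_law: "\<forall>N\<ge>1. is_ctmc_law (config_space N) (incl_rate r (d N)) (xi N (xpt i0)) (P N)"
    and Q_law: "is_ctmc_law {1, 2} (\<lambda>a b. 1 / Rfrak r m) i0 Q"
  shows "weak_conv_paths {1, 2}
           (\<lambda>N. distr (P N) (path_space {1, 2}) (spl_map N (real N / (d N)\<^sup>2))) Q"
proof -
  interpret incl r m by unfold_locales fact+
  have dp: "0 < d N" if "N \<ge> 1" for N using d_pos that by blast
  have dN: "(\<lambda>N. d N * real N) \<longlonglongrightarrow> 0"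
  proof (rule tendsto_sandwich[OF _ _ tendsto_const d_N2log2])
    show "eventually (\<lambda>N. 0 \<le> d N * real N) sequentially"
      using eventually_ge_at_top[of 1] by eventually_elim (use dp in \<open>auto intro!: mult_nonneg_nonneg less_imp_le\<close>)
    show "eventually (\<lambda>N. d N * real N \<le> d N * (real N)\<^sup>2 * (ln (real N))\<^sup>2) sequentially"
      \<comment> \<open>From N = 3 on the logarithm is at least 1, so d N is dominated by the
        quantity in \<open>d_N2log2\<close>.\<close>
      using eventually_ge_at_top[of 3]
    proof eventually_elim
      case (elim N)
      have "exp 1 \<le> real N" using exp_le elim by (auto intro: order_trans)
      then have "1 \<le> ln (real N)" using elim by (simp add: ln_ge_iff)
      then have "1 \<le> (ln (real N))\<^sup>2" by (simp add: one_le_power)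
      moreover have "real N \<le> (real N)\<^sup>2" using elim by (simp add: power2_eq_square)
      ultimately have "real N * 1 \<le> (real N)\<^sup>2 * (ln (real N))\<^sup>2" by (intro mult_mono) auto
      then have "d N * (real N * 1) \<le> d N * ((real N)\<^sup>2 * (ln (real N))\<^sup>2)" using dp[of N] elim by (intro mult_left_mono) auto
      then show ?case by (simp add: mult.assoc)
    qed
  qed
  have sub: "(\<lambda>N. real N ^ 4 * c ^ N / d N) \<longlonglongrightarrow> 0" if c: "0 < c" "c < 1" for c
  proof -
    \<comment> \<open>Half of the exponential rate of c ^ N absorbs the polynomial factor, the other
      half is compared with 1/d N by the subexponential decay.\<close>
    define e where "e = - ln c / 2"
    have e: "e > 0" unfolding e_def using c by simp
    have cN: "c ^ N = exp (- e * real N) * exp (- e * real N)" for N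
    proof -
      have "c ^ N = exp (real N * ln c)" using c by (simp add: exp_of_nat_mult)
      then show ?thesis unfolding exp_add[symmetric] e_def by (simp add: mult.commute)
    qed
    have "(\<lambda>N. real N ^ 4 * exp (- e * real N)) \<longlonglongrightarrow> 0" using e by real_asymp
    moreover have "(\<lambda>N. inverse (d N * exp (e * real N))) \<longlonglongrightarrow> 0"
      using d_subexp e tendsto_inverse_0_at_top by blast
    ultimately have "(\<lambda>N. (real N ^ 4 * exp (- e * real N)) * inverse (d N * exp (e * real N))) \<longlonglongrightarrow> 0 * 0" by (rule tendsto_mult)
    moreover have "(real N ^ 4 * exp (- e * real N)) * inverse (d N * exp (e * real N)) = real N ^ 4 * c ^ N / d N" for N
      unfolding cN by (simp add: exp_minus field_simps)
    ultimately show ?thesis by simp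
  qed
  have "\<forall>N. \<exists>h\<alpha>. N \<ge> 1 \<longrightarrow> fst h\<alpha> (xi N X1) = (1::real) \<and> fst h\<alpha> (xi N X2) = 0 \<and> snd h\<alpha> \<ge> (0::real)
     \<and> snd h\<alpha> * wgt (d N) N = dform r M (d N) (N - 1) (fst h\<alpha>) (fst h\<alpha>)
     \<and> (\<forall>g. g (xi N X1) = 1 \<longrightarrow> g (xi N X2) = 0 \<longrightarrow> snd h\<alpha> * wgt (d N) N \<le> dform r M (d N) (N - 1) g g)
     \<and> (\<forall>\<eta>\<in>config_space N. (\<Sum>b\<in>config_space N. gen_matrix (config_space N) (incl_rate r (d N)) \<eta> b * (2 * fst h\<alpha> b - 1)) + (2 * snd h\<alpha> * indicator {xi N X1, xi N X2} \<eta>) * (2 * fst h\<alpha> \<eta> - 1) = 0)"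
  proof
    fix N
    show "\<exists>h\<alpha>. N \<ge> 1 \<longrightarrow> fst h\<alpha> (xi N X1) = (1::real) \<and> fst h\<alpha> (xi N X2) = 0 \<and> snd h\<alpha> \<ge> (0::real)
     \<and> snd h\<alpha> * wgt (d N) N = dform r M (d N) (N - 1) (fst h\<alpha>) (fst h\<alpha>)
     \<and> (\<forall>g. g (xi N X1) = 1 \<longrightarrow> g (xi N X2) = 0 \<longrightarrow> snd h\<alpha> * wgt (d N) N \<le> dform r M (d N) (N - 1) g g)
     \<and> (\<forall>\<eta>\<in>config_space N. (\<Sum>b\<in>config_space N. gen_matrix (config_space N) (incl_rate r (d N)) \<eta> b * (2 * fst h\<alpha> b - 1)) + (2 * snd h\<alpha> * indicator {xi N X1, xi N X2} \<eta>) * (2 * fst h\<alpha> \<eta> - 1) = 0)"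
    proof (cases "N \<ge> 1")
      case True
      then have N: "N = Suc (N - 1)" by simp
      obtain h \<alpha> where "h (xi N X1) = (1::real)" "h (xi N X2) = 0" "\<alpha> \<ge> 0" "\<alpha> * wgt (d N) N = dform r M (d N) (N - 1) h h"
        "\<And>g. g (xi N X1) = 1 \<Longrightarrow> g (xi N X2) = 0 \<Longrightarrow> \<alpha> * wgt (d N) N \<le> dform r M (d N) (N - 1) g g"
        "\<And>\<eta>. \<eta> \<in> config_space N \<Longrightarrow> (\<Sum>b\<in>config_space N. gen_matrix (config_space N) (incl_rate r (d N)) \<eta> b * (2 * h b - 1)) + (2 * \<alpha> * indicator {xi N X1, xi N X2} \<eta>) * (2 * h \<eta> - 1) = 0"
        using reduction[OF dp[OF True] N] by blast
      then show ?thesis by (intro exI[of _ "(h, \<alpha>)"]) (simp only: fst_conv snd_conv, blast)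
    qed simp
  qed
  from choice[OF this] obtain h\<alpha> where h\<alpha>: "\<forall>N. N \<ge> 1 \<longrightarrow> fst (h\<alpha> N) (xi N X1) = (1::real) \<and> fst (h\<alpha> N) (xi N X2) = 0 \<and> snd (h\<alpha> N) \<ge> (0::real)
     \<and> snd (h\<alpha> N) * wgt (d N) N = dform r M (d N) (N - 1) (fst (h\<alpha> N)) (fst (h\<alpha> N))
     \<and> (\<forall>g. g (xi N X1) = 1 \<longrightarrow> g (xi N X2) = 0 \<longrightarrow> snd (h\<alpha> N) * wgt (d N) N \<le> dform r M (d N) (N - 1) g g)
     \<and> (\<forall>\<eta>\<in>config_space N. (\<Sum>b\<in>config_space N. gen_matrix (config_space N) (incl_rate r (d N)) \<eta> b * (2 * fst (h\<alpha> N) b - 1)) + (2 * snd (h\<alpha> N) * indicator {xi N X1, xi N X2} \<eta>) * (2 * fst (h\<alpha> N) \<eta> - 1) = 0)"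
    by blast
  define h where "h N = fst (h\<alpha> N)" for N
  define \<alpha> where "\<alpha> N = snd (h\<alpha> N)" for N
  have h: "h N (xi N X1) = 1" "h N (xi N X2) = 0" "\<alpha> N \<ge> 0" "\<alpha> N * wgt (d N) N = dform r M (d N) (N - 1) (h N) (h N)" if "N \<ge> 1" for N
    using h\<alpha> that unfolding h_def \<alpha>_def by blast+
  have hmin: "\<alpha> N * wgt (d N) N \<le> dform r M (d N) (N - 1) g g" if "N \<ge> 1" "g (xi N X1) = 1" "g (xi N X2) = 0" for N g
    using h\<alpha> that unfolding h_def \<alpha>_def by blast
  have harm: "(\<Sum>b\<in>config_space N. gen_matrix (config_space N) (incl_rate r (d N)) \<eta> b * (2 * h N b - 1)) + (2 * \<alpha> N * indicator {xi N X1, xi N X2} \<eta>) * (2 * h N \<eta> - 1) = 0"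
    if "N \<ge> 1" "\<eta> \<in> config_space N" for N \<eta>
    using h\<alpha> that unfolding h_def \<alpha>_def by blast
  define D where "D N = (real N)\<^sup>2 / d N ^ 3 * dform r M (d N) (N - 1) (h N) (h N)" for N
  have R: "R > 0" by (rule R_pos)
  obtain U where U: "eventually (\<lambda>N. (real N)\<^sup>2 / (d N) ^ 3 * dform r M (d N) (N - 1) (test_fun N) (test_fun N) \<le> U N) sequentially" "U \<longlonglongrightarrow> 1 / R"
    using test_energy_upper[OF dp d_lim dN sub] by blast
  have DU: "eventually (\<lambda>N. D N \<le> U N) sequentially"
    using U(1) eventually_ge_at_top[of 1]
  proof eventually_elim
    case (elim N)
    have "dform r M (d N) (N - 1) (h N) (h N) \<le> dform r M (d N) (N - 1) (test_fun N) (test_fun N)"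
      using hmin[OF elim(2) test_fun_xi(1)[OF elim(2)] test_fun_xi(2)[OF elim(2)]] h(4)[OF elim(2)] by simp
    then have "D N \<le> (real N)\<^sup>2 / (d N) ^ 3 * dform r M (d N) (N - 1) (test_fun N) (test_fun N)"
      unfolding D_def using dp[OF elim(2)] by (intro mult_left_mono) auto
    then show ?case using elim(1) by linarith
  qed
  have Dup: "eventually (\<lambda>N. D N < a) sequentially" if "1 / R < a" for a
    using order_tendstoD(2)[OF U(2) that] DU by eventually_elim linarith
  have Cb: "eventually (\<lambda>N. D N \<le> 1 / R + 1) sequentially"
    using Dup[of "1 / R + 1"] by (simp add: eventually_mono)
  have D: "D \<longlonglongrightarrow> 1 / R"
  proof (rule order_tendstoI)
    show "eventually (\<lambda>N. D N < a) sequentially" if "1 / R < a" for a by (rule Dup[OF that])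
    fix a assume "a < 1 / R"
    then have "eventually (\<lambda>N. 1 / R - (1 / R - a) < D N) sequentially"
      unfolding D_def using R Cb[unfolded D_def] by (intro min_energy_lower[where Cb = "1 / R + 1"] dp d_lim h) auto
    then show "eventually (\<lambda>N. a < D N) sequentially" by simp
  qed
  have prd: "(\<lambda>N. prd (d N) (N - 1)) \<longlonglongrightarrow> 1"
  proof (rule tendsto_sandwich)
    show "eventually (\<lambda>N. 1 \<le> prd (d N) (N - 1)) sequentially"
      using eventually_ge_at_top[of 1] by eventually_elim (rule prd_ge_1[OF less_imp_le[OF dp]], auto)
    show "eventually (\<lambda>N. prd (d N) (N - 1) \<le> exp (d N * real N)) sequentially"
      using eventually_ge_at_top[of 1] by eventually_elim (rule prd_le[OF less_imp_le[OF dp]], auto)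
    show "(\<lambda>N. exp (d N * real N)) \<longlonglongrightarrow> 1" using tendsto_exp[OF dN] by simp
  qed simp
  \<comment> \<open>The speed: the rate \<alpha> times the time scale, relative to the limiting rate
    1/R.\<close>
  define l where "l N = \<alpha> N * (real N / (d N)\<^sup>2) * R" for N
  have "(\<lambda>N. D N / prd (d N) (N - 1) * R) \<longlonglongrightarrow> 1 / R / 1 * R" by (intro tendsto_intros D prd) simp
  moreover have "eventually (\<lambda>N. D N / prd (d N) (N - 1) * R = l N) sequentially"
    using eventually_ge_at_top[of 1]
  proof eventually_elim
    case (elim N)
    have p: "prd (d N) (N - 1) \<ge> 1" using dp[OF elim] by (intro prd_ge_1) simp
    \<comment> \<open>The weight of a full configuration is d/N up to \<open>prd\<close>; this
      converts the energy normalised by \<open>N ^ 2 / d ^ 3\<close> into the rate \<alpha> on the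
      time scale \<open>N / d ^ 2\<close>.\<close>
    have w: "wgt (d N) N = d N * prd (d N) (N - 1) / real N" using wgt_Suc_prd[of "d N" "N - 1"] elim by simp
    have "D N = \<alpha> N * (real N / (d N)\<^sup>2) * prd (d N) (N - 1)"
      unfolding D_def h(4)[OF elim, symmetric] w using dp[OF elim] elim by (simp add: power2_eq_square power3_eq_cube)
    then show ?case unfolding l_def using p by simp
  qed
  ultimately have "l \<longlonglongrightarrow> 1 / R / 1 * R" by (rule Lim_transform_eventually)
  then have l1: "l \<longlonglongrightarrow> 1" using R by simp
  have Qp: "prob_space Q" "sets Q = sets (path_space {1, 2})" using Q_law unfolding is_ctmc_law_def by blast+
  have "eventually (\<lambda>N. l N > 0) sequentially" using l1 by (rule order_tendstoD(1)) simp
  then have "eventually (\<lambda>N. l N > 0 \<and> distr (P N) (path_space {1, 2}) (spl_map N (real N / (d N)\<^sup>2)) = distr Q (path_space {1, 2}) (\<lambda>\<omega> t. \<omega> (l N * t))) sequentially"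
    using eventually_ge_at_top[of 1]
  proof eventually_elim
    case (elim N)
    note N = elim(2)
    interpret ctmc "config_space N" "incl_rate r (d N)" "xi N (xpt i0)" "P N"
      by unfold_locales (use finite_config_space xi_config P_law N in auto)
    obtain V \<delta> where V: "\<And>a. a \<in> config_space N \<Longrightarrow> V a > (0::real)" "\<delta> > 0"
      "\<And>a. a \<in> config_space N \<Longrightarrow> a \<notin> {xi N X1, xi N X2} \<Longrightarrow> (\<Sum>b\<in>config_space N. gen_matrix (config_space N) (incl_rate r (d N)) a b * V b) \<le> - \<delta> * V a"
      using lyapunov[OF dp[OF N]] by blast
    have "is_ctmc_law {1, 2} (\<lambda>_ _. 2 * \<alpha> N / 2 * (real N / (d N)\<^sup>2)) i0 (distr (P N) (path_space {1, 2}) (spl_map N (real N / (d N)\<^sup>2)))"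
    proof (rule spl_map_law[OF ctmc_axioms N i0 _ recurrent[OF V]])
      show "0 < real N / (d N)\<^sup>2" using dp[OF N] N by simp
      show "(\<Sum>b\<in>config_space N. gen_matrix (config_space N) (incl_rate r (d N)) a b * (2 * h N b - 1)) + (2 * \<alpha> N * indicator {xi N X1, xi N X2} a) * (2 * h N a - 1) = 0"
        if "a \<in> config_space N" for a by (rule harm[OF N that])
    qed (use h[OF N] in auto)
    moreover have "2 * \<alpha> N / 2 * (real N / (d N)\<^sup>2) = 1 / Rfrak r m * l N"
      unfolding l_def R_def[symmetric] using R by simp
    ultimately have 1: "is_ctmc_law {1, 2} (\<lambda>_ _. 1 / Rfrak r m * l N) i0 (distr (P N) (path_space {1, 2}) (spl_map N (real N / (d N)\<^sup>2)))"
      by simp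
    have 2: "is_ctmc_law {1, 2} (\<lambda>_ _. 1 / Rfrak r m * l N) i0 (distr Q (path_space {1, 2}) (\<lambda>\<omega> t. \<omega> (l N * t)))"
      by (rule two_state_scale_law[OF Q_law i0 elim(1)])
    show ?case using elim(1) ctmc_law_unique[OF _ i0 1 2] by simp
  qed
  then show ?thesis by (intro weak_conv_scale[OF _ Qp l1]) auto
qed

end
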